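(* The singular and cubical chain monoidal functors $S_*,C_*:\mathbf{Top}\to\mathbf C_*(\mathbb Z)$ are weakly homotopy equivalent monoidal functors, that is, they are weakly equivalent in $\mathbf{Mon}(\mathbf{Top},\mathbf C_*(\mathbb Z))$ with respect to the class of weak homotopy equivalences: there is a finite zigzag of monoidal natural transformations $S_*\leftarrow F^1_*\to\cdots\leftarrow F^m_*\to C_*$ between monoidal functors $\mathbf{Top}\to\mathbf C_*(\mathbb Z)$, each of which is, for every topological space $X$, a chain homotopy equivalence.
   Context: $\mathbf{Top}$ is the category of topological spaces with cartesian product as monoidal structure; $\mathbf C_*(\mathbb Z)$ is the monoidal category of bounded below chain complexes of abelian groups with the usual tensor product. Monoidal functors are lax: $(F,\kappa,\eta)$ with natural Künneth morphisms $\kappa_{X,Y}:FX\otimes FY\to F(X\times Y)$ and unit $\eta:\mathbf 1\to F(\mathrm{pt})$ satisfying associativity and unit constraints; monoidal natural transformations are compatible with $\kappa$ and $\eta$. $\mathbf{Mon}(\mathbf{Top},\mathbf C_*(\mathbb Z))$ is the category of monoidal functors and monoidal natural transformations. A morphism $f$ in it is a weak homotopy equivalence if $f_X$ is a chain homotopy equivalence for every $X$ (homotopy inverses and homotopies need not be natural in $X$). $S_*(X)$: singular chains ($S_p(X)$ free on continuous maps $\Delta^p\to X$), with Künneth morphism the Eilenberg–MacLane shuffle product $\sigma\otimes\tau\mapsto\sum_{(\mu,\nu)}\varepsilon(\mu,\nu)\,(s_{\nu_q}\cdots s_{\nu_1}\sigma,\ s_{\mu_p}\cdots s_{\mu_1}\tau)$,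 the sum over $(p,q)$-shuffles. $C_*(X)$: normalized cubical chains. $Q_p(X)$ is the free abelian group on continuous maps $I^p\to X$, $I=[0,1]$, with $d(c)=\sum_{i=1}^p\sum_{\epsilon\in\{0,1\}}(-1)^{i+\epsilon}c\circ\delta_i^\epsilon$, where $\delta_i^\epsilon:I^{p-1}\to I^p$ inserts $\epsilon$ in the $i$-th place; $C_p(X)$ is the quotient of $Q_p(X)$ by the subgroup generated by degenerate cubes (those independent of at least one coordinate). Its Künneth morphism is the cross product $c\otimes d\mapsto c\times d:I^{p+q}=I^p\times I^q\to X\times Y$. *)

theory Defs
  imports "HOL-Homology.Homology" "HOL-Combinatorics.Permutations"
begin

section \<open>Chain complexes of abelian groups\<close>

text \<open>
  As in HOL-Homology, abelian groups are commutative groups of HOL-Algebra, so the addition of a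
  chain group is written multiplicatively. Complexes are indexed by all integers, the differential
  \<open>cdiff C n\<close> goes from degree \<open>n\<close> to degree \<open>n - 1\<close>.
\<close>

record 'c ccomplex =
  cgrp :: "int \<Rightarrow> 'c monoid"
  cdiff :: "int \<Rightarrow> 'c \<Rightarrow> 'c"

definition bounded_below_complex :: "'c ccomplex \<Rightarrow> bool" where
  "bounded_below_complex C \<longleftrightarrow>
     (\<forall>n. comm_group (cgrp C n)) \<and>
     (\<forall>n. cdiff C n \<in> hom (cgrp C n) (cgrp C (n - 1))) \<and>
     (\<forall>n. \<forall>a\<in>carrier (cgrp C n). cdiff C (n - 1) (cdiff C n a) = \<one>\<^bsub>cgrp C (n - 2)\<^esub>) \<and>
     (\<exists>N. \<forall>n<N. carrier (cgrp C n) = {\<one>\<^bsub>cgrp C n\<^esub>})"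

definition complex_hom :: "'a ccomplex \<Rightarrow> 'b ccomplex \<Rightarrow> (int \<Rightarrow> 'a \<Rightarrow> 'b) \<Rightarrow> bool" where
  "complex_hom A B f \<longleftrightarrow>
     (\<forall>n. f n \<in> hom (cgrp A n) (cgrp B n)) \<and>
     (\<forall>n. \<forall>a\<in>carrier (cgrp A n). cdiff B n (f n a) = f (n - 1) (cdiff A n a))"

text \<open>The homotopy equation below is \<open>f - g = dh + hd\<close>.\<close>

definition complex_homotopic ::
  "'a ccomplex \<Rightarrow> 'b ccomplex \<Rightarrow> (int \<Rightarrow> 'a \<Rightarrow> 'b) \<Rightarrow> (int \<Rightarrow> 'a \<Rightarrow> 'b) \<Rightarrow> bool" where
  "complex_homotopic A B f g \<longleftrightarrow>
     (\<exists>h. (\<forall>n. h n \<in> hom (cgrp A n) (cgrp B (n + 1))) \<and>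
          (\<forall>n. \<forall>a\<in>carrier (cgrp A n).
             f n a = g n a \<otimes>\<^bsub>cgrp B n\<^esub>
               (cdiff B (n + 1) (h n a) \<otimes>\<^bsub>cgrp B n\<^esub> h (n - 1) (cdiff A n a))))"

definition homotopy_equivalence_map ::
  "'a ccomplex \<Rightarrow> 'b ccomplex \<Rightarrow> (int \<Rightarrow> 'a \<Rightarrow> 'b) \<Rightarrow> bool" where
  "homotopy_equivalence_map A B f \<longleftrightarrow>
     complex_hom A B f \<and>
     (\<exists>g. complex_hom B A g \<and>
          complex_homotopic A A (\<lambda>n a. g n (f n a)) (\<lambda>n a. a) \<and>
          complex_homotopic B B (\<lambda>n b. f n (g n b)) (\<lambda>n b. b))"

text \<open>The integers concentrated in degree 0, the unit of the tensor product.\<close>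

definition unit_complex :: "int ccomplex" where
  "unit_complex =
     \<lparr>cgrp = (\<lambda>n. if n = 0 then integer_group else singleton_group 0),
      cdiff = (\<lambda>n a. 0)\<rparr>"


subsection \<open>The tensor product\<close>

text \<open>
  The degree \<open>n\<close> part of the tensor product, the direct sum of all \<open>A\<^sub>i \<otimes> B\<^sub>j\<close> with \<open>i + j = n\<close>,
  is presented as the free abelian group on the symbols \<open>(i, j, a, b)\<close> with \<open>i + j = n\<close>,
  \<open>a \<in> A\<^sub>i\<close>, \<open>b \<in> B\<^sub>j\<close>, modulo biadditivity.
\<close>

type_synonym ('a, 'b) tensor = "((int \<times> int \<times> 'a \<times> 'b) \<Rightarrow>\<^sub>0 int) set"

definition tensor_gens :: "'a ccomplex \<Rightarrow> 'b ccomplex \<Rightarrow> int \<Rightarrow> (int \<times> int \<times> 'a \<times> 'b) set" where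
  "tensor_gens A B n =
     {(i, j, a, b). i + j = n \<and> a \<in> carrier (cgrp A i) \<and> b \<in> carrier (cgrp B j)}"

definition tensor_rels ::
  "'a ccomplex \<Rightarrow> 'b ccomplex \<Rightarrow> int \<Rightarrow> ((int \<times> int \<times> 'a \<times> 'b) \<Rightarrow>\<^sub>0 int) set" where
  "tensor_rels A B n =
     {frag_of (i, j, a \<otimes>\<^bsub>cgrp A i\<^esub> a', b) - frag_of (i, j, a, b) - frag_of (i, j, a', b) | i j a a' b.
        i + j = n \<and> a \<in> carrier (cgrp A i) \<and> a' \<in> carrier (cgrp A i) \<and> b \<in> carrier (cgrp B j)} \<union>
     {frag_of (i, j, a, b \<otimes>\<^bsub>cgrp B j\<^esub> b') - frag_of (i, j, a, b) - frag_of (i, j, a, b') | i j a b b'.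
        i + j = n \<and> a \<in> carrier (cgrp A i) \<and> b \<in> carrier (cgrp B j) \<and> b' \<in> carrier (cgrp B j)}"

definition tensor_null ::
  "'a ccomplex \<Rightarrow> 'b ccomplex \<Rightarrow> int \<Rightarrow> ((int \<times> int \<times> 'a \<times> 'b) \<Rightarrow>\<^sub>0 int) set" where
  "tensor_null A B n = generate (free_Abelian_group (tensor_gens A B n)) (tensor_rels A B n)"

definition tensor_group :: "'a ccomplex \<Rightarrow> 'b ccomplex \<Rightarrow> int \<Rightarrow> ('a, 'b) tensor monoid" where
  "tensor_group A B n = free_Abelian_group (tensor_gens A B n) Mod tensor_null A B n"

definition elem_tensor ::
  "'a ccomplex \<Rightarrow> 'b ccomplex \<Rightarrow> int \<Rightarrow> int \<Rightarrow> 'a \<Rightarrow> 'b \<Rightarrow> ('a, 'b) tensor" where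
  "elem_tensor A B i j a b =
     tensor_null A B (i + j) #>\<^bsub>free_Abelian_group (tensor_gens A B (i + j))\<^esub> frag_of (i, j, a, b)"

text \<open>
  \<open>tensor_lift G \<beta>\<close> is the homomorphism from a group of tensors to \<open>G\<close> which sends the
  elementary tensor of \<open>(i, j, a, b)\<close> to \<open>\<beta> (i, j, a, b)\<close>, for biadditive \<open>\<beta>\<close>.
\<close>

definition free_lift :: "'g monoid \<Rightarrow> ('x \<Rightarrow> 'g) \<Rightarrow> ('x \<Rightarrow>\<^sub>0 int) \<Rightarrow> 'g" where
  "free_lift G \<beta> t =
     finprod G (\<lambda>x. \<beta> x [^]\<^bsub>G\<^esub> Poly_Mapping.lookup t x) (Poly_Mapping.keys t)"

definition tensor_lift ::
  "'g monoid \<Rightarrow> (int \<times> int \<times> 'a \<times> 'b \<Rightarrow> 'g) \<Rightarrow> ('a, 'b) tensor \<Rightarrow> 'g" where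
  "tensor_lift G \<beta> T = the_elem (free_lift G \<beta> ` T)"

text \<open>\<open>d (a \<otimes> b) = da \<otimes> b + (-1)\<^sup>i a \<otimes> db\<close> for \<open>a\<close> of degree \<open>i\<close>.\<close>

definition tensor_complex :: "'a ccomplex \<Rightarrow> 'b ccomplex \<Rightarrow> ('a, 'b) tensor ccomplex" where
  "tensor_complex A B =
     \<lparr>cgrp = tensor_group A B,
      cdiff = (\<lambda>n. tensor_lift (tensor_group A B (n - 1))
        (\<lambda>(i, j, a, b).
           elem_tensor A B (i - 1) j (cdiff A i a) b
             \<otimes>\<^bsub>tensor_group A B (n - 1)\<^esub>
           elem_tensor A B i (j - 1) a (cdiff B j b)
             [^]\<^bsub>tensor_group A B (n - 1)\<^esub> (if even i then 1 else - 1 :: int)))\<rparr>"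


section \<open>Topological spaces as a monoidal category\<close>

text \<open>
  The objects of \<open>Top\<close> are the topological spaces whose points are taken from a type \<open>'u\<close>, that is,
  all values of type \<open>'u topology\<close>; morphisms are continuous maps, compared on the underlying space.
  An injection \<open>pr\<close> of \<open>'u \<times> 'u\<close> into \<open>'u\<close> makes this category closed under cartesian products: the
  product is the usual one, transported along \<open>pr\<close>. The space with single point \<open>pt\<close> is the unit.
\<close>

definition unpair :: "('u \<times> 'u \<Rightarrow> 'u) \<Rightarrow> 'u \<Rightarrow> 'u \<times> 'u" where
  "unpair pr = inv_into UNIV pr"

definition prod_space :: "('u \<times> 'u \<Rightarrow> 'u) \<Rightarrow> 'u topology \<Rightarrow> 'u topology \<Rightarrow> 'u topology" where
  "prod_space pr X Y =
     pullback_topology (pr ` (topspace X \<times> topspace Y)) (unpair pr) (prod_topology X Y)"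

definition point_space :: "'u \<Rightarrow> 'u topology" where
  "point_space pt = discrete_topology {pt}"

definition prod_map :: "('u \<times> 'u \<Rightarrow> 'u) \<Rightarrow> ('u \<Rightarrow> 'u) \<Rightarrow> ('u \<Rightarrow> 'u) \<Rightarrow> 'u \<Rightarrow> 'u" where
  "prod_map pr f g = pr \<circ> map_prod f g \<circ> unpair pr"

text \<open>The associativity isomorphism \<open>(X \<times> Y) \<times> Z \<rightarrow> X \<times> (Y \<times> Z)\<close>; the unit isomorphisms
  \<open>pt \<times> X \<rightarrow> X\<close> and \<open>X \<times> pt \<rightarrow> X\<close> are the projections.\<close>

definition prod_assoc :: "('u \<times> 'u \<Rightarrow> 'u) \<Rightarrow> 'u \<Rightarrow> 'u" where
  "prod_assoc pr w = (case unpair pr w of (v, z) \<Rightarrow> case unpair pr v of (x, y) \<Rightarrow> pr (x, pr (y, z)))"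


section \<open>Monoidal functors from spaces to complexes\<close>

record ('u, 'c) top_functor =
  obj :: "'u topology \<Rightarrow> 'c ccomplex"
  mor :: "'u topology \<Rightarrow> 'u topology \<Rightarrow> ('u \<Rightarrow> 'u) \<Rightarrow> int \<Rightarrow> 'c \<Rightarrow> 'c"
  kunneth :: "'u topology \<Rightarrow> 'u topology \<Rightarrow> int \<Rightarrow> ('c, 'c) tensor \<Rightarrow> 'c"
  unitor :: "int \<Rightarrow> int \<Rightarrow> 'c"

definition is_functor :: "('u, 'c) top_functor \<Rightarrow> bool" where
  "is_functor F \<longleftrightarrow>
     (\<forall>X. bounded_below_complex (obj F X)) \<and>
     (\<forall>X Y f. continuous_map X Y f \<longrightarrow> complex_hom (obj F X) (obj F Y) (mor F X Y f)) \<and>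
     (\<forall>X Y f g. continuous_map X Y f \<and> (\<forall>x\<in>topspace X. f x = g x) \<longrightarrow>
        (\<forall>n. \<forall>a\<in>carrier (cgrp (obj F X) n). mor F X Y f n a = mor F X Y g n a)) \<and>
     (\<forall>X n. \<forall>a\<in>carrier (cgrp (obj F X) n). mor F X X (\<lambda>x. x) n a = a) \<and>
     (\<forall>X Y Z f g. continuous_map X Y f \<and> continuous_map Y Z g \<longrightarrow>
        (\<forall>n. \<forall>a\<in>carrier (cgrp (obj F X) n).
           mor F X Z (g \<circ> f) n a = mor F Y Z g n (mor F X Y f n a)))"

text \<open>
  The Kuenneth morphisms are morphisms of complexes out of the tensor product. Equalities between
  maps out of (iterated) tensor products are expressed on elementary tensors, which generate; in the
  unit constraints \<open>1 \<otimes> a\<close> and \<open>a \<otimes> 1\<close> generate.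
\<close>

definition monoidal_functor :: "('u \<times> 'u \<Rightarrow> 'u) \<Rightarrow> 'u \<Rightarrow> ('u, 'c) top_functor \<Rightarrow> bool" where
  "monoidal_functor pr pt F \<longleftrightarrow>
     is_functor F \<and>
     (\<forall>X Y. complex_hom (tensor_complex (obj F X) (obj F Y)) (obj F (prod_space pr X Y))
              (kunneth F X Y)) \<and>
     (\<forall>X X' Y Y' f g. continuous_map X X' f \<and> continuous_map Y Y' g \<longrightarrow>
        (\<forall>i j. \<forall>a\<in>carrier (cgrp (obj F X) i). \<forall>b\<in>carrier (cgrp (obj F Y) j).
           kunneth F X' Y' (i + j)
             (elem_tensor (obj F X') (obj F Y') i j (mor F X X' f i a) (mor F Y Y' g j b)) =
           mor F (prod_space pr X Y) (prod_space pr X' Y') (prod_map pr f g) (i + j)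
             (kunneth F X Y (i + j) (elem_tensor (obj F X) (obj F Y) i j a b)))) \<and>
     complex_hom unit_complex (obj F (point_space pt)) (unitor F) \<and>
     (\<forall>X Y Z i j k. \<forall>a\<in>carrier (cgrp (obj F X) i). \<forall>b\<in>carrier (cgrp (obj F Y) j).
        \<forall>c\<in>carrier (cgrp (obj F Z) k).
          mor F (prod_space pr (prod_space pr X Y) Z) (prod_space pr X (prod_space pr Y Z))
            (prod_assoc pr) (i + j + k)
            (kunneth F (prod_space pr X Y) Z (i + j + k)
               (elem_tensor (obj F (prod_space pr X Y)) (obj F Z) (i + j) k
                  (kunneth F X Y (i + j) (elem_tensor (obj F X) (obj F Y) i j a b)) c)) =
          kunneth F X (prod_space pr Y Z) (i + (j + k))
            (elem_tensor (obj F X) (obj F (prod_space pr Y Z)) i (j + k) a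
               (kunneth F Y Z (j + k) (elem_tensor (obj F Y) (obj F Z) j k b c)))) \<and>
     (\<forall>X i. \<forall>a\<in>carrier (cgrp (obj F X) i).
        mor F (prod_space pr (point_space pt) X) X (snd \<circ> unpair pr) i
          (kunneth F (point_space pt) X i
             (elem_tensor (obj F (point_space pt)) (obj F X) 0 i (unitor F 0 1) a)) = a) \<and>
     (\<forall>X i. \<forall>a\<in>carrier (cgrp (obj F X) i).
        mor F (prod_space pr X (point_space pt)) X (fst \<circ> unpair pr) i
          (kunneth F X (point_space pt) i
             (elem_tensor (obj F X) (obj F (point_space pt)) i 0 a (unitor F 0 1))) = a)"

definition monoidal_transformation ::
  "('u \<times> 'u \<Rightarrow> 'u) \<Rightarrow> 'u \<Rightarrow> ('u, 'a) top_functor \<Rightarrow> ('u, 'b) top_functor \<Rightarrow>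
     ('u topology \<Rightarrow> int \<Rightarrow> 'a \<Rightarrow> 'b) \<Rightarrow> bool" where
  "monoidal_transformation pr pt F G \<phi> \<longleftrightarrow>
     (\<forall>X. complex_hom (obj F X) (obj G X) (\<phi> X)) \<and>
     (\<forall>X Y f. continuous_map X Y f \<longrightarrow>
        (\<forall>n. \<forall>a\<in>carrier (cgrp (obj F X) n). \<phi> Y n (mor F X Y f n a) = mor G X Y f n (\<phi> X n a))) \<and>
     (\<forall>X Y i j. \<forall>a\<in>carrier (cgrp (obj F X) i). \<forall>b\<in>carrier (cgrp (obj F Y) j).
        \<phi> (prod_space pr X Y) (i + j)
          (kunneth F X Y (i + j) (elem_tensor (obj F X) (obj F Y) i j a b)) =
        kunneth G X Y (i + j) (elem_tensor (obj G X) (obj G Y) i j (\<phi> X i a) (\<phi> Y j b))) \<and>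
     (\<forall>n. \<forall>m\<in>carrier (cgrp unit_complex n).
        \<phi> (point_space pt) n (unitor F n m) = unitor G n m)"

text \<open>The element types of the complexes of \<open>F\<close> and \<open>G\<close> may differ, since every type serves as the
  universe of a category of complexes. The homotopy inverses and the homotopies are chosen for each
  space separately.\<close>

definition has_weak_homotopy_equivalence ::
  "('u \<times> 'u \<Rightarrow> 'u) \<Rightarrow> 'u \<Rightarrow> ('u, 'a) top_functor \<Rightarrow> ('u, 'b) top_functor \<Rightarrow> bool" where
  "has_weak_homotopy_equivalence pr pt F G \<longleftrightarrow>
     monoidal_functor pr pt F \<and> monoidal_functor pr pt G \<and>
     (\<exists>\<phi>. monoidal_transformation pr pt F G \<phi> \<and>
          (\<forall>X. homotopy_equivalence_map (obj F X) (obj G X) (\<phi> X)))"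


section \<open>Singular chains\<close>

text \<open>The degeneracy \<open>s\<^sub>i\<close> on singular \<open>p\<close>-simplices is composition with the map of standard
  simplices which sends both vertices \<open>i\<close> and \<open>i + 1\<close> to the vertex \<open>i\<close>.\<close>

definition simplicial_collapse :: "nat \<Rightarrow> (nat \<Rightarrow> real) \<Rightarrow> nat \<Rightarrow> real" where
  "simplicial_collapse i x =
     (\<lambda>j. if j < i then x j else if j = i then x i + x (Suc i) else x (Suc j))"

definition singular_degeneracy ::
  "nat \<Rightarrow> nat \<Rightarrow> ((nat \<Rightarrow> real) \<Rightarrow> 'u) \<Rightarrow> (nat \<Rightarrow> real) \<Rightarrow> 'u" where
  "singular_degeneracy p i \<sigma> = restrict (\<sigma> \<circ> simplicial_collapse i) (standard_simplex (Suc p))"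

text \<open>\<open>iterated_degeneracy p [i\<^sub>1, \<dots>, i\<^sub>r] \<sigma>\<close> is \<open>s\<^bsub>i\<^sub>r\<^esub> \<dots> s\<^bsub>i\<^sub>1\<^esub> \<sigma>\<close> for a \<open>p\<close>-simplex \<open>\<sigma>\<close>.\<close>

fun iterated_degeneracy ::
  "nat \<Rightarrow> nat list \<Rightarrow> ((nat \<Rightarrow> real) \<Rightarrow> 'u) \<Rightarrow> (nat \<Rightarrow> real) \<Rightarrow> 'u" where
  "iterated_degeneracy p [] \<sigma> = \<sigma>"
| "iterated_degeneracy p (i # is) \<sigma> = iterated_degeneracy (Suc p) is (singular_degeneracy p i \<sigma>)"

definition shuffle_pairs :: "nat \<Rightarrow> nat \<Rightarrow> (nat list \<times> nat list) set" where
  "shuffle_pairs p q =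
     {(\<mu>, \<nu>). length \<mu> = p \<and> length \<nu> = q \<and> sorted_wrt (<) \<mu> \<and> sorted_wrt (<) \<nu> \<and>
        set \<mu> \<union> set \<nu> = {..<p + q}}"

definition shuffle_sign :: "nat list \<Rightarrow> nat list \<Rightarrow> int" where
  "shuffle_sign \<mu> \<nu> = sign (\<lambda>k. if k < length (\<mu> @ \<nu>) then (\<mu> @ \<nu>) ! k else k)"

definition simplex_pair ::
  "('u \<times> 'u \<Rightarrow> 'u) \<Rightarrow> nat \<Rightarrow> ((nat \<Rightarrow> real) \<Rightarrow> 'u) \<Rightarrow> ((nat \<Rightarrow> real) \<Rightarrow> 'u) \<Rightarrow> (nat \<Rightarrow> real) \<Rightarrow> 'u" where
  "simplex_pair pr n \<sigma> \<tau> = restrict (\<lambda>x. pr (\<sigma> x, \<tau> x)) (standard_simplex n)"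

definition shuffle_simplices ::
  "('u \<times> 'u \<Rightarrow> 'u) \<Rightarrow> nat \<Rightarrow> nat \<Rightarrow> ((nat \<Rightarrow> real) \<Rightarrow> 'u) \<Rightarrow> ((nat \<Rightarrow> real) \<Rightarrow> 'u) \<Rightarrow> 'u chain" where
  "shuffle_simplices pr p q \<sigma> \<tau> =
     (\<Sum>(\<mu>, \<nu>)\<in>shuffle_pairs p q. frag_cmul (shuffle_sign \<mu> \<nu>)
        (frag_of (simplex_pair pr (p + q) (iterated_degeneracy p \<nu> \<sigma>) (iterated_degeneracy q \<mu> \<tau>))))"

definition shuffle_product ::
  "('u \<times> 'u \<Rightarrow> 'u) \<Rightarrow> nat \<Rightarrow> nat \<Rightarrow> 'u chain \<Rightarrow> 'u chain \<Rightarrow> 'u chain" where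
  "shuffle_product pr p q a b =
     frag_extend (\<lambda>\<sigma>. frag_extend (\<lambda>\<tau>. shuffle_simplices pr p q \<sigma> \<tau>) b) a"

definition singular_complex :: "'u topology \<Rightarrow> 'u chain ccomplex" where
  "singular_complex X =
     \<lparr>cgrp = (\<lambda>n. if n < 0 then singleton_group 0 else chain_group (nat n) X),
      cdiff = (\<lambda>n. chain_boundary (nat n))\<rparr>"

definition singular_functor :: "('u \<times> 'u \<Rightarrow> 'u) \<Rightarrow> 'u \<Rightarrow> ('u, 'u chain) top_functor" where
  "singular_functor pr pt =
     \<lparr>obj = singular_complex,
      mor = (\<lambda>X Y f n. chain_map (nat n) f),
      kunneth = (\<lambda>X Y n. tensor_lift (cgrp (singular_complex (prod_space pr X Y)) n)
        (\<lambda>(i, j, a, b). shuffle_product pr (nat i) (nat j) a b)),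
      unitor = (\<lambda>n m. frag_cmul m (frag_of (restrict (\<lambda>x. pt) (standard_simplex 0))))\<rparr>"


section \<open>Normalized cubical chains\<close>

text \<open>As with \<open>standard_simplex\<close>, points of the \<open>p\<close>-cube are sequences vanishing from index \<open>p\<close> on.
  The coordinate in the \<open>i\<close>-th place, counted from 1, has index \<open>i - 1\<close>.\<close>

definition standard_cube :: "nat \<Rightarrow> (nat \<Rightarrow> real) set" where
  "standard_cube p = {x. (\<forall>i<p. 0 \<le> x i \<and> x i \<le> 1) \<and> (\<forall>i\<ge>p. x i = 0)}"

definition singular_cube :: "nat \<Rightarrow> 'u topology \<Rightarrow> ((nat \<Rightarrow> real) \<Rightarrow> 'u) \<Rightarrow> bool" where
  "singular_cube p X c \<longleftrightarrow>
     continuous_map (subtopology (powertop_real UNIV) (standard_cube p)) X c \<and>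
     c \<in> extensional (standard_cube p)"

definition cube_insert :: "nat \<Rightarrow> real \<Rightarrow> (nat \<Rightarrow> real) \<Rightarrow> nat \<Rightarrow> real" where
  "cube_insert i e x = (\<lambda>j. if Suc j < i then x j else if Suc j = i then e else x (j - 1))"

definition cube_face :: "nat \<Rightarrow> nat \<Rightarrow> real \<Rightarrow> ((nat \<Rightarrow> real) \<Rightarrow> 'u) \<Rightarrow> (nat \<Rightarrow> real) \<Rightarrow> 'u" where
  "cube_face p i e c = restrict (c \<circ> cube_insert i e) (standard_cube (p - 1))"

definition cubical_boundary :: "nat \<Rightarrow> 'u chain \<Rightarrow> 'u chain" where
  "cubical_boundary p =
     frag_extend (\<lambda>c. \<Sum>i\<in>{1..p}. \<Sum>e\<in>{0, 1::nat}.
       frag_cmul ((- 1) ^ (i + e)) (frag_of (cube_face p i (real e) c)))"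

definition degenerate_cube :: "nat \<Rightarrow> ((nat \<Rightarrow> real) \<Rightarrow> 'u) \<Rightarrow> bool" where
  "degenerate_cube p c \<longleftrightarrow>
     (\<exists>i<p. \<forall>x\<in>standard_cube p. \<forall>y\<in>standard_cube p. (\<forall>j. j \<noteq> i \<longrightarrow> x j = y j) \<longrightarrow> c x = c y)"

definition cubes :: "'u topology \<Rightarrow> int \<Rightarrow> ((nat \<Rightarrow> real) \<Rightarrow> 'u) set" where
  "cubes X n = {c. 0 \<le> n \<and> singular_cube (nat n) X c}"

definition cube_group :: "'u topology \<Rightarrow> int \<Rightarrow> 'u chain monoid" where
  "cube_group X n = free_Abelian_group (cubes X n)"

definition degenerate_chains :: "'u topology \<Rightarrow> int \<Rightarrow> 'u chain set" where
  "degenerate_chains X n =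
     generate (cube_group X n) (frag_of ` {c \<in> cubes X n. degenerate_cube (nat n) c})"

definition cube_class :: "'u topology \<Rightarrow> int \<Rightarrow> 'u chain \<Rightarrow> 'u chain set" where
  "cube_class X n c = degenerate_chains X n #>\<^bsub>cube_group X n\<^esub> c"

definition cubical_complex :: "'u topology \<Rightarrow> 'u chain set ccomplex" where
  "cubical_complex X =
     \<lparr>cgrp = (\<lambda>n. cube_group X n Mod degenerate_chains X n),
      cdiff = (\<lambda>n A. the_elem ((\<lambda>c. cube_class X (n - 1) (cubical_boundary (nat n) c)) ` A))\<rparr>"

definition cube_map :: "nat \<Rightarrow> ('u \<Rightarrow> 'u) \<Rightarrow> 'u chain \<Rightarrow> 'u chain" where
  "cube_map p f = frag_extend (\<lambda>c. frag_of (restrict (f \<circ> c) (standard_cube p)))"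

definition cross_cubes ::
  "('u \<times> 'u \<Rightarrow> 'u) \<Rightarrow> nat \<Rightarrow> nat \<Rightarrow> ((nat \<Rightarrow> real) \<Rightarrow> 'u) \<Rightarrow> ((nat \<Rightarrow> real) \<Rightarrow> 'u) \<Rightarrow> (nat \<Rightarrow> real) \<Rightarrow> 'u" where
  "cross_cubes pr p q c d =
     restrict (\<lambda>x. pr (c (\<lambda>i. if i < p then x i else 0), d (\<lambda>i. x (p + i)))) (standard_cube (p + q))"

definition cross_product ::
  "('u \<times> 'u \<Rightarrow> 'u) \<Rightarrow> nat \<Rightarrow> nat \<Rightarrow> 'u chain \<Rightarrow> 'u chain \<Rightarrow> 'u chain" where
  "cross_product pr p q a b =
     frag_extend (\<lambda>c. frag_extend (\<lambda>d. frag_of (cross_cubes pr p q c d)) b) a"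

definition cubical_functor :: "('u \<times> 'u \<Rightarrow> 'u) \<Rightarrow> 'u \<Rightarrow> ('u, 'u chain set) top_functor" where
  "cubical_functor pr pt =
     \<lparr>obj = cubical_complex,
      mor = (\<lambda>X Y f n A. the_elem ((\<lambda>c. cube_class Y n (cube_map (nat n) f c)) ` A)),
      kunneth = (\<lambda>X Y n. tensor_lift (cgrp (cubical_complex (prod_space pr X Y)) n)
        (\<lambda>(i, j, A, B). the_elem
           ((\<lambda>(c, d). cube_class (prod_space pr X Y) n (cross_product pr (nat i) (nat j) c d)) ` (A \<times> B)))),
      unitor = (\<lambda>n m. cube_class (point_space pt) n
        (frag_cmul m (frag_of (restrict (\<lambda>x. pt) (standard_cube 0)))))\<rparr>"

end

(* The zigzag is S <- S' -> N <- C = C. Here S' is the singular functor with every chain replaced by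
   the singleton of that chain, so that all intermediate functors take values in sets of chains, and N
   is the functor of normalized singular chains, the quotient of S by the degenerate simplices.

   S' -> N is the projection. Coning off with the first vertex gives an endomorphism of the ordered
   chains on a vertex set which is homotopic to the identity and kills the lists with an adjacent
   repetition; transported to singular simplices it gives an inverse up to homotopy. On vertex lists
   the shuffle product is a recursively defined sum over lattice paths, for which the Leibniz rule and
   associativity are proved by induction.

   C -> N triangulates a cube by the iterated shuffle product of its edge, which makes it strictly
   compatible with the cross product. Backwards, a simplex s is precomposed with the map from the cube
   to the simplex whose barycentric coordinates from the k-th on sum to the minimum of x_0, ..., x_(k-1).
   This is a chain map modulo degenerate cubes, and triangulating the result returns s modulo
   degenerate simplices; preceded by the normalization, it kills the degenerate simplices. The other
   composite is homotopic to the identity by acyclic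
   models, with the contraction (t, x) |-> t * c x of the cubes in a cube. *)

theory Submission
  imports Defs
begin

section \<open>Free abelian groups: supports, linear extension and induced maps\<close>

section \<open>Chains supported in a set\<close>

text \<open>Faces, degeneracies, shuffles and triangulations all act by precomposition with maps
  that are affine on a simplex, and such a map is nothing but a list of vertices. Identities between
  chains are therefore proved once in free abelian groups on vertex lists and pushed forward along
  families of simplices indexed by lists.

  What shapes the zigzag is that its arrows must respect the Kuenneth morphisms strictly, whereas
  inverses and homotopies are free of this condition. Triangulating by shuffles is strictly
  multiplicative because the shuffle product is associative, but it sends a degenerate cube to
  degenerate simplices and not to zero (a constant path becomes a constant 1-simplex). Hence it
  cannot land in all singular chains, and the normalized ones have to stand in between.

  All the complexes are treated as one kind of object: free groups on generators, modulo those
  generators marked as degenerate. Every condition on functors, transformations and homotopies is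
  then an equation on generators, and for inverses and homotopies it only has to hold modulo
  degenerate ones.\<close>

definition chains_on :: "'a set \<Rightarrow> ('a \<Rightarrow>\<^sub>0 int) set" where
  "chains_on S = {c. Poly_Mapping.keys c \<subseteq> S}"

lemma chains_zero [simp, intro]: "0 \<in> chains_on S"
  by (simp add: chains_on_def)

lemma chains_of [simp]: "frag_of x \<in> chains_on S \<longleftrightarrow> x \<in> S"
  by (simp add: chains_on_def)

lemma chains_add [intro]: "a \<in> chains_on S \<Longrightarrow> b \<in> chains_on S \<Longrightarrow> a + b \<in> chains_on S"
  using keys_add by (fastforce simp: chains_on_def)

lemma chains_diff [intro]: "a \<in> chains_on S \<Longrightarrow> b \<in> chains_on S \<Longrightarrow> a - b \<in> chains_on S"
  using keys_diff by (fastforce simp: chains_on_def)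

lemma chains_minus [simp]: "- a \<in> chains_on S \<longleftrightarrow> a \<in> chains_on S"
  by (simp add: chains_on_def)

lemma chains_cmul [intro]: "a \<in> chains_on S \<Longrightarrow> frag_cmul k a \<in> chains_on S"
  using keys_cmul by (fastforce simp: chains_on_def)

lemma chains_sum [intro]: "(\<And>i. i \<in> I \<Longrightarrow> f i \<in> chains_on S) \<Longrightarrow> sum f I \<in> chains_on S"
  by (induction I rule: infinite_finite_induct) auto

lemma chains_mono: "a \<in> chains_on S \<Longrightarrow> S \<subseteq> T \<Longrightarrow> a \<in> chains_on T"
  by (auto simp: chains_on_def)

lemma chains_empty [simp]: "chains_on {} = {0}"
  by (auto simp: chains_on_def)

lemma chains_UNIV [simp]: "chains_on UNIV = UNIV"
  by (auto simp: chains_on_def)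

text \<open>Generators and differences already produce the whole free abelian group, so a single
  closure step stands for sums, negatives and multiples. Linear identities are reduced to generators
  by this rule throughout.\<close>

lemma chains_induct [consumes 1, case_names zero one diff]:
  assumes "c \<in> chains_on S" "P 0" "\<And>x. x \<in> S \<Longrightarrow> P (frag_of x)" "\<And>a b. P a \<Longrightarrow> P b \<Longrightarrow> P (a - b)"
  shows "P c"
  by (rule frag_induction[of c S]) (use assms in \<open>auto simp: chains_on_def\<close>)

lemma frag_induct [case_names zero one diff]:
  assumes "P 0" "\<And>x. P (frag_of x)" "\<And>a b. P a \<Longrightarrow> P b \<Longrightarrow> P (a - b)"
  shows "P c"
  by (rule chains_induct[of c UNIV]) (use assms in auto)

lemma chains_extend:
  assumes "c \<in> chains_on S" "\<And>x. x \<in> S \<Longrightarrow> f x \<in> chains_on T"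
  shows "frag_extend f c \<in> chains_on T"
  using assms(1) by (induction rule: chains_induct) (auto simp: assms frag_extend_diff)

lemma frag_extend_cong:
  assumes "c \<in> chains_on S" "\<And>x. x \<in> S \<Longrightarrow> f x = g x"
  shows "frag_extend f c = frag_extend g c"
  using assms(1) by (induction rule: chains_induct) (auto simp: assms frag_extend_diff)

lemma frag_extend_extend:
  "frag_extend f (frag_extend g c) = frag_extend (\<lambda>x. frag_extend f (g x)) c"
  by (induction c rule: frag_induct) (auto simp: frag_extend_diff)

lemma frag_extend_fun_add:
  "frag_extend (\<lambda>x. f x + g x) c = frag_extend f c + frag_extend g c"
  by (induction c rule: frag_induct) (auto simp: frag_extend_diff)

lemma frag_extend_fun_diff:
  "frag_extend (\<lambda>x. f x - g x) c = frag_extend f c - frag_extend g c"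
  by (induction c rule: frag_induct) (auto simp: frag_extend_diff)

lemma frag_cmul_diff_distrib2: "frag_cmul c (a - b) = frag_cmul c a - frag_cmul c b"
  by (rule poly_mapping_eqI) (simp add: lookup_minus right_diff_distrib)

lemma frag_extend_fun_cmul:
  "frag_extend (\<lambda>x. frag_cmul k (f x)) c = frag_cmul k (frag_extend f c)"
  by (induction c rule: frag_induct) (auto simp: frag_extend_diff frag_cmul_diff_distrib2)

lemma frag_extend_fun_zero [simp]: "frag_extend (\<lambda>x. 0) c = 0"
  by (induction c rule: frag_induct) (auto simp: frag_extend_diff)

lemma frag_extend_sum': "frag_extend f (sum g I) = (\<Sum>i\<in>I. frag_extend f (g i))"
  by (induction I rule: infinite_finite_induct) (auto simp: frag_extend_add)

text \<open>Both sides are the bilinear extension of \<open>f\<close>, whichever argument is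
  expanded first.\<close>

lemma frag_extend_commute:
  "frag_extend (\<lambda>x. frag_extend (f x) b) a = frag_extend (\<lambda>y. frag_extend (\<lambda>x. f x y) a) b"
  by (induction a rule: frag_induct)
    (auto simp: frag_extend_diff frag_extend_fun_diff)

lemma frag_extend_frag_of [simp]: "frag_extend frag_of c = c"
  by (rule frag_expansion[symmetric])

lemmas frag_lin = frag_extend_add frag_extend_diff frag_extend_minus frag_extend_cmul
  frag_cmul_distrib2 frag_cmul_diff_distrib2 frag_extend_fun_add frag_extend_fun_diff
  frag_extend_fun_cmul

definition fmap :: "('a \<Rightarrow> 'b) \<Rightarrow> ('a \<Rightarrow>\<^sub>0 int) \<Rightarrow> 'b \<Rightarrow>\<^sub>0 int" where
  "fmap g = frag_extend (\<lambda>x. frag_of (g x))"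

lemma fmap_of [simp]: "fmap g (frag_of x) = frag_of (g x)"
  by (simp add: fmap_def)

lemma fmap_lin [simp]:
  "fmap g 0 = 0" "fmap g (a + b) = fmap g a + fmap g b" "fmap g (a - b) = fmap g a - fmap g b"
  "fmap g (- a) = - fmap g a" "fmap g (frag_cmul k a) = frag_cmul k (fmap g a)"
  by (simp_all add: fmap_def frag_lin)

lemma fmap_extend: "fmap g (frag_extend f c) = frag_extend (\<lambda>x. fmap g (f x)) c"
  by (simp add: fmap_def frag_extend_extend)

lemma extend_fmap: "frag_extend f (fmap g c) = frag_extend (\<lambda>x. f (g x)) c"
  by (simp add: fmap_def frag_extend_extend)

lemma fmap_fmap: "fmap f (fmap g c) = fmap (\<lambda>x. f (g x)) c"
  by (simp add: fmap_def frag_extend_extend)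

lemma fmap_sum: "fmap g (sum f I) = (\<Sum>i\<in>I. fmap g (f i))"
  by (simp add: fmap_def frag_extend_sum')

lemma fmap_cong: "c \<in> chains_on S \<Longrightarrow> (\<And>x. x \<in> S \<Longrightarrow> f x = g x) \<Longrightarrow> fmap f c = fmap g c"
  unfolding fmap_def by (rule frag_extend_cong) auto

lemma fmap_ident [simp]: "fmap (\<lambda>x. x) c = c"
  by (simp add: fmap_def)

lemma chains_fmap: "c \<in> chains_on S \<Longrightarrow> (\<And>x. x \<in> S \<Longrightarrow> f x \<in> T) \<Longrightarrow> fmap f c \<in> chains_on T"
  unfolding fmap_def by (rule chains_extend) auto

lemma chains_Int: "c \<in> chains_on S \<Longrightarrow> c \<in> chains_on T \<Longrightarrow> c \<in> chains_on (S \<inter> T)"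
  by (auto simp: chains_on_def)


section \<open>The augmented ordered chain complex on a set of vertices\<close>

section \<open>Ordered chains on vertex lists\<close>

definition fcons :: "'v \<Rightarrow> ('v list \<Rightarrow>\<^sub>0 int) \<Rightarrow> 'v list \<Rightarrow>\<^sub>0 int" where
  "fcons v = fmap (Cons v)"

lemma fcons_of [simp]: "fcons v (frag_of w) = frag_of (v # w)"
  by (simp add: fcons_def)

lemma fcons_lin [simp]:
  "fcons v 0 = 0" "fcons v (a + b) = fcons v a + fcons v b" "fcons v (a - b) = fcons v a - fcons v b"
  "fcons v (- a) = - fcons v a" "fcons v (frag_cmul k a) = frag_cmul k (fcons v a)"
  by (simp_all add: fcons_def)

lemma extend_fcons: "frag_extend f (fcons v c) = frag_extend (\<lambda>w. f (v # w)) c"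
  by (simp add: fcons_def extend_fmap)

lemma fcons_extend: "fcons v (frag_extend f c) = frag_extend (\<lambda>w. fcons v (f w)) c"
  by (simp add: fcons_def fmap_extend)

lemma fmap_map_fcons: "fmap (map g) (fcons v c) = fcons (g v) (fmap (map g) c)"
  by (simp add: fcons_def fmap_fmap)

lemma chains_fcons: "c \<in> chains_on S \<Longrightarrow> (\<And>w. w \<in> S \<Longrightarrow> v # w \<in> T) \<Longrightarrow> fcons v c \<in> chains_on T"
  unfolding fcons_def by (rule chains_fmap) auto

text \<open>The boundary is augmented: the boundary of a single vertex is the empty list.\<close>

primrec list_boundary :: "'v list \<Rightarrow> 'v list \<Rightarrow>\<^sub>0 int" where
  "list_boundary [] = 0"
| "list_boundary (v # w) = frag_of w - fcons v (list_boundary w)"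

text \<open>The cone formula: thanks to the augmentation, prepending a vertex is a contracting
  homotopy in every degree, with no exception for single vertices. The homotopies on ordered chains
  all come from it.\<close>

lemma list_boundary_fcons: "frag_extend list_boundary (fcons v c) = c - fcons v (frag_extend list_boundary c)"
  by (simp add: extend_fcons frag_lin fcons_extend)

lemma list_boundary_list_boundary: "frag_extend list_boundary (list_boundary w) = 0"
  by (induction w) (auto simp: frag_lin list_boundary_fcons)

lemma list_boundary_map: "list_boundary (map g w) = fmap (map g) (list_boundary w)"
  by (induction w) (auto simp: fmap_map_fcons)

lemma list_boundary_chains: "list_boundary w \<in> chains_on {u. Suc (length u) = length w \<and> set u \<subseteq> set w}"
proof (induction w)
  case (Cons v w)
  have "fcons v (list_boundary w) \<in> chains_on {u. Suc (length u) = length (v # w) \<and> set u \<subseteq> set (v # w)}"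
    by (rule chains_fcons[OF Cons.IH]) auto
  then show ?case by auto
qed auto

text \<open>Unrolls the recursion into the alternating sum over deleted vertices, the shape in which
  the singular boundary is given.\<close>

lemma list_boundary_sum:
  "list_boundary w = (\<Sum>k<length w. frag_cmul ((-1) ^ k) (frag_of (take k w @ drop (Suc k) w)))"
proof (induction w)
  case (Cons v w)
  have "fcons v (list_boundary w) = (\<Sum>k<length w. frag_cmul ((-1) ^ k) (frag_of (v # take k w @ drop (Suc k) w)))"
    by (simp add: Cons.IH fcons_def fmap_sum)
  then show ?case
    by (simp add: sum.lessThan_Suc_shift sum_negf del: sum.lessThan_Suc flip: minus_frag_cmul)
qed auto

subsection \<open>The shuffle product of vertex lists\<close>

text \<open>The terms are the lattice paths from the first to the last pair of vertices, split according
  to their first step.\<close>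

fun ez :: "'a list \<Rightarrow> 'b list \<Rightarrow> ('a \<times> 'b) list \<Rightarrow>\<^sub>0 int" where
  "ez [] ys = 0"
| "ez (x # xs) [] = 0"
| "ez (x # xs) (y # ys) =
    (if xs = [] \<and> ys = [] then frag_of [(x, y)]
     else fcons (x, y) (ez xs (y # ys) + frag_cmul ((-1) ^ length xs) (ez (x # xs) ys)))"

lemma ez_Nil2 [simp]: "ez xs [] = 0"
  by (cases xs) auto

declare ez.simps(3) [simp del]

lemma ez_singletons [simp]: "ez [x] [y] = frag_of [(x, y)]"
  by (simp add: ez.simps)

text \<open>A first step in the second factor has to pass the \<open>length xs\<close> remaining
  steps of the first one, hence the sign. Two single vertices are excluded because there the path is
  already at its end.\<close>

lemma ez_Cons:
  "xs \<noteq> [] \<or> ys \<noteq> [] \<Longrightarrow> ez (x # xs) (y # ys) =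
     fcons (x, y) (ez xs (y # ys)) + frag_cmul ((-1) ^ length xs) (fcons (x, y) (ez (x # xs) ys))"
  by (simp add: ez.simps)

lemma ez_singleton2: "ez xs [y] = (if xs = [] then 0 else frag_of (map (\<lambda>x. (x, y)) xs))"
proof (induction xs)
  case (Cons x xs)
  then show ?case by (cases "xs = []") (auto simp: ez_Cons)
qed auto

lemma ez_singleton1: "ez [x] ys = (if ys = [] then 0 else frag_of (map (Pair x) ys))"
proof (induction ys)
  case (Cons y ys)
  then show ?case by (cases "ys = []") (auto simp: ez_Cons)
qed auto

text \<open>Naturality in the vertices. It turns faces of cubes, flattened coordinates and
  concatenated bit lists into mere relabellings.\<close>

lemma ez_map: "ez (map f xs) (map g ys) = fmap (map (map_prod f g)) (ez xs ys)"
  by (induction xs ys rule: ez.induct) (auto simp: ez.simps fmap_map_fcons)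

text \<open>A path with p + q steps has p + q + 1 vertices, one less than the two lists have
  together. The common starting point is recorded because it decides whether prepending a vertex
  creates an adjacent repetition.\<close>

lemma ez_chains:
  "ez xs ys \<in> chains_on {w. Suc (length w) = length xs + length ys \<and> set w \<subseteq> set xs \<times> set ys \<and>
     hd w = (hd xs, hd ys)}"
proof (induction xs ys rule: ez.induct)
  case (3 x xs y ys)
  show ?case
  proof (cases "xs = [] \<and> ys = []")
    case True then show ?thesis by auto
  next
    case False
    have "fcons (x, y) (ez xs (y # ys)) \<in> chains_on {w. Suc (length w) = length (x # xs) + length (y # ys)
        \<and> set w \<subseteq> set (x # xs) \<times> set (y # ys) \<and> hd w = (x, y)}"
      by (rule chains_fcons[OF 3(1)]) (use False in auto)
    moreover have "fcons (x, y) (ez (x # xs) ys) \<in> chains_on {w. Suc (length w) = length (x # xs) + length (y # ys)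
        \<and> set w \<subseteq> set (x # xs) \<times> set (y # ys) \<and> hd w = (x, y)}"
      by (rule chains_fcons[OF 3(2)]) (use False in auto)
    ultimately show ?thesis using False by (auto simp: ez_Cons)
  qed
qed auto

text \<open>The recursion with a chain in place of the first list. The lists in the chain need a
  common length for their signs to agree.\<close>

lemma ez_extend_Cons1:
  assumes "c \<in> chains_on {u. length u = n}" "n > 0 \<or> ys \<noteq> []"
  shows "frag_extend (\<lambda>u. ez (x # u) (y # ys)) c =
    fcons (x, y) (frag_extend (\<lambda>u. ez u (y # ys)) c) +
    frag_cmul ((-1) ^ n) (fcons (x, y) (frag_extend (\<lambda>u. ez (x # u) ys) c))"
proof -
  have "frag_extend (\<lambda>u. ez (x # u) (y # ys)) c = frag_extend (\<lambda>u. fcons (x, y) (ez u (y # ys)) +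
      frag_cmul ((-1) ^ n) (fcons (x, y) (ez (x # u) ys))) c"
    by (rule frag_extend_cong[OF assms(1)]) (use assms(2) in \<open>auto simp: ez_Cons\<close>)
  then show ?thesis by (simp add: frag_lin fcons_extend)
qed

lemma ez_extend_Cons2:
  assumes "c \<in> chains_on {u. length u = n}" "n > 0 \<or> xs \<noteq> []"
  shows "frag_extend (\<lambda>u. ez (x # xs) (y # u)) c =
    fcons (x, y) (frag_extend (\<lambda>u. ez xs (y # u)) c) +
    frag_cmul ((-1) ^ length xs) (fcons (x, y) (frag_extend (\<lambda>u. ez (x # xs) u) c))"
proof -
  have "frag_extend (\<lambda>u. ez (x # xs) (y # u)) c = frag_extend (\<lambda>u. fcons (x, y) (ez xs (y # u)) +
      frag_cmul ((-1) ^ length xs) (fcons (x, y) (ez (x # xs) u))) c"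
    by (rule frag_extend_cong[OF assms(1)]) (use assms(2) in \<open>auto simp: ez_Cons\<close>)
  then show ?thesis by (simp add: frag_lin fcons_extend)
qed

lemma list_boundary_length: "list_boundary w \<in> chains_on {u. length u = length w - 1}"
  by (rule chains_mono[OF list_boundary_chains]) auto

text \<open>The Leibniz rule. The augmentation does no harm: a single vertex has the empty list as
  boundary, and \<open>ez\<close> vanishes on it. Only for two single vertices would the left side
  be the empty list and the right side zero, whence the bound on the lengths.\<close>

proposition list_boundary_ez:
  assumes "xs \<noteq> []" "ys \<noteq> []" "length xs + length ys > 2"
  shows "frag_extend list_boundary (ez xs ys) = frag_extend (\<lambda>u. ez u ys) (list_boundary xs) +
    frag_cmul ((-1) ^ (length xs - 1)) (frag_extend (ez xs) (list_boundary ys))"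
  using assms
proof (induction xs ys rule: ez.induct)
  case (3 x xs y ys)
  let ?s = "(-1::int) ^ length xs"
  have ne: "xs \<noteq> [] \<or> ys \<noteq> []" using 3 by auto
  \<comment> \<open>The induction hypotheses apply only if both tails are non-empty. With a single
    vertex in one factor the product is a relabelled list and is computed directly.\<close>
  consider (a) "xs = []" "ys \<noteq> []" | (b) "xs \<noteq> []" "ys = []" "length xs = 1"
    | (c) "xs \<noteq> []" "ys = []" "length xs > 1" | (d) "xs \<noteq> []" "ys \<noteq> []"
    using ne by (metis One_nat_def length_0_conv less_one linorder_neqE_nat)
  then show ?case
  proof cases
    case a
    then show ?thesis by (simp add: ez_singleton1 list_boundary_map frag_lin extend_fcons fmap_map_fcons)
       (auto simp: fmap_def fcons_def frag_lin frag_extend_extend ez_singleton1 intro!: frag_extend_cong[OF list_boundary_length])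
  next
    case b
    then obtain x' where "xs = [x']" by (cases xs) auto
    then show ?thesis using b by (simp add: ez_singleton2 frag_lin)
  next
    case c
    have "list_boundary (x # xs) \<in> chains_on {u. length u = length xs}"
      using list_boundary_length[of "x # xs"] by auto
    then have "frag_extend (\<lambda>u. ez u [y]) (list_boundary (x # xs)) = fmap (map (\<lambda>x. (x, y))) (list_boundary (x # xs))"
      unfolding fmap_def by (rule frag_extend_cong) (use c in \<open>auto simp: ez_singleton2\<close>)
    then show ?thesis using c
      by (simp add: ez_singleton2 frag_lin fmap_map_fcons list_boundary_map)
  next
    case d
    then obtain p q where p: "length xs = Suc p" and q: "length ys = Suc q"
      by (metis length_Suc_conv neq_Nil_conv)
    have IH1: "frag_extend list_boundary (ez xs (y # ys)) = frag_extend (\<lambda>u. ez u (y # ys)) (list_boundary xs) +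
       frag_cmul ((-1) ^ p) (frag_extend (ez xs) (list_boundary (y # ys)))"
      using 3(1) d p q by auto
    have IH2: "frag_extend list_boundary (ez (x # xs) ys) = frag_extend (\<lambda>u. ez u ys) (list_boundary (x # xs)) +
       frag_cmul ?s (frag_extend (ez (x # xs)) (list_boundary ys))"
      using 3(2) d p q by auto
    have lx: "list_boundary xs \<in> chains_on {u. length u = p}" using list_boundary_length[of xs] p by simp
    have ly: "list_boundary ys \<in> chains_on {u. length u = q}" using list_boundary_length[of ys] q by simp
    note e1 = ez_extend_Cons1[OF lx, of ys x y]
    note e2 = ez_extend_Cons2[OF ly, of xs x y]
    have [simp]: "frag_cmul k a + frag_cmul (- k) a = 0" for k and a :: "('a \<times> 'b) list \<Rightarrow>\<^sub>0 int"
      by (metis add.right_inverse minus_frag_cmul)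
    have sq: "(- 1 :: int) ^ p * (- 1) ^ p = 1" by (simp flip: power_add)
    \<comment> \<open>The faces that drop the first vertex of a factor are split off. The term
      \<open>ez xs ys\<close>, with both first vertices dropped, arises once from each induction
      hypothesis, with opposite total signs, and cancels.\<close>
    have R1: "frag_extend (\<lambda>u. ez u (y # ys)) (list_boundary (x # xs)) =
        ez xs (y # ys) - frag_extend (\<lambda>u. ez (x # u) (y # ys)) (list_boundary xs)"
      "frag_extend (\<lambda>u. ez u ys) (list_boundary (x # xs)) = ez xs ys - frag_extend (\<lambda>u. ez (x # u) ys) (list_boundary xs)"
      by (simp_all add: frag_lin extend_fcons)
    have R2: "frag_extend (ez (x # xs)) (list_boundary (y # ys)) =
        ez (x # xs) ys - frag_extend (\<lambda>u. ez (x # xs) (y # u)) (list_boundary ys)"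
      "frag_extend (ez xs) (list_boundary (y # ys)) = ez xs ys - frag_extend (\<lambda>u. ez xs (y # u)) (list_boundary ys)"
      by (simp_all add: frag_lin extend_fcons)
    have L: "frag_extend list_boundary (ez (x # xs) (y # ys)) = ez xs (y # ys) - fcons (x, y) (frag_extend list_boundary (ez xs (y # ys)))
        + frag_cmul ?s (ez (x # xs) ys - fcons (x, y) (frag_extend list_boundary (ez (x # xs) ys)))"
      using d by (simp only: ez_Cons frag_extend_add frag_extend_cmul list_boundary_fcons simp_thms)
    show ?thesis
      unfolding L IH1 IH2 R1 R2 e1[OF disjI2[OF d(2)]] e2[OF disjI2[OF d(1)]]
      by (simp add: p algebra_simps sq frag_cmul_distrib2 frag_cmul_diff_distrib2 flip: minus_frag_cmul)
  qed
qed auto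

lemma frag_extend_ez_fcons:
  assumes "c \<in> chains_on {u. length u = n}" "n > 0 \<or> ys \<noteq> []"
  shows "frag_extend (\<lambda>u. ez u (y # ys)) (fcons x c) =
    fcons (x, y) (frag_extend (\<lambda>u. ez u (y # ys)) c) +
    frag_cmul ((-1) ^ n) (fcons (x, y) (frag_extend (\<lambda>u. ez u ys) (fcons x c)))"
  using ez_extend_Cons1[OF assms] by (simp only: extend_fcons)

lemma frag_extend_ez_fcons2:
  assumes "c \<in> chains_on {u. length u = n}" "n > 0 \<or> xs \<noteq> []"
  shows "frag_extend (ez (x # xs)) (fcons y c) =
    fcons (x, y) (frag_extend (ez xs) (fcons y c)) +
    frag_cmul ((-1) ^ length xs) (fcons (x, y) (frag_extend (ez (x # xs)) c))"
  using ez_extend_Cons2[OF assms] by (simp only: extend_fcons)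

definition reassoc :: "('a \<times> 'b) \<times> 'c \<Rightarrow> 'a \<times> 'b \<times> 'c" where
  "reassoc = (\<lambda>((x, y), z). (x, y, z))"

lemma reassoc_simp [simp]: "reassoc ((x, y), z) = (x, y, z)"
  by (simp add: reassoc_def)

text \<open>All lattice paths leave from the same corner, so the product is a cone. Naming the rest
  \<open>c\<close> allows the recursion to be applied to a product inside a product.\<close>

lemma ez_tail:
  assumes "xs \<noteq> []" "ys \<noteq> []"
  obtains c where "ez xs ys = fcons (hd xs, hd ys) c"
    "c \<in> chains_on {u. Suc (Suc (length u)) = length xs + length ys}"
    "length xs > 1 \<or> length ys > 1 \<Longrightarrow>
      c = ez (tl xs) ys + frag_cmul ((-1) ^ (length xs - 1)) (ez xs (tl ys))"
proof -
  obtain x xs' y ys' where [simp]: "xs = x # xs'" "ys = y # ys'"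
    using assms by (metis list.exhaust)
  show thesis
  proof (cases "xs' = [] \<and> ys' = []")
    case True
    then show thesis using that[of "frag_of []"] by simp
  next
    case False
    have "ez xs' ys \<in> chains_on {u. Suc (Suc (length u)) = length xs + length ys}"
      "ez xs ys' \<in> chains_on {u. Suc (Suc (length u)) = length xs + length ys}"
      using ez_chains[of xs' ys] ez_chains[of xs ys'] by (auto elim!: chains_mono)
    then show thesis using False
      by (intro that[of "ez xs' ys + frag_cmul ((-1) ^ length xs') (ez xs ys')"]) (auto simp: ez_Cons)
  qed
qed

text \<open>Both sides are signed sums over lattice paths in a three-dimensional grid. Splitting off
  the first step leaves three products, each with one of the factors shortened, and the signs
  collected on the two sides agree. The total length is the induction measure since a different
  factor shrinks each time.\<close>

proposition ez_assoc:
  "fmap (map reassoc) (frag_extend (\<lambda>u. ez u zs) (ez xs ys)) = frag_extend (ez xs) (ez ys zs)"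
proof (induction "length xs + length ys + length zs" arbitrary: xs ys zs rule: less_induct)
  case less
  show ?case
  proof (cases "xs = [] \<or> ys = [] \<or> zs = []")
    case True
    then show ?thesis by (auto simp: fmap_def frag_extend_extend ez.simps(1)[abs_def])
  next
    case False
    then obtain x xs' y ys' z zs' where xs: "xs = x # xs'" and ys: "ys = y # ys'" and zs: "zs = z # zs'"
      by (metis list.exhaust)
    show ?thesis
    proof (cases "xs' = [] \<and> ys' = [] \<and> zs' = []")
      case True
      then show ?thesis by (simp add: xs ys zs)
    next
      case ne: False
      obtain c where c: "ez xs ys = fcons (x, y) c"
        "c \<in> chains_on {u. length u = length xs' + length ys'}"
        "xs' \<noteq> [] \<or> ys' \<noteq> [] \<Longrightarrow> c = ez xs' ys + frag_cmul ((-1) ^ length xs') (ez xs ys')"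
        by (rule ez_tail[of xs ys]) (auto simp: xs ys)
      obtain d where d: "ez ys zs = fcons (y, z) d"
        "d \<in> chains_on {u. length u = length ys' + length zs'}"
        "ys' \<noteq> [] \<or> zs' \<noteq> [] \<Longrightarrow> d = ez ys' zs + frag_cmul ((-1) ^ length ys') (ez ys zs')"
        by (rule ez_tail[of ys zs]) (auto simp: ys zs)
      have IH1: "fmap (map reassoc) (frag_extend (\<lambda>u. ez u zs) (ez xs' ys)) = frag_extend (ez xs') (ez ys zs)"
        by (rule less) (simp add: xs ys zs)
      have IH2: "fmap (map reassoc) (frag_extend (\<lambda>u. ez u zs) (ez xs ys')) = frag_extend (ez xs) (ez ys' zs)"
        by (rule less) (simp add: xs ys zs)
      have IH3: "fmap (map reassoc) (frag_extend (\<lambda>u. ez u zs') (ez xs ys)) = frag_extend (ez xs) (ez ys zs')"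
        by (rule less) (simp add: xs ys zs)
      have c': "frag_extend (\<lambda>u. ez u zs) c = frag_extend (\<lambda>u. ez u zs) (ez xs' ys)
          + frag_cmul ((-1) ^ length xs') (frag_extend (\<lambda>u. ez u zs) (ez xs ys'))"
      proof (cases "xs' \<noteq> [] \<or> ys' \<noteq> []")
        case True
        then show ?thesis by (simp add: c(3) frag_lin)
      next
        case False
        \<comment> \<open>Here \<open>c\<close> is a multiple of the empty list, on which
          \<open>ez\<close> vanishes, and both products on the right have an empty factor.\<close>
        then have "c \<in> chains_on {[]}" using c(2) by (auto elim!: chains_mono)
        then have "frag_extend (\<lambda>u. ez u zs) c = frag_extend (\<lambda>u. 0) c"
          by (rule frag_extend_cong) auto
        then show ?thesis using False by (simp add: xs ys)
      qed
      have d': "frag_extend (ez xs) d = frag_extend (ez xs) (ez ys' zs)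
          + frag_cmul ((-1) ^ length ys') (frag_extend (ez xs) (ez ys zs'))"
      proof (cases "ys' \<noteq> [] \<or> zs' \<noteq> []")
        case True
        then show ?thesis by (simp add: d(3) frag_lin)
      next
        case False
        then have "d \<in> chains_on {[]}" using d(2) by (auto elim!: chains_mono)
        then have "frag_extend (ez xs) d = frag_extend (\<lambda>u. 0) d"
          by (rule frag_extend_cong) auto
        then show ?thesis using False by (simp add: ys zs)
      qed
      have L: "frag_extend (\<lambda>u. ez u zs) (ez xs ys) =
        fcons ((x, y), z) (frag_extend (\<lambda>u. ez u zs) c) + frag_cmul ((-1) ^ (length xs' + length ys'))
           (fcons ((x, y), z) (frag_extend (\<lambda>u. ez u zs') (ez xs ys)))"
        unfolding c(1) zs by (rule frag_extend_ez_fcons[OF c(2)]) (use ne in auto)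
      have R: "frag_extend (ez xs) (ez ys zs) =
        fcons (x, (y, z)) (frag_extend (ez xs') (ez ys zs)) + frag_cmul ((-1) ^ length xs')
           (fcons (x, (y, z)) (frag_extend (ez xs) d))"
        unfolding d(1) xs by (rule frag_extend_ez_fcons2[OF d(2)]) (use ne in auto)
      show ?thesis
        unfolding L R c' d'
        by (simp add: fmap_map_fcons IH1 IH2 IH3 frag_cmul_distrib2 power_add add.assoc)
    qed
  qed
qed

subsection \<open>Lists with adjacent repetitions\<close>

text \<open>The list counterpart of degenerate simplices. Only adjacent repetitions count: a list
  such as \<open>[x, y, x]\<close> is not in the image of a degeneracy operator.\<close>

fun adjdup :: "'v list \<Rightarrow> bool" where
  "adjdup (x # y # w) \<longleftrightarrow> x = y \<or> adjdup (y # w)"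
| "adjdup _ \<longleftrightarrow> False"

lemma adjdup_Cons: "adjdup w \<Longrightarrow> adjdup (x # w)"
  by (cases w) auto

lemma adjdup_hd: "w \<noteq> [] \<Longrightarrow> hd w = x \<Longrightarrow> adjdup (x # w)"
  by (cases w) auto

lemma adjdup_map: "adjdup w \<Longrightarrow> adjdup (map f w)"
  by (induction w rule: adjdup.induct) auto

lemma adjdup_nth: "adjdup w \<longleftrightarrow> (\<exists>i. Suc i < length w \<and> w ! i = w ! Suc i)"
proof (induction w rule: adjdup.induct)
  case (1 x y w)
  show ?case
  proof
    assume "adjdup (x # y # w)"
    then show "\<exists>i. Suc i < length (x # y # w) \<and> (x # y # w) ! i = (x # y # w) ! Suc i"
      using 1 by (auto intro: exI[of _ 0])
  next
    assume "\<exists>i. Suc i < length (x # y # w) \<and> (x # y # w) ! i = (x # y # w) ! Suc i"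
    then obtain i where "Suc i < length (x # y # w)" "(x # y # w) ! i = (x # y # w) ! Suc i" by blast
    then show "adjdup (x # y # w)"
      using 1 by (cases i) auto
  qed
qed auto

lemma adjdup_length: "adjdup w \<Longrightarrow> length w \<ge> 2"
  by (induction w rule: adjdup.induct) auto

text \<open>The two faces that delete one of the equal neighbours carry opposite signs and cancel;
  every other face keeps the repetition.\<close>

lemma list_boundary_adjdup: "adjdup w \<Longrightarrow> list_boundary w \<in> chains_on (Collect adjdup)"
proof (induction w rule: adjdup.induct)
  case (1 x y w)
  show ?case
  proof (cases "adjdup (y # w)")
    case True
    have "fcons x (list_boundary (y # w)) \<in> chains_on (Collect adjdup)"
      by (rule chains_fcons[OF 1(1)[OF True]]) (auto simp: adjdup_Cons)
    then show ?thesis using True by (auto simp del: list_boundary.simps(2) simp: list_boundary.simps(2)[of x])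
  next
    case False
    then have "x = y" using 1 by auto
    moreover have "fcons x (fcons x (list_boundary w)) \<in> chains_on (Collect adjdup)"
      by (rule chains_fcons[OF chains_fcons[of _ UNIV _ "{u. \<exists>v. u = x # v}"]]) auto
    ultimately show ?thesis by auto
  qed
qed auto

lemma ez_hd: "ez xs ys \<in> chains_on {w. w \<noteq> [] \<and> hd w = (hd xs, hd ys)}"
proof (cases "xs = [] \<or> ys = []")
  case False
  then have "length xs + length ys \<ge> 2" by (cases xs; cases ys) auto
  then show ?thesis by (intro chains_mono[OF ez_chains]) auto
qed auto

text \<open>Every lattice path passes from the first of the two equal columns to the second by a
  single horizontal step, and the endpoints of this step coincide.\<close>

lemma ez_adjdup1: "adjdup xs \<Longrightarrow> ez xs ys \<in> chains_on (Collect adjdup)"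
proof (induction xs ys rule: ez.induct)
  case (3 x xs y ys)
  then obtain x2 xs' where xs: "xs = x2 # xs'" by (cases xs) auto
  have "fcons (x, y) (ez xs (y # ys)) \<in> chains_on (Collect adjdup)"
  proof (cases "adjdup xs")
    case True
    then have "ez xs (y # ys) \<in> chains_on (Collect adjdup)"
      using 3(1) by (auto simp: xs)
    then show ?thesis
      by (rule chains_fcons) (auto simp: adjdup_Cons)
  next
    case False
    then have "x = x2" using 3(3) by (auto simp: xs)
    then show ?thesis
      by (intro chains_fcons[OF ez_hd]) (auto simp: xs adjdup_hd)
  qed
  moreover have "fcons (x, y) (ez (x # xs) ys) \<in> chains_on (Collect adjdup)"
    by (rule chains_fcons[OF 3(2)]) (use 3(3) in \<open>auto simp: xs adjdup_Cons\<close>)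
  ultimately show ?case by (auto simp: ez_Cons xs)
qed auto

lemma ez_adjdup2: "adjdup ys \<Longrightarrow> ez xs ys \<in> chains_on (Collect adjdup)"
proof (induction xs ys rule: ez.induct)
  case (3 x xs y ys)
  then obtain y2 ys' where ys: "ys = y2 # ys'" by (cases ys) auto
  have "fcons (x, y) (ez (x # xs) ys) \<in> chains_on (Collect adjdup)"
  proof (cases "adjdup ys")
    case True
    then have "ez (x # xs) ys \<in> chains_on (Collect adjdup)"
      using 3(2) by (auto simp: ys)
    then show ?thesis
      by (rule chains_fcons) (auto simp: adjdup_Cons)
  next
    case False
    then have "y = y2" using 3(3) by (auto simp: ys)
    then show ?thesis
      by (intro chains_fcons[OF ez_hd]) (auto simp: ys adjdup_hd)
  qed
  moreover have "fcons (x, y) (ez xs (y # ys)) \<in> chains_on (Collect adjdup)"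
    by (rule chains_fcons[OF 3(1)]) (use 3(3) in \<open>auto simp: ys adjdup_Cons\<close>)
  ultimately show ?case by (auto simp: ez_Cons ys)
qed auto

lemma ez_set: "ez xs ys \<in> chains_on {w. set w \<subseteq> set xs \<times> set ys}"
  by (rule chains_mono[OF ez_chains]) auto

text \<open>Along a path each coordinate advances or stands still; the relations have to be
  reflexive because of the coordinate that stands still.\<close>

lemma ez_sorted:
  assumes "sorted_wrt R xs" "sorted_wrt S ys" "\<And>x. R x x" "\<And>y. S y y"
  shows "ez xs ys \<in> chains_on {w. sorted_wrt (\<lambda>(a, b) (c, d). R a c \<and> S b d) w}"
  using assms(1,2)
proof (induction xs ys rule: ez.induct)
  case (3 x xs y ys)
  let ?T = "{w. sorted_wrt (\<lambda>(a, b) (c, d). R a c \<and> S b d) w}"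
  show ?case
  proof (cases "xs = [] \<and> ys = []")
    case False
    have "ez xs (y # ys) \<in> chains_on (?T \<inter> {w. set w \<subseteq> set xs \<times> set (y # ys)})"
      using 3(1)[OF False] 3 by (intro chains_Int ez_set) auto
    then have 1: "fcons (x, y) (ez xs (y # ys)) \<in> chains_on ?T"
      by (rule chains_fcons) (use 3(3,4) assms(3,4) in fastforce)
    have "ez (x # xs) ys \<in> chains_on (?T \<inter> {w. set w \<subseteq> set (x # xs) \<times> set ys})"
      using 3(2)[OF False] 3 by (intro chains_Int ez_set) auto
    then have 2: "fcons (x, y) (ez (x # xs) ys) \<in> chains_on ?T"
      by (rule chains_fcons) (use 3(3,4) assms(3,4) in fastforce)
    show ?thesis using 1 2 False by (auto simp: ez_Cons)
  qed auto
qed auto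

subsection \<open>Normalization\<close>

text \<open>A chain endomorphism of the ordered chains which is killed by adjacent repetitions, and a
  homotopy from it to the identity, both obtained by coning off with the first vertex.\<close>

primrec norml :: "nat \<Rightarrow> 'v list \<Rightarrow> 'v list \<Rightarrow>\<^sub>0 int" where
  "norml 0 w = frag_of w"
| "norml (Suc p) w = fcons (hd w) (frag_extend (norml p) (list_boundary w))"

primrec normlh :: "nat \<Rightarrow> 'v list \<Rightarrow> 'v list \<Rightarrow>\<^sub>0 int" where
  "normlh 0 w = 0"
| "normlh (Suc p) w =
     fcons (hd w) (norml (Suc p) w - frag_of w - frag_extend (normlh p) (list_boundary w))"

lemma list_boundary_chains': "length w = Suc (Suc p) \<Longrightarrow> list_boundary w \<in> chains_on {u. length u = Suc p \<and> set u \<subseteq> set w}"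
  by (rule chains_mono[OF list_boundary_chains]) auto

lemma norml_chains: "length w = Suc p \<Longrightarrow> norml p w \<in> chains_on {u. length u = Suc p \<and> set u \<subseteq> set w}"
proof (induction p arbitrary: w)
  case (Suc p)
  have "frag_extend (norml p) (list_boundary w) \<in> chains_on {u. length u = Suc p \<and> set u \<subseteq> set w}"
    by (rule chains_extend[OF list_boundary_chains'[OF Suc(2)]], rule chains_mono[OF Suc(1)]) auto
  then show ?case unfolding norml.simps
    by (rule chains_fcons) (use Suc(2) in \<open>cases w, auto\<close>)
qed auto

lemma normlh_chains:
  "length w = Suc p \<Longrightarrow> normlh p w \<in> chains_on {u. length u = Suc (Suc p) \<and> set u \<subseteq> set w}"
proof (induction p arbitrary: w)
  case (Suc p)
  have "frag_extend (normlh p) (list_boundary w) \<in> chains_on {u. length u = Suc (Suc p) \<and> set u \<subseteq> set w}"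
    by (rule chains_extend[OF list_boundary_chains'[OF Suc(2)]], rule chains_mono[OF Suc(1)]) auto
  then have "norml (Suc p) w - frag_of w - frag_extend (normlh p) (list_boundary w)
      \<in> chains_on {u. length u = Suc (Suc p) \<and> set u \<subseteq> set w}"
    using norml_chains[OF Suc(2)] Suc(2) by (intro chains_diff) auto
  then show ?case unfolding normlh.simps
    by (rule chains_fcons) (use Suc(2) in \<open>cases w, auto\<close>)
qed auto

lemma norml_map: "length w = Suc p \<Longrightarrow> norml p (map g w) = fmap (map g) (norml p w)"
proof (induction p arbitrary: w)
  case (Suc p)
  have "frag_extend (norml p) (list_boundary (map g w)) = frag_extend (\<lambda>u. fmap (map g) (norml p u)) (list_boundary w)"
    unfolding list_boundary_map extend_fmap
    by (rule frag_extend_cong[OF list_boundary_chains'[OF Suc(2)]]) (use Suc(1) in auto)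
  moreover have "hd (map g w) = g (hd w)" using Suc(2) by (cases w) auto
  ultimately show ?case by (simp add: fmap_map_fcons fmap_extend)
qed auto

lemma normlh_map: "length w = Suc p \<Longrightarrow> normlh p (map g w) = fmap (map g) (normlh p w)"
proof (induction p arbitrary: w)
  case (Suc p)
  have "frag_extend (normlh p) (list_boundary (map g w)) = frag_extend (\<lambda>u. fmap (map g) (normlh p u)) (list_boundary w)"
    unfolding list_boundary_map extend_fmap
    by (rule frag_extend_cong[OF list_boundary_chains'[OF Suc(2)]]) (use Suc(1) in auto)
  moreover have "hd (map g w) = g (hd w)" using Suc(2) by (cases w) auto
  ultimately show ?case
    by (simp del: norml.simps add: norml_map[OF Suc(2)] fmap_map_fcons fmap_extend)
qed auto

text \<open>The boundary of a list with an adjacent repetition is spanned by such lists, so the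
  recursion descends to degree 0, where a single vertex repeats nothing.\<close>

lemma norml_adjdup: "length w = Suc p \<Longrightarrow> adjdup w \<Longrightarrow> norml p w = 0"
proof (induction p arbitrary: w)
  case 0
  then show ?case using adjdup_length[of w] by auto
next
  case (Suc p)
  have "frag_extend (norml p) (list_boundary w) = frag_extend (\<lambda>u. 0) (list_boundary w)"
    by (rule frag_extend_cong[OF chains_Int[OF list_boundary_chains'[OF Suc(2)] list_boundary_adjdup[OF Suc(3)]]])
      (use Suc(1) in auto)
  then show ?case by simp
qed

text \<open>Once \<open>norml\<close> has dropped out, each remaining term has an adjacent
  repetition, and coning preserves it. This is what lets the homotopy pass to normalized
  chains.\<close>

lemma normlh_adjdup: "length w = Suc p \<Longrightarrow> adjdup w \<Longrightarrow> normlh p w \<in> chains_on (Collect adjdup)"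
proof (induction p arbitrary: w)
  case (Suc p)
  have "frag_extend (normlh p) (list_boundary w) \<in> chains_on (Collect adjdup)"
    by (rule chains_extend[OF chains_Int[OF list_boundary_chains'[OF Suc(2)] list_boundary_adjdup[OF Suc(3)]]])
      (use Suc(1) in auto)
  then show ?case
    unfolding normlh.simps norml_adjdup[OF Suc(2,3)]
    by (intro chains_fcons[of _ "Collect adjdup"] chains_diff) (use Suc(3) in \<open>auto simp: adjdup_Cons\<close>)
qed auto

text \<open>By the cone formula the boundary of a cone is its base minus the cone on the boundary of
  the base. That last boundary vanishes by induction, because the list boundary squares to
  zero.\<close>

lemma list_boundary_norml: "length w = Suc (Suc p) \<Longrightarrow> frag_extend list_boundary (norml (Suc p) w) = frag_extend (norml p) (list_boundary w)"
proof (induction p arbitrary: w)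
  case 0
  then show ?case by (simp add: list_boundary_fcons norml.simps(1)[abs_def] list_boundary_list_boundary)
next
  case (Suc p)
  have "frag_extend list_boundary (frag_extend (norml (Suc p)) (list_boundary w)) = frag_extend (norml p) (frag_extend list_boundary (list_boundary w))"
    unfolding frag_extend_extend
    by (rule frag_extend_cong[OF list_boundary_chains'[OF Suc(2)]]) (use Suc(1) in auto)
  then show ?case
    by (subst norml.simps(2)) (simp add: list_boundary_fcons list_boundary_list_boundary del: norml.simps)
qed

text \<open>The defect \<open>norml - id - h d\<close> is a cycle by induction, so that coning it
  off with the first vertex of \<open>w\<close> fills it.\<close>

lemma list_boundary_normlh:
  "length w = Suc (Suc p) \<Longrightarrow>
    frag_extend list_boundary (normlh (Suc p) w) + frag_extend (normlh p) (list_boundary w) = norml (Suc p) w - frag_of w"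
proof (induction p arbitrary: w)
  case 0
  have z: "normlh 0 = (\<lambda>w::'a list. 0)" "norml 0 = (frag_of :: 'a list \<Rightarrow> _)" by auto
  show ?case using list_boundary_norml[OF 0]
    by (simp add: z frag_lin list_boundary_fcons list_boundary_list_boundary)
next
  case (Suc p)
  have "frag_extend list_boundary (frag_extend (normlh (Suc p)) (list_boundary w)) =
     frag_extend (norml (Suc p)) (list_boundary w) - list_boundary w - frag_extend (normlh p) (frag_extend list_boundary (list_boundary w))"
  proof -
    have "frag_extend list_boundary (frag_extend (normlh (Suc p)) (list_boundary w)) =
      frag_extend (\<lambda>u. norml (Suc p) u - frag_of u - frag_extend (normlh p) (list_boundary u)) (list_boundary w)"
      unfolding frag_extend_extend
      by (rule frag_extend_cong[OF list_boundary_chains'[OF Suc(2)]])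
        (use Suc(1) in \<open>auto simp del: norml.simps normlh.simps simp: algebra_simps\<close>)
    then show ?thesis by (simp add: frag_lin frag_extend_extend del: norml.simps normlh.simps)
  qed
  then show ?case using list_boundary_norml[OF Suc(2)]
    by (subst normlh.simps(2)) (simp add: frag_lin list_boundary_fcons list_boundary_list_boundary del: norml.simps normlh.simps)
qed



section \<open>Identification of the recursive product with the signed sum over shuffles\<close>

subsection \<open>Shuffles as lattice paths\<close>

lemma shuffle_pairs_disjoint:
  assumes "(\<mu>, \<nu>) \<in> shuffle_pairs p q"
  shows "set \<mu> \<inter> set \<nu> = {}"
proof -
  have "distinct \<mu>" "distinct \<nu>"
    using assms by (auto simp: shuffle_pairs_def strict_sorted_iff)
  moreover have "set \<mu> \<union> set \<nu> = {..<p + q}" "length \<mu> = p" "length \<nu> = q"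
    using assms by (auto simp: shuffle_pairs_def)
  ultimately have "card (set \<mu> \<union> set \<nu>) = card (set \<mu>) + card (set \<nu>)"
    by (simp add: distinct_card)
  then show ?thesis
    using card_Un_Int[of "set \<mu>" "set \<nu>"] by simp
qed

lemma sorted_pos_map_Suc:
  assumes "sorted_wrt (<) \<mu>" "0 \<notin> set \<mu>"
  obtains \<mu>' :: "nat list" where "\<mu> = map Suc \<mu>'" "sorted_wrt (<) \<mu>'"
proof
  show 1: "\<mu> = map Suc (map (\<lambda>x. x - 1) \<mu>)"
    unfolding map_map comp_def using assms(2) by (intro map_idI[symmetric]) (metis Suc_pred' gr0I)
  show "sorted_wrt (<) (map (\<lambda>x. x - 1) \<mu>)"
    using assms(1) by (subst (asm) 1) (simp add: sorted_wrt_map del: map_map)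
qed

lemma sorted_zero_Cons:
  assumes "sorted_wrt (<) \<mu>" "(0::nat) \<in> set \<mu>"
  obtains \<mu>' where "\<mu> = 0 # map Suc \<mu>'" "sorted_wrt (<) \<mu>'"
proof -
  obtain a u where u: "\<mu> = a # u" using assms(2) by (cases \<mu>) auto
  have "a = 0" using assms u by force
  have "0 \<notin> set u" "sorted_wrt (<) u" using assms u \<open>a = 0\<close> by auto
  then obtain \<mu>' where "u = map Suc \<mu>'" "sorted_wrt (<) \<mu>'"
    by (metis sorted_pos_map_Suc)
  then show thesis using u \<open>a = 0\<close> that by blast
qed

text \<open>Prepends a step in the first factor: the steps of that factor are the indices in
  \<open>\<mu>\<close>, and all later indices move up by one.\<close>

definition xstep :: "nat list \<times> nat list \<Rightarrow> nat list \<times> nat list" where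
  "xstep = (\<lambda>(\<mu>, \<nu>). (0 # map Suc \<mu>, map Suc \<nu>))"

definition ystep :: "nat list \<times> nat list \<Rightarrow> nat list \<times> nat list" where
  "ystep = (\<lambda>(\<mu>, \<nu>). (map Suc \<mu>, 0 # map Suc \<nu>))"

lemma Suc_image_eq: "insert 0 (Suc ` A) = {..<Suc n} \<longleftrightarrow> A = {..<n}"
  by (metis lessThan_Suc_eq_insert_0 inj_Suc inj_image_eq_iff insert_ident zero_notin_Suc_image)

text \<open>The index 0 belongs to exactly one of the two lists and is its first entry. Removing it
  and lowering all other indices leaves a shorter shuffle.\<close>

lemma shuffle_pairs_step:
  assumes "p + q > 0"
  shows "shuffle_pairs p q = (if p = 0 then {} else xstep ` shuffle_pairs (p - 1) q) \<union>
    (if q = 0 then {} else ystep ` shuffle_pairs p (q - 1))"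
proof (intro Set.equalityI subsetI)
  fix z assume "z \<in> shuffle_pairs p q"
  then obtain \<mu> \<nu> where z: "z = (\<mu>, \<nu>)" and mn: "(\<mu>, \<nu>) \<in> shuffle_pairs p q"
    by (cases z) auto
  then have l: "length \<mu> = p" "length \<nu> = q" "sorted_wrt (<) \<mu>" "sorted_wrt (<) \<nu>"
    "set \<mu> \<union> set \<nu> = {..<p + q}" by (auto simp: shuffle_pairs_def)
  obtain n where n: "p + q = Suc n" using assms by (metis Suc_pred)
  have "0 \<in> set \<mu> \<union> set \<nu>" using l(5) assms by auto
  then consider "0 \<in> set \<mu>" "0 \<notin> set \<nu>" | "0 \<notin> set \<mu>" "0 \<in> set \<nu>"
    using shuffle_pairs_disjoint[OF mn] by auto
  then show "z \<in> (if p = 0 then {} else xstep ` shuffle_pairs (p - 1) q) \<union>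
    (if q = 0 then {} else ystep ` shuffle_pairs p (q - 1))"
  proof cases
    case 1
    obtain \<mu>' \<nu>' where m: "\<mu> = 0 # map Suc \<mu>'" "sorted_wrt (<) \<mu>'" "\<nu> = map Suc \<nu>'" "sorted_wrt (<) \<nu>'"
      using 1 l by (metis sorted_pos_map_Suc sorted_zero_Cons)
    have "set \<mu>' \<union> set \<nu>' = {..<n}" using l(5) m n by (simp add: Suc_image_eq flip: image_Un)
    then have "(\<mu>', \<nu>') \<in> shuffle_pairs (p - 1) q"
      using m l n by (auto simp: shuffle_pairs_def)
    then show ?thesis using m l by (auto simp: z xstep_def)
  next
    case 2
    obtain \<mu>' \<nu>' where m: "\<mu> = map Suc \<mu>'" "sorted_wrt (<) \<mu>'" "\<nu> = 0 # map Suc \<nu>'" "sorted_wrt (<) \<nu>'"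
      using 2 l by (metis sorted_pos_map_Suc sorted_zero_Cons)
    have "set \<mu>' \<union> set \<nu>' = {..<n}" using l(5) m n by (simp add: Suc_image_eq flip: image_Un)
    then have "(\<mu>', \<nu>') \<in> shuffle_pairs p (q - 1)"
      using m l n by (auto simp: shuffle_pairs_def)
    then show ?thesis using m l by (auto simp: z ystep_def)
  qed
next
  fix z assume "z \<in> (if p = 0 then {} else xstep ` shuffle_pairs (p - 1) q) \<union>
    (if q = 0 then {} else ystep ` shuffle_pairs p (q - 1))"
  then consider \<mu> \<nu> where "p > 0" "(\<mu>, \<nu>) \<in> shuffle_pairs (p - 1) q" "z = xstep (\<mu>, \<nu>)"
    | \<mu> \<nu> where "q > 0" "(\<mu>, \<nu>) \<in> shuffle_pairs p (q - 1)" "z = ystep (\<mu>, \<nu>)"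
    by (auto split: if_splits)
  then show "z \<in> shuffle_pairs p q"
  proof cases
    case 1
    then obtain p' where "p = Suc p'" by (cases p) auto
    then show ?thesis using 1
      by (auto simp: shuffle_pairs_def xstep_def sorted_wrt_map Suc_image_eq simp flip: image_Un)
  next
    case 2
    then obtain q' where "q = Suc q'" by (cases q) auto
    then show ?thesis using 2
      by (auto simp: shuffle_pairs_def ystep_def sorted_wrt_map Suc_image_eq simp flip: image_Un)
  qed
qed

lemma inj_xstep: "inj_on xstep A" and inj_ystep: "inj_on ystep A"
  by (auto simp: inj_on_def xstep_def ystep_def)

lemma xstep_ystep: "xstep ` A \<inter> ystep ` B = {}"
  by (auto simp: xstep_def ystep_def)

lemma finite_shuffle_pairs: "finite (shuffle_pairs p q)"
proof (rule finite_subset)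
  show "shuffle_pairs p q \<subseteq> {xs. set xs \<subseteq> {..<p + q} \<and> length xs = p} \<times> {xs. set xs \<subseteq> {..<p + q} \<and> length xs = q}"
    by (auto simp: shuffle_pairs_def)
qed (auto intro!: finite_cartesian_product finite_lists_length_eq)

lemma sum_shuffle_pairs:
  fixes g :: "nat list \<times> nat list \<Rightarrow> 'b \<Rightarrow>\<^sub>0 int"
  assumes "p + q > 0"
  shows "sum g (shuffle_pairs p q) = (if p = 0 then 0 else \<Sum>z\<in>shuffle_pairs (p - 1) q. g (xstep z)) +
    (if q = 0 then 0 else \<Sum>z\<in>shuffle_pairs p (q - 1). g (ystep z))"
  unfolding shuffle_pairs_step[OF assms]
  by (subst sum.union_disjoint)
     (auto simp: finite_shuffle_pairs xstep_ystep sum.reindex inj_xstep inj_ystep comp_def)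

definition lperm :: "nat list \<Rightarrow> nat \<Rightarrow> nat" where
  "lperm l = (\<lambda>k. if k < length l then l ! k else k)"

lemma lperm_permutes:
  assumes "set l = {..<length l}"
  shows "lperm l permutes {..<length l}"
proof (rule bij_imp_permutes)
  have "distinct l" using assms by (simp add: card_distinct)
  then have "bij_betw (nth l) {..<length l} (set l)" by (rule bij_betw_nth) (use assms in auto)
  then have "bij_betw (nth l) {..<length l} {..<length l}" using assms by simp
  then show "bij_betw (lperm l) {..<length l} {..<length l}"
    by (rule bij_betw_cong[THEN iffD1, rotated]) (auto simp: lperm_def)
qed (auto simp: lperm_def)

lemma lperm_permutation: "set l = {..<length l} \<Longrightarrow> permutation (lperm l)"
  using lperm_permutes permutation_permutes by blast

text \<open>Fixing 0 and shifting the rest is conjugation by the injection \<open>Suc\<close>, which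
  preserves signs.\<close>

lemma sign_lperm_Suc:
  assumes "set l = {..<length l}"
  shows "sign (lperm (0 # map Suc l)) = sign (lperm l)"
proof -
  have "lperm (0 # map Suc l) = map_permutation {..<length l} Suc (lperm l)"
  proof
    fix k
    show "lperm (0 # map Suc l) k = map_permutation {..<length l} Suc (lperm l) k"
    proof (cases "k \<in> Suc ` {..<length l}")
      case True
      then obtain i where i: "k = Suc i" "i < length l" by auto
      then have "inv_into {..<length l} Suc k = i" by (auto intro!: inv_into_f_f)
      then show ?thesis using i True by (auto simp: map_permutation_def lperm_def)
    next
      case False
      then have "k = 0 \<or> k > length l" by (cases k) auto
      then show ?thesis using False by (auto simp: map_permutation_def lperm_def)
    qed
  qed
  then show ?thesis
    by (simp add: sign_map_permutation[OF _ lperm_permutes[OF assms]])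
qed

lemma sign_lperm_swap:
  assumes "set (u @ b # a # v) = {..<length (u @ b # a # v)}"
  shows "sign (lperm (u @ b # a # v)) = - sign (lperm (u @ a # b # v))"
proof -
  let ?n = "length u"
  have eq: "lperm (u @ b # a # v) = lperm (u @ a # b # v) \<circ> Transposition.transpose ?n (Suc ?n)"
  proof
    fix k
    consider "k < ?n" | "k = ?n" | "k = Suc ?n" | "k > Suc ?n" by linarith
    then show "lperm (u @ b # a # v) k = (lperm (u @ a # b # v) \<circ> Transposition.transpose ?n (Suc ?n)) k"
    proof cases
      case 4
      then obtain m where "k = Suc (Suc (?n + m))"
        by (metis Suc_leI add_Suc le_Suc_ex)
      then show ?thesis by (auto simp: lperm_def Transposition.transpose_def nth_append)
    qed (auto simp: lperm_def Transposition.transpose_def nth_append)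
  qed
  have "set (u @ a # b # v) = {..<length (u @ a # b # v)}" using assms by auto
  then have "permutation (lperm (u @ a # b # v))" by (rule lperm_permutation)
  then show ?thesis
    unfolding eq by (subst sign_compose) (auto simp: sign_swap_id permutation_swap_id)
qed

text \<open>Moving an entry to the front costs one adjacent transposition for each entry it passes.
  This is the origin of the sign of a first step in the second factor.\<close>

lemma sign_lperm_move:
  "set (u @ a # v) = {..<length (u @ a # v)} \<Longrightarrow>
    sign (lperm (u @ a # v)) = (-1) ^ length u * sign (lperm (a # u @ v))"
proof (induction u arbitrary: v rule: rev_induct)
  case (snoc b u)
  have "sign (lperm (u @ b # a # v)) = - sign (lperm (u @ a # b # v))"
    by (rule sign_lperm_swap) (use snoc in auto)
  moreover have "sign (lperm (u @ a # b # v)) = (-1) ^ length u * sign (lperm (a # u @ b # v))"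
    by (rule snoc) (use snoc(2) in auto)
  ultimately show ?case by simp
qed auto

lemma shuffle_sign_lperm: "shuffle_sign \<mu> \<nu> = sign (lperm (\<mu> @ \<nu>))"
  by (simp add: shuffle_sign_def lperm_def)

lemma shuffle_pairs_append:
  "(\<mu>, \<nu>) \<in> shuffle_pairs p q \<Longrightarrow> set (\<mu> @ \<nu>) = {..<length (\<mu> @ \<nu>)}"
  by (auto simp: shuffle_pairs_def)

lemma shuffle_sign_xstep:
  assumes "(\<mu>, \<nu>) \<in> shuffle_pairs p q"
  shows "shuffle_sign (0 # map Suc \<mu>) (map Suc \<nu>) = shuffle_sign \<mu> \<nu>"
  using sign_lperm_Suc[OF shuffle_pairs_append[OF assms]] by (simp add: shuffle_sign_lperm)

lemma shuffle_sign_ystep: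
  assumes "(\<mu>, \<nu>) \<in> shuffle_pairs p q"
  shows "shuffle_sign (map Suc \<mu>) (0 # map Suc \<nu>) = (-1) ^ p * shuffle_sign \<mu> \<nu>"
proof -
  have s: "set \<mu> \<union> set \<nu> = {..<p + q}" "length \<mu> = p" "length \<nu> = q"
    using assms by (auto simp: shuffle_pairs_def)
  have "set (map Suc \<mu> @ 0 # map Suc \<nu>) = {..<length (map Suc \<mu> @ 0 # map Suc \<nu>)}"
    using Suc_image_eq[of "set \<mu> \<union> set \<nu>" "p + q"] s by (simp flip: image_Un)
  from sign_lperm_move[OF this] show ?thesis
    using sign_lperm_Suc[OF shuffle_pairs_append[OF assms]] s by (simp add: shuffle_sign_lperm)
qed

text \<open>The lattice path of a shuffle, listed by the points it visits: each coordinate counts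
  the earlier steps in its direction, and p + q steps visit p + q + 1 points.\<close>

definition lpath :: "nat list \<Rightarrow> nat list \<Rightarrow> (nat \<times> nat) list" where
  "lpath \<mu> \<nu> = map (\<lambda>k. (card {m \<in> set \<mu>. m < k}, card {n \<in> set \<nu>. n < k})) [0..<Suc (length \<mu> + length \<nu>)]"

lemma card_less_Suc: "card {m \<in> Suc ` A. m < Suc k} = card {m \<in> A. m < k}"
proof -
  have "{m \<in> Suc ` A. m < Suc k} = Suc ` {m \<in> A. m < k}" by auto
  then show ?thesis by (simp add: card_image)
qed

lemma card_less_Suc_insert: "finite A \<Longrightarrow> card {m. (m = 0 \<or> m \<in> Suc ` A) \<and> m < Suc k} = Suc (card {m \<in> A. m < k})"
proof -
  assume "finite A"
  have "{m. (m = 0 \<or> m \<in> Suc ` A) \<and> m < Suc k} = insert 0 (Suc ` {m \<in> A. m < k})" by auto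
  then show ?thesis using \<open>finite A\<close> by (simp add: card_image)
qed

lemma lpath_xstep: "lpath (0 # map Suc \<mu>) (map Suc \<nu>) = (0, 0) # map (map_prod Suc id) (lpath \<mu> \<nu>)"
  by (rule nth_equalityI)
     (auto simp: lpath_def nth_Cons' nth_append card_less_Suc card_less_Suc_insert simp del: upt_Suc
       split: nat.splits dest!: gr0_implies_Suc)

lemma lpath_ystep: "lpath (map Suc \<mu>) (0 # map Suc \<nu>) = (0, 0) # map (map_prod id Suc) (lpath \<mu> \<nu>)"
  by (rule nth_equalityI)
     (auto simp: lpath_def nth_Cons' nth_append card_less_Suc card_less_Suc_insert simp del: upt_Suc
       split: nat.splits dest!: gr0_implies_Suc)

text \<open>Shuffles are split by their first step, just like the recursion for \<open>ez\<close>;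
  \<open>xstep\<close> and \<open>ystep\<close> match its two summands, including signs.\<close>

proposition ez_shuffle:
  assumes "length xs = Suc p" "length ys = Suc q"
  shows "ez xs ys = (\<Sum>(\<mu>, \<nu>)\<in>shuffle_pairs p q. frag_cmul (shuffle_sign \<mu> \<nu>)
    (frag_of (map (map_prod (nth xs) (nth ys)) (lpath \<mu> \<nu>))))"
  using assms
proof (induction "p + q" arbitrary: p q xs ys)
  case 0
  have "shuffle_pairs 0 0 = {([], [])}" by (auto simp: shuffle_pairs_def)
  moreover have "shuffle_sign [] [] = 1" by (simp add: shuffle_sign_def)
  moreover obtain x y where "xs = [x]" "ys = [y]" using 0 by (auto simp: length_Suc_conv)
  ultimately show ?case using 0 by (simp add: lpath_def)
next
  case (Suc n)
  obtain x xs' y ys' where xs: "xs = x # xs'" and ys: "ys = y # ys'" "length xs' = p" "length ys' = q"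
    using Suc by (auto simp: length_Suc_conv)
  let ?g = "\<lambda>xs ys (\<mu>, \<nu>). frag_cmul (shuffle_sign \<mu> \<nu>) (frag_of (map (map_prod (nth xs) (nth ys)) (lpath \<mu> \<nu>)))"
  have comp: "map_prod (nth xs) (nth ys) \<circ> map_prod Suc id = map_prod (nth xs') (nth ys)"
    "map_prod (nth xs) (nth ys) \<circ> map_prod id Suc = map_prod (nth xs) (nth ys')"
    by (auto simp: xs ys fun_eq_iff)
  have X: "(\<Sum>z\<in>shuffle_pairs (p - 1) q. ?g xs ys (xstep z)) = fcons (x, y) (ez xs' ys)" if "p \<noteq> 0"
  proof -
    have "ez xs' ys = sum (?g xs' ys) (shuffle_pairs (p - 1) q)"
      by (rule Suc(1)) (use Suc that ys in auto)
    then have "fcons (x, y) (ez xs' ys) = (\<Sum>z\<in>shuffle_pairs (p - 1) q. fcons (x, y) (?g xs' ys z))"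
      by (simp add: fcons_def fmap_sum)
    moreover have "?g xs ys (xstep z) = fcons (x, y) (?g xs' ys z)" if "z \<in> shuffle_pairs (p - 1) q" for z
    proof -
      obtain \<mu> \<nu> where z: "z = (\<mu>, \<nu>)" by (cases z)
      show ?thesis using shuffle_sign_xstep[of \<mu> \<nu>] that
        by (simp add: z xstep_def lpath_xstep comp) (simp add: xs ys)
    qed
    ultimately show ?thesis by simp
  qed
  have Y: "(\<Sum>z\<in>shuffle_pairs p (q - 1). ?g xs ys (ystep z)) = frag_cmul ((-1) ^ p) (fcons (x, y) (ez xs ys'))"
    if "q \<noteq> 0"
  proof -
    have "ez xs ys' = sum (?g xs ys') (shuffle_pairs p (q - 1))"
      by (rule Suc(1)) (use Suc that ys in auto)
    then have "frag_cmul ((-1) ^ p) (fcons (x, y) (ez xs ys')) =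
        (\<Sum>z\<in>shuffle_pairs p (q - 1). frag_cmul ((-1) ^ p) (fcons (x, y) (?g xs ys' z)))"
      by (simp add: fcons_def fmap_sum frag_cmul_sum)
    moreover have "?g xs ys (ystep z) = frag_cmul ((-1) ^ p) (fcons (x, y) (?g xs ys' z))"
      if "z \<in> shuffle_pairs p (q - 1)" for z
    proof -
      obtain \<mu> \<nu> where z: "z = (\<mu>, \<nu>)" by (cases z)
      show ?thesis using shuffle_sign_ystep[of \<mu> \<nu>] that
        by (simp add: z ystep_def lpath_ystep comp) (simp add: xs ys)
    qed
    ultimately show ?thesis by simp
  qed
  have "xs' \<noteq> [] \<or> ys' \<noteq> []" using Suc ys by auto
  then have "ez xs ys = fcons (x, y) (ez xs' ys) + frag_cmul ((-1) ^ p) (fcons (x, y) (ez xs ys'))"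
    by (simp add: xs ys ez_Cons)
  also have "\<dots> = sum (?g xs ys) (shuffle_pairs p q)"
    using ys X Y Suc(2) by (subst sum_shuffle_pairs) auto
  finally show ?case by simp
qed

section \<open>Simplicial operators as precomposition with affine maps\<close>

section \<open>Affine simplices\<close>

definition aff :: "(nat \<Rightarrow> real) list \<Rightarrow> (nat \<Rightarrow> real) \<Rightarrow> nat \<Rightarrow> real" where
  "aff w x = (\<lambda>i. \<Sum>k<length w. x k * (w ! k) i)"

text \<open>The map \<open>c\<close> may live on any convex set containing the vertices; it is used
  for simplices and for cubes alike.\<close>

definition affine_simplex :: "((nat \<Rightarrow> real) \<Rightarrow> 'u) \<Rightarrow> (nat \<Rightarrow> real) list \<Rightarrow> (nat \<Rightarrow> real) \<Rightarrow> 'u" where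
  "affine_simplex c w = restrict (c \<circ> aff w) (standard_simplex (length w - 1))"

definition ev :: "nat \<Rightarrow> nat \<Rightarrow> real" where
  "ev a = (\<lambda>j. if j = a then 1 else 0)"

lemma ev_simplex [simp]: "ev a \<in> standard_simplex p \<longleftrightarrow> a \<le> p"
  by (simp add: ev_def)

lemma sum_simplex: "x \<in> standard_simplex (n - 1) \<Longrightarrow> n > 0 \<Longrightarrow> (\<Sum>k<n. x k) = 1"
  by (cases n) (auto simp: standard_simplex_def lessThan_Suc_atMost)

lemma aff_simplex:
  assumes "set w \<subseteq> standard_simplex p" "w \<noteq> []" "x \<in> standard_simplex (length w - 1)"
  shows "aff w x \<in> standard_simplex p"
proof -
  have x: "0 \<le> x k" for k using assms by (auto simp: standard_simplex_def)
  have w: "0 \<le> (w ! k) i" "(w ! k) i \<le> 1" "i > p \<Longrightarrow> (w ! k) i = 0" "(\<Sum>i\<le>p. (w ! k) i) = 1" if "k < length w" for k i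
    using assms(1) nth_mem[OF that] by (auto simp: standard_simplex_def)
  have s: "(\<Sum>k<length w. x k) = 1" using assms by (intro sum_simplex) auto
  have "(\<Sum>k<length w. x k * (w ! k) i) \<le> (\<Sum>k<length w. x k * 1)" for i
    by (intro sum_mono mult_left_mono) (use x w in auto)
  moreover have "(\<Sum>i\<le>p. \<Sum>k<length w. x k * (w ! k) i) = 1"
    by (subst sum.swap) (simp add: w s flip: sum_distrib_left)
  ultimately show ?thesis
    using x w s by (auto simp: standard_simplex_def aff_def intro!: sum_nonneg sum.neutral)
qed

lemma continuous_map_aff: "continuous_map (subtopology (powertop_real UNIV) S) (powertop_real UNIV) (aff w)"
  unfolding aff_def continuous_map_componentwise_UNIV
  by (auto intro!: continuous_map_sum continuous_map_real_mult continuous_map_from_subtopology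
      continuous_map_product_projection)

text \<open>An affine map is determined by its vertices, and a vertex map of standard simplices
  merely selects some of them. In coordinates this is an exchange of two finite sums.\<close>

lemma aff_map_ev:
  assumes "set bs \<subseteq> {..<length w}"
  shows "aff w (aff (map ev bs) x) = aff (map (nth w) bs) x"
proof
  fix i
  have b: "bs ! l < length w" if "l < length bs" for l using assms nth_mem[OF that] by auto
  have "aff w (aff (map ev bs) x) i =
      (\<Sum>k<length w. \<Sum>l<length bs. x l * (if k = bs ! l then (w ! k) i else 0))"
    by (auto simp: aff_def ev_def sum_distrib_right intro!: sum.cong)
  also have "\<dots> = (\<Sum>l<length bs. \<Sum>k<length w. x l * (if k = bs ! l then (w ! k) i else 0))"
    by (rule sum.swap)
  also have "\<dots> = aff (map (nth w) bs) x i"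
    using b by (auto simp: aff_def sum.delta simp flip: sum_distrib_left intro!: sum.cong)
  finally show "aff w (aff (map ev bs) x) i = aff (map (nth w) bs) x i" .
qed

lemma affine_simplex_affine_simplex:
  assumes "bs \<noteq> []" "set bs \<subseteq> {..<length w}"
  shows "affine_simplex (affine_simplex c w) (map ev bs) = affine_simplex c (map (nth w) bs)"
proof -
  have "aff (map ev bs) x \<in> standard_simplex (length w - 1)" if "x \<in> standard_simplex (length bs - 1)" for x
    by (rule aff_simplex) (use assms that in auto)
  then show ?thesis
    by (simp add: affine_simplex_def aff_map_ev[OF assms(2)] cong: restrict_cong)
qed

lemma aff_ev_id:
  assumes "x \<in> standard_simplex p"
  shows "aff (map ev [0..<Suc p]) x = x"
proof
  fix i
  have "aff (map ev [0..<Suc p]) x i = (\<Sum>k<Suc p. if k = i then x i else 0)"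
    unfolding aff_def by (rule sum.cong) (auto simp: ev_def simp del: upt_Suc)
  then show "aff (map ev [0..<Suc p]) x i = x i"
    using assms by (simp add: standard_simplex_def del: upt_Suc sum.lessThan_Suc)
qed

lemma affine_simplex_id: "c \<in> extensional (standard_simplex p) \<Longrightarrow> affine_simplex c (map ev [0..<Suc p]) = c"
  by (rule ext) (auto simp: affine_simplex_def aff_ev_id extensional_def restrict_def simp del: upt_Suc)

lemma singular_simplex_affine_simplex:
  assumes "singular_simplex p X c" "set w \<subseteq> standard_simplex p" "length w = Suc n"
  shows "singular_simplex n X (affine_simplex c w)"
proof -
  have "continuous_map (subtopology (powertop_real UNIV) (standard_simplex n))
     (subtopology (powertop_real UNIV) (standard_simplex p)) (aff w)"
    using aff_simplex[OF assms(2)] assms(3) length_0_conv[of w]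
    by (auto simp del: length_0_conv simp: continuous_map_in_subtopology continuous_map_aff)
  then show ?thesis using assms
    by (auto simp: singular_simplex_def affine_simplex_def intro: continuous_map_compose)
qed

lemma upt_remove_nth:
  "k \<le> p \<Longrightarrow> j < p \<Longrightarrow>
    map ev (take k [0..<Suc p] @ drop (Suc k) [0..<Suc p]) ! j = ev (if j < k then j else Suc j)"
  by (subst nth_map) (auto simp: nth_append min_def simp del: upt_Suc)

lemma singular_face_affine_simplex:
  assumes "k \<le> p" "p > 0"
  shows "singular_face p k c = affine_simplex c (map ev (take k [0..<Suc p] @ drop (Suc k) [0..<Suc p]))"
proof -
  let ?bs = "take k [0..<Suc p] @ drop (Suc k) [0..<Suc p]"
  have l: "length ?bs = p" using assms by auto
  have "aff (map ev ?bs) x = simplical_face k x" if "x \<in> standard_simplex (p - 1)" for x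
  proof
    fix i
    have "aff (map ev ?bs) x i = (\<Sum>j<p. x j * (if i = (if j < k then j else Suc j) then 1 else 0))"
      unfolding aff_def length_map l
    proof (rule sum.cong)
      fix j assume "j \<in> {..<p}"
      then have "map ev ?bs ! j = ev (if j < k then j else Suc j)"
        using upt_remove_nth[OF assms(1)] by (simp only: lessThan_iff)
      then show "x j * (map ev ?bs ! j) i = x j * (if i = (if j < k then j else Suc j) then 1 else 0)"
        by (simp only: ev_def)
    qed simp
    \<comment> \<open>Solved for \<open>j\<close>: an index i < k comes from j = i, an index i > k
      from j = i - 1, and i = k from no j at all, which accounts for the coordinate 0 inserted
      there.\<close>
    also have "\<dots> = (\<Sum>j<p. if j = (if i < k then i else i - 1) then (if i = k then 0 else x j) else 0)"
      by (rule sum.cong) auto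
    also have "\<dots> = simplical_face k x i"
      using that assms by (auto simp: simplical_face_def standard_simplex_def sum.delta)
    finally show "aff (map ev ?bs) x i = simplical_face k x i" .
  qed
  then show ?thesis using l
    by (simp add: singular_face_def affine_simplex_def comp_def del: upt_Suc map_append cong: restrict_cong)
qed

definition dupl :: "nat \<Rightarrow> 'v list \<Rightarrow> 'v list" where
  "dupl i w = take (Suc i) w @ drop i w"

lemma length_dupl: "i < length w \<Longrightarrow> length (dupl i w) = Suc (length w)"
  by (simp add: dupl_def)

lemma nth_dupl: "i < length w \<Longrightarrow> j \<le> length w \<Longrightarrow> dupl i w ! j = (if j \<le> i then w ! j else w ! (j - 1))"
  by (cases "Suc i < length w") (auto simp: dupl_def nth_append min_def intro!: arg_cong[where f = "nth w"])

lemma singular_degeneracy_affine_simplex: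
  assumes "i \<le> p"
  shows "singular_degeneracy p i c = affine_simplex c (map ev (dupl i [0..<Suc p]))"
proof -
  have l: "length (dupl i [0..<Suc p]) = Suc (Suc p)" using assms by (simp add: length_dupl)
  have "aff (map ev (dupl i [0..<Suc p])) x = simplicial_collapse i x" if "x \<in> standard_simplex (Suc p)" for x
  proof
    fix m
    have "aff (map ev (dupl i [0..<Suc p])) x m = (\<Sum>j<Suc (Suc p). x j * (if m = (if j \<le> i then j else j - 1) then 1 else 0))"
      unfolding aff_def length_map l
      by (rule sum.cong) (use assms l in \<open>auto simp: nth_dupl ev_def simp del: upt_Suc\<close>)
    \<comment> \<open>Vertex m is the image of j = m if m \<le> i and of j = m + 1 if m \<ge> i. For
      m = i both occur, which yields the sum of two coordinates in the collapse map.\<close>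
    also have "\<dots> = (\<Sum>j<Suc (Suc p). (if j = m then (if m \<le> i then x j else 0) else 0) +
        (if j = Suc m then (if m \<ge> i then x j else 0) else 0))"
      by (rule sum.cong) auto
    also have "\<dots> = simplicial_collapse i x m"
      unfolding sum.distrib using that assms
      by (auto simp: simplicial_collapse_def standard_simplex_def sum.delta simp del: sum.lessThan_Suc)
    finally show "aff (map ev (dupl i [0..<Suc p])) x m = simplicial_collapse i x m" .
  qed
  then show ?thesis using l
    by (simp add: singular_degeneracy_def affine_simplex_def comp_def del: upt_Suc cong: restrict_cong)
qed

subsection \<open>Realizations of vertex lists\<close>

text \<open>A family of simplices indexed by vertex lists which is compatible with all simplicial
  operators.\<close>

definition realization :: "('v list \<Rightarrow> (nat \<Rightarrow> real) \<Rightarrow> 'u) \<Rightarrow> bool" where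
  "realization F \<longleftrightarrow> (\<forall>u bs. bs \<noteq> [] \<and> set bs \<subseteq> {..<length u} \<longrightarrow>
     affine_simplex (F u) (map ev bs) = F (map (nth u) bs))"

lemma realizationD:
  "realization F \<Longrightarrow> bs \<noteq> [] \<Longrightarrow> set bs \<subseteq> {..<length u} \<Longrightarrow> affine_simplex (F u) (map ev bs) = F (map (nth u) bs)"
  by (simp add: realization_def)

definition realize :: "((nat \<Rightarrow> real) \<Rightarrow> 'u) \<Rightarrow> nat list \<Rightarrow> (nat \<Rightarrow> real) \<Rightarrow> 'u" where
  "realize c bs = affine_simplex c (map ev bs)"

lemma realization_realize: "realization (realize c)"
proof -
  have "map (nth (map ev u)) bs = map ev (map (nth u) bs)" if "set bs \<subseteq> {..<length u}" for u bs
    using that by auto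
  then show ?thesis by (simp add: realization_def realize_def affine_simplex_affine_simplex del: map_map)
qed

lemma realize_id: "c \<in> extensional (standard_simplex p) \<Longrightarrow> realize c [0..<Suc p] = c"
  by (simp only: realize_def affine_simplex_id)

lemma singular_simplex_ext: "singular_simplex p X c \<Longrightarrow> c \<in> extensional (standard_simplex p)"
  by (simp add: singular_simplex_def)

lemma realization_face:
  assumes "realization F" "length u = Suc p" "p > 0" "k \<le> p"
  shows "singular_face p k (F u) = F (take k u @ drop (Suc k) u)"
proof -
  let ?bs = "take k [0..<Suc p] @ drop (Suc k) [0..<Suc p]"
  have b: "set ?bs \<subseteq> {..<length u}" using assms by (auto dest!: in_set_takeD in_set_dropD simp del: upt_Suc)
  have "length ?bs = p" using assms by auto
  then have "singular_face p k (F u) = F (map (nth u) ?bs)"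
    using singular_face_affine_simplex[of k p "F u"] realizationD[OF assms(1) _ b] assms by (metis list.size(3) neq0_conv)
  moreover have "map (nth u) ?bs = take k u @ drop (Suc k) u"
    using assms(2) by (metis (no_types) drop_map map_append map_nth take_map)
  ultimately show ?thesis by simp
qed

text \<open>Faces of a realized simplex delete a vertex from its list. Two vertices at least are
  required, since a single vertex has zero singular boundary but the empty list as list
  boundary.\<close>

lemma boundary_realization:
  assumes "realization F" "length u = Suc (Suc p)"
  shows "chain_boundary (Suc p) (frag_of (F u)) = fmap F (list_boundary u)"
  unfolding chain_boundary_of list_boundary_sum fmap_sum
  using assms by (auto simp: realization_face lessThan_Suc_atMost simp del: sum.lessThan_Suc sum.atMost_Suc intro!: sum.cong)

lemma boundary_realization_chain:
  assumes "realization F" "c \<in> chains_on {u. length u = Suc (Suc p)}"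
  shows "chain_boundary (Suc p) (fmap F c) = fmap F (frag_extend list_boundary c)"
  using assms(2)
  by (induction rule: chains_induct)
    (auto simp: boundary_realization[OF assms(1)] chain_boundary_diff frag_lin)

lemma singular_degeneracy_realization:
  assumes "realization F" "length u = Suc p" "i \<le> p"
  shows "singular_degeneracy p i (F u) = F (dupl i u)"
proof -
  have b: "set (dupl i [0..<Suc p]) \<subseteq> {..<length u}" using assms
    by (auto simp: dupl_def dest!: in_set_takeD in_set_dropD simp del: upt_Suc)
  have "length (dupl i [0..<Suc p]) = Suc (Suc p)" using assms by (simp add: length_dupl)
  then have "singular_degeneracy p i (F u) = F (map (nth u) (dupl i [0..<Suc p]))"
    using singular_degeneracy_affine_simplex[of i p "F u"] realizationD[OF assms(1) _ b] assms by (metis list.size(3) nat.distinct(1))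
  moreover have "map (nth u) (dupl i [0..<Suc p]) = dupl i u"
    unfolding dupl_def using assms(2) by (metis (no_types) drop_map map_append map_nth take_map)
  ultimately show ?thesis by simp
qed

text \<open>Degeneracies applied in increasing order repeat a vertex at each index of
  \<open>\<nu>\<close>. Hence the vertex reached after k steps has advanced by the number of earlier
  indices outside \<open>\<nu>\<close>.\<close>

lemma iterated_degeneracy_realization:
  assumes "realization F" "length u = Suc p" "sorted_wrt (<) \<nu>" "set \<nu> \<subseteq> {..<p + length \<nu>}"
  shows "iterated_degeneracy p \<nu> (F u) =
    F (map (\<lambda>k. u ! (k - card {n \<in> set \<nu>. n < k})) [0..<Suc (p + length \<nu>)])"
  using assms(2-)
proof (induction \<nu> arbitrary: p u)
  case Nil
  have "map (\<lambda>k. u ! k) [0..<Suc p] = u" using Nil(1) map_nth[of u] by simp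
  then show ?case by (simp del: upt_Suc)
next
  case (Cons i \<nu>)
  have "distinct \<nu>" and lt: "\<And>n. n \<in> set \<nu> \<Longrightarrow> i < n" using Cons(3) by (auto simp: strict_sorted_iff)
  \<comment> \<open>Counting shows that the first degeneracy index is legal: the remaining distinct
    indices have to fit strictly between i and p + length + 1.\<close>
  have "set \<nu> \<subseteq> {i<..<Suc (p + length \<nu>)}" using Cons lt by auto
  from card_mono[OF _ this] have ip: "i \<le> p" using distinct_card[OF \<open>distinct \<nu>\<close>] Cons(4) by auto
  have "iterated_degeneracy p (i # \<nu>) (F u) = iterated_degeneracy (Suc p) \<nu> (F (dupl i u))"
    using singular_degeneracy_realization[OF assms(1) Cons(2) ip] by simp
  also have "\<dots> = F (map (\<lambda>k. dupl i u ! (k - card {n \<in> set \<nu>. n < k})) [0..<Suc (Suc p + length \<nu>)])"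
    by (rule Cons(1)) (use Cons ip in \<open>auto simp: length_dupl\<close>)
  also have "map (\<lambda>k. dupl i u ! (k - card {n \<in> set \<nu>. n < k})) [0..<Suc (Suc p + length \<nu>)] =
     map (\<lambda>k. u ! (k - card {n \<in> set (i # \<nu>). n < k})) [0..<Suc (p + length (i # \<nu>))]"
  proof (rule map_cong)
    fix k assume "k \<in> set [0..<Suc (p + length (i # \<nu>))]"
    then have k: "k \<le> Suc (p + length \<nu>)" by auto
    show "dupl i u ! (k - card {n \<in> set \<nu>. n < k}) = u ! (k - card {n \<in> set (i # \<nu>). n < k})"
    proof (cases "k \<le> i")
      case True
      then have "{n \<in> set \<nu>. n < k} = {}" "{n \<in> set (i # \<nu>). n < k} = {}" using lt by (auto dest!: lt)
      then have "card {n \<in> set \<nu>. n < k} = 0" "card {n \<in> set (i # \<nu>). n < k} = 0" by (simp_all only: card.empty)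
      then show ?thesis using True ip Cons(2) by (simp add: nth_dupl del: card_0_eq card_eq_0_iff)
    next
      case False
      have "{n \<in> set \<nu>. n < k} \<subseteq> {i<..<k}" using lt by auto
      from card_mono[OF _ this] have c: "card {n \<in> set \<nu>. n < k} \<le> k - Suc i" by simp
      have "{n \<in> set \<nu>. \<not> n < k} \<subseteq> {k..<Suc (p + length \<nu>)}" using Cons(4) by auto
      from card_mono[OF _ this] have "card {n \<in> set \<nu>. \<not> n < k} \<le> Suc (p + length \<nu>) - k" by simp
      moreover have "card (set \<nu>) = card {n \<in> set \<nu>. n < k} + card {n \<in> set \<nu>. \<not> n < k}"
        by (subst card_Un_disjoint[symmetric]) (auto intro: arg_cong[where f = card])
      ultimately have c2: "k - card {n \<in> set \<nu>. n < k} \<le> Suc p"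
        using distinct_card[OF \<open>distinct \<nu>\<close>] k by linarith
      have "{n \<in> set (i # \<nu>). n < k} = insert i {n \<in> set \<nu>. n < k}" using False by auto
      moreover have "i \<notin> {n \<in> set \<nu>. n < k}" using lt by auto
      ultimately have "card {n \<in> set (i # \<nu>). n < k} = Suc (card {n \<in> set \<nu>. n < k})" by simp
      moreover have "dupl i u ! (k - card {n \<in> set \<nu>. n < k}) = u ! (k - card {n \<in> set \<nu>. n < k} - 1)"
      proof -
        define m where "m = k - card {n \<in> set \<nu>. n < k}"
        have "\<not> m \<le> i" "m \<le> length u" "i < length u"
          using c c2 ip Cons(2) False unfolding m_def by linarith+
        then show ?thesis using nth_dupl[of i u m] by (simp add: m_def)
      qed
      ultimately show ?thesis by (simp only: diff_diff_left Suc_eq_plus1)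
    qed
  qed simp
  finally show ?case .
qed

subsection \<open>The shuffle product of realizations\<close>

definition pair_real :: "('u \<times> 'u \<Rightarrow> 'u) \<Rightarrow> ('a list \<Rightarrow> (nat \<Rightarrow> real) \<Rightarrow> 'u) \<Rightarrow>
    ('b list \<Rightarrow> (nat \<Rightarrow> real) \<Rightarrow> 'u) \<Rightarrow> ('a \<times> 'b) list \<Rightarrow> (nat \<Rightarrow> real) \<Rightarrow> 'u" where
  "pair_real pr F G w = simplex_pair pr (length w - 1) (F (map fst w)) (G (map snd w))"

lemma affine_simplex_simplex_pair:
  assumes "set w \<subseteq> standard_simplex n" "w \<noteq> []"
  shows "affine_simplex (simplex_pair pr n s t) w = simplex_pair pr (length w - 1) (affine_simplex s w) (affine_simplex t w)"
  using aff_simplex[OF assms] by (auto simp: affine_simplex_def simplex_pair_def fun_eq_iff restrict_def)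

text \<open>Products of realizations are again realizations, so that the same lemmas cover iterated
  products.\<close>

lemma realization_pair:
  assumes "realization F" "realization G"
  shows "realization (pair_real pr F G)"
  unfolding realization_def
proof (intro allI impI)
  fix u :: "('a \<times> 'c) list" and bs assume b: "bs \<noteq> [] \<and> set bs \<subseteq> {..<length u}"
  have "affine_simplex (F (map fst u)) (map ev bs) = F (map (nth (map fst u)) bs)"
    "affine_simplex (G (map snd u)) (map ev bs) = G (map (nth (map snd u)) bs)"
    using b by (auto intro!: realizationD assms)
  moreover have "map (nth (map fst u)) bs = map fst (map (nth u) bs)" "map (nth (map snd u)) bs = map snd (map (nth u) bs)"
    using b by auto
  ultimately show "affine_simplex (pair_real pr F G u) (map ev bs) = pair_real pr F G (map (nth u) bs)"
    unfolding pair_real_def using b by (subst affine_simplex_simplex_pair) auto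
qed

text \<open>Each earlier step is counted in exactly one of the two lists, so either coordinate is k
  minus the other. This is the index produced by iterated degeneracies.\<close>

lemma map_fst_lpath:
  assumes "(\<mu>, \<nu>) \<in> shuffle_pairs p q"
  shows "map fst (lpath \<mu> \<nu>) = map (\<lambda>k. k - card {n \<in> set \<nu>. n < k}) [0..<Suc (p + q)]"
    "map snd (lpath \<mu> \<nu>) = map (\<lambda>k. k - card {m \<in> set \<mu>. m < k}) [0..<Suc (p + q)]"
proof -
  have l: "length \<mu> = p" "length \<nu> = q" "set \<mu> \<union> set \<nu> = {..<p + q}"
    using assms by (auto simp: shuffle_pairs_def)
  have "card {m \<in> set \<mu>. m < k} + card {n \<in> set \<nu>. n < k} = k" if "k < Suc (p + q)" for k
  proof -
    have "{m \<in> set \<mu>. m < k} \<union> {n \<in> set \<nu>. n < k} = {x \<in> set \<mu> \<union> set \<nu>. x < k}" by blast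
    also have "\<dots> = {..<k}" unfolding l(3) using that by auto
    finally have "{m \<in> set \<mu>. m < k} \<union> {n \<in> set \<nu>. n < k} = {..<k}" .
    then have "card ({m \<in> set \<mu>. m < k} \<union> {n \<in> set \<nu>. n < k}) = k" by simp
    then show ?thesis using shuffle_pairs_disjoint[OF assms] by (subst (asm) card_Un_disjoint) auto
  qed
  moreover have "a = k - b \<and> b = k - a" if "a + b = k" for a b k :: nat
    using that by auto
  ultimately have *: "card {m \<in> set \<mu>. m < k} = k - card {n \<in> set \<nu>. n < k} \<and>
      card {n \<in> set \<nu>. n < k} = k - card {m \<in> set \<mu>. m < k}" if "k < Suc (p + q)" for k
    using that by blast
  show "map fst (lpath \<mu> \<nu>) = map (\<lambda>k. k - card {n \<in> set \<nu>. n < k}) [0..<Suc (p + q)]"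
    unfolding lpath_def l map_map comp_def fst_conv
    by (rule map_cong[OF refl], rule *[THEN conjunct1]) (simp del: upt_Suc)
  show "map snd (lpath \<mu> \<nu>) = map (\<lambda>k. k - card {m \<in> set \<mu>. m < k}) [0..<Suc (p + q)]"
    unfolding lpath_def l map_map comp_def snd_conv
    by (rule map_cong[OF refl], rule *[THEN conjunct2]) (simp del: upt_Suc)
qed

lemma length_lpath: "(\<mu>, \<nu>) \<in> shuffle_pairs p q \<Longrightarrow> length (lpath \<mu> \<nu>) = Suc (p + q)"
  by (auto simp: lpath_def shuffle_pairs_def)

text \<open>The degeneracies indexed by \<open>\<nu>\<close> hold the vertices of the first factor
  still during the steps of the second one, and vice versa, so that each pair of degenerate
  simplices is realized over a lattice path. From here on, statements about the shuffle product are
  statements about \<open>ez\<close>.\<close>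

proposition shuffle_realization:
  assumes F: "realization F" and G: "realization G" and u: "length u = Suc p" and v: "length v = Suc q"
  shows "shuffle_simplices pr p q (F u) (G v) = fmap (pair_real pr F G) (ez u v)"
proof -
  have "frag_of (simplex_pair pr (p + q) (iterated_degeneracy p \<nu> (F u)) (iterated_degeneracy q \<mu> (G v))) =
     fmap (pair_real pr F G) (frag_of (map (map_prod (nth u) (nth v)) (lpath \<mu> \<nu>)))"
    if mn: "(\<mu>, \<nu>) \<in> shuffle_pairs p q" for \<mu> \<nu>
  proof -
    have l: "length \<mu> = p" "length \<nu> = q" "set \<mu> \<union> set \<nu> = {..<p + q}" "sorted_wrt (<) \<mu>" "sorted_wrt (<) \<nu>"
      using mn by (auto simp: shuffle_pairs_def)
    have "iterated_degeneracy p \<nu> (F u) = F (map (nth u) (map fst (lpath \<mu> \<nu>)))"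
      using l iterated_degeneracy_realization[OF F u, of \<nu>] by (auto simp: map_fst_lpath[OF mn] comp_def simp del: upt_Suc)
    moreover have "iterated_degeneracy q \<mu> (G v) = G (map (nth v) (map snd (lpath \<mu> \<nu>)))"
      using l iterated_degeneracy_realization[OF G v, of \<mu>]
      by (auto simp: map_fst_lpath[OF mn] comp_def add.commute simp del: upt_Suc)
    ultimately show ?thesis
      by (simp add: pair_real_def length_lpath[OF mn] comp_def)
  qed
  then show ?thesis
    unfolding shuffle_simplices_def ez_shuffle[OF u v] fmap_sum
    by (intro sum.cong) auto
qed

section \<open>The universal property of the tensor product of complexes\<close>

section \<open>Maps out of tensor products\<close>

locale plain_comm_group = comm_group G for G :: "'g monoid" (structure)
begin

lemma free_lift_closed: "(\<And>x. x \<in> Poly_Mapping.keys t \<Longrightarrow> \<beta> x \<in> carrier G) \<Longrightarrow> free_lift G \<beta> t \<in> carrier G"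
  unfolding free_lift_def by (rule finprod_closed) auto

text \<open>Generators with coefficient zero contribute the unit. This permits a common index set
  for two summands, whose sum may have fewer keys.\<close>

lemma free_lift_superset:
  assumes "finite S" "Poly_Mapping.keys t \<subseteq> S" "\<And>x. x \<in> S \<Longrightarrow> \<beta> x \<in> carrier G"
  shows "free_lift G \<beta> t = finprod G (\<lambda>x. \<beta> x [^] Poly_Mapping.lookup t x) S"
  unfolding free_lift_def
  by (rule finprod_mono_neutral_cong_left) (use assms in \<open>auto simp: in_keys_iff\<close>)

lemma free_lift_add:
  assumes "\<And>x. x \<in> Poly_Mapping.keys s \<union> Poly_Mapping.keys t \<Longrightarrow> \<beta> x \<in> carrier G"
  shows "free_lift G \<beta> (s + t) = free_lift G \<beta> s \<otimes> free_lift G \<beta> t"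
proof -
  let ?S = "Poly_Mapping.keys s \<union> Poly_Mapping.keys t"
  have "free_lift G \<beta> (s + t) = finprod G (\<lambda>x. \<beta> x [^] Poly_Mapping.lookup (s + t) x) ?S"
    by (rule free_lift_superset) (use assms keys_add[of s t] in auto)
  also have "\<dots> = finprod G (\<lambda>x. \<beta> x [^] Poly_Mapping.lookup s x \<otimes> \<beta> x [^] Poly_Mapping.lookup t x) ?S"
    by (rule finprod_cong') (use assms in \<open>auto simp: lookup_add int_pow_mult\<close>)
  also have "\<dots> = finprod G (\<lambda>x. \<beta> x [^] Poly_Mapping.lookup s x) ?S \<otimes> finprod G (\<lambda>x. \<beta> x [^] Poly_Mapping.lookup t x) ?S"
    by (rule finprod_multf) (use assms in auto)
  also have "\<dots> = free_lift G \<beta> s \<otimes> free_lift G \<beta> t"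
    using assms by (subst (1 2) free_lift_superset[symmetric]) auto
  finally show ?thesis .
qed

lemma free_lift_hom: "(\<And>x. x \<in> S \<Longrightarrow> \<beta> x \<in> carrier G) \<Longrightarrow> free_lift G \<beta> \<in> hom (free_Abelian_group S) G"
  by (rule homI) (auto intro!: free_lift_closed free_lift_add)

lemma free_lift_of: "\<beta> x \<in> carrier G \<Longrightarrow> free_lift G \<beta> (frag_of x) = \<beta> x"
  by (subst free_lift_superset[of "{x}"]) auto

lemma free_lift_group_hom:
  "(\<And>x. x \<in> S \<Longrightarrow> \<beta> x \<in> carrier G) \<Longrightarrow> group_hom (free_Abelian_group S) G (free_lift G \<beta>)"
  by (simp add: group_hom_def group_hom_axioms_def free_lift_hom is_group)

lemma free_lift_diff:
  assumes "\<And>x. x \<in> S \<Longrightarrow> \<beta> x \<in> carrier G" "Poly_Mapping.keys s \<subseteq> S" "Poly_Mapping.keys t \<subseteq> S"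
  shows "free_lift G \<beta> (s - t) = free_lift G \<beta> s \<otimes> inv (free_lift G \<beta> t)"
proof -
  interpret h: group_hom "free_Abelian_group S" G "free_lift G \<beta>"
    by (rule free_lift_group_hom) (use assms in auto)
  show ?thesis
    using h.hom_mult[of s "- t"] h.hom_inv[of t] assms(2,3) by simp
qed

end

definition biadditive :: "'a ccomplex \<Rightarrow> 'b ccomplex \<Rightarrow> int \<Rightarrow> 'g monoid \<Rightarrow> (int \<times> int \<times> 'a \<times> 'b \<Rightarrow> 'g) \<Rightarrow> bool" where
  "biadditive A B n G \<beta> \<longleftrightarrow>
    (\<forall>i j. i + j = n \<longrightarrow> (\<forall>a\<in>carrier (cgrp A i). \<forall>b\<in>carrier (cgrp B j). \<beta> (i, j, a, b) \<in> carrier G \<and>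
       (\<forall>a'\<in>carrier (cgrp A i). \<beta> (i, j, a \<otimes>\<^bsub>cgrp A i\<^esub> a', b) = \<beta> (i, j, a, b) \<otimes>\<^bsub>G\<^esub> \<beta> (i, j, a', b)) \<and>
       (\<forall>b'\<in>carrier (cgrp B j). \<beta> (i, j, a, b \<otimes>\<^bsub>cgrp B j\<^esub> b') = \<beta> (i, j, a, b) \<otimes>\<^bsub>G\<^esub> \<beta> (i, j, a, b'))))"

lemma in_tensor_gens [simp]:
  "(i, j, a, b) \<in> tensor_gens A B n \<longleftrightarrow> i + j = n \<and> a \<in> carrier (cgrp A i) \<and> b \<in> carrier (cgrp B j)"
  by (simp add: tensor_gens_def)

locale tensor_pair =
  fixes A :: "'a ccomplex" and B :: "'b ccomplex"
  assumes A: "\<And>i. comm_group (cgrp A i)" and B: "\<And>i. comm_group (cgrp B i)"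
begin

abbreviation "Fr n \<equiv> free_Abelian_group (tensor_gens A B n)"

lemma mult_A [simp]: "a \<in> carrier (cgrp A i) \<Longrightarrow> a' \<in> carrier (cgrp A i) \<Longrightarrow> a \<otimes>\<^bsub>cgrp A i\<^esub> a' \<in> carrier (cgrp A i)"
  using A by (simp add: comm_group_def comm_monoid_def monoid.m_closed)

lemma mult_B [simp]: "a \<in> carrier (cgrp B i) \<Longrightarrow> a' \<in> carrier (cgrp B i) \<Longrightarrow> a \<otimes>\<^bsub>cgrp B i\<^esub> a' \<in> carrier (cgrp B i)"
  using B by (simp add: comm_group_def comm_monoid_def monoid.m_closed)

lemma carrier_Fr: "carrier (Fr n) = chains_on (tensor_gens A B n)"
  by (simp add: chains_on_def free_Abelian_group_def)

lemma tensor_rels_subset: "tensor_rels A B n \<subseteq> carrier (Fr n)"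
  unfolding carrier_Fr by (auto simp: tensor_rels_def tensor_gens_def intro!: chains_diff)

lemma tensor_null_subgroup: "subgroup (tensor_null A B n) (Fr n)"
  unfolding tensor_null_def
  by (rule group.generate_is_subgroup[OF group_free_Abelian_group tensor_rels_subset])

lemma tensor_null_normal: "tensor_null A B n \<lhd> Fr n"
  by (rule comm_group.normal_iff_subgroup[OF abelian_free_Abelian_group, THEN iffD2, OF tensor_null_subgroup])

lemma comm_group_tensor: "comm_group (tensor_group A B n)"
  unfolding tensor_group_def
  by (rule comm_group.abelian_FactGroup[OF abelian_free_Abelian_group tensor_null_subgroup])

abbreviation "coset n c \<equiv> tensor_null A B n #>\<^bsub>Fr n\<^esub> c"

lemma carrier_tensor: "carrier (tensor_group A B n) = coset n ` chains_on (tensor_gens A B n)"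
  by (auto simp: tensor_group_def FactGroup_def RCOSETS_def chains_on_def)

lemma mult_tensor:
  "c \<in> chains_on (tensor_gens A B n) \<Longrightarrow> d \<in> chains_on (tensor_gens A B n) \<Longrightarrow>
    coset n c \<otimes>\<^bsub>tensor_group A B n\<^esub> coset n d = coset n (c + d)"
  using normal.rcos_sum[OF tensor_null_normal, of c n d] by (simp add: tensor_group_def FactGroup_def chains_on_def)

lemma coset_hom: "coset n \<in> hom (Fr n) (tensor_group A B n)"
  by (rule homI) (auto simp: carrier_tensor mult_tensor chains_on_def)

lemma elem_tensor_closed:
  "a \<in> carrier (cgrp A i) \<Longrightarrow> b \<in> carrier (cgrp B j) \<Longrightarrow> n = i + j \<Longrightarrow>
     elem_tensor A B i j a b \<in> carrier (tensor_group A B n)"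
  by (auto simp: elem_tensor_def carrier_tensor tensor_gens_def)

lemma coset_eq:
  assumes "c \<in> chains_on (tensor_gens A B n)" "d \<in> chains_on (tensor_gens A B n)" "d - c \<in> tensor_null A B n"
  shows "coset n c = coset n d"
proof -
  have "d \<in> coset n c"
    unfolding r_coset_def using assms by (auto intro!: bexI[of _ "d - c"])
  then show ?thesis
    using group.repr_independence[OF group_free_Abelian_group _ _ tensor_null_subgroup] assms(1)
    by (auto simp: chains_on_def)
qed

lemma elem_tensor_add1:
  assumes "a \<in> carrier (cgrp A i)" "a' \<in> carrier (cgrp A i)" "b \<in> carrier (cgrp B j)" "n = i + j"
  shows "elem_tensor A B i j (a \<otimes>\<^bsub>cgrp A i\<^esub> a') b =
    elem_tensor A B i j a b \<otimes>\<^bsub>tensor_group A B n\<^esub> elem_tensor A B i j a' b"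
proof -
  let ?c = "frag_of (i, j, a, b) + frag_of (i, j, a', b)"
  have "frag_of (i, j, a \<otimes>\<^bsub>cgrp A i\<^esub> a', b) - ?c \<in> tensor_rels A B n"
    unfolding tensor_rels_def diff_diff_add[symmetric] using assms by blast
  then have "frag_of (i, j, a \<otimes>\<^bsub>cgrp A i\<^esub> a', b) - ?c \<in> tensor_null A B n"
    unfolding tensor_null_def by (rule generate.incl)
  then have "coset n ?c = coset n (frag_of (i, j, a \<otimes>\<^bsub>cgrp A i\<^esub> a', b))"
    by (intro coset_eq) (use assms in auto)
  then show ?thesis
    using assms by (simp add: elem_tensor_def mult_tensor)
qed

lemma elem_tensor_add2:
  assumes "a \<in> carrier (cgrp A i)" "b \<in> carrier (cgrp B j)" "b' \<in> carrier (cgrp B j)" "n = i + j"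
  shows "elem_tensor A B i j a (b \<otimes>\<^bsub>cgrp B j\<^esub> b') =
    elem_tensor A B i j a b \<otimes>\<^bsub>tensor_group A B n\<^esub> elem_tensor A B i j a b'"
proof -
  let ?c = "frag_of (i, j, a, b) + frag_of (i, j, a, b')"
  have "frag_of (i, j, a, b \<otimes>\<^bsub>cgrp B j\<^esub> b') - ?c \<in> tensor_rels A B n"
    unfolding tensor_rels_def diff_diff_add[symmetric] using assms by blast
  then have "frag_of (i, j, a, b \<otimes>\<^bsub>cgrp B j\<^esub> b') - ?c \<in> tensor_null A B n"
    unfolding tensor_null_def by (rule generate.incl)
  then have "coset n ?c = coset n (frag_of (i, j, a, b \<otimes>\<^bsub>cgrp B j\<^esub> b'))"
    by (intro coset_eq) (use assms in auto)
  then show ?thesis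
    using assms by (simp add: elem_tensor_def mult_tensor)
qed

lemma biadditive_gens:
  "biadditive A B n G \<beta> \<Longrightarrow> x \<in> tensor_gens A B n \<Longrightarrow> \<beta> x \<in> carrier G"
  by (auto simp: biadditive_def tensor_gens_def)

text \<open>The free lift sends each biadditivity relation to the unit, hence is constant on cosets
  of \<open>tensor_null\<close>, and \<open>the_elem\<close> extracts the constant value.\<close>

lemma tensor_lift_coset:
  assumes G: "comm_group G" and \<beta>: "biadditive A B n G \<beta>" and c: "c \<in> chains_on (tensor_gens A B n)"
  shows "tensor_lift G \<beta> (coset n c) = free_lift G \<beta> c"
proof -
  interpret G: plain_comm_group G by (rule plain_comm_group.intro[OF G])
  interpret h: group_hom "Fr n" G "free_lift G \<beta>"
    by (rule G.free_lift_group_hom) (rule biadditive_gens[OF \<beta>])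
  have z: "x \<otimes>\<^bsub>G\<^esub> y \<otimes>\<^bsub>G\<^esub> inv\<^bsub>G\<^esub> x \<otimes>\<^bsub>G\<^esub> inv\<^bsub>G\<^esub> y = \<one>\<^bsub>G\<^esub>" if "x \<in> carrier G" "y \<in> carrier G" for x y
    using that by (simp add: G.m_comm[of x y] G.m_assoc G.r_inv)
  have fd: "free_lift G \<beta> (frag_of x - frag_of y - frag_of w) = \<beta> x \<otimes>\<^bsub>G\<^esub> inv\<^bsub>G\<^esub> \<beta> y \<otimes>\<^bsub>G\<^esub> inv\<^bsub>G\<^esub> \<beta> w"
    if "x \<in> tensor_gens A B n" "y \<in> tensor_gens A B n" "w \<in> tensor_gens A B n" for x y w
  proof -
    have c: "\<beta> x \<in> carrier G" if "x \<in> tensor_gens A B n" for x by (rule biadditive_gens[OF \<beta> that])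
    have k: "Poly_Mapping.keys (frag_of x - frag_of y) \<subseteq> tensor_gens A B n"
      using that keys_diff[of "frag_of x" "frag_of y"] by auto
    then have "free_lift G \<beta> (frag_of x - frag_of y - frag_of w) =
        free_lift G \<beta> (frag_of x - frag_of y) \<otimes>\<^bsub>G\<^esub> inv\<^bsub>G\<^esub> \<beta> w"
      using that c by (subst G.free_lift_diff[of "tensor_gens A B n"]) (auto simp: G.free_lift_of)
    also have "free_lift G \<beta> (frag_of x - frag_of y) = \<beta> x \<otimes>\<^bsub>G\<^esub> inv\<^bsub>G\<^esub> \<beta> y"
      using that c by (subst G.free_lift_diff[of "tensor_gens A B n"]) (auto simp: G.free_lift_of)
    finally show ?thesis .
  qed
  have "free_lift G \<beta> x = \<one>\<^bsub>G\<^esub>" if "x \<in> tensor_rels A B n" for x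
    using that \<beta> unfolding tensor_rels_def
    by (auto simp: fd tensor_gens_def biadditive_def z)
  then have "tensor_rels A B n \<subseteq> kernel (Fr n) G (free_lift G \<beta>)"
    unfolding kernel_def using tensor_rels_subset by blast
  then have "tensor_null A B n \<subseteq> kernel (Fr n) G (free_lift G \<beta>)"
    unfolding tensor_null_def
    by (rule group.generate_subgroup_incl[OF group_free_Abelian_group _ h.subgroup_kernel])
  then have "free_lift G \<beta> (x + c) = free_lift G \<beta> c" if "x \<in> tensor_null A B n" for x
    using that c h.hom_mult[of x c] h.hom_closed[of c] by (auto simp: kernel_def chains_on_def)
  then have "free_lift G \<beta> ` coset n c = {free_lift G \<beta> c}"
    using subgroup.one_closed[OF tensor_null_subgroup, of n] by (auto simp: r_coset_def image_iff)
  then show ?thesis by (simp add: tensor_lift_def)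
qed

lemma tensor_lift_elem:
  assumes G: "comm_group G" and \<beta>: "biadditive A B (i + j) G \<beta>"
    and "a \<in> carrier (cgrp A i)" "b \<in> carrier (cgrp B j)"
  shows "tensor_lift G \<beta> (elem_tensor A B i j a b) = \<beta> (i, j, a, b)"
proof -
  interpret G: plain_comm_group G by (rule plain_comm_group.intro[OF G])
  have x: "(i, j, a, b) \<in> tensor_gens A B (i + j)" using assms by (simp add: tensor_gens_def)
  then show ?thesis
    using biadditive_gens[OF \<beta> x] by (simp add: elem_tensor_def tensor_lift_coset[OF G \<beta>] G.free_lift_of)
qed

lemma tensor_lift_hom:
  assumes G: "comm_group G" and \<beta>: "biadditive A B n G \<beta>"
  shows "tensor_lift G \<beta> \<in> hom (tensor_group A B n) G"
proof -
  interpret G: plain_comm_group G by (rule plain_comm_group.intro[OF G])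
  have h: "free_lift G \<beta> \<in> hom (Fr n) G"
    by (rule G.free_lift_hom) (rule biadditive_gens[OF \<beta>])
  have c: "x \<in> carrier (Fr n) \<longleftrightarrow> x \<in> chains_on (tensor_gens A B n)" for x by (simp add: chains_on_def)
  show ?thesis
  proof (rule homI)
    fix S T assume "S \<in> carrier (tensor_group A B n)" "T \<in> carrier (tensor_group A B n)"
    then obtain s t where "S = coset n s" "T = coset n t" "s \<in> chains_on (tensor_gens A B n)" "t \<in> chains_on (tensor_gens A B n)"
      by (auto simp: carrier_tensor)
    moreover from this have "s + t \<in> chains_on (tensor_gens A B n)" by auto
    ultimately show "tensor_lift G \<beta> (S \<otimes>\<^bsub>tensor_group A B n\<^esub> T) = tensor_lift G \<beta> S \<otimes>\<^bsub>G\<^esub> tensor_lift G \<beta> T"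
      using hom_mult[OF h, of s t] by (simp add: mult_tensor tensor_lift_coset[OF G \<beta>] chains_on_def)
  qed (use hom_in_carrier[OF h] in \<open>auto simp: carrier_tensor tensor_lift_coset[OF G \<beta>] carrier_Fr\<close>)
qed

text \<open>The cosets of the free generators are the elementary tensors, and they generate the
  group.\<close>

lemma tensor_hom_eq:
  assumes "group G" "f \<in> hom (tensor_group A B n) G" "g \<in> hom (tensor_group A B n) G"
    and eq: "\<And>i j a b. n = i + j \<Longrightarrow> a \<in> carrier (cgrp A i) \<Longrightarrow> b \<in> carrier (cgrp B j) \<Longrightarrow>
      f (elem_tensor A B i j a b) = g (elem_tensor A B i j a b)"
    and T: "T \<in> carrier (tensor_group A B n)"
  shows "f T = g T"
proof -
  interpret G: group G by fact
  have fc: "f \<circ> coset n \<in> hom (Fr n) G" and triangulate_inv: "g \<circ> coset n \<in> hom (Fr n) G"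
    using hom_compose[OF coset_hom] assms by auto
  interpret f: group_hom "Fr n" G "f \<circ> coset n"
    by (simp add: group_hom_def group_hom_axioms_def fc G.is_group)
  interpret g: group_hom "Fr n" G "g \<circ> coset n"
    by (simp add: group_hom_def group_hom_axioms_def triangulate_inv G.is_group)
  obtain c where c: "T = coset n c" "Poly_Mapping.keys c \<subseteq> tensor_gens A B n"
    using T by (auto simp: carrier_tensor chains_on_def)
  have "c \<in> chains_on (tensor_gens A B n)" using c by (simp add: chains_on_def)
  then have "c \<in> chains_on (tensor_gens A B n) \<and> (f \<circ> coset n) c = (g \<circ> coset n) c"
  proof (induction rule: chains_induct)
    case zero
    then show ?case using f.hom_one g.hom_one by simp
  next
    case (diff x y)
    then have k: "Poly_Mapping.keys x \<subseteq> tensor_gens A B n" "Poly_Mapping.keys y \<subseteq> tensor_gens A B n"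
      by (auto simp: chains_on_def)
    have "(f \<circ> coset n) (x - y) = (f \<circ> coset n) x \<otimes>\<^bsub>G\<^esub> inv\<^bsub>G\<^esub> ((f \<circ> coset n) y)"
      using f.hom_mult[of x "- y"] f.hom_inv[of y] k by (simp del: comp_apply)
    moreover have "(g \<circ> coset n) (x - y) = (g \<circ> coset n) x \<otimes>\<^bsub>G\<^esub> inv\<^bsub>G\<^esub> ((g \<circ> coset n) y)"
      using g.hom_mult[of x "- y"] g.hom_inv[of y] k by (simp del: comp_apply)
    ultimately show ?case using diff by (simp only: chains_diff)
  next
    case (one x)
    obtain i j a b where "x = (i, j, a, b)" by (cases x) auto
    then show ?case using eq[of i j a b] one by (auto simp: elem_tensor_def)
  qed
  then show ?thesis by (simp add: c)
qed

lemma tensor_cdiff_biadditive: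
  assumes dA: "\<And>i. cdiff A i \<in> hom (cgrp A i) (cgrp A (i - 1))"
    and dB: "\<And>i. cdiff B i \<in> hom (cgrp B i) (cgrp B (i - 1))"
  shows "biadditive A B n (tensor_group A B (n - 1))
     (\<lambda>(i, j, a, b). elem_tensor A B (i - 1) j (cdiff A i a) b \<otimes>\<^bsub>tensor_group A B (n - 1)\<^esub>
           elem_tensor A B i (j - 1) a (cdiff B j b) [^]\<^bsub>tensor_group A B (n - 1)\<^esub> (if even i then 1 else - 1 :: int))"
proof -
  interpret T: comm_group "tensor_group A B (n - 1)" by (rule comm_group_tensor)
  have inv: "x [^]\<^bsub>tensor_group A B (n - 1)\<^esub> (- 1 :: int) = inv\<^bsub>tensor_group A B (n - 1)\<^esub> x"
    if "x \<in> carrier (tensor_group A B (n - 1))" for x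
    using that T.int_pow_neg[of x 1] by simp
  note [simp] = hom_in_carrier[OF dA] hom_in_carrier[OF dB] hom_mult[OF dA] hom_mult[OF dB]
  show ?thesis
    unfolding biadditive_def
    by (auto simp: elem_tensor_closed elem_tensor_add1[where n = "n - 1"] elem_tensor_add2[where n = "n - 1"]
        inv T.inv_mult T.m_ac)
qed

text \<open>Both composites with the differentials are homomorphisms out of the tensor product, so
  the condition on a morphism of complexes reduces to the Leibniz rule on elementary
  tensors.\<close>

proposition tensor_complex_hom:
  fixes C :: "'c ccomplex"
  assumes dA: "\<And>i. cdiff A i \<in> hom (cgrp A i) (cgrp A (i - 1))"
    and dB: "\<And>i. cdiff B i \<in> hom (cgrp B i) (cgrp B (i - 1))"
    and C: "\<And>i. comm_group (cgrp C i)" and dC: "\<And>i. cdiff C i \<in> hom (cgrp C i) (cgrp C (i - 1))"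
    and \<beta>: "\<And>n. biadditive A B n (cgrp C n) (\<beta> n)"
    and leibniz: "\<And>i j a b. a \<in> carrier (cgrp A i) \<Longrightarrow> b \<in> carrier (cgrp B j) \<Longrightarrow>
      cdiff C (i + j) (\<beta> (i + j) (i, j, a, b)) = \<beta> (i + j - 1) (i - 1, j, cdiff A i a, b) \<otimes>\<^bsub>cgrp C (i + j - 1)\<^esub>
        \<beta> (i + j - 1) (i, j - 1, a, cdiff B j b) [^]\<^bsub>cgrp C (i + j - 1)\<^esub> (if even i then 1 else - 1 :: int)"
  shows "complex_hom (tensor_complex A B) C (\<lambda>n. tensor_lift (cgrp C n) (\<beta> n))"
  unfolding complex_hom_def
proof (intro conjI allI ballI)
  show "tensor_lift (cgrp C n) (\<beta> n) \<in> hom (cgrp (tensor_complex A B) n) (cgrp C n)" for n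
    using tensor_lift_hom[OF C \<beta>] by (simp add: tensor_complex_def)
  fix n T assume T: "T \<in> carrier (cgrp (tensor_complex A B) n)"
  let ?\<delta> = "\<lambda>n (i, j, a, b). elem_tensor A B (i - 1) j (cdiff A i a) b \<otimes>\<^bsub>tensor_group A B (n - 1)\<^esub>
           elem_tensor A B i (j - 1) a (cdiff B j b) [^]\<^bsub>tensor_group A B (n - 1)\<^esub> (if even i then 1 else - 1 :: int)"
  let ?d = "tensor_lift (tensor_group A B (n - 1)) (?\<delta> n)"
  note \<delta> = tensor_cdiff_biadditive[OF dA dB]
  have d: "?d \<in> hom (tensor_group A B n) (tensor_group A B (n - 1))"
    by (rule tensor_lift_hom[OF comm_group_tensor \<delta>])
  have l: "tensor_lift (cgrp C (n - 1)) (\<beta> (n - 1)) \<in> hom (tensor_group A B (n - 1)) (cgrp C (n - 1))"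
    by (rule tensor_lift_hom[OF C \<beta>])
  have "(cdiff C n \<circ> tensor_lift (cgrp C n) (\<beta> n)) T = (tensor_lift (cgrp C (n - 1)) (\<beta> (n - 1)) \<circ> ?d) T"
  proof (rule tensor_hom_eq)
    show "group (cgrp C (n - 1))" using C comm_group_def by blast
    show "cdiff C n \<circ> tensor_lift (cgrp C n) (\<beta> n) \<in> hom (tensor_group A B n) (cgrp C (n - 1))"
      by (rule hom_compose[OF tensor_lift_hom[OF C \<beta>] dC])
    show "tensor_lift (cgrp C (n - 1)) (\<beta> (n - 1)) \<circ> ?d \<in> hom (tensor_group A B n) (cgrp C (n - 1))"
      by (rule hom_compose[OF d l])
    show "T \<in> carrier (tensor_group A B n)" using T by (simp add: tensor_complex_def)
    fix i j a b assume n: "n = i + j" and a: "a \<in> carrier (cgrp A i)" and b: "b \<in> carrier (cgrp B j)"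
    note da = hom_in_carrier[OF dA a] and db = hom_in_carrier[OF dB b]
    interpret T: comm_group "tensor_group A B (n - 1)" by (rule comm_group_tensor)
    interpret l: group_hom "tensor_group A B (n - 1)" "cgrp C (n - 1)" "tensor_lift (cgrp C (n - 1)) (\<beta> (n - 1))"
      using C l by (simp add: group_hom_def group_hom_axioms_def comm_group_def T.is_group)
    have e1: "elem_tensor A B (i - 1) j (cdiff A i a) b \<in> carrier (tensor_group A B (n - 1))"
      by (rule elem_tensor_closed) (use da b n in auto)
    have e2: "elem_tensor A B i (j - 1) a (cdiff B j b) \<in> carrier (tensor_group A B (n - 1))"
      by (rule elem_tensor_closed) (use a db n in auto)
    have "?d (elem_tensor A B i j a b) = ?\<delta> n (i, j, a, b)"
      using tensor_lift_elem[OF comm_group_tensor \<delta> a b] by (simp add: n)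
    moreover have "tensor_lift (cgrp C (n - 1)) (\<beta> (n - 1)) (elem_tensor A B (i - 1) j (cdiff A i a) b) =
        \<beta> (n - 1) (i - 1, j, cdiff A i a, b)"
      using tensor_lift_elem[OF C \<beta>, of "cdiff A i a" "i - 1" b j] da b n by (simp add: algebra_simps)
    moreover have "tensor_lift (cgrp C (n - 1)) (\<beta> (n - 1)) (elem_tensor A B i (j - 1) a (cdiff B j b)) =
        \<beta> (n - 1) (i, j - 1, a, cdiff B j b)"
      using tensor_lift_elem[OF C \<beta>, of a i "cdiff B j b" "j - 1"] a db n by (simp add: algebra_simps)
    ultimately show "(cdiff C n \<circ> tensor_lift (cgrp C n) (\<beta> n)) (elem_tensor A B i j a b) =
        (tensor_lift (cgrp C (n - 1)) (\<beta> (n - 1)) \<circ> ?d) (elem_tensor A B i j a b)"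
      using leibniz[OF a b] tensor_lift_elem[OF C \<beta> a b] e1 e2
      by (simp add: n[symmetric] l.hom_mult l.hom_int_pow)
  qed
  then show "cdiff C n (tensor_lift (cgrp C n) (\<beta> n) T) =
      tensor_lift (cgrp C (n - 1)) (\<beta> (n - 1)) (cdiff (tensor_complex A B) n T)"
    by (simp add: tensor_complex_def)
qed

end

section \<open>Free complexes modulo degenerate generators, and maps prescribed on
  generators\<close>

section \<open>Complexes presented by generators\<close>

text \<open>Complexes are indexed by the integers and generators by the naturals. Since
  \<open>nat\<close> sends all negative degrees to 0, these must be emptied explicitly.\<close>

definition int_graded :: "(nat \<Rightarrow> 'b set) \<Rightarrow> int \<Rightarrow> 'b set" where
  "int_graded G n = (if n < 0 then {} else G (nat n))"

lemma chains_int_graded_neg: "n < 0 \<Longrightarrow> c \<in> chains_on (int_graded G n) \<Longrightarrow> c = 0"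
  by (simp add: int_graded_def)

lemma int_graded_extend:
  assumes "c \<in> chains_on (int_graded G n)" "\<And>k x. x \<in> G k \<Longrightarrow> F k x \<in> chains_on (G' (k + s))"
  shows "frag_extend (F (nat n)) c \<in> chains_on (int_graded G' (n + int s))"
proof (cases "n < 0")
  case False
  then have "nat (n + int s) = nat n + s" "\<not> n + int s < 0" by auto
  then show ?thesis
    using assms False unfolding int_graded_def by (auto intro: chains_extend[of c "G (nat n)"])
qed (simp add: chains_int_graded_neg[OF _ assms(1)])

lemma int_graded_extend0:
  assumes "c \<in> chains_on (int_graded G n)" "\<And>k x. x \<in> G k \<Longrightarrow> F k x \<in> chains_on (G' k)"
  shows "frag_extend (F (nat n)) c \<in> chains_on (int_graded G' n)"
  using int_graded_extend[OF assms(1), of F G' 0] assms(2) by simp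

lemma int_graded_fmap:
  assumes "c \<in> chains_on (int_graded G n)" "\<And>k x. x \<in> G k \<Longrightarrow> F k x \<in> G' k"
  shows "fmap (F (nat n)) c \<in> chains_on (int_graded G' n)"
  unfolding fmap_def by (rule int_graded_extend0[OF assms(1)]) (use assms(2) in auto)

text \<open>Degree 0 is critical: \<open>nat n - 1\<close> remains 0 there, while the integer degree
  drops to -1, which has no generators. So the map has to vanish in degree 0.\<close>

lemma int_graded_extend_pred:
  assumes "c \<in> chains_on (int_graded G n)" "\<And>k x. x \<in> G k \<Longrightarrow> F k x \<in> chains_on (G' (k - 1))" "\<And>x. F 0 x = 0"
  shows "frag_extend (F (nat n)) c \<in> chains_on (int_graded G' (n - 1))"
proof (cases "n \<le> 0")
  case True
  then have "nat n = 0" by auto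
  moreover have "F 0 = (\<lambda>x. 0)" using assms(3) by auto
  ultimately show ?thesis by simp
next
  case False
  then have "nat (n - 1) = nat n - 1" "\<not> n - 1 < 0" by auto
  then show ?thesis
    using assms False unfolding int_graded_def by (auto intro: chains_extend[of c "G (nat n)"])
qed

text \<open>The generators in \<open>D\<close> are the degenerate ones, to be set to zero.\<close>

locale chain_data =
  fixes G D :: "nat \<Rightarrow> 'b set" and bd :: "nat \<Rightarrow> 'b \<Rightarrow> 'b \<Rightarrow>\<^sub>0 int"
  assumes D_sub: "D n \<subseteq> G n"
    and bd_G: "x \<in> G n \<Longrightarrow> bd n x \<in> chains_on (G (n - 1))"
    and bd_0: "bd 0 x = 0"
    and bd_D: "x \<in> D n \<Longrightarrow> bd n x \<in> chains_on (D (n - 1))"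
    and bd_bd: "x \<in> G n \<Longrightarrow> frag_extend (bd (n - 1)) (bd n x) \<in> chains_on (D (n - 1 - 1))"
begin

lemma int_graded_D: "int_graded D n \<subseteq> int_graded G n"
  using D_sub by (auto simp: int_graded_def)

lemma bd_int_graded: "c \<in> chains_on (int_graded G n) \<Longrightarrow> frag_extend (bd (nat n)) c \<in> chains_on (int_graded G (n - 1))"
  by (rule int_graded_extend_pred) (use bd_G bd_0 in auto)

lemma bd_int_graded_D: "c \<in> chains_on (int_graded D n) \<Longrightarrow> frag_extend (bd (nat n)) c \<in> chains_on (int_graded D (n - 1))"
  by (rule int_graded_extend_pred) (use bd_D bd_0 in auto)

lemma bd_bd_int_graded:
  assumes "c \<in> chains_on (int_graded G n)"
  shows "frag_extend (bd (nat (n - 1))) (frag_extend (bd (nat n)) c) \<in> chains_on (int_graded D (n - 2))"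
proof (cases "n \<le> 1")
  case True
  then have "nat (n - 1) = 0" by auto
  moreover have "bd 0 = (\<lambda>x. 0)" using bd_0 by auto
  ultimately show ?thesis by simp
next
  case False
  then have "nat (n - 1) = nat n - 1" "nat (n - 2) = nat n - 1 - 1" "\<not> n - 2 < 0" by auto
  then show ?thesis
    using chains_extend[of c "G (nat n)" "\<lambda>x. frag_extend (bd (nat n - 1)) (bd (nat n) x)"] bd_bd assms False
    by (simp add: int_graded_def frag_extend_extend)
qed

end

text \<open>Degree n of \<open>C\<close> is exhibited by \<open>r n\<close> as the free group on
  \<open>G\<close> modulo the one on \<open>D\<close>. This covers the singular complex itself, with
  \<open>D\<close> empty and \<open>r\<close> the identity, as well as groups of cosets.\<close>

locale presented = chain_data G D bd for G D :: "nat \<Rightarrow> 'b set" and bd +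
  fixes C :: "'c ccomplex" and r :: "int \<Rightarrow> ('b \<Rightarrow>\<^sub>0 int) \<Rightarrow> 'c"
  assumes grp: "comm_group (cgrp C n)"
    and r_hom: "r n \<in> hom (free_Abelian_group (int_graded G n)) (cgrp C n)"
    and r_surj: "a \<in> carrier (cgrp C n) \<Longrightarrow> \<exists>c\<in>chains_on (int_graded G n). a = r n c"
    and r_ker: "c \<in> chains_on (int_graded G n) \<Longrightarrow> r n c = \<one>\<^bsub>cgrp C n\<^esub> \<longleftrightarrow> c \<in> chains_on (int_graded D n)"
    and r_bd: "c \<in> chains_on (int_graded G n) \<Longrightarrow> cdiff C n (r n c) = r (n - 1) (frag_extend (bd (nat n)) c)"
begin

lemma r_closed [simp]: "c \<in> chains_on (int_graded G n) \<Longrightarrow> r n c \<in> carrier (cgrp C n)"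
  using hom_in_carrier[OF r_hom] by (simp add: chains_on_def)

lemma r_add: "c \<in> chains_on (int_graded G n) \<Longrightarrow> d \<in> chains_on (int_graded G n) \<Longrightarrow> r n (c + d) = r n c \<otimes>\<^bsub>cgrp C n\<^esub> r n d"
  using hom_mult[OF r_hom, of c n d] by (simp add: chains_on_def)

lemma r_group_hom: "group_hom (free_Abelian_group (int_graded G n)) (cgrp C n) (r n)"
  using grp r_hom by (simp add: group_hom_def group_hom_axioms_def comm_group_def)

lemma r_zero: "r n 0 = \<one>\<^bsub>cgrp C n\<^esub>"
  using group_hom.hom_one[OF r_group_hom] by simp

lemma r_minus: "c \<in> chains_on (int_graded G n) \<Longrightarrow> r n (- c) = inv\<^bsub>cgrp C n\<^esub> r n c"
  using group_hom.hom_inv[OF r_group_hom, of c n] by (simp add: chains_on_def)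

lemma r_pow: "c \<in> chains_on (int_graded G n) \<Longrightarrow> r n (frag_cmul k c) = r n c [^]\<^bsub>cgrp C n\<^esub> (k::int)"
  using group_hom.hom_int_pow[OF r_group_hom, of c n k] by (simp add: chains_on_def)

lemma r_eq:
  assumes c: "c \<in> chains_on (int_graded G n)" and d: "d \<in> chains_on (int_graded G n)"
  shows "r n c = r n d \<longleftrightarrow> c - d \<in> chains_on (int_graded D n)"
proof -
  interpret K: comm_group "cgrp C n" by (rule grp)
  have "r n (c + - d) = r n c \<otimes>\<^bsub>cgrp C n\<^esub> inv\<^bsub>cgrp C n\<^esub> r n d"
    using c d by (subst r_add) (simp_all add: r_minus)
  then have "r n (c - d) = r n c \<otimes>\<^bsub>cgrp C n\<^esub> inv\<^bsub>cgrp C n\<^esub> r n d" by simp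
  moreover have "r n c = r n d \<longleftrightarrow> r n c \<otimes>\<^bsub>cgrp C n\<^esub> inv\<^bsub>cgrp C n\<^esub> r n d = \<one>\<^bsub>cgrp C n\<^esub>"
  proof
    assume "r n c \<otimes>\<^bsub>cgrp C n\<^esub> inv\<^bsub>cgrp C n\<^esub> r n d = \<one>\<^bsub>cgrp C n\<^esub>"
    then have "\<one>\<^bsub>cgrp C n\<^esub> \<otimes>\<^bsub>cgrp C n\<^esub> r n d = r n c \<otimes>\<^bsub>cgrp C n\<^esub> inv\<^bsub>cgrp C n\<^esub> r n d \<otimes>\<^bsub>cgrp C n\<^esub> r n d"
      by simp
    then show "r n c = r n d" using c d by (simp add: K.m_assoc)
  qed (use c d in simp)
  ultimately show ?thesis using r_ker[of "c - d" n] c d by auto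
qed

lemma r_eqI: "c \<in> chains_on (int_graded G n) \<Longrightarrow> d \<in> chains_on (int_graded G n) \<Longrightarrow> c - d \<in> chains_on (int_graded D n) \<Longrightarrow> r n c = r n d"
  using r_eq by blast

lemma r_cases [consumes 1]:
  assumes "a \<in> carrier (cgrp C n)"
  obtains c where "c \<in> chains_on (int_graded G n)" "a = r n c"
  using r_surj[OF assms] by blast

lemma hom_from_presentation:
  assumes "\<And>c. c \<in> chains_on (int_graded G n) \<Longrightarrow> f (r n c) = g c" "\<And>c. c \<in> chains_on (int_graded G n) \<Longrightarrow> g c \<in> carrier H"
    "\<And>c d. c \<in> chains_on (int_graded G n) \<Longrightarrow> d \<in> chains_on (int_graded G n) \<Longrightarrow> g (c + d) = g c \<otimes>\<^bsub>H\<^esub> g d"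
  shows "f \<in> hom (cgrp C n) H"
proof (rule homI)
  fix a b assume "a \<in> carrier (cgrp C n)" "b \<in> carrier (cgrp C n)"
  then obtain c d where "c \<in> chains_on (int_graded G n)" "a = r n c" "d \<in> chains_on (int_graded G n)" "b = r n d"
    by (metis r_cases)
  then show "f (a \<otimes>\<^bsub>cgrp C n\<^esub> b) = f a \<otimes>\<^bsub>H\<^esub> f b"
    using assms(1)[of "c + d"] assms(1,3) by (simp add: r_add[symmetric] chains_add)
next
  fix a assume "a \<in> carrier (cgrp C n)"
  then obtain c where "c \<in> chains_on (int_graded G n)" "a = r n c" by (rule r_cases)
  then show "f a \<in> carrier H" using assms(1,2) by simp
qed

lemma cdiff_hom: "cdiff C n \<in> hom (cgrp C n) (cgrp C (n - 1))"
  by (rule hom_from_presentation[where g = "\<lambda>c. r (n - 1) (frag_extend (bd (nat n)) c)"])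
     (auto simp: r_bd bd_int_graded r_add frag_lin)

lemma bounded_below: "bounded_below_complex C"
  unfolding bounded_below_complex_def
proof (intro conjI allI ballI)
  fix n a assume "a \<in> carrier (cgrp C n)"
  then obtain c where "c \<in> chains_on (int_graded G n)" "a = r n c" by (rule r_cases)
  then show "cdiff C (n - 1) (cdiff C n a) = \<one>\<^bsub>cgrp C (n - 2)\<^esub>"
    using bd_bd_int_graded[of c n] bd_int_graded[of c n] bd_int_graded[of "frag_extend (bd (nat n)) c" "n - 1"]
    by (simp add: r_bd r_ker)
next
  show "\<exists>N. \<forall>n<N. carrier (cgrp C n) = {\<one>\<^bsub>cgrp C n\<^esub>}"
  proof (intro exI[of _ 0] allI impI)
    fix n :: int assume n: "n < 0"
    have "a = \<one>\<^bsub>cgrp C n\<^esub>" if "a \<in> carrier (cgrp C n)" for a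
    proof -
      obtain c where "c \<in> chains_on (int_graded G n)" "a = r n c"
        using \<open>a \<in> carrier (cgrp C n)\<close> by (rule r_cases)
      moreover from this have "c = 0" using n chains_int_graded_neg by blast
      ultimately show ?thesis by (simp add: r_zero)
    qed
    moreover have "\<one>\<^bsub>cgrp C n\<^esub> \<in> carrier (cgrp C n)" using r_closed[of 0 n] r_zero by simp
    ultimately show "carrier (cgrp C n) = {\<one>\<^bsub>cgrp C n\<^esub>}" by blast
  qed
qed (auto simp: grp cdiff_hom)

end

locale presented_pair = A: presented GA DA bdA A rA + B: presented GB DB bdB B rB
  for GA DA :: "nat \<Rightarrow> 'a set" and bdA and A :: "'c ccomplex" and rA
  and GB DB :: "nat \<Rightarrow> 'b set" and bdB and B :: "'d ccomplex" and rB
begin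

text \<open>The shift \<open>s\<close> is 0 for chain maps and 1 for homotopies.\<close>

definition induces :: "nat \<Rightarrow> (nat \<Rightarrow> 'a \<Rightarrow> 'b \<Rightarrow>\<^sub>0 int) \<Rightarrow> (int \<Rightarrow> 'c \<Rightarrow> 'd) \<Rightarrow> bool" where
  "induces s F \<phi> \<longleftrightarrow> (\<forall>n. \<forall>c\<in>chains_on (int_graded GA n). \<phi> n (rA n c) = rB (n + int s) (frag_extend (F (nat n)) c))"

lemma inducesD: "induces 0 F \<phi> \<Longrightarrow> c \<in> chains_on (int_graded GA n) \<Longrightarrow> \<phi> n (rA n c) = rB n (frag_extend (F (nat n)) c)"
  by (simp add: induces_def)

text \<open>An arbitrary choice of representatives works because \<open>F\<close> carries degenerate
  generators to degenerate chains.\<close>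

lemma induces_ex:
  assumes "\<And>k x. x \<in> GA k \<Longrightarrow> F k x \<in> chains_on (GB (k + s))" "\<And>k x. x \<in> DA k \<Longrightarrow> F k x \<in> chains_on (DB (k + s))"
  obtains \<phi> where "induces s F \<phi>"
proof
  define \<phi> where "\<phi> n a = rB (n + int s) (frag_extend (F (nat n)) (SOME c. c \<in> chains_on (int_graded GA n) \<and> rA n c = a))" for n a
  show "induces s F \<phi>"
    unfolding induces_def
  proof (intro allI ballI)
    fix n c assume c: "c \<in> chains_on (int_graded GA n)"
    define d where "d = (SOME d. d \<in> chains_on (int_graded GA n) \<and> rA n d = rA n c)"
    have "d \<in> chains_on (int_graded GA n) \<and> rA n d = rA n c"
      unfolding d_def by (rule someI[of _ c]) (use c in auto)
    then have d: "d \<in> chains_on (int_graded GA n)" "d - c \<in> chains_on (int_graded DA n)" using c A.r_eq by auto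
    have "frag_extend (F (nat n)) (d - c) \<in> chains_on (int_graded DB (n + int s))"
      by (rule int_graded_extend[OF d(2), of F DB s, OF assms(2)])
    then have "rB (n + int s) (frag_extend (F (nat n)) d) = rB (n + int s) (frag_extend (F (nat n)) c)"
      by (intro B.r_eqI) (auto simp: frag_lin intro!: int_graded_extend[where G = GA] c d assms(1))
    then show "\<phi> n (rA n c) = rB (n + int s) (frag_extend (F (nat n)) c)"
      by (simp add: \<phi>_def d_def)
  qed
qed

lemma induces_hom:
  assumes "induces s F \<phi>" "\<And>k x. x \<in> GA k \<Longrightarrow> F k x \<in> chains_on (GB (k + s))"
  shows "\<phi> n \<in> hom (cgrp A n) (cgrp B (n + int s))"
  by (rule A.hom_from_presentation[where g = "\<lambda>c. rB (n + int s) (frag_extend (F (nat n)) c)"])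
     (use assms in \<open>auto simp: induces_def frag_lin intro!: B.r_add B.r_closed int_graded_extend[where G = GA]\<close>)

lemma induces_complex_hom:
  assumes \<phi>: "induces 0 F \<phi>" and F: "\<And>k x. x \<in> GA k \<Longrightarrow> F k x \<in> chains_on (GB k)"
    and ch: "\<And>k x. x \<in> GA k \<Longrightarrow> frag_extend (bdB k) (F k x) - frag_extend (F (k - 1)) (bdA k x) \<in> chains_on (DB (k - 1))"
  shows "complex_hom A B \<phi>"
  unfolding complex_hom_def
proof (intro conjI allI ballI)
  show "\<phi> n \<in> hom (cgrp A n) (cgrp B n)" for n using induces_hom[OF \<phi>, of n] F by simp
  fix n a assume "a \<in> carrier (cgrp A n)"
  then obtain c where c: "c \<in> chains_on (int_graded GA n)" "a = rA n c" by (rule A.r_cases)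
  have 1: "frag_extend (F (nat n)) c \<in> chains_on (int_graded GB n)"
    by (rule int_graded_extend0[OF c(1) F])
  have 2: "frag_extend (F (nat (n - 1))) (frag_extend (bdA (nat n)) c) \<in> chains_on (int_graded GB (n - 1))"
    by (rule int_graded_extend0[OF A.bd_int_graded[OF c(1)] F])
  \<comment> \<open>The defect of commutation with the boundaries lowers the degree by one, and it
    vanishes in degree 0 because both boundaries do.\<close>
  have "frag_extend (\<lambda>x. frag_extend (bdB (nat n)) (F (nat n) x) - frag_extend (F (nat n - 1)) (bdA (nat n) x)) c
      \<in> chains_on (int_graded DB (n - 1))"
    by (rule int_graded_extend_pred[OF c(1), where F = "\<lambda>k x. frag_extend (bdB k) (F k x) - frag_extend (F (k - 1)) (bdA k x)"])
       (use ch in \<open>auto simp: A.bd_0 B.bd_0[abs_def]\<close>)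
  moreover have "nat n - 1 = nat (n - 1)" by auto
  ultimately have 3: "frag_extend (bdB (nat n)) (frag_extend (F (nat n)) c) -
      frag_extend (F (nat (n - 1))) (frag_extend (bdA (nat n)) c) \<in> chains_on (int_graded DB (n - 1))"
    by (simp add: frag_lin frag_extend_extend)
  show "cdiff B n (\<phi> n a) = \<phi> (n - 1) (cdiff A n a)"
    using B.r_eqI[OF B.bd_int_graded[OF 1] 2 3] c 1 A.bd_int_graded[OF c(1)]
    by (simp add: A.r_bd B.r_bd inducesD[OF \<phi>])
qed

lemma induces_homotopic:
  assumes f: "induces 0 F f" and g: "induces 0 F' g"
    and F: "\<And>k x. x \<in> GA k \<Longrightarrow> F k x \<in> chains_on (GB k)" and F': "\<And>k x. x \<in> GA k \<Longrightarrow> F' k x \<in> chains_on (GB k)"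
    and H: "\<And>k x. x \<in> GA k \<Longrightarrow> H k x \<in> chains_on (GB (k + 1))"
    and HD: "\<And>k x. x \<in> DA k \<Longrightarrow> H k x \<in> chains_on (DB (k + 1))"
    and eq: "\<And>k x. x \<in> GA k \<Longrightarrow> F k x - F' k x - frag_extend (bdB (k + 1)) (H k x)
        - frag_extend (H (k - 1)) (bdA k x) \<in> chains_on (DB k)"
  shows "complex_homotopic A B f g"
proof -
  obtain h where h: "induces 1 H h"
    using induces_ex[of H 1] H HD by auto
  show ?thesis
    unfolding complex_homotopic_def
  proof (intro exI[of _ h] conjI allI ballI)
    show "h n \<in> hom (cgrp A n) (cgrp B (n + 1))" for n
      using induces_hom[OF h, of n] H by simp
    fix n a assume "a \<in> carrier (cgrp A n)"
    then obtain c where c: "c \<in> chains_on (int_graded GA n)" "a = rA n c" by (rule A.r_cases)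
    let ?d = "frag_extend (bdA (nat n)) c"
    have d: "?d \<in> chains_on (int_graded GA (n - 1))" by (rule A.bd_int_graded[OF c(1)])
    have 1: "frag_extend (H (nat n)) c \<in> chains_on (int_graded GB (n + 1))"
      using int_graded_extend[OF c(1), of H GB 1] H by simp
    have 2: "frag_extend (H (nat (n - 1))) ?d \<in> chains_on (int_graded GB n)"
      using int_graded_extend[OF d, of H GB 1] H by simp
    have 3: "frag_extend (bdB (nat (n + 1))) (frag_extend (H (nat n)) c) \<in> chains_on (int_graded GB n)"
      using B.bd_int_graded[OF 1] by simp
    have Fc: "frag_extend (F (nat n)) c \<in> chains_on (int_graded GB n)" "frag_extend (F' (nat n)) c \<in> chains_on (int_graded GB n)"
      by (auto intro!: int_graded_extend0[OF c(1)] F F')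
    have "frag_extend (\<lambda>x. F (nat n) x - F' (nat n) x - frag_extend (bdB (nat n + 1)) (H (nat n) x)
        - frag_extend (H (nat n - 1)) (bdA (nat n) x)) c \<in> chains_on (int_graded DB n)"
      by (rule int_graded_extend0[OF c(1), where F = "\<lambda>k x. F k x - F' k x - frag_extend (bdB (k + 1)) (H k x)
        - frag_extend (H (k - 1)) (bdA k x)"]) (rule eq)
    then have "frag_extend (F (nat n)) c - frag_extend (F' (nat n)) c
        - frag_extend (bdB (nat n + 1)) (frag_extend (H (nat n)) c) - frag_extend (H (nat n - 1)) ?d \<in> chains_on (int_graded DB n)"
      by (simp add: frag_lin frag_extend_extend)
    moreover have "nat n - 1 = nat (n - 1)" by auto
    \<comment> \<open>\<open>nat n + 1\<close> and \<open>nat (n + 1)\<close> differ for negative n,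
      where the chain is zero anyway.\<close>
    moreover have "frag_extend (bdB (nat n + 1)) (frag_extend (H (nat n)) c) =
        frag_extend (bdB (nat (n + 1))) (frag_extend (H (nat n)) c)"
    proof (cases "n < 0")
      case True
      then have "c = 0" using c(1) by (rule chains_int_graded_neg)
      then show ?thesis by simp
    next
      case False
      then show ?thesis by (simp add: nat_add_distrib)
    qed
    ultimately have "frag_extend (F (nat n)) c - (frag_extend (F' (nat n)) c
        + (frag_extend (bdB (nat (n + 1))) (frag_extend (H (nat n)) c) + frag_extend (H (nat (n - 1))) ?d)) \<in> chains_on (int_graded DB n)"
      by (simp add: algebra_simps)
    then have "rB n (frag_extend (F (nat n)) c) = rB n (frag_extend (F' (nat n)) c
        + (frag_extend (bdB (nat (n + 1))) (frag_extend (H (nat n)) c) + frag_extend (H (nat (n - 1))) ?d))"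
      by (intro B.r_eqI) (auto intro: Fc 2 3)
    also have "\<dots> = rB n (frag_extend (F' (nat n)) c) \<otimes>\<^bsub>cgrp B n\<^esub>
       (rB n (frag_extend (bdB (nat (n + 1))) (frag_extend (H (nat n)) c)) \<otimes>\<^bsub>cgrp B n\<^esub>
        rB n (frag_extend (H (nat (n - 1))) ?d))"
      by (simp add: B.r_add Fc 2 3 chains_add)
    finally show "f n a = g n a \<otimes>\<^bsub>cgrp B n\<^esub> (cdiff B (n + 1) (h n a) \<otimes>\<^bsub>cgrp B n\<^esub> h (n - 1) (cdiff A n a))"
      using c d h 1 by (simp add: inducesD[OF f] inducesD[OF g] A.r_bd induces_def B.r_bd)
  qed
qed

end

text \<open>The interface through which all equivalences are obtained. \<open>F'\<close> and the
  homotopies must preserve degenerate generators in order to descend to the quotients; the equations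
  are demanded only modulo degenerate chains.\<close>

lemma induces_homotopy_equivalence:
  assumes "presented GA DA bdA A rA" "presented GB DB bdB B rB"
    and \<phi>: "presented_pair.induces GA rA rB 0 F \<phi>"
    and F: "\<And>k x. x \<in> GA k \<Longrightarrow> F k x \<in> chains_on (GB k)"
    and chF: "\<And>k x. x \<in> GA k \<Longrightarrow> frag_extend (bdB k) (F k x) - frag_extend (F (k - 1)) (bdA k x) \<in> chains_on (DB (k - 1))"
    and F': "\<And>k x. x \<in> GB k \<Longrightarrow> F' k x \<in> chains_on (GA k)" "\<And>k x. x \<in> DB k \<Longrightarrow> F' k x \<in> chains_on (DA k)"
    and chF': "\<And>k x. x \<in> GB k \<Longrightarrow> frag_extend (bdA k) (F' k x) - frag_extend (F' (k - 1)) (bdB k x) \<in> chains_on (DA (k - 1))"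
    and HA: "\<And>k x. x \<in> GA k \<Longrightarrow> HA k x \<in> chains_on (GA (k + 1))" "\<And>k x. x \<in> DA k \<Longrightarrow> HA k x \<in> chains_on (DA (k + 1))"
    and eqA: "\<And>k x. x \<in> GA k \<Longrightarrow> frag_extend (F' k) (F k x) - frag_of x - frag_extend (bdA (k + 1)) (HA k x)
        - frag_extend (HA (k - 1)) (bdA k x) \<in> chains_on (DA k)"
    and HB: "\<And>k x. x \<in> GB k \<Longrightarrow> HB k x \<in> chains_on (GB (k + 1))" "\<And>k x. x \<in> DB k \<Longrightarrow> HB k x \<in> chains_on (DB (k + 1))"
    and eqB: "\<And>k x. x \<in> GB k \<Longrightarrow> frag_extend (F k) (F' k x) - frag_of x - frag_extend (bdB (k + 1)) (HB k x)
        - frag_extend (HB (k - 1)) (bdB k x) \<in> chains_on (DB k)"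
  shows "homotopy_equivalence_map A B \<phi>"
proof -
  interpret A: presented GA DA bdA A rA by fact
  interpret B: presented GB DB bdB B rB by fact
  interpret AB: presented_pair GA DA bdA A rA GB DB bdB B rB ..
  interpret BA: presented_pair GB DB bdB B rB GA DA bdA A rA ..
  interpret AA: presented_pair GA DA bdA A rA GA DA bdA A rA ..
  interpret BB: presented_pair GB DB bdB B rB GB DB bdB B rB ..
  obtain \<psi> where \<psi>: "BA.induces 0 F' \<psi>"
    using BA.induces_ex[of F' 0] F' by auto
  have cF: "c \<in> chains_on (int_graded GA n) \<Longrightarrow> frag_extend (F (nat n)) c \<in> chains_on (int_graded GB n)" for c n
    by (rule int_graded_extend0) (use F in auto)
  have cF': "c \<in> chains_on (int_graded GB n) \<Longrightarrow> frag_extend (F' (nat n)) c \<in> chains_on (int_graded GA n)" for c n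
    by (rule int_graded_extend0) (use F' in auto)
  have 1: "AA.induces 0 (\<lambda>k x. frag_extend (F' k) (F k x)) (\<lambda>n a. \<psi> n (\<phi> n a))"
    using \<phi> \<psi> cF by (simp add: AA.induces_def AB.induces_def BA.induces_def frag_extend_extend)
  have 2: "BB.induces 0 (\<lambda>k x. frag_extend (F k) (F' k x)) (\<lambda>n a. \<phi> n (\<psi> n a))"
    using \<phi> \<psi> cF' by (simp add: BB.induces_def AB.induces_def BA.induces_def frag_extend_extend)
  have 3: "AA.induces 0 (\<lambda>k. frag_of) (\<lambda>n a. a)" "BB.induces 0 (\<lambda>k. frag_of) (\<lambda>n a. a)"
    by (simp_all add: AA.induces_def BB.induces_def)
  show ?thesis
    unfolding homotopy_equivalence_map_def
  proof (intro conjI exI[of _ \<psi>])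
    show "complex_hom A B \<phi>" by (rule AB.induces_complex_hom[OF \<phi> F chF])
    show "complex_hom B A \<psi>" by (rule BA.induces_complex_hom[OF \<psi> F'(1) chF'])
    show "complex_homotopic A A (\<lambda>n a. \<psi> n (\<phi> n a)) (\<lambda>n a. a)"
      by (rule AA.induces_homotopic[OF 1 3(1) _ _ HA eqA])
        (auto intro: chains_extend[OF F F'(1)])
    show "complex_homotopic B B (\<lambda>n b. \<phi> n (\<psi> n b)) (\<lambda>n b. b)"
      by (rule BB.induces_homotopic[OF 2 3(2) _ _ HB eqB])
        (auto intro: chains_extend[OF F'(1) F])
  qed
qed

section \<open>Cartesian products transported along the pairing injection\<close>

section \<open>Products of spaces\<close>

lemma unpair_pr [simp]: "inj pr \<Longrightarrow> unpair pr (pr z) = z"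
  by (simp add: unpair_def)

text \<open>In a pullback topology a map is continuous if it lands in the encoded rectangle and its
  composite with \<open>unpair pr\<close> is continuous.\<close>

lemma continuous_map_into_prod:
  assumes "inj pr" "continuous_map Z X f" "continuous_map Z Y g" "\<And>z. z \<in> topspace Z \<Longrightarrow> h z = pr (f z, g z)"
  shows "continuous_map Z (prod_space pr X Y) h"
proof -
  have "continuous_map Z (prod_topology X Y) (unpair pr \<circ> h)"
    by (rule continuous_map_eq[OF continuous_map_pairedI[OF assms(2,3)]]) (use assms in auto)
  moreover have "topspace Z \<subseteq> h -` (pr ` (topspace X \<times> topspace Y))"
  proof
    fix z assume z: "z \<in> topspace Z"
    then have "f z \<in> topspace X" "g z \<in> topspace Y"
      using continuous_map_image_subset_topspace[OF assms(2)] continuous_map_image_subset_topspace[OF assms(3)] by blast+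
    then show "z \<in> h -` (pr ` (topspace X \<times> topspace Y))" using assms(4)[OF z] by auto
  qed
  ultimately show ?thesis
    unfolding prod_space_def by (rule continuous_map_pullback')
qed

lemma continuous_map_fst_prod: "continuous_map (prod_space pr X Y) X (fst \<circ> unpair pr)"
  unfolding prod_space_def by (rule continuous_map_pullback[OF continuous_map_fst])

lemma continuous_map_snd_prod: "continuous_map (prod_space pr X Y) Y (snd \<circ> unpair pr)"
  unfolding prod_space_def by (rule continuous_map_pullback[OF continuous_map_snd])

lemma continuous_map_prod_map:
  assumes "inj pr" "continuous_map X X' f" "continuous_map Y Y' g"
  shows "continuous_map (prod_space pr X Y) (prod_space pr X' Y') (prod_map pr f g)"
  by (rule continuous_map_into_prod[OF assms(1) continuous_map_compose[OF continuous_map_fst_prod assms(2)]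
        continuous_map_compose[OF continuous_map_snd_prod assms(3)]])
     (auto simp: prod_map_def map_prod_def split: prod.splits)

lemma continuous_map_prod_assoc:
  assumes "inj pr"
  shows "continuous_map (prod_space pr (prod_space pr X Y) Z) (prod_space pr X (prod_space pr Y Z)) (prod_assoc pr)"
proof (rule continuous_map_into_prod[OF assms])
  let ?W = "prod_space pr (prod_space pr X Y) Z"
  show 1: "continuous_map ?W X ((fst \<circ> unpair pr) \<circ> (fst \<circ> unpair pr))"
    by (rule continuous_map_compose[OF continuous_map_fst_prod continuous_map_fst_prod])
  have 2: "continuous_map ?W Y ((snd \<circ> unpair pr) \<circ> (fst \<circ> unpair pr))"
    by (rule continuous_map_compose[OF continuous_map_fst_prod continuous_map_snd_prod])
  show "continuous_map ?W (prod_space pr Y Z)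
     (\<lambda>w. pr ((snd \<circ> unpair pr \<circ> (fst \<circ> unpair pr)) w, (snd \<circ> unpair pr) w))"
    by (rule continuous_map_into_prod[OF assms 2 continuous_map_snd_prod]) simp
qed (auto simp: prod_assoc_def split: prod.splits)

section \<open>Monoidal functors and monoidal transformations given on generators\<close>

section \<open>Monoidal functors presented by generators\<close>

text \<open>A continuous map sends a generator to a generator (\<open>mp\<close>), whereas the
  product of two generators may be a chain (\<open>cr\<close>), as shuffles require. By
  \<open>cr_D1\<close> and \<open>cr_D2\<close> degenerate generators form an ideal, so that the
  product descends to the quotients; \<open>un\<close> generates the unit.\<close>

locale top_chains =
  fixes pr :: "'u \<times> 'u \<Rightarrow> 'u" and pt :: 'u
    and G D :: "'u topology \<Rightarrow> nat \<Rightarrow> 'b set"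
    and bd :: "nat \<Rightarrow> 'b \<Rightarrow> 'b \<Rightarrow>\<^sub>0 int"
    and mp :: "nat \<Rightarrow> ('u \<Rightarrow> 'u) \<Rightarrow> 'b \<Rightarrow> 'b"
    and cr :: "nat \<Rightarrow> nat \<Rightarrow> 'b \<Rightarrow> 'b \<Rightarrow> 'b \<Rightarrow>\<^sub>0 int"
    and un :: 'b
  assumes inj_pr: "inj pr"
    and chain_data: "chain_data (G X) (D X) bd"
    and mp_G: "continuous_map X Y f \<Longrightarrow> x \<in> G X n \<Longrightarrow> mp n f x \<in> G Y n"
    and mp_D: "continuous_map X Y f \<Longrightarrow> x \<in> D X n \<Longrightarrow> mp n f x \<in> D Y n"
    and mp_bd: "continuous_map X Y f \<Longrightarrow> x \<in> G X n \<Longrightarrow> bd n (mp n f x) = fmap (mp (n - 1) f) (bd n x)"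
    and mp_cong: "x \<in> G X n \<Longrightarrow> (\<And>y. y \<in> topspace X \<Longrightarrow> f y = g y) \<Longrightarrow> mp n f x = mp n g x"
    and mp_id: "x \<in> G X n \<Longrightarrow> mp n (\<lambda>x. x) x = x"
    and mp_comp: "continuous_map X Y f \<Longrightarrow> continuous_map Y Z g \<Longrightarrow> x \<in> G X n \<Longrightarrow> mp n (g \<circ> f) x = mp n g (mp n f x)"
    and cr_G: "x \<in> G X p \<Longrightarrow> y \<in> G Y q \<Longrightarrow> cr p q x y \<in> chains_on (G (prod_space pr X Y) (p + q))"
    and cr_D1: "x \<in> D X p \<Longrightarrow> y \<in> G Y q \<Longrightarrow> cr p q x y \<in> chains_on (D (prod_space pr X Y) (p + q))"
    and cr_D2: "x \<in> G X p \<Longrightarrow> y \<in> D Y q \<Longrightarrow> cr p q x y \<in> chains_on (D (prod_space pr X Y) (p + q))"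
    and cr_bd: "x \<in> G X p \<Longrightarrow> y \<in> G Y q \<Longrightarrow> frag_extend (bd (p + q)) (cr p q x y) =
      frag_extend (\<lambda>x'. cr (p - 1) q x' y) (bd p x) + frag_cmul ((-1) ^ p) (frag_extend (cr p (q - 1) x) (bd q y))"
    and cr_mp: "continuous_map X X' f \<Longrightarrow> continuous_map Y Y' g \<Longrightarrow> x \<in> G X p \<Longrightarrow> y \<in> G Y q \<Longrightarrow>
      cr p q (mp p f x) (mp q g y) = fmap (mp (p + q) (prod_map pr f g)) (cr p q x y)"
    and un_G: "un \<in> G (point_space pt) 0"
    and cr_assoc: "x \<in> G X p \<Longrightarrow> y \<in> G Y q \<Longrightarrow> z \<in> G Z s \<Longrightarrow>
      fmap (mp (p + q + s) (prod_assoc pr)) (frag_extend (\<lambda>w. cr (p + q) s w z) (cr p q x y)) =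
      frag_extend (cr p (q + s) x) (cr q s y z)"
    and cr_un1: "x \<in> G X n \<Longrightarrow> fmap (mp n (snd \<circ> unpair pr)) (cr 0 n un x) = frag_of x"
    and cr_un2: "x \<in> G X n \<Longrightarrow> fmap (mp n (fst \<circ> unpair pr)) (cr n 0 x un) = frag_of x"
begin

definition crc :: "nat \<Rightarrow> nat \<Rightarrow> ('b \<Rightarrow>\<^sub>0 int) \<Rightarrow> ('b \<Rightarrow>\<^sub>0 int) \<Rightarrow> 'b \<Rightarrow>\<^sub>0 int" where
  "crc p q a b = frag_extend (\<lambda>x. frag_extend (cr p q x) b) a"

lemma crc_of [simp]: "crc p q (frag_of x) (frag_of y) = cr p q x y"
  by (simp add: crc_def)

lemma crc_lin [simp]:
  "crc p q 0 b = 0" "crc p q a 0 = 0"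
  "crc p q (a + a') b = crc p q a b + crc p q a' b" "crc p q a (b + b') = crc p q a b + crc p q a b'"
  "crc p q (a - a') b = crc p q a b - crc p q a' b" "crc p q a (b - b') = crc p q a b - crc p q a b'"
  "crc p q (frag_cmul k a) b = frag_cmul k (crc p q a b)" "crc p q a (frag_cmul k b) = frag_cmul k (crc p q a b)"
  by (simp_all add: crc_def frag_lin)

lemma crc_of1: "crc p q (frag_of x) b = frag_extend (cr p q x) b"
  by (simp add: crc_def)

lemma crc_of2: "crc p q a (frag_of y) = frag_extend (\<lambda>x. cr p q x y) a"
  by (simp add: crc_def)

lemma bilinear_induct [consumes 2, case_names gen zero1 zero2 diff1 diff2]:
  assumes "a \<in> chains_on S" "b \<in> chains_on T"
    and "\<And>x y. x \<in> S \<Longrightarrow> y \<in> T \<Longrightarrow> P (frag_of x) (frag_of y)"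
    and "\<And>a. P a 0" "\<And>b. P 0 b"
    and "\<And>a a' b. P a b \<Longrightarrow> P a' b \<Longrightarrow> P (a - a') b" "\<And>a b b'. P a b \<Longrightarrow> P a b' \<Longrightarrow> P a (b - b')"
  shows "P a b"
  using assms(1)
proof (induction rule: chains_induct)
  case (one x)
  show ?case using assms(2)
    by (induction rule: chains_induct) (use assms one in auto)
qed (use assms in auto)

lemma crc_chains:
  assumes "a \<in> chains_on S" "b \<in> chains_on T" "\<And>x y. x \<in> S \<Longrightarrow> y \<in> T \<Longrightarrow> cr p q x y \<in> chains_on U"
  shows "crc p q a b \<in> chains_on U"
  unfolding crc_def by (intro chains_extend[OF assms(1)] chains_extend[OF assms(2)] assms(3))

lemma int_graded_crc:
  assumes "a \<in> chains_on (int_graded A i)" "b \<in> chains_on (int_graded B j)"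
    "\<And>p q x y. x \<in> A p \<Longrightarrow> y \<in> B q \<Longrightarrow> cr p q x y \<in> chains_on (E (p + q))"
  shows "crc (nat i) (nat j) a b \<in> chains_on (int_graded E (i + j))"
proof (cases "i < 0 \<or> j < 0")
  case True
  then have "a = 0 \<or> b = 0" using assms chains_int_graded_neg by blast
  then show ?thesis by auto
next
  case False
  then have "nat (i + j) = nat i + nat j" "\<not> i + j < 0" by auto
  then show ?thesis
    using assms False unfolding int_graded_def by (auto intro!: crc_chains[of a "A (nat i)" b "B (nat j)"])
qed

lemma crc_int_graded:
  "a \<in> chains_on (int_graded (G X) i) \<Longrightarrow> b \<in> chains_on (int_graded (G Y) j) \<Longrightarrow>
    crc (nat i) (nat j) a b \<in> chains_on (int_graded (G (prod_space pr X Y)) (i + j))"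
  by (erule int_graded_crc) (auto intro: cr_G)

lemma crc_int_graded_D1:
  "a \<in> chains_on (int_graded (D X) i) \<Longrightarrow> b \<in> chains_on (int_graded (G Y) j) \<Longrightarrow>
    crc (nat i) (nat j) a b \<in> chains_on (int_graded (D (prod_space pr X Y)) (i + j))"
  by (erule int_graded_crc) (auto intro: cr_D1)

lemma crc_int_graded_D2:
  "a \<in> chains_on (int_graded (G X) i) \<Longrightarrow> b \<in> chains_on (int_graded (D Y) j) \<Longrightarrow>
    crc (nat i) (nat j) a b \<in> chains_on (int_graded (D (prod_space pr X Y)) (i + j))"
  by (erule int_graded_crc) (auto intro: cr_D2)

lemma bd_zero [simp]: "bd 0 x = 0"
  using chain_data.bd_0[OF chain_data] .

lemma bd_zero_fun [simp]: "bd 0 = (\<lambda>x. 0)"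
  by auto

lemma crc_bd:
  assumes "a \<in> chains_on (int_graded (G X) i)" "b \<in> chains_on (int_graded (G Y) j)"
  shows "frag_extend (bd (nat (i + j))) (crc (nat i) (nat j) a b) =
    crc (nat (i - 1)) (nat j) (frag_extend (bd (nat i)) a) b +
    frag_cmul (if even i then 1 else - 1) (crc (nat i) (nat (j - 1)) a (frag_extend (bd (nat j)) b))"
proof (cases "i < 0 \<or> j < 0")
  case True
  then have "a = 0 \<or> b = 0" using assms chains_int_graded_neg by blast
  then show ?thesis by auto
next
  case False
  define p q where "p = nat i" and "q = nat j"
  have a: "a \<in> chains_on (G X p)" and b: "b \<in> chains_on (G Y q)"
    using assms False by (auto simp: int_graded_def p_def q_def)
  have pq: "nat (i + j) = p + q" "nat (i - 1) = p - 1" "nat (j - 1) = q - 1"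
    "(if even i then 1 else - 1 :: int) = (-1) ^ p"
    using False by (auto simp: p_def q_def nat_add_distrib even_nat_iff)
  show ?thesis
    unfolding pq p_def[symmetric] q_def[symmetric]
    using a b
  proof (induction a b rule: bilinear_induct)
    case (gen x y)
    then show ?case by (simp add: cr_bd crc_of1 crc_of2)
  qed (simp_all add: frag_lin algebra_simps)
qed

text \<open>Only the values of \<open>\<beta>\<close> on representatives are prescribed, because the
  functors at hand feed differently written functions into \<open>tensor_lift\<close>: a product of
  chains in one case, a choice-free product of cosets in the other.\<close>

definition presents_functor :: "('u, 'c) top_functor \<Rightarrow> ('u topology \<Rightarrow> int \<Rightarrow> ('b \<Rightarrow>\<^sub>0 int) \<Rightarrow> 'c) \<Rightarrow> bool" where
  "presents_functor F r \<longleftrightarrow>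
    (\<forall>X. presented (G X) (D X) bd (obj F X) (r X)) \<and>
    (\<forall>X Y f n. continuous_map X Y f \<longrightarrow> (\<forall>c\<in>chains_on (int_graded (G X) n).
       mor F X Y f n (r X n c) = r Y n (fmap (mp (nat n) f) c))) \<and>
    (\<exists>\<beta>. \<forall>X Y. kunneth F X Y = (\<lambda>n. tensor_lift (cgrp (obj F (prod_space pr X Y)) n) (\<beta> X Y n)) \<and>
       (\<forall>i j. \<forall>a\<in>chains_on (int_graded (G X) i). \<forall>b\<in>chains_on (int_graded (G Y) j).
          \<beta> X Y (i + j) (i, j, r X i a, r Y j b) = r (prod_space pr X Y) (i + j) (crc (nat i) (nat j) a b))) \<and>
    (\<forall>n. \<forall>m\<in>carrier (cgrp unit_complex n). unitor F n m = r (point_space pt) n (frag_cmul m (frag_of un)))"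

context
  fixes F :: "('u, 'c) top_functor" and r
  assumes F: "presents_functor F r"
begin

lemma presented: "presented (G X) (D X) bd (obj F X) (r X)"
  using F by (simp add: presents_functor_def)

lemma mor_presented:
  "continuous_map X Y f \<Longrightarrow> c \<in> chains_on (int_graded (G X) n) \<Longrightarrow> mor F X Y f n (r X n c) = r Y n (fmap (mp (nat n) f) c)"
  using F unfolding presents_functor_def by blast

lemma unitor_presented:
  "m \<in> carrier (cgrp unit_complex n) \<Longrightarrow> unitor F n m = r (point_space pt) n (frag_cmul m (frag_of un))"
  using F by (simp add: presents_functor_def)

lemma tensor_pair_presented: "tensor_pair (obj F X) (obj F Y)"
  using presented.grp[OF presented] by (simp add: tensor_pair_def)

text \<open>Every element has a representative chain, so biadditivity and the Leibniz rule for
  \<open>\<beta>\<close> are inherited from \<open>crc\<close>.\<close>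

lemma kunneth_presented:
  "complex_hom (tensor_complex (obj F X) (obj F Y)) (obj F (prod_space pr X Y)) (kunneth F X Y)"
  "a \<in> chains_on (int_graded (G X) i) \<Longrightarrow> b \<in> chains_on (int_graded (G Y) j) \<Longrightarrow>
    kunneth F X Y (i + j) (elem_tensor (obj F X) (obj F Y) i j (r X i a) (r Y j b)) =
    r (prod_space pr X Y) (i + j) (crc (nat i) (nat j) a b)"
proof -
  let ?Z = "prod_space pr X Y"
  interpret X: presented "G X" "D X" bd "obj F X" "r X" by (rule presented)
  interpret Y: presented "G Y" "D Y" bd "obj F Y" "r Y" by (rule presented)
  interpret Z: presented "G ?Z" "D ?Z" bd "obj F ?Z" "r ?Z" by (rule presented)
  interpret T: tensor_pair "obj F X" "obj F Y" by (rule tensor_pair_presented)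
  obtain \<beta>' where \<beta>': "\<forall>X Y. kunneth F X Y = (\<lambda>n. tensor_lift (cgrp (obj F (prod_space pr X Y)) n) (\<beta>' X Y n)) \<and>
       (\<forall>i j. \<forall>a\<in>chains_on (int_graded (G X) i). \<forall>b\<in>chains_on (int_graded (G Y) j).
          \<beta>' X Y (i + j) (i, j, r X i a, r Y j b) = r (prod_space pr X Y) (i + j) (crc (nat i) (nat j) a b))"
    using F[unfolded presents_functor_def] by (elim conjE exE)
  define \<beta> where "\<beta> = \<beta>' X Y"
  have k: "kunneth F X Y = (\<lambda>n. tensor_lift (cgrp (obj F ?Z) n) (\<beta> n))"
    unfolding \<beta>_def by (rule \<beta>'[THEN spec, THEN spec, of X Y, THEN conjunct1])
  have \<beta>: "\<beta> (i + j) (i, j, r X i a, r Y j b) = r ?Z (i + j) (crc (nat i) (nat j) a b)"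
    if "a \<in> chains_on (int_graded (G X) i)" "b \<in> chains_on (int_graded (G Y) j)" for i j a b
    unfolding \<beta>_def using \<beta>'[THEN spec, THEN spec, of X Y, THEN conjunct2] that by blast
  have bi: "biadditive (obj F X) (obj F Y) n (cgrp (obj F ?Z) n) (\<beta> n)" for n
    unfolding biadditive_def
  proof (intro allI impI ballI conjI)
    fix i j x y assume n: "i + j = n" and x: "x \<in> carrier (cgrp (obj F X) i)" and y: "y \<in> carrier (cgrp (obj F Y) j)"
    obtain a where a: "a \<in> chains_on (int_graded (G X) i)" "x = r X i a" using x by (rule X.r_cases)
    obtain b where b: "b \<in> chains_on (int_graded (G Y) j)" "y = r Y j b" using y by (rule Y.r_cases)
    note ab = crc_int_graded[OF a(1) b(1)]
    show "\<beta> n (i, j, x, y) \<in> carrier (cgrp (obj F ?Z) n)"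
      using \<beta>[OF a(1) b(1)] ab by (auto simp: a b n)
    show "\<beta> n (i, j, x \<otimes>\<^bsub>cgrp (obj F X) i\<^esub> x', y) = \<beta> n (i, j, x, y) \<otimes>\<^bsub>cgrp (obj F ?Z) n\<^esub> \<beta> n (i, j, x', y)"
      if x': "x' \<in> carrier (cgrp (obj F X) i)" for x'
    proof -
      obtain a' where a': "a' \<in> chains_on (int_graded (G X) i)" "x' = r X i a'" using x' by (rule X.r_cases)
      have "a + a' \<in> chains_on (int_graded (G X) i)" using a a' by auto
      from \<beta>[OF this b(1)] \<beta>[OF a(1) b(1)] \<beta>[OF a'(1) b(1)] show ?thesis
        using ab crc_int_graded[OF a'(1) b(1)] by (simp add: a b a' n X.r_add[symmetric] Z.r_add)
    qed
    show "\<beta> n (i, j, x, y \<otimes>\<^bsub>cgrp (obj F Y) j\<^esub> y') = \<beta> n (i, j, x, y) \<otimes>\<^bsub>cgrp (obj F ?Z) n\<^esub> \<beta> n (i, j, x, y')"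
      if y': "y' \<in> carrier (cgrp (obj F Y) j)" for y'
    proof -
      obtain b' where b': "b' \<in> chains_on (int_graded (G Y) j)" "y' = r Y j b'" using y' by (rule Y.r_cases)
      have "b + b' \<in> chains_on (int_graded (G Y) j)" using b b' by auto
      from \<beta>[OF a(1) this] \<beta>[OF a(1) b(1)] \<beta>[OF a(1) b'(1)] show ?thesis
        using ab crc_int_graded[OF a(1) b'(1)] by (simp add: a b b' n Y.r_add[symmetric] Z.r_add)
    qed
  qed
  show "complex_hom (tensor_complex (obj F X) (obj F Y)) (obj F ?Z) (kunneth F X Y)"
    unfolding k
  proof (rule T.tensor_complex_hom[OF X.cdiff_hom Y.cdiff_hom Z.grp Z.cdiff_hom bi])
    fix i j x y assume x: "x \<in> carrier (cgrp (obj F X) i)" and y: "y \<in> carrier (cgrp (obj F Y) j)"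
    obtain a where a: "a \<in> chains_on (int_graded (G X) i)" "x = r X i a" using x by (rule X.r_cases)
    obtain b where b: "b \<in> chains_on (int_graded (G Y) j)" "y = r Y j b" using y by (rule Y.r_cases)
    note da = X.bd_int_graded[OF a(1)] and db = Y.bd_int_graded[OF b(1)]
    have e: "i - 1 + j = i + j - 1" "i + (j - 1) = i + j - 1" by auto
    have 1: "\<beta> (i + j - 1) (i - 1, j, cdiff (obj F X) i x, y) =
        r ?Z (i + j - 1) (crc (nat (i - 1)) (nat j) (frag_extend (bd (nat i)) a) b)"
      using \<beta>[OF da b(1)] by (simp add: a b X.r_bd e)
    have 2: "\<beta> (i + j - 1) (i, j - 1, x, cdiff (obj F Y) j y) =
        r ?Z (i + j - 1) (crc (nat i) (nat (j - 1)) a (frag_extend (bd (nat j)) b))"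
      using \<beta>[OF a(1) db] by (simp add: a b Y.r_bd e)
    show "cdiff (obj F ?Z) (i + j) (\<beta> (i + j) (i, j, x, y)) =
       \<beta> (i + j - 1) (i - 1, j, cdiff (obj F X) i x, y) \<otimes>\<^bsub>cgrp (obj F ?Z) (i + j - 1)\<^esub>
        \<beta> (i + j - 1) (i, j - 1, x, cdiff (obj F Y) j y) [^]\<^bsub>cgrp (obj F ?Z) (i + j - 1)\<^esub> (if even i then 1 else - 1 :: int)"
      unfolding 1 2 using \<beta>[OF a(1) b(1)] crc_int_graded[OF a(1) b(1)] crc_bd[OF a(1) b(1)]
        crc_int_graded[OF da b(1)] crc_int_graded[OF a(1) db]
      by (simp add: a(2) b(2) Z.r_bd e Z.r_pow[symmetric] Z.r_add chains_cmul del: if_split)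
  qed
  show "kunneth F X Y (i + j) (elem_tensor (obj F X) (obj F Y) i j (r X i a) (r Y j b)) =
    r (prod_space pr X Y) (i + j) (crc (nat i) (nat j) a b)"
    if a: "a \<in> chains_on (int_graded (G X) i)" and b: "b \<in> chains_on (int_graded (G Y) j)"
    using T.tensor_lift_elem[OF Z.grp bi, of "r X i a" i "r Y j b" j] \<beta>[OF a b] a b by (simp add: k)
qed

lemma fmap_mp_int_graded:
  "continuous_map X Y f \<Longrightarrow> c \<in> chains_on (int_graded (G X) n) \<Longrightarrow> fmap (mp (nat n) f) c \<in> chains_on (int_graded (G Y) n)"
  by (rule int_graded_fmap) (auto intro: mp_G)

lemma fmap_cong_int_graded:
  assumes "c \<in> chains_on (int_graded A n)" "\<And>k x. x \<in> A k \<Longrightarrow> f k x = g k x"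
  shows "fmap (f (nat n)) c = fmap (g (nat n)) c"
proof (cases "n < 0")
  case True
  then have "c = 0" using assms(1) by (rule chains_int_graded_neg)
  then show ?thesis by simp
next
  case False
  then have "c \<in> chains_on (A (nat n))" using assms(1) by (simp add: int_graded_def)
  then show ?thesis by (rule fmap_cong) (use assms(2) in auto)
qed

lemma is_functor_presented: "is_functor F"
  unfolding is_functor_def
proof (intro conjI allI impI ballI)
  show "bounded_below_complex (obj F X)" for X by (rule presented.bounded_below[OF presented])
  show "complex_hom (obj F X) (obj F Y) (mor F X Y f)" if f: "continuous_map X Y f" for X Y f
  proof -
    interpret XY: presented_pair "G X" "D X" bd "obj F X" "r X" "G Y" "D Y" bd "obj F Y" "r Y"
      by (intro presented_pair.intro presented)
    have "XY.induces 0 (\<lambda>k x. frag_of (mp k f x)) (mor F X Y f)"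
      using mor_presented[OF f] by (simp add: XY.induces_def fmap_def)
    then show ?thesis
      by (rule XY.induces_complex_hom) (auto simp: mp_G[OF f] mp_bd[OF f] fmap_def)
  qed
next
  fix X Y :: "'u topology" and f g n a assume fg: "continuous_map X Y f \<and> (\<forall>x\<in>topspace X. f x = g x)" and a: "a \<in> carrier (cgrp (obj F X) n)"
  then have g: "continuous_map X Y g" using continuous_map_eq by blast
  obtain c where c: "c \<in> chains_on (int_graded (G X) n)" "a = r X n c" using a by (rule presented.r_cases[OF presented])
  have "fmap (mp (nat n) f) c = fmap (mp (nat n) g) c"
    by (rule fmap_cong_int_graded[OF c(1)]) (use fg in \<open>auto intro: mp_cong\<close>)
  then show "mor F X Y f n a = mor F X Y g n a"
    using fg g c by (simp add: mor_presented)
next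
  fix X n a assume a: "a \<in> carrier (cgrp (obj F X) n)"
  obtain c where c: "c \<in> chains_on (int_graded (G X) n)" "a = r X n c" using a by (rule presented.r_cases[OF presented])
  have "fmap (mp (nat n) (\<lambda>x. x)) c = fmap (\<lambda>x. x) c"
    by (rule fmap_cong_int_graded[OF c(1), of "\<lambda>k. mp k (\<lambda>x. x)" "\<lambda>k x. x"]) (auto intro: mp_id)
  then show "mor F X X (\<lambda>x. x) n a = a" using c by (simp add: mor_presented)
next
  fix X Y Z :: "'u topology" and f g n a assume fg: "continuous_map X Y f \<and> continuous_map Y Z g" and a: "a \<in> carrier (cgrp (obj F X) n)"
  obtain c where c: "c \<in> chains_on (int_graded (G X) n)" "a = r X n c" using a by (rule presented.r_cases[OF presented])
  have "fmap (mp (nat n) (g \<circ> f)) c = fmap (\<lambda>x. mp (nat n) g (mp (nat n) f x)) c"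
    by (rule fmap_cong_int_graded[OF c(1), of "\<lambda>k. mp k (g \<circ> f)" "\<lambda>k x. mp k g (mp k f x)"]) (use fg in \<open>auto intro: mp_comp\<close>)
  then show "mor F X Z (g \<circ> f) n a = mor F Y Z g n (mor F X Y f n a)"
    using fg c fmap_mp_int_graded[of X Y f c n] mor_presented[OF continuous_map_compose[of X Y f Z g] c(1)]
    by (simp add: mor_presented fmap_fmap)
qed

lemma cr_naturality_chains:
  assumes "continuous_map X X' f" "continuous_map Y Y' g"
    "a \<in> chains_on (int_graded (G X) i)" "b \<in> chains_on (int_graded (G Y) j)"
  shows "crc (nat i) (nat j) (fmap (mp (nat i) f) a) (fmap (mp (nat j) g) b) =
    fmap (mp (nat (i + j)) (prod_map pr f g)) (crc (nat i) (nat j) a b)"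
proof (cases "i < 0 \<or> j < 0")
  case True
  then have "a = 0 \<or> b = 0" using assms chains_int_graded_neg by blast
  then show ?thesis by auto
next
  case False
  then have "nat (i + j) = nat i + nat j" by auto
  moreover have a: "a \<in> chains_on (G X (nat i))" "b \<in> chains_on (G Y (nat j))"
    using assms False by (auto simp: int_graded_def)
  moreover have "crc (nat i) (nat j) (fmap (mp (nat i) f) a) (fmap (mp (nat j) g) b) =
    fmap (mp (nat i + nat j) (prod_map pr f g)) (crc (nat i) (nat j) a b)"
    using a by (induction a b rule: bilinear_induct) (simp_all add: cr_mp[OF assms(1,2)])
  ultimately show ?thesis by simp
qed

lemma crc_assoc_chains:
  assumes "a \<in> chains_on (int_graded (G X) i)" "b \<in> chains_on (int_graded (G Y) j)" "c \<in> chains_on (int_graded (G Z) k)"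
  shows "fmap (mp (nat (i + j + k)) (prod_assoc pr)) (crc (nat (i + j)) (nat k) (crc (nat i) (nat j) a b) c) =
    crc (nat i) (nat (j + k)) a (crc (nat j) (nat k) b c)"
proof (cases "i < 0 \<or> j < 0 \<or> k < 0")
  case True
  then have "a = 0 \<or> b = 0 \<or> c = 0" using assms chains_int_graded_neg by blast
  then show ?thesis by auto
next
  case False
  then have n: "nat (i + j) = nat i + nat j" "nat (j + k) = nat j + nat k" "nat (i + j + k) = nat i + nat j + nat k" by auto
  have "a \<in> chains_on (G X (nat i))" "b \<in> chains_on (G Y (nat j))" "c \<in> chains_on (G Z (nat k))"
    using assms False by (auto simp: int_graded_def)
  then show ?thesis unfolding n
  proof (induction a b rule: bilinear_induct)
    case (gen x y)
    from this(3) show ?case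
      by (induction c rule: chains_induct) (simp_all add: cr_assoc[OF gen(1,2)] crc_of1 crc_of2)
  qed simp_all
qed

proposition monoidal_functor_presented: "monoidal_functor pr pt F"
  unfolding monoidal_functor_def
proof (intro conjI allI impI ballI)
  show "is_functor F" by (rule is_functor_presented)
  show "complex_hom (tensor_complex (obj F X) (obj F Y)) (obj F (prod_space pr X Y)) (kunneth F X Y)" for X Y
    by (rule kunneth_presented)
next
  fix X X' Y Y' :: "'u topology" and f g i j x y
  assume fg: "continuous_map X X' f \<and> continuous_map Y Y' g"
    and x: "x \<in> carrier (cgrp (obj F X) i)" and y: "y \<in> carrier (cgrp (obj F Y) j)"
  obtain a where a: "a \<in> chains_on (int_graded (G X) i)" "x = r X i a" using x by (rule presented.r_cases[OF presented])
  obtain b where b: "b \<in> chains_on (int_graded (G Y) j)" "y = r Y j b" using y by (rule presented.r_cases[OF presented])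
  show "kunneth F X' Y' (i + j) (elem_tensor (obj F X') (obj F Y') i j (mor F X X' f i x) (mor F Y Y' g j y)) =
     mor F (prod_space pr X Y) (prod_space pr X' Y') (prod_map pr f g) (i + j)
       (kunneth F X Y (i + j) (elem_tensor (obj F X) (obj F Y) i j x y))"
  proof -
    have f: "continuous_map X X' f" and g: "continuous_map Y Y' g" using fg by auto
    show ?thesis
      using kunneth_presented(2)[OF fmap_mp_int_graded[OF f a(1)] fmap_mp_int_graded[OF g b(1)]]
        kunneth_presented(2)[OF a(1) b(1)] cr_naturality_chains[OF f g a(1) b(1)]
        mor_presented[OF continuous_map_prod_map[OF inj_pr f g] crc_int_graded[OF a(1) b(1)]]
      by (simp add: a(2) b(2) mor_presented[OF f a(1)] mor_presented[OF g b(1)])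
  qed
next
  let ?P = "point_space pt"
  interpret P: presented "G ?P" "D ?P" bd "obj F ?P" "r ?P" by (rule presented)
  \<comment> \<open>Outside degree 0 the unit complex contains only 0, so the multiple of
    \<open>un\<close> vanishes there.\<close>
  have mem: "frag_cmul m (frag_of un) \<in> chains_on (int_graded (G ?P) n)" if "m \<in> carrier (cgrp unit_complex n)" for n m
    using that un_G by (cases "n = 0") (auto simp: unit_complex_def singleton_group_def int_graded_def)
  show "complex_hom unit_complex (obj F ?P) (unitor F)"
    unfolding complex_hom_def
  proof (intro conjI allI ballI)
    show "unitor F n \<in> hom (cgrp unit_complex n) (cgrp (obj F ?P) n)" for n
    proof (rule homI)
      fix m k assume m: "m \<in> carrier (cgrp unit_complex n)" "k \<in> carrier (cgrp unit_complex n)"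
      have "m \<otimes>\<^bsub>cgrp unit_complex n\<^esub> k = m + k" "m + k \<in> carrier (cgrp unit_complex n)"
        using m by (auto simp: unit_complex_def singleton_group_def integer_group_def split: if_splits)
      then show "unitor F n (m \<otimes>\<^bsub>cgrp unit_complex n\<^esub> k) = unitor F n m \<otimes>\<^bsub>cgrp (obj F ?P) n\<^esub> unitor F n k"
        using m mem by (simp add: unitor_presented frag_cmul_distrib P.r_add)
    qed (auto simp: unitor_presented intro!: P.r_closed mem)
    fix n m assume m: "m \<in> carrier (cgrp unit_complex n)"
    have z: "cdiff unit_complex n m = 0" "0 \<in> carrier (cgrp unit_complex (n - 1))"
      by (auto simp: unit_complex_def singleton_group_def)
    have "frag_extend (bd (nat n)) (frag_cmul m (frag_of un)) = 0"
      using m by (cases "n = 0") (auto simp: unit_complex_def singleton_group_def frag_lin)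
    then show "cdiff (obj F ?P) n (unitor F n m) = unitor F (n - 1) (cdiff unit_complex n m)"
      using z mem[OF m] by (simp add: unitor_presented m P.r_bd)
  qed
next
  fix X Y Z :: "'u topology" and i j k x y z
  assume x: "x \<in> carrier (cgrp (obj F X) i)" and y: "y \<in> carrier (cgrp (obj F Y) j)" and z: "z \<in> carrier (cgrp (obj F Z) k)"
  obtain a where a: "a \<in> chains_on (int_graded (G X) i)" "x = r X i a" using x by (rule presented.r_cases[OF presented])
  obtain b where b: "b \<in> chains_on (int_graded (G Y) j)" "y = r Y j b" using y by (rule presented.r_cases[OF presented])
  obtain c where c: "c \<in> chains_on (int_graded (G Z) k)" "z = r Z k c" using z by (rule presented.r_cases[OF presented])
  show "mor F (prod_space pr (prod_space pr X Y) Z) (prod_space pr X (prod_space pr Y Z)) (prod_assoc pr) (i + j + k)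
      (kunneth F (prod_space pr X Y) Z (i + j + k)
         (elem_tensor (obj F (prod_space pr X Y)) (obj F Z) (i + j) k
            (kunneth F X Y (i + j) (elem_tensor (obj F X) (obj F Y) i j x y)) z)) =
     kunneth F X (prod_space pr Y Z) (i + (j + k))
       (elem_tensor (obj F X) (obj F (prod_space pr Y Z)) i (j + k) x
         (kunneth F Y Z (j + k) (elem_tensor (obj F Y) (obj F Z) j k y z)))"
    using kunneth_presented(2)[OF crc_int_graded[OF a(1) b(1)] c(1)] kunneth_presented(2)[OF a(1) crc_int_graded[OF b(1) c(1)]]
      crc_assoc_chains[OF a(1) b(1) c(1)]
      mor_presented[OF continuous_map_prod_assoc[OF inj_pr] crc_int_graded[OF crc_int_graded[OF a(1) b(1)] c(1)]]
    by (simp add: a(2) b(2) c(2) kunneth_presented(2)[OF a(1) b(1)] kunneth_presented(2)[OF b(1) c(1)] add.assoc)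
next
  fix X i x assume x: "x \<in> carrier (cgrp (obj F X) i)"
  let ?P = "point_space pt"
  obtain a where a: "a \<in> chains_on (int_graded (G X) i)" "x = r X i a" using x by (rule presented.r_cases[OF presented])
  have u: "frag_of un \<in> chains_on (int_graded (G ?P) 0)" using un_G by (simp add: int_graded_def)
  have u1: "unitor F 0 1 = r ?P 0 (frag_of un)"
    by (subst unitor_presented) (auto simp: unit_complex_def)
  have "fmap (mp (nat i) (snd \<circ> unpair pr)) (crc 0 (nat i) (frag_of un) a) = frag_extend frag_of a"
    "fmap (mp (nat i) (fst \<circ> unpair pr)) (crc (nat i) 0 a (frag_of un)) = frag_extend frag_of a"
  proof -
    have "a \<in> chains_on (G X (nat i))"
      using a(1) by (cases "i < 0") (simp_all add: int_graded_def)
    then show "fmap (mp (nat i) (snd \<circ> unpair pr)) (crc 0 (nat i) (frag_of un) a) = frag_extend frag_of a"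
      "fmap (mp (nat i) (fst \<circ> unpair pr)) (crc (nat i) 0 a (frag_of un)) = frag_extend frag_of a"
      by (auto simp: crc_of1 crc_of2 fmap_extend cr_un1 cr_un2 simp del: frag_extend_frag_of intro!: frag_extend_cong)
  qed
  then have 1: "fmap (mp (nat i) (snd \<circ> unpair pr)) (crc (nat 0) (nat i) (frag_of un) a) = a"
    "fmap (mp (nat i) (fst \<circ> unpair pr)) (crc (nat i) (nat 0) a (frag_of un)) = a" by simp_all
  show "mor F (prod_space pr ?P X) X (snd \<circ> unpair pr) i
          (kunneth F ?P X i (elem_tensor (obj F ?P) (obj F X) 0 i (unitor F 0 1) x)) = x"
    using crc_int_graded[OF u a(1)] mor_presented[OF continuous_map_snd_prod crc_int_graded[OF u a(1)]] kunneth_presented(2)[OF u a(1)] 1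
    by (simp add: u1 a)
  show "mor F (prod_space pr X ?P) X (fst \<circ> unpair pr) i
          (kunneth F X ?P i (elem_tensor (obj F X) (obj F ?P) i 0 x (unitor F 0 1))) = x"
    using crc_int_graded[OF a(1) u] mor_presented[OF continuous_map_fst_prod crc_int_graded[OF a(1) u]] kunneth_presented(2)[OF a(1) u] 1
    by (simp add: u1 a)
qed

end

end

text \<open>The forward map \<open>\<Phi>\<close> commutes with boundaries, induced maps and
  products on the nose, as chains and not merely modulo degenerate ones.\<close>

locale top_chains_pair =
  A: top_chains pr pt GA DA bdA mpA crA unA + B: top_chains pr pt GB DB bdB mpB crB unB
  for pr :: "'u \<times> 'u \<Rightarrow> 'u" and pt :: 'u
    and GA DA :: "'u topology \<Rightarrow> nat \<Rightarrow> 'a set" and bdA mpA crA unA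
    and GB DB :: "'u topology \<Rightarrow> nat \<Rightarrow> 'b set" and bdB mpB crB unB +
  fixes \<Phi> :: "nat \<Rightarrow> 'a \<Rightarrow> 'b \<Rightarrow>\<^sub>0 int"
  assumes \<Phi>_G: "x \<in> GA X n \<Longrightarrow> \<Phi> n x \<in> chains_on (GB X n)"
    and \<Phi>_D: "x \<in> DA X n \<Longrightarrow> \<Phi> n x \<in> chains_on (DB X n)"
    and \<Phi>_bd: "x \<in> GA X n \<Longrightarrow> frag_extend (bdB n) (\<Phi> n x) = frag_extend (\<Phi> (n - 1)) (bdA n x)"
    and \<Phi>_mp: "continuous_map X Y f \<Longrightarrow> x \<in> GA X n \<Longrightarrow> \<Phi> n (mpA n f x) = fmap (mpB n f) (\<Phi> n x)"
    and \<Phi>_cr: "x \<in> GA X p \<Longrightarrow> y \<in> GA Y q \<Longrightarrow>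
      frag_extend (\<Phi> (p + q)) (crA p q x y) = B.crc p q (\<Phi> p x) (\<Phi> q y)"
    and \<Phi>_un: "\<Phi> 0 unA = frag_of unB"
begin

lemma transformation:
  assumes F: "A.presents_functor F rA" and F': "B.presents_functor F' rB"
    and \<phi>: "\<And>X. presented_pair.induces (GA X) (rA X) (rB X) 0 \<Phi> (\<phi> X)"
  shows "monoidal_transformation pr pt F F' \<phi>"
  unfolding monoidal_transformation_def
proof (intro conjI allI impI ballI)
  note pA = A.presented[OF F] and pB = B.presented[OF F']
  have \<phi>': "\<phi> X n (rA X n c) = rB X n (frag_extend (\<Phi> (nat n)) c)" if "c \<in> chains_on (int_graded (GA X) n)" for X n c
    using presented_pair.inducesD[OF presented_pair.intro[OF pA pB] \<phi> that] .
  have cl: "frag_extend (\<Phi> (nat n)) c \<in> chains_on (int_graded (GB X) n)" if "c \<in> chains_on (int_graded (GA X) n)" for X n c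
    by (rule int_graded_extend0[OF that \<Phi>_G])
  show "complex_hom (obj F X) (obj F' X) (\<phi> X)" for X
    by (rule presented_pair.induces_complex_hom[OF presented_pair.intro[OF pA pB] \<phi>]) (auto simp: \<Phi>_bd intro: \<Phi>_G)
  fix X Y :: "'u topology"
  show "\<phi> Y n (mor F X Y f n x) = mor F' X Y f n (\<phi> X n x)"
    if f: "continuous_map X Y f" and x: "x \<in> carrier (cgrp (obj F X) n)" for f n x
  proof -
    obtain c where c: "c \<in> chains_on (int_graded (GA X) n)" "x = rA X n c" using x by (rule presented.r_cases[OF pA])
    have "frag_extend (\<Phi> (nat n)) (fmap (mpA (nat n) f) c) = fmap (mpB (nat n) f) (frag_extend (\<Phi> (nat n)) c)"
    proof (cases "n < 0")
      case True
      then have "c = 0" using c(1) by (rule chains_int_graded_neg)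
      then show ?thesis by simp
    next
      case False
      then have "c \<in> chains_on (GA X (nat n))" using c(1) by (simp add: int_graded_def)
      then show ?thesis
        unfolding extend_fmap fmap_extend by (rule frag_extend_cong) (rule \<Phi>_mp[OF f])
    qed
    then show ?thesis
      using \<phi>'[OF A.fmap_mp_int_graded[OF F f c(1)]] B.mor_presented[OF F' f cl[OF c(1)]]
      by (simp add: c(2) A.mor_presented[OF F f c(1)] \<phi>'[OF c(1)])
  qed
  show "\<phi> (prod_space pr X Y) (i + j) (kunneth F X Y (i + j) (elem_tensor (obj F X) (obj F Y) i j x y)) =
        kunneth F' X Y (i + j) (elem_tensor (obj F' X) (obj F' Y) i j (\<phi> X i x) (\<phi> Y j y))"
    if x: "x \<in> carrier (cgrp (obj F X) i)" and y: "y \<in> carrier (cgrp (obj F Y) j)" for i j x y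
  proof -
    obtain a where a: "a \<in> chains_on (int_graded (GA X) i)" "x = rA X i a" using x by (rule presented.r_cases[OF pA])
    obtain b where b: "b \<in> chains_on (int_graded (GA Y) j)" "y = rA Y j b" using y by (rule presented.r_cases[OF pA])
    have "frag_extend (\<Phi> (nat (i + j))) (A.crc (nat i) (nat j) a b) =
        B.crc (nat i) (nat j) (frag_extend (\<Phi> (nat i)) a) (frag_extend (\<Phi> (nat j)) b)"
    proof (cases "i < 0 \<or> j < 0")
      case True
      then have "a = 0 \<or> b = 0" using a(1) b(1) chains_int_graded_neg by blast
      then show ?thesis by auto
    next
      case False
      then have n: "nat (i + j) = nat i + nat j" by auto
      have "a \<in> chains_on (GA X (nat i))" "b \<in> chains_on (GA Y (nat j))"
        using a b False by (auto simp: int_graded_def)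
      then show ?thesis unfolding n
        by (induction a b rule: A.bilinear_induct) (simp_all add: \<Phi>_cr frag_lin)
    qed
    then show ?thesis
      using \<phi>'[OF A.crc_int_graded[OF a(1) b(1)]] B.kunneth_presented(2)[OF F' cl[OF a(1)] cl[OF b(1)]]
      by (simp add: a(2) b(2) A.kunneth_presented(2)[OF F a(1) b(1)] \<phi>'[OF a(1)] \<phi>'[OF b(1)])
  qed
  show "\<phi> (point_space pt) n (unitor F n m) = unitor F' n m" if m: "m \<in> carrier (cgrp unit_complex n)" for n m
  proof -
    have mem: "frag_cmul m (frag_of unA) \<in> chains_on (int_graded (GA (point_space pt)) n)"
      using m A.un_G by (cases "n = 0") (auto simp: unit_complex_def singleton_group_def int_graded_def)
    have "frag_extend (\<Phi> (nat n)) (frag_cmul m (frag_of unA)) = frag_cmul m (frag_of unB)"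
      using m \<Phi>_un by (cases "n = 0") (auto simp: unit_complex_def singleton_group_def frag_lin)
    then show ?thesis
      using m by (simp add: A.unitor_presented[OF F] B.unitor_presented[OF F'] \<phi>'[OF mem])
  qed
qed

text \<open>Products and induced maps impose conditions on \<open>\<Phi>\<close> only. The inverse
  \<open>\<Psi>\<close> and the homotopies are constrained by boundaries and degenerate generators,
  since a weak equivalence provides them for each space separately.\<close>

proposition weak_homotopy_equivalence:
  assumes F: "A.presents_functor F rA" and F': "B.presents_functor F' rB"
    and \<Psi>: "\<And>X k x. x \<in> GB X k \<Longrightarrow> \<Psi> k x \<in> chains_on (GA X k)" "\<And>X k x. x \<in> DB X k \<Longrightarrow> \<Psi> k x \<in> chains_on (DA X k)"
    and ch\<Psi>: "\<And>X k x. x \<in> GB X k \<Longrightarrow> frag_extend (bdA k) (\<Psi> k x) - frag_extend (\<Psi> (k - 1)) (bdB k x) \<in> chains_on (DA X (k - 1))"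
    and HA: "\<And>X k x. x \<in> GA X k \<Longrightarrow> HA k x \<in> chains_on (GA X (k + 1))" "\<And>X k x. x \<in> DA X k \<Longrightarrow> HA k x \<in> chains_on (DA X (k + 1))"
    and eqA: "\<And>X k x. x \<in> GA X k \<Longrightarrow> frag_extend (\<Psi> k) (\<Phi> k x) - frag_of x - frag_extend (bdA (k + 1)) (HA k x)
        - frag_extend (HA (k - 1)) (bdA k x) \<in> chains_on (DA X k)"
    and HB: "\<And>X k x. x \<in> GB X k \<Longrightarrow> HB k x \<in> chains_on (GB X (k + 1))" "\<And>X k x. x \<in> DB X k \<Longrightarrow> HB k x \<in> chains_on (DB X (k + 1))"
    and eqB: "\<And>X k x. x \<in> GB X k \<Longrightarrow> frag_extend (\<Phi> k) (\<Psi> k x) - frag_of x - frag_extend (bdB (k + 1)) (HB k x)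
        - frag_extend (HB (k - 1)) (bdB k x) \<in> chains_on (DB X k)"
  shows "has_weak_homotopy_equivalence pr pt F F'"
proof -
  note pA = A.presented[OF F] and pB = B.presented[OF F']
  have "\<exists>\<phi>. presented_pair.induces (GA X) (rA X) (rB X) 0 \<Phi> \<phi>" for X
  proof -
    obtain \<phi> where "presented_pair.induces (GA X) (rA X) (rB X) 0 \<Phi> \<phi>"
      by (rule presented_pair.induces_ex[OF presented_pair.intro[OF pA[of X] pB[of X]], of \<Phi> 0])
        (use \<Phi>_G \<Phi>_D in auto)
    then show ?thesis by blast
  qed
  then obtain \<phi> where \<phi>: "\<And>X. presented_pair.induces (GA X) (rA X) (rB X) 0 \<Phi> (\<phi> X)" by metis
  show ?thesis
    unfolding has_weak_homotopy_equivalence_def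
  proof (intro conjI exI[of _ \<phi>] allI)
    show "monoidal_functor pr pt F" by (rule A.monoidal_functor_presented[OF F])
    show "monoidal_functor pr pt F'" by (rule B.monoidal_functor_presented[OF F'])
    show "monoidal_transformation pr pt F F' \<phi>" by (rule transformation[OF F F' \<phi>])
    show "homotopy_equivalence_map (obj F X) (obj F' X) (\<phi> X)" for X
      by (rule induces_homotopy_equivalence[OF pA pB \<phi> \<Phi>_G _ \<Psi> ch\<Psi> HA eqA HB eqB]) (auto simp: \<Phi>_bd)
  qed
qed

end

section \<open>The quotient of a presented functor by its degenerate generators\<close>

subsection \<open>The quotient functor\<close>

definition free_int_graded :: "('u topology \<Rightarrow> nat \<Rightarrow> 'b set) \<Rightarrow> 'u topology \<Rightarrow> int \<Rightarrow> ('b \<Rightarrow>\<^sub>0 int) monoid" where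
  "free_int_graded G X n = free_Abelian_group (int_graded (G X) n)"

definition degen_span :: "('u topology \<Rightarrow> nat \<Rightarrow> 'b set) \<Rightarrow> ('u topology \<Rightarrow> nat \<Rightarrow> 'b set) \<Rightarrow>
    'u topology \<Rightarrow> int \<Rightarrow> ('b \<Rightarrow>\<^sub>0 int) set" where
  "degen_span G D X n = generate (free_int_graded G X n) (frag_of ` int_graded (D X) n)"

definition qclass :: "('u topology \<Rightarrow> nat \<Rightarrow> 'b set) \<Rightarrow> ('u topology \<Rightarrow> nat \<Rightarrow> 'b set) \<Rightarrow>
    'u topology \<Rightarrow> int \<Rightarrow> ('b \<Rightarrow>\<^sub>0 int) \<Rightarrow> ('b \<Rightarrow>\<^sub>0 int) set" where
  "qclass G D X n c = degen_span G D X n #>\<^bsub>free_int_graded G X n\<^esub> c"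

definition qcomplex :: "('u topology \<Rightarrow> nat \<Rightarrow> 'b set) \<Rightarrow> ('u topology \<Rightarrow> nat \<Rightarrow> 'b set) \<Rightarrow>
    (nat \<Rightarrow> 'b \<Rightarrow> 'b \<Rightarrow>\<^sub>0 int) \<Rightarrow> 'u topology \<Rightarrow> ('b \<Rightarrow>\<^sub>0 int) set ccomplex" where
  "qcomplex G D bd X =
     \<lparr>cgrp = (\<lambda>n. free_int_graded G X n Mod degen_span G D X n),
      cdiff = (\<lambda>n A. the_elem ((\<lambda>c. qclass G D X (n - 1) (frag_extend (bd (nat n)) c)) ` A))\<rparr>"

text \<open>Shaped like the definition of the cubical functor, which is thereby an instance. Without
  degenerate generators it encodes each chain as a singleton coset.\<close>

definition qfunctor :: "('u \<times> 'u \<Rightarrow> 'u) \<Rightarrow> 'u \<Rightarrow> ('u topology \<Rightarrow> nat \<Rightarrow> 'b set) \<Rightarrow> ('u topology \<Rightarrow> nat \<Rightarrow> 'b set) \<Rightarrow>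
    (nat \<Rightarrow> 'b \<Rightarrow> 'b \<Rightarrow>\<^sub>0 int) \<Rightarrow> (nat \<Rightarrow> ('u \<Rightarrow> 'u) \<Rightarrow> 'b \<Rightarrow> 'b) \<Rightarrow> (nat \<Rightarrow> nat \<Rightarrow> 'b \<Rightarrow> 'b \<Rightarrow> 'b \<Rightarrow>\<^sub>0 int) \<Rightarrow> 'b \<Rightarrow>
    ('u, ('b \<Rightarrow>\<^sub>0 int) set) top_functor" where
  "qfunctor pr pt G D bd mp cr un =
     \<lparr>obj = qcomplex G D bd,
      mor = (\<lambda>X Y f n A. the_elem ((\<lambda>c. qclass G D Y n (fmap (mp (nat n) f) c)) ` A)),
      kunneth = (\<lambda>X Y n. tensor_lift (cgrp (qcomplex G D bd (prod_space pr X Y)) n)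
        (\<lambda>(i, j, A, B). the_elem
           ((\<lambda>(c, d). qclass G D (prod_space pr X Y) n
              (frag_extend (\<lambda>x. frag_extend (cr (nat i) (nat j) x) d) c)) ` (A \<times> B)))),
      unitor = (\<lambda>n m. qclass G D (point_space pt) n (frag_cmul m (frag_of un)))\<rparr>"

lemma the_elem_image: "x \<in> A \<Longrightarrow> (\<And>y. y \<in> A \<Longrightarrow> f y = f x) \<Longrightarrow> the_elem (f ` A) = f x"
proof -
  assume "x \<in> A" "\<And>y. y \<in> A \<Longrightarrow> f y = f x"
  then have "f ` A = {f x}" by blast
  then show ?thesis by simp
qed

text \<open>A subgroup generated by some of the free generators consists of the chains supported on
  them. Equality of cosets thus becomes a condition on supports.\<close>

lemma generate_frag_of:
  assumes "T \<subseteq> S"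
  shows "generate (free_Abelian_group S) (frag_of ` T) = chains_on T"
proof
  have "subgroup (chains_on T) (free_Abelian_group S)"
    by (rule group.subgroupI[OF group_free_Abelian_group]) (use assms in \<open>auto simp: chains_on_def dest!: subsetD[OF keys_add]\<close>)
  then show "generate (free_Abelian_group S) (frag_of ` T) \<subseteq> chains_on T"
    by (intro group.generate_subgroup_incl[OF group_free_Abelian_group]) auto
  have sg: "subgroup (generate (free_Abelian_group S) (frag_of ` T)) (free_Abelian_group S)"
    by (rule group.generate_is_subgroup[OF group_free_Abelian_group]) (use assms in auto)
  show "chains_on T \<subseteq> generate (free_Abelian_group S) (frag_of ` T)"
  proof
    fix c assume "c \<in> chains_on T"
    then show "c \<in> generate (free_Abelian_group S) (frag_of ` T)"
    proof (induction rule: chains_induct)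
      case zero then show ?case using subgroup.one_closed[OF sg] by simp
    next
      case (one x) then show ?case by (auto intro: generate.incl)
    next
      case (diff a b)
      then have "Poly_Mapping.keys b \<subseteq> S" using subgroup.subset[OF sg] by (meson carrier_free_Abelian_group_iff subsetD)
      then have "- b \<in> generate (free_Abelian_group S) (frag_of ` T)"
        using subgroup.m_inv_closed[OF sg diff(2)] by simp
      from subgroup.m_closed[OF sg diff(1) this] show ?case by simp
    qed
  qed
qed

context top_chains
begin

lemma degen_span_eq: "degen_span G D X n = chains_on (int_graded (D X) n)"
  unfolding degen_span_def free_int_graded_def by (rule generate_frag_of[OF chain_data.int_graded_D[OF chain_data]])

lemma qclass_eq: "qclass G D X n c = {d + c | d. d \<in> chains_on (int_graded (D X) n)}"
  by (auto simp: qclass_def degen_span_eq r_coset_def free_int_graded_def)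

lemma mem_qclass: "d \<in> qclass G D X n c \<longleftrightarrow> d - c \<in> chains_on (int_graded (D X) n)"
  unfolding qclass_eq by (auto intro: exI[of _ "d - c"])

lemma qclass_cong: "d - c \<in> chains_on (int_graded (D X) n) \<Longrightarrow> qclass G D X n d = qclass G D X n c"
proof -
  assume a: "d - c \<in> chains_on (int_graded (D X) n)"
  have "x - d \<in> chains_on (int_graded (D X) n) \<longleftrightarrow> x - c \<in> chains_on (int_graded (D X) n)" for x
  proof
    show "x - c \<in> chains_on (int_graded (D X) n)" if "x - d \<in> chains_on (int_graded (D X) n)"
      using chains_add[OF that a] by simp
    show "x - d \<in> chains_on (int_graded (D X) n)" if "x - c \<in> chains_on (int_graded (D X) n)"
      using chains_diff[OF that a] by simp
  qed
  then show ?thesis by (auto simp: mem_qclass)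
qed

lemma the_elem_qclass:
  assumes "\<And>d. d - c \<in> chains_on (int_graded (D X) n) \<Longrightarrow> h d = h c"
  shows "the_elem (h ` qclass G D X n c) = h c"
  by (rule the_elem_image, simp add: mem_qclass, rule assms, simp add: mem_qclass)

lemma presented_qcomplex: "presented (G X) (D X) bd (qcomplex G D bd X) (qclass G D X)"
proof -
  interpret chain_data "G X" "D X" bd by (rule chain_data)
  have sg: "subgroup (degen_span G D X n) (free_int_graded G X n)" for n
    unfolding degen_span_def free_int_graded_def
    by (rule group.generate_is_subgroup[OF group_free_Abelian_group]) (auto intro: int_graded_D[THEN subsetD])
  have ab: "comm_group (free_int_graded G X n)" for n by (simp add: free_int_graded_def abelian_free_Abelian_group)
  have nm: "degen_span G D X n \<lhd> free_int_graded G X n" for n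
    using comm_group.normal_iff_subgroup[OF ab] sg by blast
  show ?thesis
  proof (rule presented.intro[OF chain_data presented_axioms.intro])
    show "comm_group (cgrp (qcomplex G D bd X) n)" for n
      using comm_group.abelian_FactGroup[OF ab sg] by (simp add: qcomplex_def)
    show "qclass G D X n \<in> hom (free_Abelian_group (int_graded (G X) n)) (cgrp (qcomplex G D bd X) n)" for n
    proof (rule homI)
      fix c d assume "c \<in> carrier (free_Abelian_group (int_graded (G X) n))" "d \<in> carrier (free_Abelian_group (int_graded (G X) n))"
      then show "qclass G D X n (c \<otimes>\<^bsub>free_Abelian_group (int_graded (G X) n)\<^esub> d) =
          qclass G D X n c \<otimes>\<^bsub>cgrp (qcomplex G D bd X) n\<^esub> qclass G D X n d"
        using normal.rcos_sum[OF nm, of c n d] by (simp add: qclass_def qcomplex_def FactGroup_def free_int_graded_def)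
    qed (auto simp: qclass_def qcomplex_def FactGroup_def free_int_graded_def RCOSETS_def)
    show "\<exists>c\<in>chains_on (int_graded (G X) n). a = qclass G D X n c" if "a \<in> carrier (cgrp (qcomplex G D bd X) n)" for a n
    proof -
      have "a \<in> rcosets\<^bsub>free_int_graded G X n\<^esub> degen_span G D X n"
        using that by (simp add: qcomplex_def FactGroup_def)
      then obtain c where "c \<in> carrier (free_int_graded G X n)" "a = qclass G D X n c"
        unfolding RCOSETS_def qclass_def by blast
      then show ?thesis by (intro bexI[of _ c]) (simp_all add: free_int_graded_def chains_on_def)
    qed
    show "qclass G D X n c = \<one>\<^bsub>cgrp (qcomplex G D bd X) n\<^esub> \<longleftrightarrow> c \<in> chains_on (int_graded (D X) n)" for n c
    proof -
      have "\<one>\<^bsub>cgrp (qcomplex G D bd X) n\<^esub> = qclass G D X n 0"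
        by (auto simp: qcomplex_def FactGroup_def degen_span_eq mem_qclass)
      then show ?thesis using qclass_cong[of c 0] mem_qclass[of c X n c] mem_qclass[of c X n 0] by auto
    qed
    show "cdiff (qcomplex G D bd X) n (qclass G D X n c) = qclass G D X (n - 1) (frag_extend (bd (nat n)) c)" for n c
      unfolding qcomplex_def
      by (simp, rule the_elem_qclass, rule qclass_cong) (simp add: bd_int_graded_D flip: frag_extend_diff)
  qed
qed

lemma presents_qfunctor: "presents_functor (qfunctor pr pt G D bd mp cr un) (qclass G D)"
  unfolding presents_functor_def
proof (intro conjI allI impI ballI exI)
  show "presented (G X) (D X) bd (obj (qfunctor pr pt G D bd mp cr un) X) (qclass G D X)" for X
    by (simp add: qfunctor_def presented_qcomplex)
  show "mor (qfunctor pr pt G D bd mp cr un) X Y f n (qclass G D X n c) = qclass G D Y n (fmap (mp (nat n) f) c)"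
    if "continuous_map X Y f" for X Y f n c
  proof -
    have "fmap (mp (nat n) f) d - fmap (mp (nat n) f) c \<in> chains_on (int_graded (D Y) n)" if "d - c \<in> chains_on (int_graded (D X) n)" for d
      using int_graded_fmap[OF that, of "\<lambda>k. mp k f" "D Y"] mp_D[OF \<open>continuous_map X Y f\<close>] by simp
    then show ?thesis
      unfolding qfunctor_def by (simp, intro the_elem_qclass qclass_cong)
  qed
  fix X Y
  show "kunneth (qfunctor pr pt G D bd mp cr un) X Y =
      (\<lambda>n. tensor_lift (cgrp (obj (qfunctor pr pt G D bd mp cr un) (prod_space pr X Y)) n)
        ((\<lambda>X Y n (i, j, A, B). the_elem ((\<lambda>(c, d). qclass G D (prod_space pr X Y) n (crc (nat i) (nat j) c d)) ` (A \<times> B))) X Y n))"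
    by (simp add: qfunctor_def crc_def)
  fix i j a b assume a: "a \<in> chains_on (int_graded (G X) i)" and b: "b \<in> chains_on (int_graded (G Y) j)"
  let ?Z = "prod_space pr X Y"
  have "the_elem ((\<lambda>(c, d). qclass G D ?Z (i + j) (crc (nat i) (nat j) c d)) ` (qclass G D X i a \<times> qclass G D Y j b)) =
      (\<lambda>(c, d). qclass G D ?Z (i + j) (crc (nat i) (nat j) c d)) (a, b)"
  proof (rule the_elem_image)
    show "(a, b) \<in> qclass G D X i a \<times> qclass G D Y j b" by (simp add: mem_qclass)
    fix y assume "y \<in> qclass G D X i a \<times> qclass G D Y j b"
    then obtain c d where y: "y = (c, d)" and c: "c - a \<in> chains_on (int_graded (D X) i)" and d: "d - b \<in> chains_on (int_graded (D Y) j)"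
      by (auto simp: mem_qclass)
    have "d - b \<in> chains_on (int_graded (G Y) j)"
      using d chain_data.int_graded_D[OF chain_data] by (rule chains_mono)
    from chains_add[OF this b] have d': "d \<in> chains_on (int_graded (G Y) j)" by simp
    \<comment> \<open>The usual splitting cd - ab = (c - a)d + a(d - b) changes one factor at a
      time.\<close>
    have "crc (nat i) (nat j) (c - a) d + crc (nat i) (nat j) a (d - b) \<in> chains_on (int_graded (D ?Z) (i + j))"
      by (intro chains_add crc_int_graded_D1 crc_int_graded_D2 a c d d')
    then show "(\<lambda>(c, d). qclass G D ?Z (i + j) (crc (nat i) (nat j) c d)) y =
      (\<lambda>(c, d). qclass G D ?Z (i + j) (crc (nat i) (nat j) c d)) (a, b)"
      by (auto simp: y intro!: qclass_cong)
  qed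
  then show "(\<lambda>X Y n (i, j, A, B). the_elem ((\<lambda>(c, d). qclass G D (prod_space pr X Y) n (crc (nat i) (nat j) c d)) ` (A \<times> B)))
      X Y (i + j) (i, j, qclass G D X i a, qclass G D Y j b) = qclass G D ?Z (i + j) (crc (nat i) (nat j) a b)"
    by simp
qed (simp add: qfunctor_def)

end

section \<open>Degenerate simplices and the shuffle product on singular chains\<close>

section \<open>Singular chains\<close>

subsection \<open>Degenerate simplices\<close>

text \<open>Instead of asking for a lower-dimensional simplex of which \<open>s\<close> is a
  degeneracy, \<open>s\<close> is required to be fixed by a vertex map that identifies two
  neighbours. Operators on \<open>s\<close> can then be computed from the list
  \<open>ls\<close>.\<close>

definition sdeg :: "nat \<Rightarrow> ((nat \<Rightarrow> real) \<Rightarrow> 'u) \<Rightarrow> bool" where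
  "sdeg n s \<longleftrightarrow> (\<exists>ls. adjdup ls \<and> length ls = Suc n \<and> set ls \<subseteq> {..n} \<and> realize s ls = s)"

lemma sdeg_realization:
  assumes "realization F" "length u = Suc n" "adjdup u"
  shows "sdeg n (F u)"
proof -
  obtain i where i: "Suc i < length u" "u ! i = u ! Suc i" using assms(3) by (auto simp: adjdup_nth)
  \<comment> \<open>The vertex map sending i + 1 to i and fixing all others. As \<open>u\<close> has
    equal entries in these places, relabelling along it changes nothing.\<close>
  let ?ls = "[0..<Suc n][Suc i := i]"
  have l: "length ?ls = Suc n" by simp
  have "?ls ! i = i" "?ls ! Suc i = i" using i assms(2) by (auto simp: nth_list_update simp del: upt_Suc)
  then have a: "adjdup ?ls" using i assms(2) l by (auto simp: adjdup_nth simp del: upt_Suc)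
  have s: "set ?ls \<subseteq> {..n}"
    using i assms(2) by (auto dest!: set_update_subset_insert[THEN subsetD] simp del: upt_Suc)
  have "map (nth u) ?ls = (map (nth u) [0..<Suc n])[Suc i := u ! i]" by (simp add: map_update del: upt_Suc)
  also have "\<dots> = u" using assms(2) i map_nth[of u] by (metis list_update_id)
  finally have "map (nth u) ?ls = u" .
  moreover have "affine_simplex (F u) (map ev ?ls) = F (map (nth u) ?ls)"
  proof (rule realizationD[OF assms(1)])
    show "?ls \<noteq> []" using l by (metis list.size(3) nat.distinct(1))
    show "set ?ls \<subseteq> {..<length u}" using s assms(2) by auto
  qed
  ultimately have "realize (F u) ?ls = F u" by (simp only: realize_def)
  then show ?thesis unfolding sdeg_def using a l s by blast
qed

lemma sdegE:
  assumes "sdeg n s"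
  obtains ls where "adjdup ls" "length ls = Suc n" "set ls \<subseteq> {..n}" "s = realize s ls"
  using assms unfolding sdeg_def by metis

subsection \<open>The generators\<close>

definition sgen :: "'u topology \<Rightarrow> nat \<Rightarrow> ((nat \<Rightarrow> real) \<Rightarrow> 'u) set" where
  "sgen X n = singular_simplex_set n X"

definition sdgen :: "'u topology \<Rightarrow> nat \<Rightarrow> ((nat \<Rightarrow> real) \<Rightarrow> 'u) set" where
  "sdgen X n = {s \<in> sgen X n. sdeg n s}"

definition sbd :: "nat \<Rightarrow> ((nat \<Rightarrow> real) \<Rightarrow> 'u) \<Rightarrow> 'u chain" where
  "sbd n s = chain_boundary n (frag_of s)"

definition spt :: "'u \<Rightarrow> (nat \<Rightarrow> real) \<Rightarrow> 'u" where
  "spt pt = restrict (\<lambda>x. pt) (standard_simplex 0)"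

lemma sbd_extend: "frag_extend (sbd n) c = chain_boundary n c"
  by (induction c rule: frag_induct) (auto simp: sbd_def chain_boundary_diff frag_extend_diff)

lemma chain_map_fmap: "chain_map n f c = fmap (simplex_map n f) c"
  by (simp add: chain_map_def fmap_def comp_def)

lemma singular_chain_iff: "singular_chain n X c \<longleftrightarrow> c \<in> chains_on (sgen X n)"
  by (simp add: singular_chain_def chains_on_def sgen_def)

lemma set_upt_Suc: "set [0..<Suc n] = {..n}"
  by auto

lemma realize_self: "s \<in> sgen X n \<Longrightarrow> realize s [0..<Suc n] = s"
  using singular_simplex_ext realize_id unfolding sgen_def by blast

lemma sgen_realize:
  assumes "s \<in> sgen X m" "length ls = Suc n" "set ls \<subseteq> {..m}"
  shows "realize s ls \<in> sgen X n"
  unfolding realize_def sgen_def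
  by (rule CollectI, rule singular_simplex_affine_simplex) (use assms in \<open>auto simp: sgen_def\<close>)

lemma sdgen_realize:
  assumes "s \<in> sgen X m" "length ls = Suc n" "set ls \<subseteq> {..m}" "adjdup ls"
  shows "realize s ls \<in> sdgen X n"
  using sgen_realize[OF assms(1-3)] sdeg_realization[OF realization_realize assms(2,4), of s] by (simp add: sdgen_def)

lemma simplex_map_affine_simplex:
  assumes "set w \<subseteq> standard_simplex m" "length w = Suc n"
  shows "simplex_map n f (affine_simplex s w) = affine_simplex (simplex_map m f s) w"
proof -
  have "aff w x \<in> standard_simplex m" if "x \<in> standard_simplex n" for x
    by (rule aff_simplex) (use assms that in auto)
  then show ?thesis using assms(2)
    by (simp add: simplex_map_def affine_simplex_def comp_def cong: restrict_cong)
qed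

lemma simplex_map_realize:
  "length ls = Suc n \<Longrightarrow> set ls \<subseteq> {..m} \<Longrightarrow> simplex_map n f (realize s ls) = realize (simplex_map m f s) ls"
  unfolding realize_def by (rule simplex_map_affine_simplex) auto

lemma sbd_realize: "length ls = Suc (Suc n) \<Longrightarrow> sbd (Suc n) (realize s ls) = fmap (realize s) (list_boundary ls)"
  unfolding sbd_def by (rule boundary_realization[OF realization_realize])

lemma sbd_0: "sbd 0 s = 0"
  by (simp add: sbd_def chain_boundary_of)

lemma sbd_sgen: "s \<in> sgen X n \<Longrightarrow> sbd n s \<in> chains_on (sgen X (n - 1))"
  unfolding sbd_def using singular_chain_boundary[of n X "frag_of s"]
  by (simp add: singular_chain_iff)

text \<open>Since \<open>s\<close> equals \<open>realize s ls\<close> for a list with an adjacent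
  repetition, its boundary may be computed from \<open>ls\<close>, where the faces without
  repetition cancel.\<close>

lemma sbd_sdgen:
  assumes "s \<in> sdgen X n"
  shows "sbd n s \<in> chains_on (sdgen X (n - 1))"
proof (cases n)
  case 0
  then show ?thesis by (simp add: sbd_0)
next
  case (Suc m)
  have s: "s \<in> sgen X n" "sdeg n s" using assms by (auto simp: sdgen_def)
  then obtain ls where ls: "adjdup ls" "length ls = Suc n" "set ls \<subseteq> {..n}" "s = realize s ls"
    by (elim sdegE)
  have "sbd n (realize s ls) = fmap (realize s) (list_boundary ls)"
    using sbd_realize[of ls m s] ls(2) Suc by simp
  moreover have "fmap (realize s) (list_boundary ls) \<in> chains_on (sdgen X m)"
  proof (rule chains_fmap[OF chains_Int[OF list_boundary_chains list_boundary_adjdup[OF ls(1)]]])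
    fix l assume "l \<in> {u. Suc (length u) = length ls \<and> set u \<subseteq> set ls} \<inter> Collect adjdup"
    then show "realize s l \<in> sdgen X m"
      using ls Suc by (intro sdgen_realize[OF s(1)]) auto
  qed
  ultimately show ?thesis using ls(4) Suc by simp
qed

lemma singular_chain_data:
  fixes X :: "'u topology"
  assumes "\<And>n. D n \<subseteq> sgen X n" "\<And>s n. s \<in> D n \<Longrightarrow> sbd n s \<in> chains_on (D (n - 1))"
  shows "chain_data (sgen X) D sbd"
proof
  show "frag_extend (sbd (n - 1)) (sbd n s) \<in> chains_on (D (n - 1 - 1))" if "s \<in> sgen X n" for s n
    using chain_boundary_boundary[of n X "frag_of s"] that
    by (simp add: sbd_extend) (simp add: sbd_def singular_chain_iff)
qed (use assms sbd_sgen sbd_0 in auto)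

lemma simplex_pair_sgen:
  assumes "inj pr" "s \<in> sgen X n" "t \<in> sgen Y n"
  shows "simplex_pair pr n s t \<in> sgen (prod_space pr X Y) n"
  using assms unfolding sgen_def simplex_pair_def
  by (auto simp: singular_simplex_def intro!: continuous_map_into_prod[OF assms(1), of _ X s Y t])

lemma pair_real_sgen:
  assumes "inj pr" "s \<in> sgen X p" "t \<in> sgen Y q" "length w = Suc n" "set w \<subseteq> {..p} \<times> {..q}"
  shows "pair_real pr (realize s) (realize t) w \<in> sgen (prod_space pr X Y) n"
  unfolding pair_real_def using assms(4,5)
  by (simp, intro simplex_pair_sgen assms(1) sgen_realize[OF assms(2)] sgen_realize[OF assms(3)]) auto

lemma shuffle_realize:
  assumes "length u = Suc p" "length v = Suc q"
  shows "shuffle_simplices pr p q (realize s u) (realize t v) = fmap (pair_real pr (realize s) (realize t)) (ez u v)"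
  by (rule shuffle_realization[OF realization_realize realization_realize assms])

lemma shuffle_sgen:
  assumes "s \<in> sgen X p" "t \<in> sgen Y q"
  shows "shuffle_simplices pr p q s t = fmap (pair_real pr (realize s) (realize t)) (ez [0..<Suc p] [0..<Suc q])"
  using shuffle_realize[of "[0..<Suc p]" p "[0..<Suc q]" q pr s t] by (simp only: realize_self[OF assms(1)] realize_self[OF assms(2)] length_upt diff_zero)

lemma shuffle_chains:
  assumes "inj pr" "s \<in> sgen X p" "t \<in> sgen Y q"
  shows "shuffle_simplices pr p q s t \<in> chains_on (sgen (prod_space pr X Y) (p + q))"
  unfolding shuffle_sgen[OF assms(2,3)]
proof (rule chains_fmap[OF ez_chains])
  fix w assume "w \<in> {w. Suc (length w) = length [0..<Suc p] + length [0..<Suc q] \<and>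
     set w \<subseteq> set [0..<Suc p] \<times> set [0..<Suc q] \<and> hd w = (hd [0..<Suc p], hd [0..<Suc q])}"
  then show "pair_real pr (realize s) (realize t) w \<in> sgen (prod_space pr X Y) (p + q)"
    by (intro pair_real_sgen[OF assms]) (auto simp del: upt_Suc)
qed

lemma shuffle_sdgen:
  assumes "inj pr" "s \<in> sgen X p" "t \<in> sgen Y q" "sdeg p s \<or> sdeg q t"
  shows "shuffle_simplices pr p q s t \<in> chains_on (sdgen (prod_space pr X Y) (p + q))"
proof -
  \<comment> \<open>The degenerate factor is replaced by a list with a repetition, the other one by
    the full list of its vertices.\<close>
  obtain u v where u: "length u = Suc p" "set u \<subseteq> {..p}" "s = realize s u" and v: "length v = Suc q" "set v \<subseteq> {..q}" "t = realize t v"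
    and d: "adjdup u \<or> adjdup v"
  proof (cases "sdeg p s")
    case True
    then obtain u where "adjdup u" "length u = Suc p" "set u \<subseteq> {..p}" "s = realize s u" by (elim sdegE)
    then show thesis
      by (intro that[of u "[0..<Suc q]"]) (simp_all add: set_upt_Suc realize_self[OF assms(3)] del: upt_Suc set_upt)
  next
    case False
    then have "sdeg q t" using assms(4) by blast
    then obtain v where "adjdup v" "length v = Suc q" "set v \<subseteq> {..q}" "t = realize t v" by (elim sdegE)
    then show thesis
      by (intro that[of "[0..<Suc p]" v]) (simp_all add: set_upt_Suc realize_self[OF assms(2)] del: upt_Suc set_upt)
  qed
  have "ez u v \<in> chains_on (Collect adjdup)" using d ez_adjdup1 ez_adjdup2 by blast
  then have e: "ez u v \<in> chains_on ({w. Suc (length w) = length u + length v \<and> set w \<subseteq> set u \<times> set v \<and>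
     hd w = (hd u, hd v)} \<inter> Collect adjdup)"
    by (rule chains_Int[OF ez_chains])
  have "shuffle_simplices pr p q s t = fmap (pair_real pr (realize s) (realize t)) (ez u v)"
    using shuffle_realize[OF u(1) v(1), of pr s t] u(3) v(3) by simp
  also have "\<dots> \<in> chains_on (sdgen (prod_space pr X Y) (p + q))"
  proof (rule chains_fmap[OF e])
    fix w assume w: "w \<in> {w. Suc (length w) = length u + length v \<and> set w \<subseteq> set u \<times> set v \<and>
     hd w = (hd u, hd v)} \<inter> Collect adjdup"
    have "pair_real pr (realize s) (realize t) w \<in> sgen (prod_space pr X Y) (p + q)"
      by (rule pair_real_sgen[OF assms(1-3)]) (use w u v in auto)
    moreover have "sdeg (p + q) (pair_real pr (realize s) (realize t) w)"
      by (rule sdeg_realization[OF realization_pair[OF realization_realize realization_realize]]) (use w u v in auto)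
    ultimately show "pair_real pr (realize s) (realize t) w \<in> sdgen (prod_space pr X Y) (p + q)"
      by (simp add: sdgen_def)
  qed
  finally show ?thesis .
qed

lemma shuffle_extend1:
  assumes "c \<in> chains_on {u. length u = Suc p}" "length v = Suc q"
  shows "frag_extend (\<lambda>s'. shuffle_simplices pr p q s' (realize t v)) (fmap (realize s) c) =
    fmap (pair_real pr (realize s) (realize t)) (frag_extend (\<lambda>u. ez u v) c)"
  unfolding extend_fmap fmap_extend
  by (rule frag_extend_cong[OF assms(1)]) (use assms(2) in \<open>simp add: shuffle_realize\<close>)

lemma shuffle_extend2:
  assumes "c \<in> chains_on {u. length u = Suc q}" "length u = Suc p"
  shows "frag_extend (shuffle_simplices pr p q (realize s u)) (fmap (realize t) c) =
    fmap (pair_real pr (realize s) (realize t)) (frag_extend (ez u) c)"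
  unfolding extend_fmap fmap_extend
  by (rule frag_extend_cong[OF assms(1)]) (use assms(2) in \<open>simp add: shuffle_realize\<close>)

lemma shuffle_boundary:
  assumes s: "s \<in> sgen X p" and t: "t \<in> sgen Y q"
  shows "frag_extend (sbd (p + q)) (shuffle_simplices pr p q s t) =
      frag_extend (\<lambda>s'. shuffle_simplices pr (p - 1) q s' t) (sbd p s) +
      frag_cmul ((-1) ^ p) (frag_extend (shuffle_simplices pr p (q - 1) s) (sbd q t))"
proof (cases "p + q")
  case 0
  then show ?thesis by (simp add: sbd_0[abs_def])
next
  case (Suc n)
  let ?I = "[0..<Suc p]" and ?J = "[0..<Suc q]" and ?P = "pair_real pr (realize s) (realize t)"
  have sI: "realize s ?I = s" and tJ: "realize t ?J = t" using realize_self s t by auto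
  have "ez ?I ?J \<in> chains_on {w. length w = Suc (Suc n)}"
    by (rule chains_mono[OF ez_chains]) (use Suc in \<open>auto simp del: upt_Suc\<close>)
  then have "frag_extend (sbd (p + q)) (shuffle_simplices pr p q s t) = fmap ?P (frag_extend list_boundary (ez ?I ?J))"
    unfolding sbd_extend shuffle_sgen[OF s t] Suc
    by (intro boundary_realization_chain realization_pair realization_realize)
  also have "frag_extend list_boundary (ez ?I ?J) = frag_extend (\<lambda>u. ez u ?J) (list_boundary ?I) +
    frag_cmul ((-1) ^ p) (frag_extend (ez ?I) (list_boundary ?J))"
    by (subst list_boundary_ez) (use Suc in \<open>auto simp del: upt_Suc\<close>)
  also have "fmap ?P \<dots> = fmap ?P (frag_extend (\<lambda>u. ez u ?J) (list_boundary ?I)) +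
    frag_cmul ((-1) ^ p) (fmap ?P (frag_extend (ez ?I) (list_boundary ?J)))" by simp
  also have "fmap ?P (frag_extend (\<lambda>u. ez u ?J) (list_boundary ?I)) =
      frag_extend (\<lambda>s'. shuffle_simplices pr (p - 1) q s' t) (sbd p s)"
  \<comment> \<open>For p = 0 the list boundary is the empty list, on which \<open>ez\<close>
    vanishes, in agreement with the zero boundary of a 0-simplex.\<close>
  proof (cases p)
    case 0
    then show ?thesis by (simp add: sbd_0 del: upt_Suc) simp
  next
    case (Suc p')
    have "list_boundary ?I \<in> chains_on {u. length u = Suc p'}" using list_boundary_length[of ?I] Suc by (simp del: upt_Suc)
    from shuffle_extend1[OF this, of ?J q pr t s] show ?thesis
      using sbd_realize[of ?I p' s] Suc by (simp add: tJ sI[unfolded Suc] del: upt_Suc)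
  qed
  also have "fmap ?P (frag_extend (ez ?I) (list_boundary ?J)) = frag_extend (shuffle_simplices pr p (q - 1) s) (sbd q t)"
  proof (cases q)
    case 0
    then show ?thesis by (simp add: sbd_0 del: upt_Suc) simp
  next
    case (Suc q')
    have "list_boundary ?J \<in> chains_on {u. length u = Suc q'}" using list_boundary_length[of ?J] Suc by (simp del: upt_Suc)
    from shuffle_extend2[OF this, of ?I p pr s t] show ?thesis
      using sbd_realize[of ?J q' t] Suc by (simp add: sI tJ[unfolded Suc] del: upt_Suc)
  qed
  finally show ?thesis .
qed

lemma simplex_map_pair:
  assumes "inj pr"
  shows "simplex_map n (prod_map pr f g) (simplex_pair pr n s t) = simplex_pair pr n (simplex_map n f s) (simplex_map n g t)"
  using assms by (auto simp: simplex_map_def simplex_pair_def prod_map_def fun_eq_iff)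

lemma ez_range: "ez [0..<Suc p] [0..<Suc q] \<in> chains_on {w. length w = Suc (p + q) \<and> set w \<subseteq> {..p} \<times> {..q}}"
  by (rule chains_mono[OF ez_chains]) (auto simp del: upt_Suc)

lemma set_map_fst: "set w \<subseteq> A \<times> B \<Longrightarrow> set (map fst w) \<subseteq> A" and set_map_snd: "set w \<subseteq> A \<times> B \<Longrightarrow> set (map snd w) \<subseteq> B"
  by auto

lemma shuffle_simplex_map:
  assumes "inj pr" "continuous_map X X' f" "continuous_map Y Y' g" and s: "s \<in> sgen X p" and t: "t \<in> sgen Y q"
  shows "shuffle_simplices pr p q (simplex_map p f s) (simplex_map q g t) =
    fmap (simplex_map (p + q) (prod_map pr f g)) (shuffle_simplices pr p q s t)"
proof -
  have f: "simplex_map p f s \<in> sgen X' p" and g: "simplex_map q g t \<in> sgen Y' q"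
    using assms by (auto simp: sgen_def intro: singular_simplex_simplex_map)
  show ?thesis
    unfolding shuffle_sgen[OF s t] shuffle_sgen[OF f g] fmap_fmap
  proof (rule fmap_cong[OF ez_range])
    fix w assume "w \<in> {w. length w = Suc (p + q) \<and> set w \<subseteq> {..p} \<times> {..q}}"
    then have w: "length w = Suc (p + q)" "set (map fst w) \<subseteq> {..p}" "set (map snd w) \<subseteq> {..q}"
      using set_map_fst[of w "{..p}" "{..q}"] set_map_snd[of w "{..p}" "{..q}"] by simp_all
    then have "simplex_map (p + q) f (realize s (map fst w)) = realize (simplex_map p f s) (map fst w)"
      "simplex_map (p + q) g (realize t (map snd w)) = realize (simplex_map q g t) (map snd w)"
      by (intro simplex_map_realize; simp)+
    with w show "pair_real pr (realize (simplex_map p f s)) (realize (simplex_map q g t)) w =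
        simplex_map (p + q) (prod_map pr f g) (pair_real pr (realize s) (realize t) w)"
      by (simp add: pair_real_def simplex_map_pair[OF assms(1)])
  qed
qed

lemma prod_assoc_pr [simp]: "inj pr \<Longrightarrow> prod_assoc pr (pr (pr (x, y), z)) = pr (x, pr (y, z))"
  by (simp add: prod_assoc_def)

text \<open>By \<open>ez_assoc\<close> both bracketings are realized over the same lists of triples,
  and on each such list the two simplices differ exactly by the associator.\<close>

lemma shuffle_assoc:
  assumes "inj pr" and s: "s \<in> sgen X p" and t: "t \<in> sgen Y q" and z: "z \<in> sgen Z r"
  shows "fmap (simplex_map (p + q + r) (prod_assoc pr))
      (frag_extend (\<lambda>w. shuffle_simplices pr (p + q) r w z) (shuffle_simplices pr p q s t)) =
    frag_extend (shuffle_simplices pr p (q + r) s) (shuffle_simplices pr q r t z)"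
proof -
  let ?I = "[0..<Suc p]" and ?J = "[0..<Suc q]" and ?K = "[0..<Suc r]"
  let ?st = "pair_real pr (realize s) (realize t)" and ?tz = "pair_real pr (realize t) (realize z)"
  have "frag_extend (\<lambda>w. shuffle_simplices pr (p + q) r w z) (shuffle_simplices pr p q s t) =
     frag_extend (\<lambda>w. fmap (pair_real pr ?st (realize z)) (ez w ?K)) (ez ?I ?J)"
    unfolding shuffle_sgen[OF s t] extend_fmap
  proof (rule frag_extend_cong[OF ez_range])
    fix w assume "w \<in> {w. length w = Suc (p + q) \<and> set w \<subseteq> {..p} \<times> {..q}}"
    then have "shuffle_simplices pr (p + q) r (?st w) (realize z ?K) = fmap (pair_real pr ?st (realize z)) (ez w ?K)"
      by (intro shuffle_realization realization_pair realization_realize) auto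
    then show "shuffle_simplices pr (p + q) r (?st w) z = fmap (pair_real pr ?st (realize z)) (ez w ?K)"
      by (simp only: realize_self[OF z])
  qed
  also have "\<dots> = fmap (pair_real pr ?st (realize z)) (frag_extend (\<lambda>w. ez w ?K) (ez ?I ?J))"
    by (simp only: fmap_extend)
  finally have L: "fmap (simplex_map (p + q + r) (prod_assoc pr))
      (frag_extend (\<lambda>w. shuffle_simplices pr (p + q) r w z) (shuffle_simplices pr p q s t)) =
      fmap (\<lambda>w. simplex_map (p + q + r) (prod_assoc pr) (pair_real pr ?st (realize z) w)) (frag_extend (\<lambda>w. ez w ?K) (ez ?I ?J))"
    by (simp only: fmap_fmap)
  have "frag_extend (shuffle_simplices pr p (q + r) s) (shuffle_simplices pr q r t z) =
     frag_extend (\<lambda>w. fmap (pair_real pr (realize s) ?tz) (ez ?I w)) (ez ?J ?K)"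
    unfolding shuffle_sgen[OF t z] extend_fmap
  proof (rule frag_extend_cong[OF ez_range])
    fix w assume "w \<in> {w. length w = Suc (q + r) \<and> set w \<subseteq> {..q} \<times> {..r}}"
    then have "shuffle_simplices pr p (q + r) (realize s ?I) (?tz w) = fmap (pair_real pr (realize s) ?tz) (ez ?I w)"
      by (intro shuffle_realization realization_pair realization_realize) auto
    then show "shuffle_simplices pr p (q + r) s (?tz w) = fmap (pair_real pr (realize s) ?tz) (ez ?I w)"
      by (simp only: realize_self[OF s])
  qed
  also have "\<dots> = fmap (pair_real pr (realize s) ?tz) (fmap (map reassoc) (frag_extend (\<lambda>w. ez w ?K) (ez ?I ?J)))"
    unfolding ez_assoc by (simp only: fmap_extend)
  also have "\<dots> = fmap (\<lambda>w. simplex_map (p + q + r) (prod_assoc pr) (pair_real pr ?st (realize z) w)) (frag_extend (\<lambda>w. ez w ?K) (ez ?I ?J))"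
  proof -
    have "frag_extend (\<lambda>w. ez w ?K) (ez ?I ?J) \<in> chains_on {w. length w = Suc (p + q + r)}"
      by (rule chains_extend[OF ez_range], rule chains_mono[OF ez_chains]) (auto simp del: upt_Suc)
    then show ?thesis
      unfolding fmap_fmap
    proof (rule fmap_cong)
      fix w :: "((nat \<times> nat) \<times> nat) list" assume "w \<in> {w. length w = Suc (p + q + r)}"
      then have w: "length w = Suc (p + q + r)" by simp
      have e: "map (fst \<circ> reassoc) w = map (fst \<circ> fst) w"
        "map (fst \<circ> (snd \<circ> reassoc)) w = map (snd \<circ> fst) w" "map (snd \<circ> (snd \<circ> reassoc)) w = map snd w"
        by (auto simp: reassoc_def)
      show "pair_real pr (realize s) ?tz (map reassoc w) =
          simplex_map (p + q + r) (prod_assoc pr) (pair_real pr ?st (realize z) w)"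
        unfolding pair_real_def map_map length_map e w
        using assms(1) by (auto simp: simplex_map_def simplex_pair_def fun_eq_iff)
    qed
  qed
  finally show ?thesis using L by simp
qed

text \<open>A grid with a single row or column has just one lattice path, so the product with the
  point is one simplex, whose projection is the given one.\<close>

lemma shuffle_unit:
  assumes "inj pr" and s: "s \<in> sgen X n"
  shows "fmap (simplex_map n (snd \<circ> unpair pr)) (shuffle_simplices pr 0 n (spt pt) s) = frag_of s"
    "fmap (simplex_map n (fst \<circ> unpair pr)) (shuffle_simplices pr n 0 s (spt pt)) = frag_of s"
proof -
  have u: "spt pt \<in> sgen (point_space pt) 0"
    by (auto simp: spt_def sgen_def singular_simplex_def point_space_def)
  have e: "s \<in> extensional (standard_simplex n)" using s by (auto simp: sgen_def singular_simplex_def)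
  have c: "map (fst \<circ> Pair 0) [0..<Suc n] = map (\<lambda>i. 0) [0..<Suc n]" "map (snd \<circ> Pair 0) [0..<Suc n] = [0..<Suc n]"
    "map (fst \<circ> (\<lambda>x. (x, 0))) [0..<Suc n] = [0..<Suc n]" "map (snd \<circ> (\<lambda>x. (x, 0))) [0..<Suc n] = map (\<lambda>i. 0) [0..<Suc n]"
    for a :: nat
    by (auto simp: comp_def simp del: upt_Suc)
  have "shuffle_simplices pr 0 n (spt pt) s = frag_of (pair_real pr (realize (spt pt)) (realize s) (map (Pair 0) [0..<Suc n]))"
    unfolding shuffle_sgen[OF u s] by (simp add: ez_singleton1)
  also have "pair_real pr (realize (spt pt)) (realize s) (map (Pair 0) [0..<Suc n]) = simplex_pair pr n (realize (spt pt) (map (\<lambda>i. 0) [0..<Suc n])) s"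
    unfolding pair_real_def map_map c realize_self[OF s] by simp
  finally show "fmap (simplex_map n (snd \<circ> unpair pr)) (shuffle_simplices pr 0 n (spt pt) s) = frag_of s"
    using assms(1) e by (auto simp: simplex_map_def simplex_pair_def fun_eq_iff extensional_def intro!: arg_cong[where f = frag_of])
  have "shuffle_simplices pr n 0 s (spt pt) = frag_of (pair_real pr (realize s) (realize (spt pt)) (map (\<lambda>x. (x, 0)) [0..<Suc n]))"
    unfolding shuffle_sgen[OF s u] by (simp add: ez_singleton2)
  also have "pair_real pr (realize s) (realize (spt pt)) (map (\<lambda>x. (x, 0)) [0..<Suc n]) = simplex_pair pr n s (realize (spt pt) (map (\<lambda>i. 0) [0..<Suc n]))"
    unfolding pair_real_def map_map c realize_self[OF s] by simp
  finally show "fmap (simplex_map n (fst \<circ> unpair pr)) (shuffle_simplices pr n 0 s (spt pt)) = frag_of s"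
    using assms(1) e by (auto simp: simplex_map_def simplex_pair_def fun_eq_iff extensional_def intro!: arg_cong[where f = frag_of])
qed

lemma simplex_map_sdgen:
  assumes "continuous_map X Y f" "s \<in> sdgen X n"
  shows "simplex_map n f s \<in> sdgen Y n"
proof -
  have s: "s \<in> sgen X n" "sdeg n s" using assms by (auto simp: sdgen_def)
  then obtain ls where ls: "adjdup ls" "length ls = Suc n" "set ls \<subseteq> {..n}" "s = realize s ls" by (elim sdegE)
  have "simplex_map n f s \<in> sgen Y n" using assms(1) s(1) by (auto simp: sgen_def intro: singular_simplex_simplex_map)
  from sdgen_realize[OF this ls(2,3,1)] show ?thesis
    using simplex_map_realize[OF ls(2,3), of f s] ls(4) by simp
qed

lemma simplex_map_sbd:
  assumes "s \<in> sgen X n"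
  shows "sbd n (simplex_map n f s) = fmap (simplex_map (n - 1) f) (sbd n s)"
proof (cases n)
  case 0
  then show ?thesis by (simp add: sbd_0)
next
  case (Suc m)
  have *: "simplex_map n f s = realize (simplex_map n f s) [0..<Suc n]"
    using simplex_map_realize[of "[0..<Suc n]" n n f s]
    by (simp add: realize_self[OF assms] set_upt_Suc del: upt_Suc set_upt)
  have "sbd n (simplex_map n f s) = fmap (realize (simplex_map n f s)) (list_boundary [0..<Suc n])"
    using sbd_realize[of "[0..<Suc n]" m "simplex_map n f s"] Suc * by (simp del: upt_Suc)
  also have "\<dots> = fmap (\<lambda>l. simplex_map m f (realize s l)) (list_boundary [0..<Suc n])"
    by (rule fmap_cong[OF list_boundary_chains]) (use Suc in \<open>auto intro!: simplex_map_realize[symmetric] simp del: upt_Suc\<close>)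
  also have "\<dots> = fmap (simplex_map m f) (sbd n s)"
    using sbd_realize[of "[0..<Suc n]" m s] Suc realize_self[OF assms] by (simp add: fmap_fmap del: upt_Suc)
  finally show ?thesis using Suc by simp
qed

text \<open>Treats two functors at once: no degenerate generators for all singular chains,
  \<open>sdgen\<close> for the normalized ones.\<close>

lemma singular_top_chains:
  assumes "inj pr" and D: "D = (\<lambda>X n. {}) \<or> D = sdgen"
  shows "top_chains pr pt sgen D sbd simplex_map (shuffle_simplices pr) (spt pt)"
proof (rule top_chains.intro)
  show "inj pr" by fact
next
  fix X :: "'a topology"
  show "chain_data (sgen X) (D X) sbd"
  proof (rule singular_chain_data)
    show "D X n \<subseteq> sgen X n" for n using D by (auto simp: sdgen_def)
    show "s \<in> D X n \<Longrightarrow> sbd n s \<in> chains_on (D X (n - 1))" for s n using D sbd_sdgen by auto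
  qed
next
  show "spt pt \<in> sgen (point_space pt) 0"
    by (auto simp: spt_def sgen_def singular_simplex_def point_space_def)
next
  fix X Y Z :: "'a topology" and f g :: "'a \<Rightarrow> 'a" and x n
  assume "continuous_map X Y f" "continuous_map Y Z g" and x: "x \<in> sgen X n"
  show "simplex_map n (g \<circ> f) x = simplex_map n g (simplex_map n f x)"
    by (simp add: simplex_map_compose)
next
  show "x \<in> sgen X p \<Longrightarrow> y \<in> sgen Y q \<Longrightarrow> shuffle_simplices pr p q x y \<in> chains_on (sgen (prod_space pr X Y) (p + q))" for x y X Y p q
    by (rule shuffle_chains[OF assms(1)])
  show "x \<in> sgen X p \<Longrightarrow> y \<in> D Y q \<Longrightarrow> shuffle_simplices pr p q x y \<in> chains_on (D (prod_space pr X Y) (p + q))" for x y X Y p q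
    using D shuffle_sdgen[OF assms(1)] by (auto simp: sdgen_def)
  show "x \<in> D X p \<Longrightarrow> y \<in> sgen Y q \<Longrightarrow> shuffle_simplices pr p q x y \<in> chains_on (D (prod_space pr X Y) (p + q))" for x y X Y p q
    using D shuffle_sdgen[OF assms(1)] by (auto simp: sdgen_def)
  show "continuous_map X Y f \<Longrightarrow> x \<in> D X n \<Longrightarrow> simplex_map n f x \<in> D Y n" for X Y f x n
    using D simplex_map_sdgen by auto
qed (auto simp: simplex_map_sbd shuffle_assoc[OF assms(1)] shuffle_unit[OF assms(1)] shuffle_boundary
    intro: shuffle_chains[OF assms(1)] shuffle_simplex_map[OF assms(1)] simp: sgen_def intro!: singular_simplex_simplex_map simplex_map_eq simplex_map_id_gen)

section \<open>The normalization theorem for singular chains\<close>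

subsection \<open>The normalization homotopy equivalence\<close>

definition normalize_simplex :: "nat \<Rightarrow> ((nat \<Rightarrow> real) \<Rightarrow> 'u) \<Rightarrow> 'u chain" where
  "normalize_simplex n s = fmap (realize s) (norml n [0..<Suc n])"

definition normalize_homotopy :: "nat \<Rightarrow> ((nat \<Rightarrow> real) \<Rightarrow> 'u) \<Rightarrow> 'u chain" where
  "normalize_homotopy n s = fmap (realize s) (normlh n [0..<Suc n])"

text \<open>\<open>norml\<close> is natural under relabelling of vertices, so the normalization of a
  realized simplex may be computed on its own list instead of the standard one.\<close>

lemma normalize_simplex_realization:
  assumes "realization F" "length u = Suc n"
  shows "normalize_simplex n (F u) = fmap F (norml n u)"
proof -
  have u: "map (nth u) [0..<Suc n] = u" using assms(2) map_nth[of u] by simp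
  have "normalize_simplex n (F u) = fmap (\<lambda>l. F (map (nth u) l)) (norml n [0..<Suc n])"
    unfolding normalize_simplex_def realize_def
  proof (rule fmap_cong[OF norml_chains])
    fix l assume "l \<in> {l. length l = Suc n \<and> set l \<subseteq> set [0..<Suc n]}"
    then show "affine_simplex (F u) (map ev l) = F (map (nth u) l)"
      using assms(2) by (intro realizationD[OF assms(1)]) (auto simp: subset_iff)
  qed simp
  also have "\<dots> = fmap F (norml n (map (nth u) [0..<Suc n]))"
    by (subst norml_map) (simp_all add: fmap_fmap)
  finally show ?thesis by (simp only: u)
qed

lemma normalize_homotopy_realization:
  assumes "realization F" "length u = Suc n"
  shows "normalize_homotopy n (F u) = fmap F (normlh n u)"
proof -
  have u: "map (nth u) [0..<Suc n] = u" using assms(2) map_nth[of u] by simp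
  have "normalize_homotopy n (F u) = fmap (\<lambda>l. F (map (nth u) l)) (normlh n [0..<Suc n])"
    unfolding normalize_homotopy_def realize_def
  proof (rule fmap_cong[OF normlh_chains])
    fix l assume "l \<in> {l. length l = Suc (Suc n) \<and> set l \<subseteq> set [0..<Suc n]}"
    then show "affine_simplex (F u) (map ev l) = F (map (nth u) l)"
      using assms(2) by (intro realizationD[OF assms(1)]) (auto simp: subset_iff)
  qed simp
  also have "\<dots> = fmap F (normlh n (map (nth u) [0..<Suc n]))"
    by (subst normlh_map) (simp_all add: fmap_fmap)
  finally show ?thesis by (simp only: u)
qed

lemma normalize_simplex_sgen: "s \<in> sgen X n \<Longrightarrow> normalize_simplex n s \<in> chains_on (sgen X n)"
  unfolding normalize_simplex_def by (rule chains_fmap[OF norml_chains]) (auto simp: set_upt_Suc simp del: set_upt upt_Suc intro!: sgen_realize)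

lemma normalize_homotopy_sgen: "s \<in> sgen X n \<Longrightarrow> normalize_homotopy n s \<in> chains_on (sgen X (n + 1))"
  unfolding normalize_homotopy_def by (rule chains_fmap[OF normlh_chains]) (auto simp: set_upt_Suc simp del: set_upt upt_Suc intro!: sgen_realize)

text \<open>A degenerate simplex is realized over a list with an adjacent repetition, where
  \<open>norml\<close> vanishes.\<close>

lemma normalize_simplex_sdgen:
  assumes "s \<in> sdgen X n"
  shows "normalize_simplex n s = 0"
proof -
  obtain ls where ls: "adjdup ls" "length ls = Suc n" "s = realize s ls"
    using assms by (auto simp: sdgen_def elim: sdegE)
  have "normalize_simplex n (realize s ls) = 0"
    by (simp add: normalize_simplex_realization[OF realization_realize ls(2)] norml_adjdup[OF ls(2,1)])
  then show ?thesis using ls(3) by simp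
qed

lemma normalize_homotopy_sdgen:
  assumes "s \<in> sdgen X n"
  shows "normalize_homotopy n s \<in> chains_on (sdgen X (n + 1))"
proof -
  obtain ls where ls: "adjdup ls" "length ls = Suc n" "set ls \<subseteq> {..n}" "s = realize s ls" and s: "s \<in> sgen X n"
    using assms by (auto simp: sdgen_def elim: sdegE)
  have "normalize_homotopy n (realize s ls) = fmap (realize s) (normlh n ls)"
    by (rule normalize_homotopy_realization[OF realization_realize ls(2)])
  also have "\<dots> \<in> chains_on (sdgen X (n + 1))"
    by (rule chains_fmap[OF chains_Int[OF normlh_chains[OF ls(2)] normlh_adjdup[OF ls(2,1)]]])
      (use ls(3) in \<open>auto intro!: sdgen_realize[OF s]\<close>)
  finally show ?thesis using ls(4) by simp
qed

lemma sbd_self: "s \<in> sgen X (Suc m) \<Longrightarrow> sbd (Suc m) s = fmap (realize s) (list_boundary [0..<Suc (Suc m)])"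
  using sbd_realize[of "[0..<Suc (Suc m)]" m s] realize_self[of s X "Suc m"] by (simp del: upt_Suc)

lemma normalize_simplex_sbd:
  assumes "s \<in> sgen X n"
  shows "frag_extend (sbd n) (normalize_simplex n s) = frag_extend (normalize_simplex (n - 1)) (sbd n s)"
proof (cases n)
  case 0
  then show ?thesis by (simp add: sbd_0[abs_def])
next
  case (Suc m)
  let ?I = "[0..<Suc (Suc m)]"
  have I: "length ?I = Suc (Suc m)" by simp
  have "frag_extend (sbd n) (normalize_simplex n s) = fmap (realize s) (frag_extend list_boundary (norml (Suc m) ?I))"
    unfolding sbd_extend normalize_simplex_def Suc
    by (rule boundary_realization_chain[OF realization_realize], rule chains_mono[OF norml_chains[OF I]]) auto
  also have "\<dots> = frag_extend (\<lambda>l. fmap (realize s) (norml m l)) (list_boundary ?I)"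
    unfolding list_boundary_norml[OF I] fmap_extend ..
  also have "\<dots> = frag_extend (normalize_simplex m) (sbd n s)"
    using assms unfolding Suc sbd_self[OF assms[unfolded Suc]] extend_fmap
    by (intro frag_extend_cong[OF list_boundary_chains'[OF I]]) (simp add: normalize_simplex_realization[OF realization_realize])
  finally show ?thesis using Suc by simp
qed

text \<open>An exact identity of singular chains. It holds a fortiori modulo degenerate simplices
  and so serves for both composites of the projection with its inverse.\<close>

lemma normalize_homotopy_sbd:
  assumes "s \<in> sgen X n"
  shows "normalize_simplex n s - frag_of s - frag_extend (sbd (n + 1)) (normalize_homotopy n s) - frag_extend (normalize_homotopy (n - 1)) (sbd n s) = 0"
proof (cases n)
  case 0
  then show ?thesis using realize_self[of s X 0] assms by (simp add: normalize_simplex_def normalize_homotopy_def sbd_0)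
next
  case (Suc m)
  let ?I = "[0..<Suc (Suc m)]"
  have I: "length ?I = Suc (Suc m)" by simp
  have "frag_extend (sbd (n + 1)) (normalize_homotopy n s) = fmap (realize s) (frag_extend list_boundary (normlh (Suc m) ?I))"
    unfolding sbd_extend normalize_homotopy_def Suc add_Suc_right One_nat_def add_0_right
    by (rule boundary_realization_chain[OF realization_realize], rule chains_mono[OF normlh_chains[OF I]]) auto
  moreover have "frag_extend (normalize_homotopy (n - 1)) (sbd n s) = fmap (realize s) (frag_extend (normlh m) (list_boundary ?I))"
    using assms unfolding Suc sbd_self[OF assms[unfolded Suc]] extend_fmap fmap_extend diff_Suc_1
    by (intro frag_extend_cong[OF list_boundary_chains'[OF I]]) (simp add: normalize_homotopy_realization[OF realization_realize])
  moreover have "fmap (realize s) (frag_extend list_boundary (normlh (Suc m) ?I)) + fmap (realize s) (frag_extend (normlh m) (list_boundary ?I)) =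
      normalize_simplex n s - frag_of s"
    using arg_cong[OF list_boundary_normlh[OF I], of "fmap (realize s)"] realize_self[OF assms] Suc
    by (simp add: normalize_simplex_def del: upt_Suc norml.simps normlh.simps)
  ultimately show ?thesis by (simp add: algebra_simps)
qed

subsection \<open>The singular functors\<close>

lemma singular_presents:
  assumes "inj pr"
  shows "top_chains.presents_functor pr pt sgen (\<lambda>X n. {}) sbd simplex_map (shuffle_simplices pr) (spt pt)
     (singular_functor pr pt) (\<lambda>X n c. c)"
proof -
  interpret T: top_chains pr pt sgen "\<lambda>X n. {}" sbd simplex_map "shuffle_simplices pr" "spt pt"
    by (rule singular_top_chains[OF assms]) simp
  have c0: "c = 0" if "c \<in> chains_on (int_graded (sgen X) n)" "n < 0" for c :: "'a chain" and X n
    using that chains_int_graded_neg by blast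
  have ch: "c \<in> chains_on (int_graded (sgen X) n) \<longleftrightarrow> c \<in> carrier (cgrp (singular_complex X) n)" for c :: "'a chain" and X n
    by (cases "n < 0") (auto simp: singular_complex_def int_graded_def singular_chain_iff singleton_group_def)
  have pres: "presented (sgen X) (\<lambda>n. {}) sbd (singular_complex X) (\<lambda>n c. c)" for X :: "'a topology"
  proof (rule presented.intro[OF T.chain_data presented_axioms.intro])
    fix n
    show "comm_group (cgrp (singular_complex X) n)"
      by (auto simp: singular_complex_def chain_group_def abelian_free_Abelian_group)
    show "(\<lambda>c. c) \<in> hom (free_Abelian_group (int_graded (sgen X) n)) (cgrp (singular_complex X) n)"
      using ch[of _ X n] by (intro homI) (auto simp: chains_on_def singular_complex_def chain_group_def singleton_group_def dest: c0)
  qed (use ch in \<open>auto simp: singular_complex_def sbd_extend int_graded_def chain_group_def chains_on_def singleton_group_def\<close>)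
  show ?thesis
    unfolding T.presents_functor_def
  proof (intro conjI allI impI ballI exI)
    show "presented (sgen X) (\<lambda>n. {}) sbd (obj (singular_functor pr pt) X) (\<lambda>n c. c)" for X
      using pres by (simp add: singular_functor_def)
    show "kunneth (singular_functor pr pt) X Y = (\<lambda>n. tensor_lift (cgrp (obj (singular_functor pr pt) (prod_space pr X Y)) n)
        ((\<lambda>X Y n (i, j, a, b). shuffle_product pr (nat i) (nat j) a b) X Y n))" for X Y
      by (simp add: singular_functor_def)
  qed (auto simp: singular_functor_def chain_map_fmap T.crc_def shuffle_product_def spt_def)
qed

definition encoded_singular :: "('u \<times> 'u \<Rightarrow> 'u) \<Rightarrow> 'u \<Rightarrow> ('u, 'u chain set) top_functor" where
  "encoded_singular pr pt = qfunctor pr pt sgen (\<lambda>X n. {}) sbd simplex_map (shuffle_simplices pr) (spt pt)"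

definition normalized_singular :: "('u \<times> 'u \<Rightarrow> 'u) \<Rightarrow> 'u \<Rightarrow> ('u, 'u chain set) top_functor" where
  "normalized_singular pr pt = qfunctor pr pt sgen sdgen sbd simplex_map (shuffle_simplices pr) (spt pt)"

lemma encoded_singular_equivalence:
  assumes "inj pr"
  shows "has_weak_homotopy_equivalence pr pt (encoded_singular pr pt) (singular_functor pr pt)"
proof -
  interpret T: top_chains pr pt sgen "\<lambda>X n. {}" sbd simplex_map "shuffle_simplices pr" "spt pt"
    by (rule singular_top_chains[OF assms]) simp
  interpret P: top_chains_pair pr pt sgen "\<lambda>X n. {}" sbd simplex_map "shuffle_simplices pr" "spt pt"
      sgen "\<lambda>X n. {}" sbd simplex_map "shuffle_simplices pr" "spt pt" "\<lambda>n. frag_of"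
    by (intro top_chains_pair.intro top_chains_pair_axioms.intro T.top_chains_axioms) auto
  show ?thesis
    unfolding encoded_singular_def
    by (rule P.weak_homotopy_equivalence[OF T.presents_qfunctor singular_presents[OF assms],
        where \<Psi> = "\<lambda>n. frag_of" and HA = "\<lambda>n x. 0" and HB = "\<lambda>n x. 0"]) auto
qed

lemma normalization_equivalence:
  assumes "inj pr"
  shows "has_weak_homotopy_equivalence pr pt (encoded_singular pr pt) (normalized_singular pr pt)"
proof -
  interpret T: top_chains pr pt sgen "\<lambda>X n. {}" sbd simplex_map "shuffle_simplices pr" "spt pt"
    by (rule singular_top_chains[OF assms]) simp
  interpret N: top_chains pr pt sgen sdgen sbd simplex_map "shuffle_simplices pr" "spt pt"
    by (rule singular_top_chains[OF assms]) simp
  interpret P: top_chains_pair pr pt sgen "\<lambda>X n. {}" sbd simplex_map "shuffle_simplices pr" "spt pt"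
      sgen sdgen sbd simplex_map "shuffle_simplices pr" "spt pt" "\<lambda>n. frag_of"
    by (intro top_chains_pair.intro top_chains_pair_axioms.intro T.top_chains_axioms N.top_chains_axioms) auto
  show ?thesis
    unfolding encoded_singular_def normalized_singular_def
    by (rule P.weak_homotopy_equivalence[OF T.presents_qfunctor N.presents_qfunctor,
        where \<Psi> = normalize_simplex and HA = normalize_homotopy and HB = normalize_homotopy])
      (auto simp: normalize_simplex_sbd normalize_homotopy_sbd normalize_simplex_sdgen intro: normalize_simplex_sgen normalize_homotopy_sgen normalize_homotopy_sdgen simp del: One_nat_def)
qed

section \<open>Normalized cubical chains and the cross product\<close>

section \<open>Cubical chains\<close>

abbreviation cube_top :: "nat \<Rightarrow> (nat \<Rightarrow> real) topology" where
  "cube_top n \<equiv> subtopology (powertop_real UNIV) (standard_cube n)"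

definition cgen :: "'u topology \<Rightarrow> nat \<Rightarrow> ((nat \<Rightarrow> real) \<Rightarrow> 'u) set" where
  "cgen X n = {c. singular_cube n X c}"

definition cdgen :: "'u topology \<Rightarrow> nat \<Rightarrow> ((nat \<Rightarrow> real) \<Rightarrow> 'u) set" where
  "cdgen X n = {c \<in> cgen X n. degenerate_cube n c}"

definition cbd :: "nat \<Rightarrow> ((nat \<Rightarrow> real) \<Rightarrow> 'u) \<Rightarrow> 'u chain" where
  "cbd n c = (\<Sum>i\<in>{1..n}. \<Sum>e\<in>{0, 1::nat}. frag_cmul ((- 1) ^ (i + e)) (frag_of (cube_face n i (real e) c)))"

text \<open>The type of points may change: for a cube \<open>c\<close> in X, postcomposition with
  \<open>c\<close> carries cubes of the model cube to cubes of X.\<close>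

definition cmap :: "nat \<Rightarrow> ('a \<Rightarrow> 'u) \<Rightarrow> ((nat \<Rightarrow> real) \<Rightarrow> 'a) \<Rightarrow> (nat \<Rightarrow> real) \<Rightarrow> 'u" where
  "cmap n g c = restrict (g \<circ> c) (standard_cube n)"

definition ccr :: "('u \<times> 'u \<Rightarrow> 'u) \<Rightarrow> nat \<Rightarrow> nat \<Rightarrow> ((nat \<Rightarrow> real) \<Rightarrow> 'u) \<Rightarrow> ((nat \<Rightarrow> real) \<Rightarrow> 'u) \<Rightarrow> 'u chain" where
  "ccr pr p q c d = frag_of (cross_cubes pr p q c d)"

definition cpt :: "'u \<Rightarrow> (nat \<Rightarrow> real) \<Rightarrow> 'u" where
  "cpt pt = restrict (\<lambda>x. pt) (standard_cube 0)"

lemma cube_coord: "x \<in> standard_cube n \<Longrightarrow> 0 \<le> x i \<and> x i \<le> 1"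
  by (cases "i < n") (auto simp: standard_cube_def)

lemma cube_zero: "x \<in> standard_cube n \<Longrightarrow> i \<ge> n \<Longrightarrow> x i = 0"
  by (simp add: standard_cube_def)

lemma cube_upd: "x \<in> standard_cube n \<Longrightarrow> x(i := 0) \<in> standard_cube n"
  by (auto simp: standard_cube_def)

lemma cgen_compose:
  assumes "c \<in> cgen X n" "continuous_map (cube_top m) (cube_top n) \<phi>"
  shows "restrict (c \<circ> \<phi>) (standard_cube m) \<in> cgen X m"
  using assms by (auto simp: cgen_def singular_cube_def intro: continuous_map_compose)

lemma continuous_map_cube:
  "continuous_map (cube_top m) (cube_top n) \<phi> \<longleftrightarrow>
    (\<forall>i. continuous_map (cube_top m) euclideanreal (\<lambda>x. \<phi> x i)) \<and> (\<forall>x\<in>standard_cube m. \<phi> x \<in> standard_cube n)"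
  by (auto simp: continuous_map_in_subtopology continuous_map_componentwise_UNIV)

lemma continuous_map_coord: "continuous_map (cube_top m) euclideanreal (\<lambda>x. x i)"
  by (intro continuous_map_from_subtopology continuous_map_product_projection) simp

lemma cmap_cgen: "c \<in> cgen X n \<Longrightarrow> continuous_map X Y f \<Longrightarrow> cmap n f c \<in> cgen Y n"
  by (auto simp: cgen_def singular_cube_def cmap_def intro: continuous_map_compose)

lemma cgen_ext: "c \<in> cgen X n \<Longrightarrow> c \<in> extensional (standard_cube n)"
  by (simp add: cgen_def singular_cube_def)

lemma cgen_mem: "c \<in> cgen X n \<Longrightarrow> x \<in> standard_cube n \<Longrightarrow> c x \<in> topspace X"
  by (auto simp: cgen_def singular_cube_def continuous_map_def)

text \<open>Comparing each point with the one whose coordinate is reset to 0 suffices. Degeneracy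
  thus becomes invariance under a self-map of the cube.\<close>

lemma degenerate_cube_iff:
  "degenerate_cube n c \<longleftrightarrow> (\<exists>i<n. \<forall>x\<in>standard_cube n. c (x(i := 0)) = c x)"
proof
  assume "degenerate_cube n c"
  then obtain i where i: "i < n" "\<And>x y. x \<in> standard_cube n \<Longrightarrow> y \<in> standard_cube n \<Longrightarrow> (\<And>j. j \<noteq> i \<Longrightarrow> x j = y j) \<Longrightarrow> c x = c y"
    unfolding degenerate_cube_def by blast
  then show "\<exists>i<n. \<forall>x\<in>standard_cube n. c (x(i := 0)) = c x"
    by (intro exI[of _ i] conjI ballI i(2) cube_upd) auto
next
  assume "\<exists>i<n. \<forall>x\<in>standard_cube n. c (x(i := 0)) = c x"
  then obtain i where i: "i < n" "\<And>x. x \<in> standard_cube n \<Longrightarrow> c (x(i := 0)) = c x" by blast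
  show "degenerate_cube n c"
    unfolding degenerate_cube_def
  proof (intro exI[of _ i] conjI ballI impI)
    fix x y assume x: "x \<in> standard_cube n" and y: "y \<in> standard_cube n" and "\<forall>j. j \<noteq> i \<longrightarrow> x j = y j"
    then have "x(i := 0) = y(i := 0)" by auto
    then show "c x = c y" using i(2)[OF x] i(2)[OF y] by metis
  qed (rule i(1))
qed

lemma cdgenI:
  "c \<in> cgen X n \<Longrightarrow> i < n \<Longrightarrow> (\<And>x. x \<in> standard_cube n \<Longrightarrow> c (x(i := 0)) = c x) \<Longrightarrow> c \<in> cdgen X n"
  by (auto simp: cdgen_def degenerate_cube_iff)

lemma cdgenE:
  assumes "c \<in> cdgen X n"
  obtains i where "c \<in> cgen X n" "i < n" "\<And>x. x \<in> standard_cube n \<Longrightarrow> c (x(i := 0)) = c x"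
  using assms by (auto simp: cdgen_def degenerate_cube_iff)

lemma cmap_cdgen:
  assumes "c \<in> cdgen X n" "continuous_map X Y f"
  shows "cmap n f c \<in> cdgen Y n"
proof -
  obtain i where i: "c \<in> cgen X n" "i < n" "\<And>x. x \<in> standard_cube n \<Longrightarrow> c (x(i := 0)) = c x"
    using assms(1) by (elim cdgenE) blast
  show ?thesis
    by (rule cdgenI[OF cmap_cgen[OF i(1) assms(2)] i(2)]) (simp add: cmap_def cube_upd i(3))
qed

subsection \<open>Faces\<close>

lemma cube_insert_cube:
  assumes "x \<in> standard_cube (n - 1)" "1 \<le> i" "i \<le> n" "0 \<le> e" "e \<le> 1"
  shows "cube_insert i e x \<in> standard_cube n"
  using assms cube_coord[OF assms(1)] cube_zero[OF assms(1)] by (auto simp: standard_cube_def cube_insert_def)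

lemma continuous_map_cube_insert:
  assumes "1 \<le> i" "i \<le> n" "0 \<le> e" "e \<le> 1"
  shows "continuous_map (cube_top (n - 1)) (cube_top n) (cube_insert i e)"
proof -
  have "continuous_map (cube_top (n - 1)) euclideanreal (\<lambda>x. cube_insert i e x j)" for j
    unfolding cube_insert_def
    by (cases "Suc j < i"; cases "Suc j = i") (simp_all add: continuous_map_coord del: continuous_map_if_iff)
  then show ?thesis
    using cube_insert_cube[OF _ assms] by (auto simp: continuous_map_cube)
qed

lemma cube_face_cgen:
  "c \<in> cgen X n \<Longrightarrow> 1 \<le> i \<Longrightarrow> i \<le> n \<Longrightarrow> 0 \<le> e \<Longrightarrow> e \<le> 1 \<Longrightarrow> cube_face n i e c \<in> cgen X (n - 1)"
  unfolding cube_face_def by (rule cgen_compose[OF _ continuous_map_cube_insert])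

lemma cbd_chains:
  assumes "\<And>i e. 1 \<le> i \<Longrightarrow> i \<le> n \<Longrightarrow> e \<in> {0, 1} \<Longrightarrow> cube_face n i e c \<in> S"
  shows "cbd n c \<in> chains_on S"
  unfolding cbd_def by (intro chains_sum chains_cmul) (use assms in auto)

lemma cbd_cgen: "c \<in> cgen X n \<Longrightarrow> cbd n c \<in> chains_on (cgen X (n - 1))"
  by (rule cbd_chains) (auto intro!: cube_face_cgen simp del: One_nat_def)

lemma cbd_0 [simp]: "cbd 0 c = 0"
  by (simp add: cbd_def)

lemma cbd_alt: "cbd n c = (\<Sum>i\<in>{1..n}. frag_cmul ((-1) ^ i) (frag_of (cube_face n i 0 c) - frag_of (cube_face n i 1 c)))"
  unfolding cbd_def by (rule sum.cong) (auto simp: frag_cmul_diff_distrib2 simp flip: minus_frag_cmul)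

lemma cube_face_cmap:
  "1 \<le> i \<Longrightarrow> i \<le> n \<Longrightarrow> 0 \<le> e \<Longrightarrow> e \<le> 1 \<Longrightarrow> cube_face n i e (cmap n f c) = cmap (n - 1) f (cube_face n i e c)"
  using cube_insert_cube[of _ n i e] by (auto simp: cube_face_def cmap_def fun_eq_iff restrict_def)

lemma cbd_cmap: "cbd n (cmap n f c) = fmap (cmap (n - 1) f) (cbd n c)"
  unfolding cbd_alt fmap_sum by (rule sum.cong) (auto simp: cube_face_cmap)

lemma cube_insert_commute:
  "1 \<le> i \<Longrightarrow> i \<le> j \<Longrightarrow> cube_insert i e (cube_insert j e' x) = cube_insert (Suc j) e' (cube_insert i e x)"
  by (auto simp: cube_insert_def fun_eq_iff)

lemma cube_face_face:
  assumes "1 \<le> i" "i \<le> j" "j \<le> n" "e \<in> {0, 1}" "e' \<in> {0, 1}"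
  shows "cube_face n j e' (cube_face (Suc n) i e c) = cube_face n i e (cube_face (Suc n) (Suc j) e' c)"
proof -
  have "cube_insert j e' x \<in> standard_cube n" "cube_insert i e x \<in> standard_cube n" if "x \<in> standard_cube (n - 1)" for x
    by (rule cube_insert_cube[OF that]; use assms in auto)+
  then show ?thesis
    using cube_insert_commute[OF assms(1,2), of e e']
    by (intro ext) (simp add: cube_face_def)
qed

text \<open>The correspondence between (i, j) with i \<le> j and (j + 1, i) pairs off all terms with
  opposite signs.\<close>

lemma alternating_double_sum:
  fixes t :: "nat \<Rightarrow> nat \<Rightarrow> 'g::ab_group_add"
  assumes "\<And>i j. 1 \<le> i \<Longrightarrow> i \<le> j \<Longrightarrow> j \<le> n \<Longrightarrow> t (Suc j) i = - t i j"
  shows "(\<Sum>i\<in>{1..Suc n}. \<Sum>j\<in>{1..n}. t i j) = 0"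
proof -
  let ?A = "{(i, j). 1 \<le> i \<and> i \<le> j \<and> j \<le> n}" and ?B = "{(i, j). 1 \<le> j \<and> j < i \<and> i \<le> Suc n}"
  have fin: "finite ?A" "finite ?B"
    by (auto intro: finite_subset[of _ "{..Suc n} \<times> {..Suc n}"])
  have "(\<Sum>i\<in>{1..Suc n}. \<Sum>j\<in>{1..n}. t i j) = (\<Sum>(i, j)\<in>?A \<union> ?B. t i j)"
    unfolding sum.cartesian_product by (rule sum.cong) auto
  also have "\<dots> = (\<Sum>(i, j)\<in>?A. t i j) + (\<Sum>(i, j)\<in>?B. t i j)"
    by (rule sum.union_disjoint[OF fin]) auto
  also have "(\<Sum>(i, j)\<in>?B. t i j) = (\<Sum>(i, j)\<in>?A. t (Suc j) i)"
    by (rule sum.reindex_bij_witness[of _ "\<lambda>(i, j). (Suc j, i)" "\<lambda>(i, j). (j, i - 1)"]) auto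
  also have "\<dots> = (\<Sum>(i, j)\<in>?A. - t i j)"
    by (rule sum.cong) (auto simp: assms)
  also have "(\<Sum>(i, j)\<in>?A. t i j) + (\<Sum>(i, j)\<in>?A. - t i j) = 0"
    by (simp add: split_def sum_negf)
  finally show ?thesis .
qed

lemma cbd_cbd: "frag_extend (cbd (n - 1)) (cbd n c) = 0"
proof (cases n)
  case (Suc m)
  let ?t = "\<lambda>i j. \<Sum>e\<in>{0, 1::nat}. \<Sum>e'\<in>{0, 1::nat}.
     frag_cmul ((-1) ^ (i + e + j + e')) (frag_of (cube_face m j (real e') (cube_face (Suc m) i (real e) c)))"
  have "frag_extend (cbd (n - 1)) (cbd n c) = (\<Sum>i\<in>{1..Suc m}. \<Sum>e\<in>{0, 1::nat}. \<Sum>j\<in>{1..m}. \<Sum>e'\<in>{0, 1::nat}.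
     frag_cmul ((-1) ^ (i + e + j + e')) (frag_of (cube_face m j (real e') (cube_face (Suc m) i (real e) c))))"
    unfolding Suc cbd_def frag_extend_sum' frag_extend_cmul frag_extend_of frag_cmul_sum frag_cmul_cmul
    by (simp only: power_add diff_Suc_1 mult.assoc)
  also have "\<dots> = (\<Sum>i\<in>{1..Suc m}. \<Sum>j\<in>{1..m}. ?t i j)"
    by (rule sum.cong[OF refl], rule sum.swap)
  also have "\<dots> = 0"
  proof (rule alternating_double_sum)
    fix i j assume ij: "1 \<le> i" "i \<le> j" "j \<le> m"
    have "?t (Suc j) i = (\<Sum>e'\<in>{0, 1::nat}. \<Sum>e\<in>{0, 1::nat}.
       frag_cmul ((-1) ^ (Suc j + e + i + e')) (frag_of (cube_face m i (real e') (cube_face (Suc m) (Suc j) (real e) c))))"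
      by (rule sum.swap)
    also have "\<dots> = (\<Sum>e'\<in>{0, 1::nat}. \<Sum>e\<in>{0, 1::nat}.
       - frag_cmul ((-1) ^ (i + e' + j + e)) (frag_of (cube_face m j (real e) (cube_face (Suc m) i (real e') c))))"
    proof (intro sum.cong refl)
      fix e e' :: nat assume "e \<in> {0, 1}" "e' \<in> {0, 1}"
      then have "cube_face m j (real e) (cube_face (Suc m) i (real e') c) = cube_face m i (real e') (cube_face (Suc m) (Suc j) (real e) c)"
        by (intro cube_face_face ij) auto
      moreover have "(-1::int) ^ (Suc j + e + i + e') = - ((-1) ^ (i + e' + j + e))"
        by (simp add: power_add)
      ultimately show "frag_cmul ((-1) ^ (Suc j + e + i + e')) (frag_of (cube_face m i (real e') (cube_face (Suc m) (Suc j) (real e) c))) =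
        - frag_cmul ((-1) ^ (i + e' + j + e)) (frag_of (cube_face m j (real e) (cube_face (Suc m) i (real e') c)))"
        by (simp only: minus_frag_cmul)
    qed
    finally show "?t (Suc j) i = - ?t i j" by (simp only: sum_negf)
  qed
  finally show ?thesis .
qed (simp add: cbd_def)

lemma cube_face_degenerate:
  assumes "c \<in> cgen X n" "k < n" "\<And>x. x \<in> standard_cube n \<Longrightarrow> c (x(k := 0)) = c x"
    and "1 \<le> i" "i \<le> n" "i \<noteq> Suc k" "e \<in> {0, 1}"
  shows "cube_face n i e c \<in> cdgen X (n - 1)"
proof (rule cdgenI)
  \<comment> \<open>The removed place i has index i - 1; if this lies before the degenerate
    coordinate k, that coordinate moves down by one.\<close>
  let ?k = "if i \<le> k then k - 1 else k"
  show "cube_face n i e c \<in> cgen X (n - 1)" using assms by (intro cube_face_cgen) auto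
  show "?k < n - 1" using assms by auto
  fix x assume x: "x \<in> standard_cube (n - 1)"
  have "cube_insert i e (x(?k := 0)) = (cube_insert i e x)(k := 0)"
  proof
    fix j
    show "cube_insert i e (x(?k := 0)) j = ((cube_insert i e x)(k := 0)) j"
    proof (cases "i \<le> k")
      case True
      then obtain k' where k: "k = Suc k'" using assms(4) by (cases k) auto
      have "i \<le> j \<Longrightarrow> \<exists>j'. j = Suc j'" using assms(4) by (cases j) auto
      then consider "Suc j < i" | "Suc j = i" | j' where "j = Suc j'" "i \<le> j" by fastforce
      then show ?thesis using True assms(4) k by cases (auto simp: cube_insert_def)
    next
      case False
      then have "j - 1 \<noteq> k" "j \<noteq> k" if "j \<ge> i" using that assms(6) by linarith+
      then show ?thesis using False assms(6) by (simp add: cube_insert_def)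
    qed
  qed
  moreover have "cube_insert i e x \<in> standard_cube n" using assms by (intro cube_insert_cube[OF x]) auto
  ultimately show "cube_face n i e c (x(?k := 0)) = cube_face n i e c x"
    using assms(3) x cube_upd[OF x] by (simp add: cube_face_def)
qed

text \<open>The two faces in the degenerate direction coincide and cancel; all others are still
  independent of a coordinate.\<close>

lemma cbd_cdgen:
  assumes "c \<in> cdgen X n"
  shows "cbd n c \<in> chains_on (cdgen X (n - 1))"
proof -
  obtain k where k: "c \<in> cgen X n" "k < n" "\<And>x. x \<in> standard_cube n \<Longrightarrow> c (x(k := 0)) = c x"
    using assms by (elim cdgenE) blast
  have eq: "cube_face n (Suc k) 0 c = cube_face n (Suc k) 1 c"
  proof -
    have "c (cube_insert (Suc k) 0 x) = c (cube_insert (Suc k) 1 x)" if "x \<in> standard_cube (n - 1)" for x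
    proof -
      have "cube_insert (Suc k) 1 x \<in> standard_cube n" using k(2) by (intro cube_insert_cube[OF that]) auto
      moreover have "(cube_insert (Suc k) 1 x)(k := 0) = cube_insert (Suc k) 0 x"
        by (auto simp: cube_insert_def fun_eq_iff)
      ultimately show ?thesis using k(3)[of "cube_insert (Suc k) 1 x"] by simp
    qed
    then show ?thesis by (intro ext) (simp add: cube_face_def)
  qed
  show ?thesis
    unfolding cbd_alt
  proof (rule chains_sum)
    fix i assume i: "i \<in> {1..n}"
    show "frag_cmul ((-1) ^ i) (frag_of (cube_face n i 0 c) - frag_of (cube_face n i 1 c)) \<in> chains_on (cdgen X (n - 1))"
    proof (cases "i = Suc k")
      case True then show ?thesis by (simp only: eq) simp
    next
      case False
      then show ?thesis using i by (intro chains_cmul chains_diff) (auto intro!: cube_face_degenerate[OF k] simp del: One_nat_def)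
    qed
  qed
qed

subsection \<open>The cross product\<close>

definition cfst :: "nat \<Rightarrow> (nat \<Rightarrow> real) \<Rightarrow> nat \<Rightarrow> real" where
  "cfst p x = (\<lambda>i. if i < p then x i else 0)"

definition csnd :: "nat \<Rightarrow> (nat \<Rightarrow> real) \<Rightarrow> nat \<Rightarrow> real" where
  "csnd p x = (\<lambda>i. x (p + i))"

lemma cfst_cube: "x \<in> standard_cube (p + q) \<Longrightarrow> cfst p x \<in> standard_cube p"
  by (auto simp: standard_cube_def cfst_def)

lemma csnd_cube: "x \<in> standard_cube (p + q) \<Longrightarrow> csnd p x \<in> standard_cube q"
  by (auto simp: standard_cube_def csnd_def)

lemma continuous_map_cfst: "continuous_map (cube_top (p + q)) (cube_top p) (cfst p)"
  unfolding continuous_map_cube using cfst_cube continuous_map_coord by (auto simp: cfst_def)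

lemma continuous_map_csnd: "continuous_map (cube_top (p + q)) (cube_top q) (csnd p)"
  unfolding continuous_map_cube using csnd_cube continuous_map_coord by (auto simp: csnd_def)

lemma cross_cubes_alt: "cross_cubes pr p q c d = restrict (\<lambda>x. pr (c (cfst p x), d (csnd p x))) (standard_cube (p + q))"
  by (simp add: cross_cubes_def cfst_def csnd_def)

lemma cross_cubes_cgen:
  assumes "inj pr" "c \<in> cgen X p" "d \<in> cgen Y q"
  shows "cross_cubes pr p q c d \<in> cgen (prod_space pr X Y) (p + q)"
proof -
  have "continuous_map (cube_top (p + q)) X (c \<circ> cfst p)" "continuous_map (cube_top (p + q)) Y (d \<circ> csnd p)"
    using assms continuous_map_compose[OF continuous_map_cfst[of p q]] continuous_map_compose[OF continuous_map_csnd[of p q]]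
    by (auto simp: cgen_def singular_cube_def)
  then have "continuous_map (cube_top (p + q)) (prod_space pr X Y) (cross_cubes pr p q c d)"
    by (rule continuous_map_into_prod[OF assms(1)]) (simp add: cross_cubes_alt)
  then show ?thesis by (simp add: cgen_def singular_cube_def cross_cubes_alt)
qed

lemma cross_cubes_cdgen1:
  assumes "inj pr" "c \<in> cdgen X p" "d \<in> cgen Y q"
  shows "cross_cubes pr p q c d \<in> cdgen (prod_space pr X Y) (p + q)"
proof -
  obtain k where k: "c \<in> cgen X p" "k < p" "\<And>x. x \<in> standard_cube p \<Longrightarrow> c (x(k := 0)) = c x"
    using assms(2) by (elim cdgenE) blast
  show ?thesis
  proof (rule cdgenI[OF cross_cubes_cgen[OF assms(1) k(1) assms(3)]])
    show "k < p + q" using k(2) by simp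
    fix x assume x: "x \<in> standard_cube (p + q)"
    have "cfst p (x(k := 0)) = (cfst p x)(k := 0)" "csnd p (x(k := 0)) = csnd p x"
      using k(2) by (auto simp: cfst_def csnd_def fun_eq_iff)
    then show "cross_cubes pr p q c d (x(k := 0)) = cross_cubes pr p q c d x"
      using x cube_upd[OF x] k(3)[OF cfst_cube[OF x]] by (simp add: cross_cubes_alt)
  qed
qed

lemma cross_cubes_cdgen2:
  assumes "inj pr" "c \<in> cgen X p" "d \<in> cdgen Y q"
  shows "cross_cubes pr p q c d \<in> cdgen (prod_space pr X Y) (p + q)"
proof -
  obtain k where k: "d \<in> cgen Y q" "k < q" "\<And>x. x \<in> standard_cube q \<Longrightarrow> d (x(k := 0)) = d x"
    using assms(3) by (elim cdgenE) blast
  show ?thesis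
  proof (rule cdgenI[OF cross_cubes_cgen[OF assms(1,2) k(1)]])
    show "p + k < p + q" using k(2) by simp
    fix x assume x: "x \<in> standard_cube (p + q)"
    have "cfst p (x(p + k := 0)) = cfst p x" "csnd p (x(p + k := 0)) = (csnd p x)(k := 0)"
      by (auto simp: cfst_def csnd_def fun_eq_iff)
    then show "cross_cubes pr p q c d (x(p + k := 0)) = cross_cubes pr p q c d x"
      using x cube_upd[OF x] k(3)[OF csnd_cube[OF x]] by (simp add: cross_cubes_alt)
  qed
qed

lemma cube_face_cross1:
  assumes "1 \<le> i" "i \<le> p" "e \<in> {0, 1}"
  shows "cube_face (p + q) i e (cross_cubes pr p q c d) = cross_cubes pr (p - 1) q (cube_face p i e c) d"
proof -
  have pq: "p + q - 1 = p - 1 + q" using assms by auto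
  have "cross_cubes pr p q c d (cube_insert i e x) = pr (cube_face p i e c (cfst (p - 1) x), d (csnd (p - 1) x))"
    if x: "x \<in> standard_cube (p - 1 + q)" for x
  proof -
    have "cube_insert i e x \<in> standard_cube (p + q)" using assms x pq by (intro cube_insert_cube) auto
    moreover have "cfst p (cube_insert i e x) = cube_insert i e (cfst (p - 1) x)" "csnd p (cube_insert i e x) = csnd (p - 1) x"
      using assms by (auto simp: cfst_def csnd_def cube_insert_def fun_eq_iff)
    ultimately show ?thesis using cfst_cube[OF x] by (simp add: cross_cubes_alt cube_face_def)
  qed
  then show ?thesis unfolding cube_face_def[of "p + q"] pq cross_cubes_alt[of pr "p - 1"]
    by (auto simp: fun_eq_iff restrict_def)
qed

lemma cube_face_cross2:
  assumes "1 \<le> i" "i \<le> q" "e \<in> {0, 1}"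
  shows "cube_face (p + q) (p + i) e (cross_cubes pr p q c d) = cross_cubes pr p (q - 1) c (cube_face q i e d)"
proof -
  have pq: "p + q - 1 = p + (q - 1)" using assms by auto
  have "cross_cubes pr p q c d (cube_insert (p + i) e x) = pr (c (cfst p x), cube_face q i e d (csnd p x))"
    if x: "x \<in> standard_cube (p + (q - 1))" for x
  proof -
    have "cube_insert (p + i) e x \<in> standard_cube (p + q)" using assms x pq by (intro cube_insert_cube) auto
    moreover have "cfst p (cube_insert (p + i) e x) = cfst p x" "csnd p (cube_insert (p + i) e x) = cube_insert i e (csnd p x)"
      using assms by (auto simp: cfst_def csnd_def cube_insert_def fun_eq_iff)
    ultimately show ?thesis using csnd_cube[OF x] by (simp add: cross_cubes_alt cube_face_def)
  qed
  then show ?thesis unfolding cube_face_def[of "p + q"] pq cross_cubes_alt[of pr p "q - 1"]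
    by (auto simp: fun_eq_iff restrict_def)
qed

text \<open>The first p directions belong to \<open>c\<close>. Those of \<open>d\<close> come with
  their number raised by p, which produces the sign of the Leibniz rule.\<close>

lemma cbd_cross:
  "cbd (p + q) (cross_cubes pr p q c d) =
    frag_extend (\<lambda>c'. ccr pr (p - 1) q c' d) (cbd p c) + frag_cmul ((-1) ^ p) (frag_extend (ccr pr p (q - 1) c) (cbd q d))"
proof -
  let ?f = "\<lambda>i. frag_cmul ((-1) ^ i) (frag_of (cube_face (p + q) i 0 (cross_cubes pr p q c d)) - frag_of (cube_face (p + q) i 1 (cross_cubes pr p q c d)))"
  have "cbd (p + q) (cross_cubes pr p q c d) = sum ?f {1..p} + sum ?f {p + 1..p + q}"
    unfolding cbd_alt by (subst sum.union_disjoint[symmetric]) (auto intro!: sum.cong)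
  also have "sum ?f {1..p} = frag_extend (\<lambda>c'. ccr pr (p - 1) q c' d) (cbd p c)"
    unfolding cbd_alt frag_extend_sum'
    by (rule sum.cong) (auto simp: frag_lin ccr_def cube_face_cross1)
  also have "sum ?f {p + 1..p + q} = (\<Sum>i\<in>{1..q}. ?f (p + i))"
    by (rule sum.reindex_bij_witness[of _ "\<lambda>i. p + i" "\<lambda>i. i - p"]) auto
  also have "\<dots> = frag_cmul ((-1) ^ p) (frag_extend (ccr pr p (q - 1) c) (cbd q d))"
    unfolding cbd_alt frag_extend_sum' frag_cmul_sum
    by (rule sum.cong) (auto simp: frag_lin ccr_def cube_face_cross2 power_add)
  finally show ?thesis .
qed

lemma cross_cubes_cmap:
  assumes "inj pr"
  shows "cross_cubes pr p q (cmap p f c) (cmap q g d) = cmap (p + q) (prod_map pr f g) (cross_cubes pr p q c d)"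
  using assms cfst_cube csnd_cube
  by (auto simp: cross_cubes_alt cmap_def fun_eq_iff restrict_def prod_map_def)

lemma cross_cubes_assoc:
  assumes "inj pr"
  shows "cmap (p + q + r) (prod_assoc pr) (cross_cubes pr (p + q) r (cross_cubes pr p q c d) z) =
    cross_cubes pr p (q + r) c (cross_cubes pr q r d z)"
proof -
  have "cfst p (cfst (p + q) x) = cfst p x" "csnd p (cfst (p + q) x) = cfst q (csnd p x)" "csnd (p + q) x = csnd q (csnd p x)" for x
    by (auto simp: cfst_def csnd_def fun_eq_iff add.assoc)
  moreover have "cfst (p + q) x \<in> standard_cube (p + q)" "csnd p x \<in> standard_cube (q + r)" if "x \<in> standard_cube (p + q + r)" for x
    using cfst_cube[OF that] csnd_cube[of x p "q + r"] that by (auto simp: add.assoc)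
  ultimately show ?thesis
    using assms by (intro ext) (auto simp: cmap_def cross_cubes_alt add.assoc)
qed

lemma cross_cubes_unit1:
  assumes "inj pr" "c \<in> cgen X n"
  shows "cmap n (snd \<circ> unpair pr) (cross_cubes pr 0 n (cpt pt) c) = c"
proof -
  have "csnd 0 x = x" for x by (simp add: csnd_def)
  then show ?thesis
    using assms(1) cgen_ext[OF assms(2)] by (intro ext) (auto simp: cmap_def cross_cubes_alt extensional_def)
qed

lemma cross_cubes_unit2:
  assumes "inj pr" "c \<in> cgen X n"
  shows "cmap n (fst \<circ> unpair pr) (cross_cubes pr n 0 c (cpt pt)) = c"
proof -
  have "cfst n x = x" if "x \<in> standard_cube n" for x using that by (auto simp: cfst_def standard_cube_def)
  then show ?thesis
    using assms(1) cgen_ext[OF assms(2)] by (intro ext) (auto simp: cmap_def cross_cubes_alt extensional_def)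
qed

lemma cmap_id: "c \<in> cgen X n \<Longrightarrow> (\<And>y. y \<in> topspace X \<Longrightarrow> f y = y) \<Longrightarrow> cmap n f c = c"
  using cgen_ext[of c X n] cgen_mem[of c X n] by (auto simp: cmap_def fun_eq_iff extensional_def)

lemma cmap_cong: "c \<in> cgen X n \<Longrightarrow> (\<And>y. y \<in> topspace X \<Longrightarrow> f y = g y) \<Longrightarrow> cmap n f c = cmap n g c"
  using cgen_mem[of c X n] by (auto simp: cmap_def fun_eq_iff restrict_def)

lemma cmap_comp: "cmap n (g \<circ> f) c = cmap n g (cmap n f c)"
  by (auto simp: cmap_def fun_eq_iff)

lemma cpt_cgen: "cpt pt \<in> cgen (point_space pt) 0"
  by (auto simp: cpt_def cgen_def singular_cube_def point_space_def)

lemma cubical_top_chains: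
  assumes "inj pr"
  shows "top_chains pr pt cgen cdgen cbd cmap (ccr pr) (cpt pt)"
proof (rule top_chains.intro)
  show "inj pr" by fact
  show "chain_data (cgen X) (cdgen X) cbd" for X :: "'a topology"
    by (rule chain_data.intro) (rule cbd_cgen cbd_cdgen cbd_0 | assumption | simp add: cbd_cbd cdgen_def del: One_nat_def)+
  show "ccr pr p q x y \<in> chains_on (cgen (prod_space pr X Y) (p + q))" if "x \<in> cgen X p" "y \<in> cgen Y q" for x y X Y p q
    using cross_cubes_cgen[OF assms that] by (simp add: ccr_def)
  show "ccr pr p q x y \<in> chains_on (cdgen (prod_space pr X Y) (p + q))" if "x \<in> cdgen X p" "y \<in> cgen Y q" for x y X Y p q
    using cross_cubes_cdgen1[OF assms that] by (simp add: ccr_def)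
  show "ccr pr p q x y \<in> chains_on (cdgen (prod_space pr X Y) (p + q))" if "x \<in> cgen X p" "y \<in> cdgen Y q" for x y X Y p q
    using cross_cubes_cdgen2[OF assms that] by (simp add: ccr_def)
  show "frag_extend (cbd (p + q)) (ccr pr p q x y) =
     frag_extend (\<lambda>x'. ccr pr (p - 1) q x' y) (cbd p x) + frag_cmul ((- 1) ^ p) (frag_extend (ccr pr p (q - 1) x) (cbd q y))" for p q x y
    using cbd_cross by (simp add: ccr_def)
  show "cmap n f x = cmap n g x" if "x \<in> cgen X n" "\<And>y. y \<in> topspace X \<Longrightarrow> f y = g y" for x X n f g
    using that by (rule cmap_cong)
  show "cmap n (\<lambda>x. x) x = x" if "x \<in> cgen X n" for x X n
    using that by (rule cmap_id) simp
  show "cmap n (g \<circ> f) x = cmap n g (cmap n f x)" for n f g x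
    by (rule cmap_comp)
qed (auto simp: ccr_def cross_cubes_cmap[OF assms] cross_cubes_assoc[OF assms] cross_cubes_unit1[OF assms] cross_cubes_unit2[OF assms]
     cpt_cgen cbd_cmap intro: cmap_cgen cmap_cdgen)

lemma cubical_functor_alt:
  "cubical_functor pr pt = qfunctor pr pt cgen cdgen cbd cmap (ccr pr) (cpt pt)"
proof -
  have c: "cubes X n = int_graded (cgen X) n" "{c \<in> cubes X n. degenerate_cube (nat n) c} = int_graded (cdgen X) n" for X :: "'a topology" and n
    by (auto simp: cubes_def int_graded_def cgen_def cdgen_def)
  have g: "cube_group X n = free_int_graded cgen X n" for X :: "'a topology" and n
    by (simp add: cube_group_def free_int_graded_def c)
  have d: "degenerate_chains X n = degen_span cgen cdgen X n" for X :: "'a topology" and n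
    by (simp only: degenerate_chains_def degen_span_def c(2) g)
  have q: "cube_class X n c = qclass cgen cdgen X n c" for X :: "'a topology" and n c
    by (simp add: cube_class_def qclass_def g d)
  have b: "cubical_boundary p = frag_extend (cbd p)" for p
    unfolding cubical_boundary_def cbd_def[abs_def] ..
  have x: "cubical_complex X = qcomplex cgen cdgen cbd X" for X :: "'a topology"
    by (simp add: cubical_complex_def qcomplex_def g d q b)
  have m: "cube_map p f = fmap (cmap p f)" for p and f :: "'a \<Rightarrow> 'a"
    unfolding cube_map_def fmap_def cmap_def[abs_def] ..
  have k: "cross_product pr p q a b = frag_extend (\<lambda>x. frag_extend (ccr pr p q x) b) a" for p q a b
    unfolding cross_product_def ccr_def[abs_def] ..
  show ?thesis
    by (simp add: cubical_functor_def qfunctor_def x[abs_def] q m k cpt_def)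
qed

section \<open>The shuffle triangulation of the cube and the induced map to singular chains\<close>

section \<open>Triangulation of cubes\<close>

text \<open>The vertices of the cube are lists of bits; the triangulation is the iterated shuffle product of
  the edge.\<close>

primrec cube_triangulation :: "nat \<Rightarrow> bool list list \<Rightarrow>\<^sub>0 int" where
  "cube_triangulation 0 = frag_of [[]]"
| "cube_triangulation (Suc n) = fmap (map (\<lambda>(a, b). a # b)) (frag_extend (ez [False, True]) (cube_triangulation n))"

text \<open>The vertex map of a face inclusion. Positions of bits are counted from 0, those in
  \<open>cube_insert\<close> from 1.\<close>

definition bins :: "nat \<Rightarrow> bool \<Rightarrow> bool list \<Rightarrow> bool list" where
  "bins i e b = take i b @ e # drop i b"

lemma bins_0 [simp]: "bins 0 e b = e # b"
  by (simp add: bins_def)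

lemma bins_0_fun: "bins 0 e = Cons e"
  by (rule ext) simp

lemma bins_Suc [simp]: "bins (Suc i) e (a # b) = a # bins i e b"
  by (simp add: bins_def)

text \<open>Vertices increase coordinatewise along each simplex of the triangulation. This
  monotonicity later makes minima of coordinates affine on the simplex.\<close>

lemma cube_triangulation_chains:
  "cube_triangulation n \<in> chains_on {w. length w = Suc n \<and> (\<forall>b\<in>set w. length b = n) \<and> sorted_wrt (list_all2 (\<longrightarrow>)) w}"
proof (induction n)
  case (Suc n)
  have "frag_extend (ez [False, True]) (cube_triangulation n) \<in> chains_on {w. Suc (length w) = 2 + Suc n \<and> (\<forall>(a, b)\<in>set w. length b = n) \<and>
      sorted_wrt (\<lambda>(a, b) (c, d). (a \<longrightarrow> c) \<and> list_all2 (\<longrightarrow>) b d) w}"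
  proof (rule chains_extend[OF Suc])
    fix w assume w: "w \<in> {w. length w = Suc n \<and> (\<forall>b\<in>set w. length b = n) \<and> sorted_wrt (list_all2 (\<longrightarrow>)) w}"
    have "ez [False, True] w \<in> chains_on {w. sorted_wrt (\<lambda>(a, b) (c, d). (a \<longrightarrow> c) \<and> list_all2 (\<longrightarrow>) b d) w}"
      by (rule ez_sorted) (use w in \<open>auto intro: list_all2_refl\<close>)
    from chains_Int[OF this ez_chains] show "ez [False, True] w \<in> chains_on {w. Suc (length w) = 2 + Suc n \<and> (\<forall>(a, b)\<in>set w. length b = n) \<and>
      sorted_wrt (\<lambda>(a, b) (c, d). (a \<longrightarrow> c) \<and> list_all2 (\<longrightarrow>) b d) w}"
      by (rule chains_mono) (use w in auto)
  qed
  then show ?case unfolding cube_triangulation.simps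
    by (rule chains_fmap) (auto simp: sorted_wrt_map split_def)
qed auto

lemma cube_triangulation_chains': "cube_triangulation n \<in> chains_on {w. length w = Suc n}"
  by (rule chains_mono[OF cube_triangulation_chains]) auto

lemma list_boundary_fmap_map: "frag_extend list_boundary (fmap (map f) c) = fmap (map f) (frag_extend list_boundary c)"
  unfolding extend_fmap fmap_extend by (simp add: list_boundary_map)

lemma cube_triangulation_edge_bins:
  "fmap (map (\<lambda>(a, b). a # b)) (frag_extend (ez [False, True]) (fmap (map (bins i e)) c)) =
   fmap (map (bins (Suc i) e)) (fmap (map (\<lambda>(a, b). a # b)) (frag_extend (ez [False, True]) c))"
proof -
  have "ez [False, True] (map (bins i e) w) = fmap (map (map_prod id (bins i e))) (ez [False, True] w)" for w
    using ez_map[of id "[False, True]" "bins i e" w] by simp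
  then show ?thesis
    by (simp add: extend_fmap fmap_extend fmap_fmap comp_def split_def)
qed

text \<open>The Leibniz rule for the leading edge: its two endpoints give the faces in the first
  direction, the rest comes from induction with the direction raised by one and the sign
  reversed.\<close>

lemma list_boundary_cube_triangulation:
  "frag_extend list_boundary (cube_triangulation (Suc n)) = (\<Sum>i<Suc n. frag_cmul ((-1) ^ Suc i)
     (fmap (map (bins i False)) (cube_triangulation n) - fmap (map (bins i True)) (cube_triangulation n)))"
proof (induction n)
  case 0
  show ?case by (simp add: ez_singleton2 frag_lin)
next
  case (Suc n)
  let ?c = "map (\<lambda>(a, b). a # (b :: bool list))" and ?I = "[False, True]"
  have "frag_extend list_boundary (frag_extend (ez ?I) (cube_triangulation (Suc n))) =
     frag_extend (\<lambda>w. frag_of (map (Pair True) w) - frag_of (map (Pair False) w) - frag_extend (ez ?I) (list_boundary w)) (cube_triangulation (Suc n))"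
    unfolding frag_extend_extend
  proof (rule frag_extend_cong[OF cube_triangulation_chains'])
    fix w :: "bool list list" assume "w \<in> {w. length w = Suc (Suc n)}"
    then have w: "w \<noteq> []" "length w = Suc (Suc n)" by auto
    then show "frag_extend list_boundary (ez ?I w) = frag_of (map (Pair True) w) - frag_of (map (Pair False) w) - frag_extend (ez ?I) (list_boundary w)"
      by (subst list_boundary_ez) (auto simp: frag_lin ez_singleton1)
  qed
  also have "\<dots> = fmap (map (Pair True)) (cube_triangulation (Suc n)) - fmap (map (Pair False)) (cube_triangulation (Suc n))
      - frag_extend (ez ?I) (frag_extend list_boundary (cube_triangulation (Suc n)))"
    by (simp only: frag_lin frag_extend_extend fmap_def)
  finally have 1: "frag_extend list_boundary (frag_extend (ez ?I) (cube_triangulation (Suc n))) = \<dots>" .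
  have p: "fmap ?c (fmap (map (Pair e)) (cube_triangulation (Suc n))) = fmap (map (bins 0 e)) (cube_triangulation (Suc n))" for e
    by (simp only: fmap_fmap map_map comp_def prod.case bins_0_fun)
  have "frag_extend list_boundary (cube_triangulation (Suc (Suc n))) = fmap ?c (frag_extend list_boundary (frag_extend (ez ?I) (cube_triangulation (Suc n))))"
    by (simp only: cube_triangulation.simps(2)[of "Suc n"] list_boundary_fmap_map)
  also have "\<dots> = fmap (map (bins 0 True)) (cube_triangulation (Suc n)) - fmap (map (bins 0 False)) (cube_triangulation (Suc n))
      - (\<Sum>i<Suc n. frag_cmul ((-1) ^ Suc i)
     (fmap (map (bins (Suc i) False)) (cube_triangulation (Suc n)) - fmap (map (bins (Suc i) True)) (cube_triangulation (Suc n))))"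
    unfolding 1 Suc fmap_lin p
    by (simp only: frag_extend_sum' fmap_sum frag_lin fmap_lin cube_triangulation_edge_bins cube_triangulation.simps(2)[of n])
  also have "\<dots> = (\<Sum>i<Suc (Suc n). frag_cmul ((-1) ^ Suc i)
     (fmap (map (bins i False)) (cube_triangulation (Suc n)) - fmap (map (bins i True)) (cube_triangulation (Suc n))))"
    by (subst sum.lessThan_Suc_shift[of _ "Suc n"]) (simp add: sum_negf[symmetric] del: sum.lessThan_Suc cube_triangulation.simps)
  finally show ?case .
qed

text \<open>An iterated product may be bracketed at any place, by \<open>ez_assoc\<close>. This is
  the reason why triangulation is strictly multiplicative.\<close>

lemma cube_triangulation_append:
  "cube_triangulation (p + q) = fmap (map (\<lambda>(a, b). a @ b)) (frag_extend (\<lambda>u. frag_extend (ez u) (cube_triangulation q)) (cube_triangulation p))"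
proof (induction p)
  case 0
  have "frag_extend (ez [[] :: bool list]) (cube_triangulation q) = frag_extend (\<lambda>w. frag_of (map (Pair []) w)) (cube_triangulation q)"
    by (rule frag_extend_cong[OF cube_triangulation_chains']) (auto simp: ez_singleton1)
  then have "frag_extend (ez [[] :: bool list]) (cube_triangulation q) = fmap (map (Pair [])) (cube_triangulation q)" by (simp only: fmap_def)
  then show ?case by (simp add: fmap_fmap comp_def)
next
  case (Suc p)
  let ?I = "[False, True]" and ?A = "\<lambda>a :: bool list \<times> bool list. fst a @ snd a"
    and ?C = "\<lambda>a :: bool \<times> bool list. fst a # snd a"
  have e1: "ez ?I (map ?A w) = fmap (map (map_prod id ?A)) (ez ?I w)" for w
    using ez_map[of id ?I ?A w] by simp
  have e2: "ez (map ?C w) v = fmap (map (map_prod ?C id)) (ez w v)" for w and v :: "bool list list"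
    using ez_map[of ?C w id v] by simp
  have "cube_triangulation (Suc p + q) = fmap (map (\<lambda>(a, b, c). a # b @ c)) (frag_extend (\<lambda>u. frag_extend (\<lambda>v. frag_extend (ez ?I) (ez u v)) (cube_triangulation q)) (cube_triangulation p))"
    by (simp add: Suc extend_fmap e1 fmap_extend fmap_fmap frag_extend_extend comp_def split_def)
  also have "\<dots> = fmap (map (\<lambda>((a, b), c). a # b @ c)) (frag_extend (\<lambda>u. frag_extend (\<lambda>v. frag_extend (\<lambda>w. ez w v) (ez ?I u)) (cube_triangulation q)) (cube_triangulation p))"
    by (simp add: ez_assoc[symmetric] fmap_extend fmap_fmap comp_def reassoc_def split_def)
  also have "\<dots> = fmap (map (\<lambda>((a, b), c). a # b @ c)) (frag_extend (\<lambda>u. frag_extend (\<lambda>w. frag_extend (ez w) (cube_triangulation q)) (ez ?I u)) (cube_triangulation p))"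
    by (simp add: frag_extend_commute[of _ "ez ?I _" "cube_triangulation q"])
  also have "\<dots> = fmap (map (\<lambda>(a, b). a @ b)) (frag_extend (\<lambda>u. frag_extend (ez u) (cube_triangulation q)) (cube_triangulation (Suc p)))"
    by (simp add: extend_fmap e2 fmap_extend fmap_fmap frag_extend_extend comp_def split_def)
  finally show ?case .
qed

text \<open>Clearing one bit turns an edge factor into a repeated vertex, and a product with a
  degenerate factor has only degenerate terms.\<close>

lemma cube_triangulation_update:
  "i < n \<Longrightarrow> fmap (map (\<lambda>b. b[i := False])) (cube_triangulation n) \<in> chains_on (Collect adjdup)"
proof (induction n arbitrary: i)
  case (Suc n)
  show ?case
  proof (cases i)
    case 0
    have "ez [False, False] w = fmap (map (map_prod (\<lambda>a. False) id)) (ez [False, True] w)" for w :: "bool list list"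
      using ez_map[of "\<lambda>a. False" "[False, True]" id w] by simp
    then have "fmap (map (\<lambda>b. b[i := False])) (cube_triangulation (Suc n)) = fmap (map (\<lambda>(a, b). a # b)) (frag_extend (ez [False, False]) (cube_triangulation n))"
      by (simp add: 0 extend_fmap fmap_extend fmap_fmap comp_def split_def)
    also have "\<dots> \<in> chains_on (Collect adjdup)"
      by (rule chains_fmap[OF chains_extend[of _ UNIV]]) (auto intro: ez_adjdup1 adjdup_map)
    finally show ?thesis .
  next
    case (Suc k)
    have "ez [False, True] (map (\<lambda>b. b[k := False]) w) = fmap (map (map_prod id (\<lambda>b. b[k := False]))) (ez [False, True] w)" for w
      using ez_map[of id "[False, True]" "\<lambda>b. b[k := False]" w] by simp
    then have "fmap (map (\<lambda>b. b[i := False])) (cube_triangulation (Suc n)) = fmap (map (\<lambda>(a, b). a # b)) (frag_extend (ez [False, True])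
        (fmap (map (\<lambda>b. b[k := False])) (cube_triangulation n)))"
      by (simp add: Suc extend_fmap fmap_extend fmap_fmap comp_def split_def)
    also have "\<dots> \<in> chains_on (Collect adjdup)"
      by (rule chains_fmap[OF chains_extend[OF Suc.IH]]) (use Suc Suc.prems in \<open>auto intro: ez_adjdup2 adjdup_map\<close>)
    finally show ?thesis .
  qed
qed simp

definition ones :: "bool list \<Rightarrow> nat" where
  "ones b = length (takeWhile id b)"

lemma ones_simps [simp]: "ones [] = 0" "ones (a # b) = (if a then Suc (ones b) else 0)"
  by (simp_all add: ones_def)

text \<open>A path that does not set the first bit at once begins with two vertices without leading
  ones, a repetition. Recursively, only the path setting the bits from left to right survives; it
  has sign +1, and its counts run through 0, ..., n.\<close>

lemma cube_triangulation_ones: "fmap (map ones) (cube_triangulation n) - frag_of [0..<Suc n] \<in> chains_on (Collect adjdup)"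
proof (induction n)
  case (Suc n)
  let ?N = "map (\<lambda>(a, b). ones (a # b))"
  have 1: "fmap ?N (ez [False, True] w) - frag_of (0 # map Suc (map ones w)) \<in> chains_on (Collect adjdup)"
    if l: "w \<in> {w. length w = Suc n}" for w
  proof -
    obtain v ws where w: "w = v # ws" using l by (cases w) auto
    have "fcons (False, v) (ez [False, True] ws) \<in> chains_on {w. adjdup (?N w)}"
    proof (cases "ws = []")
      case False
      show ?thesis
      proof (rule chains_fcons[OF ez_hd])
        fix z assume z: "z \<in> {w. w \<noteq> [] \<and> hd w = (hd [False, True], hd ws)}"
        then obtain b z' where "z = (False, b) # z'" by (cases z) auto
        then show "(False, v) # z \<in> {w. adjdup (?N w)}" by simp
      qed
    qed simp
    then have "fmap ?N (fcons (False, v) (ez [False, True] ws)) \<in> chains_on (Collect adjdup)"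
      by (rule chains_fmap) simp
    moreover have "fmap ?N (ez [False, True] w) - frag_of (0 # map Suc (map ones w)) =
       - fmap ?N (fcons (False, v) (ez [False, True] ws))"
      by (simp add: w ez_Cons ez_singleton1 comp_def)
    ultimately show ?thesis by simp
  qed
  have "frag_extend (\<lambda>w. fmap ?N (ez [False, True] w) - frag_of (0 # map Suc (map ones w))) (cube_triangulation n) \<in> chains_on (Collect adjdup)"
    by (rule chains_extend[OF cube_triangulation_chains' 1])
  moreover have "fmap (map ones) (cube_triangulation (Suc n)) = frag_extend (\<lambda>w. fmap ?N (ez [False, True] w)) (cube_triangulation n)"
    by (simp add: fmap_fmap fmap_extend comp_def split_def del: ones_simps)
  ultimately have A: "fmap (map ones) (cube_triangulation (Suc n)) - fmap (\<lambda>w. 0 # map Suc w) (fmap (map ones) (cube_triangulation n)) \<in> chains_on (Collect adjdup)"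
    by (simp add: frag_lin fmap_fmap) (simp add: fmap_def)
  have B: "fmap (\<lambda>w. 0 # map Suc w) (fmap (map ones) (cube_triangulation n) - frag_of [0..<Suc n]) \<in> chains_on (Collect adjdup)"
    by (rule chains_fmap[OF Suc]) (auto intro: adjdup_Cons adjdup_map)
  have "0 # map Suc [0..<Suc n] = [0..<Suc (Suc n)]"
    by (simp only: map_Suc_upt upt_conv_Cons[of 0 "Suc (Suc n)"])
  then show ?case using chains_add[OF A B] by (simp del: upt_Suc cube_triangulation.simps)
qed simp

subsection \<open>The triangulation map\<close>

definition bvec :: "bool list \<Rightarrow> nat \<Rightarrow> real" where
  "bvec b i = (if i < length b \<and> b ! i then 1 else 0)"

definition realize_bits :: "((nat \<Rightarrow> real) \<Rightarrow> 'u) \<Rightarrow> bool list list \<Rightarrow> (nat \<Rightarrow> real) \<Rightarrow> 'u" where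
  "realize_bits c w = affine_simplex c (map bvec w)"

definition triangulate :: "nat \<Rightarrow> ((nat \<Rightarrow> real) \<Rightarrow> 'u) \<Rightarrow> 'u chain" where
  "triangulate n c = fmap (realize_bits c) (cube_triangulation n)"

lemma realization_realize_bits: "realization (realize_bits c)"
proof -
  have "map (nth (map bvec u)) bs = map bvec (map (nth u) bs)" if "set bs \<subseteq> {..<length u}" for u bs
    using that by auto
  then show ?thesis by (simp add: realization_def realize_bits_def affine_simplex_affine_simplex del: map_map)
qed

lemma bvec_cube: "length b = n \<Longrightarrow> bvec b \<in> standard_cube n"
  by (auto simp: bvec_def standard_cube_def)

lemma aff_cube:
  assumes "set w \<subseteq> standard_cube n" "w \<noteq> []" "x \<in> standard_simplex (length w - 1)"
  shows "aff w x \<in> standard_cube n"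
proof -
  have x: "0 \<le> x k" for k using assms by (auto simp: standard_simplex_def)
  have w: "w ! k \<in> standard_cube n" if "k < length w" for k using assms(1) nth_mem[OF that] by auto
  have s: "(\<Sum>k<length w. x k) = 1" using assms by (intro sum_simplex) auto
  have "(\<Sum>k<length w. x k * (w ! k) i) \<le> (\<Sum>k<length w. x k * 1)" for i
    by (intro sum_mono mult_left_mono) (use x cube_coord[OF w] in auto)
  then show ?thesis
    using x cube_coord[OF w] cube_zero[OF w] s by (auto simp: standard_cube_def aff_def intro!: sum_nonneg sum.neutral)
qed

lemma set_map_bvec: "(\<forall>b\<in>set w. length b = n) \<Longrightarrow> set (map bvec w) \<subseteq> standard_cube n"
  by (auto simp: bvec_cube)

lemma realize_bits_cong:
  assumes "length w = length w'" "\<And>x. x \<in> standard_simplex (length w - 1) \<Longrightarrow> c (aff (map bvec w) x) = d (aff (map bvec w') x)"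
  shows "realize_bits c w = realize_bits d w'"
  unfolding realize_bits_def affine_simplex_def using assms by (intro ext) simp

lemma realize_bits_sgen:
  assumes "c \<in> cgen X n" "length w = Suc m" "\<forall>b\<in>set w. length b = n"
  shows "realize_bits c w \<in> sgen X m"
proof -
  have "continuous_map (subtopology (powertop_real UNIV) (standard_simplex m)) (cube_top n) (aff (map bvec w))"
    using aff_cube[OF set_map_bvec[OF assms(3)]] assms(2) length_0_conv[of w]
    by (auto simp: continuous_map_in_subtopology continuous_map_aff simp del: length_0_conv)
  then show ?thesis using assms
    by (auto simp: sgen_def singular_simplex_def realize_bits_def affine_simplex_def cgen_def singular_cube_def intro: continuous_map_compose)
qed

lemma triangulate_sgen: "c \<in> cgen X n \<Longrightarrow> triangulate n c \<in> chains_on (sgen X n)"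
  unfolding triangulate_def by (rule chains_fmap[OF cube_triangulation_chains]) (auto intro: realize_bits_sgen)

lemma triangulate_cmap: "triangulate n (cmap n f c) = fmap (simplex_map n f) (triangulate n c)"
  unfolding triangulate_def fmap_fmap
proof (rule fmap_cong[OF cube_triangulation_chains])
  fix w :: "bool list list" assume "w \<in> {w. length w = Suc n \<and> (\<forall>b\<in>set w. length b = n) \<and> sorted_wrt (list_all2 (\<longrightarrow>)) w}"
  then have w: "length w = Suc n" "\<forall>b\<in>set w. length b = n" by auto
  have "aff (map bvec w) x \<in> standard_cube n" if "x \<in> standard_simplex n" for x
    by (rule aff_cube[OF set_map_bvec[OF w(2)]]) (use w that in auto)
  then show "realize_bits (cmap n f c) w = simplex_map n f (realize_bits c w)"
    using w(1) by (intro ext) (simp add: realize_bits_def affine_simplex_def cmap_def simplex_map_def)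
qed

text \<open>The inserted constant survives the affine combination because barycentric coordinates
  sum to 1.\<close>

lemma aff_cube_insert:
  assumes "x \<in> standard_simplex (length w - 1)" "w \<noteq> []"
  shows "aff (map (cube_insert i e) w) x = cube_insert i e (aff w x)"
proof
  fix j
  have s: "(\<Sum>k<length w. x k) = 1" using assms by (intro sum_simplex) auto
  have "(\<Sum>k<length w. x k * e) = e" using s by (simp flip: sum_distrib_right)
  then show "aff (map (cube_insert i e) w) x j = cube_insert i e (aff w x) j"
    by (simp add: aff_def cube_insert_def)
qed

lemma bvec_bins:
  assumes "i \<le> length b"
  shows "bvec (bins i e b) = cube_insert (Suc i) (if e then 1 else 0) (bvec b)"
proof
  fix j
  consider "j < i" | "j = i" | k where "j = Suc (i + k)" by (metis less_imp_Suc_add linorder_neqE_nat)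
  then show "bvec (bins i e b) j = cube_insert (Suc i) (if e then 1 else 0) (bvec b) j"
    by cases (use assms in \<open>auto simp: bvec_def bins_def cube_insert_def nth_append min_def\<close>)
qed

lemma triangulate_face:
  assumes "i \<le> n"
  shows "triangulate n (cube_face (Suc n) (Suc i) (if e then 1 else 0) c) = fmap (realize_bits c) (fmap (map (bins i e)) (cube_triangulation n))"
  unfolding triangulate_def fmap_fmap
proof (rule fmap_cong[OF cube_triangulation_chains])
  fix w :: "bool list list" assume "w \<in> {w. length w = Suc n \<and> (\<forall>b\<in>set w. length b = n) \<and> sorted_wrt (list_all2 (\<longrightarrow>)) w}"
  then have w: "length w = Suc n" "\<forall>b\<in>set w. length b = n" by auto
  show "realize_bits (cube_face (Suc n) (Suc i) (if e then 1 else 0) c) w = realize_bits c (map (bins i e) w)"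
  proof (rule realize_bits_cong)
    fix x assume x: "x \<in> standard_simplex (length w - 1)"
    have "w \<noteq> []" using w by auto
    have "map bvec (map (bins i e) w) = map (cube_insert (Suc i) (if e then 1 else 0)) (map bvec w)"
      using w assms by (auto simp: bvec_bins simp del: if_split)
    then have "aff (map bvec (map (bins i e) w)) x = cube_insert (Suc i) (if e then 1 else 0) (aff (map bvec w) x)"
      using aff_cube_insert[of x "map bvec w"] x \<open>w \<noteq> []\<close> by (simp del: map_map)
    moreover have "aff (map bvec w) x \<in> standard_cube n"
      by (rule aff_cube[OF set_map_bvec[OF w(2)]]) (use x \<open>w \<noteq> []\<close> in auto)
    ultimately show "cube_face (Suc n) (Suc i) (if e then 1 else 0) c (aff (map bvec w) x) = c (aff (map bvec (map (bins i e) w)) x)"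
      by (simp add: cube_face_def)
  qed simp
qed

lemma triangulate_sbd: "frag_extend (sbd n) (triangulate n c) = frag_extend (triangulate (n - 1)) (cbd n c)"
proof (cases n)
  case 0
  then show ?thesis by (simp add: sbd_0[abs_def])
next
  case (Suc m)
  have "frag_extend (sbd n) (triangulate n c) = fmap (realize_bits c) (frag_extend list_boundary (cube_triangulation (Suc m)))"
    unfolding sbd_extend triangulate_def Suc
    by (rule boundary_realization_chain[OF realization_realize_bits cube_triangulation_chains'])
  also have "\<dots> = (\<Sum>i<Suc m. frag_cmul ((-1) ^ Suc i) (triangulate m (cube_face (Suc m) (Suc i) 0 c) - triangulate m (cube_face (Suc m) (Suc i) 1 c)))"
    unfolding list_boundary_cube_triangulation fmap_sum
    by (rule sum.cong) (use triangulate_face[of _ m False c] triangulate_face[of _ m True c] in auto)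
  also have "\<dots> = (\<Sum>i\<in>{1..n}. frag_cmul ((-1) ^ i) (triangulate m (cube_face n i 0 c) - triangulate m (cube_face n i 1 c)))"
    by (rule sum.reindex_bij_witness[of _ "\<lambda>i. i - 1" Suc]) (auto simp: Suc)
  also have "\<dots> = frag_extend (triangulate (n - 1)) (cbd n c)"
    by (simp add: Suc cbd_alt frag_extend_sum' frag_lin)
  finally show ?thesis .
qed

text \<open>A cube independent of coordinate k has the same triangulation after bit k of every
  vertex is cleared, and then each vertex list has an adjacent repetition.\<close>

lemma triangulate_cdgen:
  assumes "c \<in> cdgen X n"
  shows "triangulate n c \<in> chains_on (sdgen X n)"
proof -
  obtain k where k: "c \<in> cgen X n" "k < n" "\<And>x. x \<in> standard_cube n \<Longrightarrow> c (x(k := 0)) = c x"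
    using assms by (elim cdgenE) blast
  let ?u = "\<lambda>b. b[k := False]"
  have "triangulate n c = fmap (realize_bits c) (fmap (map ?u) (cube_triangulation n))"
    unfolding triangulate_def fmap_fmap
  proof (rule fmap_cong[OF cube_triangulation_chains])
    fix w :: "bool list list" assume "w \<in> {w. length w = Suc n \<and> (\<forall>b\<in>set w. length b = n) \<and> sorted_wrt (list_all2 (\<longrightarrow>)) w}"
    then have w: "length w = Suc n" "\<forall>b\<in>set w. length b = n" by auto
    show "realize_bits c w = realize_bits c (map ?u w)"
    proof (rule realize_bits_cong)
      fix x assume x: "x \<in> standard_simplex (length w - 1)"
      have "bvec (?u b) i = (if i = k then 0 else bvec b i)" for b i
        by (auto simp: bvec_def nth_list_update)
      then have "aff (map bvec (map ?u w)) x = (aff (map bvec w) x)(k := 0)"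
        by (auto simp: aff_def fun_eq_iff)
      moreover have "aff (map bvec w) x \<in> standard_cube n"
        by (rule aff_cube[OF set_map_bvec[OF w(2)]]) (use x w in auto)
      ultimately show "c (aff (map bvec w) x) = c (aff (map bvec (map ?u w)) x)" using k(3) by simp
    qed simp
  qed
  also have "\<dots> \<in> chains_on (sdgen X n)"
  proof (rule chains_fmap)
    show "fmap (map ?u) (cube_triangulation n) \<in> chains_on ({w. length w = Suc n \<and> (\<forall>b\<in>set w. length b = n)} \<inter> Collect adjdup)"
      by (rule chains_Int[OF chains_fmap[OF cube_triangulation_chains] cube_triangulation_update[OF k(2)]]) auto
    fix w :: "bool list list" assume w: "w \<in> {w. length w = Suc n \<and> (\<forall>b\<in>set w. length b = n)} \<inter> Collect adjdup"
    then show "realize_bits c w \<in> sdgen X n"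
      using realize_bits_sgen[OF k(1), of w n] sdeg_realization[OF realization_realize_bits, of w n c] by (simp add: sdgen_def)
  qed
  finally show ?thesis .
qed

lemma bvec_append: "length a = p \<Longrightarrow> cfst p (bvec (a @ b)) = bvec a" "length a = p \<Longrightarrow> csnd p (bvec (a @ b)) = bvec b"
  by (auto simp: bvec_def cfst_def csnd_def fun_eq_iff nth_append)

lemma cfst_aff: "cfst p (aff w x) = aff (map (cfst p) w) x" and csnd_aff: "csnd p (aff w x) = aff (map (csnd p) w) x"
  by (auto simp: cfst_def csnd_def aff_def fun_eq_iff)

text \<open>Concatenating bit lists is concatenating coordinates, so this is the realized form of
  \<open>cube_triangulation_append\<close>.\<close>

lemma triangulate_cross:
  "triangulate (p + q) (cross_cubes pr p q c d) =
    frag_extend (\<lambda>s. frag_extend (shuffle_simplices pr p q s) (triangulate q d)) (triangulate p c)"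
proof -
  let ?A = "\<lambda>(a :: bool list, b). a @ b"
  let ?S = "\<lambda>p. {w. length w = Suc p \<and> (\<forall>b\<in>set w. length b = p) \<and> sorted_wrt (list_all2 (\<longrightarrow>)) w}"
  have "frag_extend (\<lambda>s. frag_extend (shuffle_simplices pr p q s) (triangulate q d)) (triangulate p c) =
    frag_extend (\<lambda>u. frag_extend (\<lambda>v. fmap (pair_real pr (realize_bits c) (realize_bits d)) (ez u v)) (cube_triangulation q)) (cube_triangulation p)"
    unfolding triangulate_def extend_fmap
    by (intro frag_extend_cong[OF cube_triangulation_chains'] shuffle_realization realization_realize_bits) auto
  also have "\<dots> = frag_extend (\<lambda>u. frag_extend (\<lambda>v. fmap (\<lambda>w. realize_bits (cross_cubes pr p q c d) (map ?A w)) (ez u v)) (cube_triangulation q)) (cube_triangulation p)"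
  proof (intro frag_extend_cong[OF cube_triangulation_chains] fmap_cong[OF ez_chains])
    fix u v w assume u: "u \<in> ?S p" and v: "v \<in> ?S q"
      and w: "w \<in> {w. Suc (length w) = length u + length v \<and> set w \<subseteq> set u \<times> set v \<and> hd w = (hd u, hd v)}"
    have l: "length w = Suc (p + q)" and ab: "\<And>a b. (a, b) \<in> set w \<Longrightarrow> length a = p \<and> length b = q"
      using u v w by auto
    have 1: "map (cfst p) (map bvec (map ?A w)) = map bvec (map fst w)" "map (csnd p) (map bvec (map ?A w)) = map bvec (map snd w)"
      using ab by (auto simp: bvec_append)
    have 2: "set (map bvec (map ?A w)) \<subseteq> standard_cube (p + q)"
      using ab by (intro set_map_bvec) auto
    show "pair_real pr (realize_bits c) (realize_bits d) w = realize_bits (cross_cubes pr p q c d) (map ?A w)"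
    proof
      fix x
      show "pair_real pr (realize_bits c) (realize_bits d) w x = realize_bits (cross_cubes pr p q c d) (map ?A w) x"
      proof (cases "x \<in> standard_simplex (p + q)")
        case True
        have "aff (map bvec (map ?A w)) x \<in> standard_cube (p + q)"
          by (rule aff_cube[OF 2]) (use l True in auto)
        then show ?thesis using True l 1
          by (simp add: pair_real_def simplex_pair_def realize_bits_def affine_simplex_def cross_cubes_alt cfst_aff csnd_aff del: map_map)
      qed (simp add: pair_real_def simplex_pair_def realize_bits_def affine_simplex_def l)
    qed
  qed
  also have "\<dots> = triangulate (p + q) (cross_cubes pr p q c d)"
    by (simp only: triangulate_def cube_triangulation_append fmap_fmap fmap_extend)
  finally show ?thesis ..
qed

lemma triangulate_point: "triangulate 0 (cpt pt) = frag_of (spt pt)"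
proof -
  have "aff (map bvec [[]]) x \<in> standard_cube 0" if "x \<in> standard_simplex 0" for x
    by (rule aff_cube) (use that in \<open>auto simp: bvec_cube\<close>)
  then have "realize_bits (cpt pt) [[]] = spt pt"
    by (intro ext) (simp add: realize_bits_def affine_simplex_def cpt_def spt_def)
  then show ?thesis by (simp add: triangulate_def)
qed

section \<open>The map from the cube to the simplex by prefix minima\<close>

section \<open>From simplices to cubes\<close>

text \<open>The value 1 on the empty prefix is neutral for coordinates in the unit interval, and it
  is what makes the barycentric coordinates, being consecutive differences, sum to 1.\<close>

primrec prefix_min :: "(nat \<Rightarrow> real) \<Rightarrow> nat \<Rightarrow> real" where
  "prefix_min x 0 = 1"
| "prefix_min x (Suc k) = min (prefix_min x k) (x k)"

text \<open>On the cube with vertices \<open>b\<close> this is the affine extension of the map counting the leading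
  ones of \<open>b\<close> over each simplex of the triangulation, see \<open>cube_to_simplex_aff\<close>.\<close>

definition cube_to_simplex :: "(nat \<Rightarrow> real) \<Rightarrow> nat \<Rightarrow> real" where
  "cube_to_simplex x = (\<lambda>k. prefix_min x k - prefix_min x (Suc k))"

definition simplex_to_cube :: "nat \<Rightarrow> ((nat \<Rightarrow> real) \<Rightarrow> 'u) \<Rightarrow> (nat \<Rightarrow> real) \<Rightarrow> 'u" where
  "simplex_to_cube n s = restrict (s \<circ> cube_to_simplex) (standard_cube n)"

lemma prefix_min_bounds: "x \<in> standard_cube n \<Longrightarrow> 0 \<le> prefix_min x k \<and> prefix_min x k \<le> 1"
  by (induction k) (auto simp: cube_coord min_def)

lemma prefix_min_zero: "x \<in> standard_cube n \<Longrightarrow> i < k \<Longrightarrow> x i = 0 \<Longrightarrow> prefix_min x k = 0"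
proof (induction k)
  case (Suc k)
  then show ?case using prefix_min_bounds[of x n k] cube_coord[of x n k] by (cases "i = k") (auto simp: min_def)
qed simp

lemma cube_to_simplex_simplex:
  assumes "x \<in> standard_cube n"
  shows "cube_to_simplex x \<in> standard_simplex n"
proof -
  \<comment> \<open>Points of the n-cube vanish at index n, so every longer prefix has minimum 0.
    This closes the telescoping sum.\<close>
  have z: "prefix_min x k = 0" if "k > n" for k
    using that by (intro prefix_min_zero[OF assms, of n]) (auto simp: cube_zero[OF assms])
  have "(\<Sum>i\<le>n. cube_to_simplex x i) = prefix_min x 0 - prefix_min x (Suc n)"
    unfolding cube_to_simplex_def by (rule sum_telescope)
  moreover have "0 \<le> cube_to_simplex x k" "cube_to_simplex x k \<le> 1" for k
    using prefix_min_bounds[OF assms, of k] prefix_min_bounds[OF assms, of "Suc k"] prefix_min.simps(2)[of x k]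
    unfolding cube_to_simplex_def by linarith+
  moreover have "cube_to_simplex x k = 0" if "k > n" for k
    using z[of k] z[of "Suc k"] that unfolding cube_to_simplex_def by simp
  ultimately show ?thesis
    using z[of "Suc n"] by (simp add: standard_simplex_def)
qed

lemma continuous_map_cube_to_simplex:
  "continuous_map (cube_top n) (subtopology (powertop_real UNIV) (standard_simplex n)) cube_to_simplex"
proof -
  have prefix_min: "continuous_map (cube_top n) euclideanreal (\<lambda>x. prefix_min x k)" for k
    by (induction k) (auto intro!: continuous_map_real_min continuous_map_coord)
  have "continuous_map (cube_top n) euclideanreal (\<lambda>x. cube_to_simplex x k)" for k
    unfolding cube_to_simplex_def by (intro continuous_map_diff prefix_min)
  then show ?thesis
    using cube_to_simplex_simplex by (auto simp: continuous_map_in_subtopology continuous_map_componentwise_UNIV)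
qed

lemma simplex_to_cube_cgen: "s \<in> sgen X n \<Longrightarrow> simplex_to_cube n s \<in> cgen X n"
  using continuous_map_compose[OF continuous_map_cube_to_simplex]
  by (auto simp: sgen_def singular_simplex_def cgen_def singular_cube_def simplex_to_cube_def)

lemma simplex_to_cube_simplex_map: "simplex_to_cube n (simplex_map n f s) = cmap n f (simplex_to_cube n s)"
  by (intro ext) (simp add: simplex_to_cube_def simplex_map_def cmap_def cube_to_simplex_simplex)

lemma prefix_min_insert: "k \<le> i \<Longrightarrow> prefix_min (cube_insert (Suc i) e x) k = prefix_min x k"
  by (induction k) (auto simp: cube_insert_def)

lemma prefix_min_insert_one:
  assumes "x \<in> standard_cube n" "k \<ge> i"
  shows "prefix_min (cube_insert (Suc i) 1 x) (Suc k) = prefix_min x k"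
  using assms(2)
proof (induction k rule: dec_induct)
  case base
  have "prefix_min (cube_insert (Suc i) 1 x) (Suc i) = min (prefix_min x i) 1"
    using prefix_min_insert[of i i 1 x] by (simp add: cube_insert_def)
  then show ?case using prefix_min_bounds[OF assms(1), of i] by simp
next
  case (step k)
  have "cube_insert (Suc i) 1 x (Suc k) = x k" using step(1) by (simp add: cube_insert_def)
  then show ?case using step(3) by (simp only: prefix_min.simps)
qed

text \<open>A coordinate 1 does not change any minimum. Inserting it repeats one prefix minimum, and
  the difference there is the barycentric coordinate that vanishes on the i-th face.\<close>

lemma cube_to_simplex_insert_one:
  assumes "x \<in> standard_cube n"
  shows "cube_to_simplex (cube_insert (Suc i) 1 x) = simplical_face i (cube_to_simplex x)"
proof
  fix j
  note a = prefix_min_insert[of _ i 1 x] and b = prefix_min_insert_one[OF assms, of i]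
  consider "j < i" | "j = i" | l where "j = Suc l" "l \<ge> i" by (metis Suc_pred less_imp_le less_Suc_eq_le linorder_neqE_nat not_less_zero)
  then show "cube_to_simplex (cube_insert (Suc i) 1 x) j = simplical_face i (cube_to_simplex x) j"
  proof cases
    case 1
    then show ?thesis using a[of j] a[of "Suc j"] by (simp add: cube_to_simplex_def simplical_face_def del: prefix_min.simps)
  next
    case 2
    then show ?thesis using a[of i] b[of i] by (simp add: cube_to_simplex_def simplical_face_def del: prefix_min.simps)
  next
    case 3
    then show ?thesis using b[of l] b[of "Suc l"] by (simp add: cube_to_simplex_def simplical_face_def del: prefix_min.simps)
  qed
qed

lemma simplex_to_cube_face_one:
  assumes "i \<le> n"
  shows "cube_face (Suc n) (Suc i) 1 (simplex_to_cube (Suc n) s) = simplex_to_cube n (singular_face (Suc n) i s)"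
proof
  fix x
  show "cube_face (Suc n) (Suc i) 1 (simplex_to_cube (Suc n) s) x = simplex_to_cube n (singular_face (Suc n) i s) x"
  proof (cases "x \<in> standard_cube n")
    case True
    have "cube_insert (Suc i) 1 x \<in> standard_cube (Suc n)" using True assms by (intro cube_insert_cube) auto
    then show ?thesis using True cube_to_simplex_simplex[OF True] cube_to_simplex_insert_one[OF True, of i]
      by (simp add: cube_face_def simplex_to_cube_def singular_face_def)
  qed (simp add: cube_face_def simplex_to_cube_def)
qed

text \<open>A point of the n-cube already vanishes from index n on, so inserting 0 in the last place
  leaves it unchanged and its last barycentric coordinate is 0.\<close>

lemma simplex_to_cube_face_last:
  "cube_face (Suc n) (Suc n) 0 (simplex_to_cube (Suc n) s) = simplex_to_cube n (singular_face (Suc n) (Suc n) s)"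
proof
  fix x
  show "cube_face (Suc n) (Suc n) 0 (simplex_to_cube (Suc n) s) x = simplex_to_cube n (singular_face (Suc n) (Suc n) s) x"
  proof (cases "x \<in> standard_cube n")
    case True
    have i: "cube_insert (Suc n) 0 x = x"
      using cube_zero[OF True] by (auto simp: cube_insert_def fun_eq_iff)
    have "cube_to_simplex x j = 0" if "j > n" for j using cube_to_simplex_simplex[OF True] that by (simp add: standard_simplex_def)
    then have "simplical_face (Suc n) (cube_to_simplex x) = cube_to_simplex x"
      by (auto simp: simplical_face_def fun_eq_iff)
    moreover have "x \<in> standard_cube (Suc n)" using cube_insert_cube[of x "Suc n" "Suc n" 0] True i by simp
    ultimately show ?thesis using True cube_to_simplex_simplex[OF True] i
      by (simp add: cube_face_def simplex_to_cube_def singular_face_def)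
  qed (simp add: cube_face_def simplex_to_cube_def)
qed

text \<open>All prefix minima beyond a zero vanish, so the coordinates after it have no influence; i
  < n ensures that there is one.\<close>

lemma simplex_to_cube_face_zero:
  assumes "s \<in> sgen X (Suc n)" "i < n"
  shows "cube_face (Suc n) (Suc i) 0 (simplex_to_cube (Suc n) s) \<in> cdgen X n"
proof (rule cdgenI)
  show "cube_face (Suc n) (Suc i) 0 (simplex_to_cube (Suc n) s) \<in> cgen X n"
    using cube_face_cgen[OF simplex_to_cube_cgen[OF assms(1)], of "Suc i" 0] assms(2) by simp
  show "n - 1 < n" using assms by simp
  fix x assume x: "x \<in> standard_cube n"
  let ?y = "x(n - 1 := 0)"
  have c: "cube_insert (Suc i) 0 x \<in> standard_cube (Suc n)" "cube_insert (Suc i) 0 ?y \<in> standard_cube (Suc n)"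
    using x cube_upd[OF x] assms(2) by (auto intro!: cube_insert_cube)
  have "prefix_min (cube_insert (Suc i) 0 x) k = prefix_min (cube_insert (Suc i) 0 ?y) k" for k
  proof (cases "k \<le> i")
    case True
    have "prefix_min ?y k = prefix_min x k" using True assms(2) by (induction k) auto
    then show ?thesis using True prefix_min_insert[of k i 0] by simp
  next
    case False
    have "cube_insert (Suc i) 0 y i = 0" for y by (simp add: cube_insert_def)
    then show ?thesis using False prefix_min_zero[OF c(1), of i k] prefix_min_zero[OF c(2), of i k] by simp
  qed
  then have "cube_to_simplex (cube_insert (Suc i) 0 ?y) = cube_to_simplex (cube_insert (Suc i) 0 x)" by (simp add: cube_to_simplex_def del: prefix_min.simps)
  then show "cube_face (Suc n) (Suc i) 0 (simplex_to_cube (Suc n) s) ?y = cube_face (Suc n) (Suc i) 0 (simplex_to_cube (Suc n) s) x"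
    using x cube_upd[OF x] c by (simp add: cube_face_def simplex_to_cube_def)
qed

text \<open>The faces at 1 are the simplicial faces except the last, the face at 0 in the last
  direction is the last one, and the remaining faces at 0 are degenerate. The signs agree with the
  simplicial ones.\<close>

lemma simplex_to_cube_boundary:
  assumes "s \<in> sgen X n"
  shows "cbd n (simplex_to_cube n s) - fmap (simplex_to_cube (n - 1)) (sbd n s) \<in> chains_on (cdgen X (n - 1))"
proof (cases n)
  case 0
  then show ?thesis by (simp add: sbd_0)
next
  case (Suc m)
  let ?c = "simplex_to_cube (Suc m) s"
  let ?f0 = "\<lambda>i. frag_of (cube_face (Suc m) (Suc i) 0 ?c)" and ?f1 = "\<lambda>i. frag_of (cube_face (Suc m) (Suc i) 1 ?c)"
  have "cbd n (simplex_to_cube n s) = (\<Sum>i<Suc m. frag_cmul ((-1) ^ Suc i) (?f0 i - ?f1 i))"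
    unfolding Suc cbd_alt by (rule sum.reindex_bij_witness[of _ Suc "\<lambda>i. i - 1"]) auto
  also have "\<dots> = (\<Sum>i<m. frag_cmul ((-1) ^ Suc i) (?f0 i)) + (frag_cmul ((-1) ^ Suc m) (?f0 m) + (\<Sum>i<Suc m. frag_cmul ((-1) ^ i) (?f1 i)))"
    by (simp add: frag_cmul_diff_distrib2 sum_subtractf sum_negf algebra_simps flip: minus_frag_cmul)
  also have "frag_cmul ((-1) ^ Suc m) (?f0 m) + (\<Sum>i<Suc m. frag_cmul ((-1) ^ i) (?f1 i)) = fmap (simplex_to_cube (n - 1)) (sbd n s)"
  proof -
    have "sbd n s = (\<Sum>k<Suc m. frag_cmul ((-1) ^ k) (frag_of (singular_face (Suc m) k s))) + frag_cmul ((-1) ^ Suc m) (frag_of (singular_face (Suc m) (Suc m) s))"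
      unfolding sbd_def chain_boundary_of Suc by (simp add: lessThan_Suc_atMost[symmetric])
    moreover have "(\<Sum>i<Suc m. frag_cmul ((-1) ^ i) (?f1 i)) =
      fmap (simplex_to_cube m) (\<Sum>k<Suc m. frag_cmul ((-1) ^ k) (frag_of (singular_face (Suc m) k s)))"
      unfolding fmap_sum by (rule sum.cong) (auto simp: simplex_to_cube_face_one)
    ultimately show ?thesis using Suc simplex_to_cube_face_last[of m s] by (simp del: sum.lessThan_Suc)
  qed
  finally have "cbd n (simplex_to_cube n s) - fmap (simplex_to_cube (n - 1)) (sbd n s) = (\<Sum>i<m. frag_cmul ((-1) ^ Suc i) (?f0 i))"
    by (simp add: algebra_simps)
  also have "\<dots> \<in> chains_on (cdgen X m)"
    using assms simplex_to_cube_face_zero[of s X m] Suc by (intro chains_sum chains_cmul) simp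
  finally show ?thesis using Suc by simp
qed

lemma all_take_ones: "k \<le> length b \<Longrightarrow> (\<forall>i<k. b ! i) \<longleftrightarrow> k \<le> ones b"
proof (induction b arbitrary: k)
  case (Cons a b)
  then show ?case
  proof (cases k)
    case (Suc m)
    have "(\<forall>i<Suc m. (a # b) ! i) \<longleftrightarrow> a \<and> (\<forall>i<m. b ! i)" by (simp add: All_less_Suc2)
    then show ?thesis using Cons.IH[of m] Cons.prems Suc by simp
  qed simp
qed simp

lemma ones_le: "ones b \<le> length b"
  by (simp add: ones_def length_takeWhile_le)

text \<open>Along a chain of vertices the sets of indices whose first bits are all one are nested, so that the
  minimum of two coordinates is one of them.\<close>

lemma prefix_min_aff:
  assumes w: "sorted_wrt (list_all2 (\<longrightarrow>)) w" "\<forall>b\<in>set w. length b = n" "w \<noteq> []" and x: "x \<in> standard_simplex (length w - 1)"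
    and "k \<le> n"
  shows "prefix_min (aff (map bvec w) x) k = (\<Sum>l<length w. x l * (if k \<le> ones (w ! l) then 1 else 0))"
  using \<open>k \<le> n\<close>
proof (induction k)
  case 0
  then show ?case using sum_simplex[OF x] w(3) by simp
next
  case (Suc k)
  let ?A = "\<lambda>l. k \<le> ones (w ! l)" and ?B = "\<lambda>l. w ! l ! k" and ?C = "\<lambda>l. Suc k \<le> ones (w ! l)"
  let ?N = "length w"
  have l: "length (w ! i) = n" if "i < ?N" for i using w(2) nth_mem[OF that] by auto
  have le: "w ! i ! j \<Longrightarrow> w ! i' ! j" if "i \<le> i'" "i' < ?N" "j < n" for i i' j
  proof (cases "i = i'")
    case False
    then have "list_all2 (\<longrightarrow>) (w ! i) (w ! i')" using sorted_wrt_nth_less[OF w(1)] that by auto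
    then show "w ! i ! j \<Longrightarrow> w ! i' ! j" using list_all2_nthD[of _ "w ! i" "w ! i'" j] l[of i] that by auto
  qed auto
  have C: "?C i \<longleftrightarrow> ?A i \<and> ?B i" if "i < ?N" for i
    using all_take_ones[of "Suc k" "w ! i"] all_take_ones[of k "w ! i"] l[OF that] Suc(2) by (auto simp: less_Suc_eq)
  have Amono: "?A i \<Longrightarrow> ?A i'" if "i \<le> i'" "i' < ?N" for i i'
    using all_take_ones[of k "w ! i"] all_take_ones[of k "w ! i'"] l[of i] l[of i'] le[OF that] that Suc(2)
    by (metis Suc_leD less_le_trans le_less_trans)
  have x0: "0 \<le> x i" for i using x by (simp add: standard_simplex_def)
  have B: "aff (map bvec w) x k = (\<Sum>l<?N. x l * (if ?B l then 1 else 0))"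
    unfolding aff_def using Suc(2) by (auto intro!: sum.cong simp: bvec_def l)
  have IH: "prefix_min (aff (map bvec w) x) k = (\<Sum>l<?N. x l * (if ?A l then 1 else 0))" using Suc by simp
  consider "\<forall>i<?N. ?A i \<longrightarrow> ?B i" | "\<forall>i<?N. ?B i \<longrightarrow> ?A i"
  proof (cases "\<forall>i<?N. ?A i \<longrightarrow> ?B i")
    case False
    then obtain i where i: "i < ?N" "?A i" "\<not> ?B i" by blast
    have "?A j" if "j < ?N" "?B j" for j
    proof (cases "i \<le> j")
      case True then show ?thesis using Amono[of i j] i that by blast
    next
      case False then show ?thesis using le[of j i k] i that Suc(2) by auto
    qed
    then show thesis using that(2) by blast
  qed (use that in blast)
  then show ?case
  proof cases
    case 1
    then have "(\<Sum>l<?N. x l * (if ?A l then 1 else 0)) \<le> (\<Sum>l<?N. x l * (if ?B l then 1 else 0))"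
      by (intro sum_mono mult_left_mono x0) auto
    moreover have "(\<Sum>l<?N. x l * (if ?A l then 1 else 0)) = (\<Sum>l<?N. x l * (if ?C l then 1 else 0))"
      using 1 C by (intro sum.cong) auto
    ultimately show ?thesis unfolding prefix_min.simps IH B by (simp only: min_absorb1)
  next
    case 2
    then have "(\<Sum>l<?N. x l * (if ?B l then 1 else 0)) \<le> (\<Sum>l<?N. x l * (if ?A l then 1 else 0))"
      by (intro sum_mono mult_left_mono x0) auto
    moreover have "(\<Sum>l<?N. x l * (if ?B l then 1 else 0)) = (\<Sum>l<?N. x l * (if ?C l then 1 else 0))"
      using 2 C by (intro sum.cong) auto
    ultimately show ?thesis unfolding prefix_min.simps IH B by (simp only: min_absorb2)
  qed
qed

text \<open>Each prefix minimum sums the weights of the vertices with at least k leading ones;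
  consecutive differences single out those with exactly k.\<close>

lemma cube_to_simplex_aff:
  assumes w: "sorted_wrt (list_all2 (\<longrightarrow>)) w" "\<forall>b\<in>set w. length b = n" "w \<noteq> []" and x: "x \<in> standard_simplex (length w - 1)"
  shows "cube_to_simplex (aff (map bvec w) x) = aff (map ev (map ones w)) x"
proof
  fix k
  have cube: "aff (map bvec w) x \<in> standard_cube n"
    by (rule aff_cube[OF set_map_bvec[OF w(2)]]) (use w x in auto)
  have prefix_min: "prefix_min (aff (map bvec w) x) k = (\<Sum>l<length w. x l * (if k \<le> ones (w ! l) then 1 else 0))" for k
  proof (cases "k \<le> n")
    case False
    have "ones (w ! l) \<le> n" if "l < length w" for l using ones_le[of "w ! l"] w(2) nth_mem[OF that] by auto
    then have "(\<Sum>l<length w. x l * (if k \<le> ones (w ! l) then 1 else 0)) = 0"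
      using False by (intro sum.neutral) (auto dest: order_trans)
    then show ?thesis using prefix_min_zero[OF cube, of n k] cube_zero[OF cube, of n] False by simp
  qed (rule prefix_min_aff[OF assms])
  have "cube_to_simplex (aff (map bvec w) x) k = (\<Sum>l<length w. x l * (if k = ones (w ! l) then 1 else 0))"
    unfolding cube_to_simplex_def prefix_min sum_subtractf[symmetric] by (rule sum.cong) auto
  then show "cube_to_simplex (aff (map bvec w) x) k = aff (map ev (map ones w)) x k"
    by (simp add: aff_def ev_def)
qed

text \<open>On every simplex of the triangulation the map to the standard simplex is affine with
  vertex map \<open>ones\<close>. The triangulated cube is therefore \<open>s\<close> realized over
  lists of counts, of which only the full list is without repetition.\<close>

lemma triangulate_simplex_to_cube:
  assumes "s \<in> sgen X n"
  shows "triangulate n (simplex_to_cube n s) - frag_of s \<in> chains_on (sdgen X n)"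
proof -
  have "triangulate n (simplex_to_cube n s) = fmap (realize s) (fmap (map ones) (cube_triangulation n))"
    unfolding triangulate_def fmap_fmap
  proof (rule fmap_cong[OF cube_triangulation_chains])
    fix w :: "bool list list" assume "w \<in> {w. length w = Suc n \<and> (\<forall>b\<in>set w. length b = n) \<and> sorted_wrt (list_all2 (\<longrightarrow>)) w}"
    then have w: "length w = Suc n" "\<forall>b\<in>set w. length b = n" "sorted_wrt (list_all2 (\<longrightarrow>)) w" "w \<noteq> []" by auto
    show "realize_bits (simplex_to_cube n s) w = realize s (map ones w)"
    proof
      fix x
      show "realize_bits (simplex_to_cube n s) w x = realize s (map ones w) x"
      proof (cases "x \<in> standard_simplex n")
        case True
        then have "aff (map bvec w) x \<in> standard_cube n"
          by (intro aff_cube[OF set_map_bvec[OF w(2)]]) (use w in auto)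
        then show ?thesis using True w(1) cube_to_simplex_aff[OF w(3,2,4), of x]
          by (simp add: realize_bits_def realize_def affine_simplex_def simplex_to_cube_def del: map_map)
      qed (simp add: realize_bits_def realize_def affine_simplex_def w(1))
    qed
  qed
  then have "triangulate n (simplex_to_cube n s) - frag_of s = fmap (realize s) (fmap (map ones) (cube_triangulation n) - frag_of [0..<Suc n])"
    using realize_self[OF assms] by (simp del: upt_Suc)
  also have "\<dots> \<in> chains_on (sdgen X n)"
  proof (rule chains_fmap[OF chains_Int[OF _ cube_triangulation_ones]])
    have "fmap (map ones) (cube_triangulation n) \<in> chains_on {l. length l = Suc n \<and> set l \<subseteq> {..n}}"
      by (rule chains_fmap[OF cube_triangulation_chains]) (use ones_le in fastforce)
    then show "fmap (map ones) (cube_triangulation n) - frag_of [0..<Suc n] \<in> chains_on {l. length l = Suc n \<and> set l \<subseteq> {..n}}"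
      by (rule chains_diff) auto
    fix l assume "l \<in> {l. length l = Suc n \<and> set l \<subseteq> {..n}} \<inter> Collect adjdup"
    then show "realize s l \<in> sdgen X n" by (intro sdgen_realize[OF assms]) auto
  qed
  finally show ?thesis .
qed

section \<open>Normalization followed by the passage to cubes\<close>

subsection \<open>The homotopy inverse of the triangulation\<close>

text \<open>Normalizing first is essential, as the cube of a degenerate simplex need not be
  degenerate: a 2-simplex that merges its first two vertices yields a function of the minimum of
  both coordinates.\<close>

definition triangulate_inv :: "nat \<Rightarrow> ((nat \<Rightarrow> real) \<Rightarrow> 'u) \<Rightarrow> 'u chain" where
  "triangulate_inv n s = fmap (simplex_to_cube n) (normalize_simplex n s)"

lemma triangulate_inv_cgen: "s \<in> sgen X n \<Longrightarrow> triangulate_inv n s \<in> chains_on (cgen X n)"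
  unfolding triangulate_inv_def by (rule chains_fmap[OF normalize_simplex_sgen]) (auto intro: simplex_to_cube_cgen)

lemma triangulate_inv_sdgen: "s \<in> sdgen X n \<Longrightarrow> triangulate_inv n s = 0"
  by (simp add: triangulate_inv_def normalize_simplex_sdgen)

lemma triangulate_inv_boundary:
  assumes "s \<in> sgen X n"
  shows "frag_extend (cbd n) (triangulate_inv n s) - frag_extend (triangulate_inv (n - 1)) (sbd n s) \<in> chains_on (cdgen X (n - 1))"
proof -
  have "frag_extend (\<lambda>u. cbd n (simplex_to_cube n u) - fmap (simplex_to_cube (n - 1)) (sbd n u)) (normalize_simplex n s) \<in> chains_on (cdgen X (n - 1))"
    by (rule chains_extend[OF normalize_simplex_sgen[OF assms] simplex_to_cube_boundary])
  moreover have "frag_extend (\<lambda>u. fmap (simplex_to_cube (n - 1)) (sbd n u)) (normalize_simplex n s) = frag_extend (triangulate_inv (n - 1)) (sbd n s)"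
    unfolding triangulate_inv_def[abs_def] fmap_extend[symmetric] normalize_simplex_sbd[OF assms] ..
  ultimately show ?thesis by (simp add: frag_lin triangulate_inv_def extend_fmap)
qed

lemma triangulate_triangulate_inv:
  assumes "s \<in> sgen X n"
  shows "frag_extend (triangulate n) (triangulate_inv n s) - normalize_simplex n s \<in> chains_on (sdgen X n)"
proof -
  have "frag_extend (\<lambda>u. triangulate n (simplex_to_cube n u) - frag_of u) (normalize_simplex n s) \<in> chains_on (sdgen X n)"
    by (rule chains_extend[OF normalize_simplex_sgen[OF assms] triangulate_simplex_to_cube])
  then show ?thesis by (simp add: frag_lin triangulate_inv_def extend_fmap)
qed

definition triangulate_back :: "nat \<Rightarrow> ((nat \<Rightarrow> real) \<Rightarrow> 'u) \<Rightarrow> 'u chain" where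
  "triangulate_back n c = frag_extend (triangulate_inv n) (triangulate n c)"

lemma triangulate_back_cgen: "c \<in> cgen X n \<Longrightarrow> triangulate_back n c \<in> chains_on (cgen X n)"
  unfolding triangulate_back_def by (rule chains_extend[OF triangulate_sgen triangulate_inv_cgen])

lemma triangulate_back_cdgen:
  assumes "c \<in> cdgen X n"
  shows "triangulate_back n c = 0"
proof -
  have "frag_extend (triangulate_inv n) (triangulate n c) = frag_extend (\<lambda>s. 0) (triangulate n c)"
    by (rule frag_extend_cong[OF triangulate_cdgen[OF assms]]) (rule triangulate_inv_sdgen)
  then show ?thesis by (simp add: triangulate_back_def)
qed

lemma triangulate_back_boundary:
  assumes "c \<in> cgen X n"
  shows "frag_extend (cbd n) (triangulate_back n c) - frag_extend (triangulate_back (n - 1)) (cbd n c) \<in> chains_on (cdgen X (n - 1))"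
proof -
  have "frag_extend (\<lambda>s. frag_extend (cbd n) (triangulate_inv n s) - frag_extend (triangulate_inv (n - 1)) (sbd n s)) (triangulate n c) \<in> chains_on (cdgen X (n - 1))"
    by (rule chains_extend[OF triangulate_sgen[OF assms] triangulate_inv_boundary])
  moreover have "frag_extend (\<lambda>s. frag_extend (triangulate_inv (n - 1)) (sbd n s)) (triangulate n c) = frag_extend (triangulate_back (n - 1)) (cbd n c)"
    using triangulate_sbd[of n c] by (simp add: triangulate_back_def[abs_def] frag_extend_extend[symmetric])
  ultimately show ?thesis by (simp add: frag_lin triangulate_back_def frag_extend_extend)
qed

lemma normalize_simplex_simplex_map: "normalize_simplex n (simplex_map n f s) = fmap (simplex_map n f) (normalize_simplex n s)"
  unfolding normalize_simplex_def fmap_fmap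
  by (rule fmap_cong[OF norml_chains]) (auto simp: set_upt_Suc simplex_map_realize simp del: set_upt upt_Suc)

lemma triangulate_inv_simplex_map: "triangulate_inv n (simplex_map n f s) = fmap (cmap n f) (triangulate_inv n s)"
  by (simp add: triangulate_inv_def normalize_simplex_simplex_map fmap_fmap simplex_to_cube_simplex_map)

text \<open>Naturality under maps that may also change the type of points. It allows the homotopy to
  be constructed on the model cube alone and pushed forward along any singular cube.\<close>

lemma triangulate_back_cmap: "triangulate_back n (cmap n f c) = fmap (cmap n f) (triangulate_back n c)"
  by (simp add: triangulate_back_def triangulate_cmap extend_fmap triangulate_inv_simplex_map fmap_extend)

subsection \<open>The cone on a cube\<close>

definition cube_cone :: "nat \<Rightarrow> ((nat \<Rightarrow> real) \<Rightarrow> nat \<Rightarrow> real) \<Rightarrow> (nat \<Rightarrow> real) \<Rightarrow> nat \<Rightarrow> real" where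
  "cube_cone n c = restrict (\<lambda>x i. x 0 * c (csnd 1 x) i) (standard_cube (Suc n))"

definition id_cube :: "nat \<Rightarrow> (nat \<Rightarrow> real) \<Rightarrow> nat \<Rightarrow> real" where
  "id_cube n = restrict (\<lambda>x. x) (standard_cube n)"

lemma csnd_Suc: "x \<in> standard_cube (Suc n) \<Longrightarrow> csnd 1 x \<in> standard_cube n"
  using csnd_cube[of x 1 n] by simp

lemma cgen_cube_mem: "c \<in> cgen (cube_top m) n \<Longrightarrow> x \<in> standard_cube n \<Longrightarrow> c x \<in> standard_cube m"
  using cgen_mem[of c "cube_top m" n x] by simp

lemma id_cube_cgen: "id_cube n \<in> cgen (cube_top n) n"
  by (auto simp: id_cube_def cgen_def singular_cube_def)

lemma cmap_id_cube: "c \<in> cgen X n \<Longrightarrow> cmap n c (id_cube n) = c"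
  using cgen_ext[of c X n] by (intro ext) (auto simp: cmap_def id_cube_def extensional_def)

lemma scale_cube: "x \<in> standard_cube n \<Longrightarrow> 0 \<le> t \<Longrightarrow> t \<le> 1 \<Longrightarrow> (\<lambda>i. t * x i) \<in> standard_cube n"
  by (simp add: standard_cube_def mult_le_one)

lemma cube_cone_cgen:
  assumes "c \<in> cgen (cube_top m) n"
  shows "cube_cone n c \<in> cgen (cube_top m) (Suc n)"
proof -
  have "continuous_map (cube_top n) (cube_top m) c" using assms by (simp add: cgen_def singular_cube_def)
  then have "continuous_map (cube_top (Suc n)) (cube_top m) (c \<circ> csnd 1)"
    using continuous_map_compose[OF continuous_map_csnd[of 1 n]] by simp
  then have "continuous_map (cube_top (Suc n)) euclideanreal (\<lambda>x. (c \<circ> csnd 1) x i)" for i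
    by (simp add: continuous_map_cube)
  then have "continuous_map (cube_top (Suc n)) euclideanreal (\<lambda>x. x 0 * (c \<circ> csnd 1) x i)" for i
    by (intro continuous_map_real_mult continuous_map_coord)
  moreover have "(\<lambda>i. x 0 * c (csnd 1 x) i) \<in> standard_cube m" if "x \<in> standard_cube (Suc n)" for x
    using scale_cube[OF cgen_cube_mem[OF assms csnd_Suc[OF that]]] cube_coord[OF that] by simp
  ultimately have "continuous_map (cube_top (Suc n)) (cube_top m) (\<lambda>x i. x 0 * c (csnd 1 x) i)"
    by (simp add: continuous_map_cube)
  then show ?thesis by (simp add: cgen_def singular_cube_def cube_cone_def)
qed

lemma cube_cone_cdgen:
  assumes "c \<in> cdgen (cube_top m) n"
  shows "cube_cone n c \<in> cdgen (cube_top m) (Suc n)"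
proof -
  obtain k where k: "c \<in> cgen (cube_top m) n" "k < n" "\<And>x. x \<in> standard_cube n \<Longrightarrow> c (x(k := 0)) = c x"
    using assms by (elim cdgenE) blast
  show ?thesis
  proof (rule cdgenI[OF cube_cone_cgen[OF k(1)]])
    show "Suc k < Suc n" using k(2) by simp
    fix x assume x: "x \<in> standard_cube (Suc n)"
    have "csnd 1 (x(Suc k := 0)) = (csnd 1 x)(k := 0)" by (auto simp: csnd_def fun_eq_iff)
    then show "cube_cone n c (x(Suc k := 0)) = cube_cone n c x"
      using x cube_upd[OF x] k(3)[OF csnd_Suc[OF x]] by (simp add: cube_cone_def)
  qed
qed

lemma cube_cone_face_one:
  assumes "c \<in> cgen (cube_top m) n"
  shows "cube_face (Suc n) 1 1 (cube_cone n c) = c"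
proof
  fix x
  have "csnd 1 (cube_insert 1 1 x) = x" "cube_insert 1 1 x 0 = 1" by (auto simp: csnd_def cube_insert_def)
  moreover have "cube_insert 1 1 x \<in> standard_cube (Suc n)" if "x \<in> standard_cube n"
    by (rule cube_insert_cube) (use that in auto)
  ultimately show "cube_face (Suc n) 1 1 (cube_cone n c) x = c x"
    using cgen_ext[OF assms] by (auto simp: cube_face_def cube_cone_def extensional_def)
qed

text \<open>The bottom of the cone is constant at the origin, and a constant cube is degenerate as
  soon as it has a direction. In degree 0 this fails.\<close>

lemma cube_cone_face_zero:
  assumes "c \<in> cgen (cube_top m) n" "n > 0"
  shows "cube_face (Suc n) 1 0 (cube_cone n c) \<in> cdgen (cube_top m) n"
proof (rule cdgenI[OF _ assms(2)])
  show "cube_face (Suc n) 1 0 (cube_cone n c) \<in> cgen (cube_top m) n"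
    using cube_face_cgen[OF cube_cone_cgen[OF assms(1)], of 1 0] by simp
  have *: "cube_face (Suc n) 1 0 (cube_cone n c) x = (\<lambda>i. 0)" if "x \<in> standard_cube n" for x
  proof -
    have "cube_insert 1 0 x \<in> standard_cube (Suc n)" by (rule cube_insert_cube) (use that in auto)
    moreover have "cube_insert 1 0 x 0 = 0" by (simp add: cube_insert_def)
    ultimately show ?thesis using that by (simp add: cube_face_def cube_cone_def)
  qed
  show "cube_face (Suc n) 1 0 (cube_cone n c) (x(0 := 0)) = cube_face (Suc n) 1 0 (cube_cone n c) x" if "x \<in> standard_cube n" for x
    using *[OF that] *[OF cube_upd[OF that]] by simp
qed

lemma cube_cone_face_Suc:
  assumes "1 \<le> j" "j \<le> n" "e \<in> {0, 1}"
  shows "cube_face (Suc n) (Suc j) e (cube_cone n c) = cube_cone (n - 1) (cube_face n j e c)"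
proof
  fix x
  have n: "Suc (n - 1) = n" using assms by auto
  have "csnd 1 (cube_insert (Suc j) e x) = cube_insert j e (csnd 1 x)" "cube_insert (Suc j) e x 0 = x 0"
    using assms(1) by (auto simp: csnd_def cube_insert_def fun_eq_iff)
  moreover have "cube_insert (Suc j) e x \<in> standard_cube (Suc n)" if "x \<in> standard_cube n"
    by (rule cube_insert_cube) (use that assms in auto)
  moreover have "csnd 1 x \<in> standard_cube (n - 1)" if "x \<in> standard_cube n"
    using csnd_Suc[of x "n - 1"] that n by simp
  ultimately show "cube_face (Suc n) (Suc j) e (cube_cone n c) x = cube_cone (n - 1) (cube_face n j e c) x"
    using n by (simp add: cube_face_def cube_cone_def)
qed

text \<open>The cone direction comes first: its face at 1 returns \<open>c\<close> with positive
  sign, its face at 0 is degenerate. In the other directions the number rises by one, so the cone on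
  the boundary enters with a minus sign.\<close>

lemma cube_cone_boundary:
  assumes "c \<in> cgen (cube_top m) n" "n > 0"
  shows "cbd (Suc n) (cube_cone n c) - (frag_of c - fmap (cube_cone (n - 1)) (cbd n c)) \<in> chains_on (cdgen (cube_top m) n)"
proof -
  let ?f = "\<lambda>i. frag_cmul ((-1) ^ i) (frag_of (cube_face (Suc n) i 0 (cube_cone n c)) - frag_of (cube_face (Suc n) i 1 (cube_cone n c)))"
  have "cbd (Suc n) (cube_cone n c) = ?f 1 + sum ?f {2..Suc n}"
    unfolding cbd_alt by (subst sum.atLeast_Suc_atMost) (auto simp: numeral_2_eq_2)
  also have "?f 1 = frag_of c - frag_of (cube_face (Suc n) 1 0 (cube_cone n c))"
    using cube_cone_face_one[OF assms(1)] by (simp del: One_nat_def)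
  also have "sum ?f {2..Suc n} = (\<Sum>j\<in>{1..n}. ?f (Suc j))"
    by (rule sum.reindex_bij_witness[of _ Suc "\<lambda>i. i - 1"]) auto
  also have "\<dots> = - fmap (cube_cone (n - 1)) (cbd n c)"
    unfolding cbd_alt fmap_sum sum_negf[symmetric]
    by (rule sum.cong) (auto simp: cube_cone_face_Suc simp del: One_nat_def)
  finally have "cbd (Suc n) (cube_cone n c) - (frag_of c - fmap (cube_cone (n - 1)) (cbd n c)) = - frag_of (cube_face (Suc n) 1 0 (cube_cone n c))"
    by simp
  then show ?thesis using cube_cone_face_zero[OF assms] by simp
qed

section \<open>Acyclic models on the identity cubes\<close>

subsection \<open>The homotopy on cubical chains\<close>

text \<open>The chain \<open>cube_homotopy_gen n\<close> is the value of the homotopy at the identity of the \<open>n\<close>-cube.\<close>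

primrec cube_homotopy_gen :: "nat \<Rightarrow> (nat \<Rightarrow> real) chain" where
  "cube_homotopy_gen 0 = 0"
| "cube_homotopy_gen (Suc n) = fmap (cube_cone (Suc n)) (triangulate_back (Suc n) (id_cube (Suc n)) - frag_of (id_cube (Suc n)) -
     frag_extend (\<lambda>d. fmap (cmap (Suc n) d) (cube_homotopy_gen n)) (cbd (Suc n) (id_cube (Suc n))))"

definition cube_homotopy :: "nat \<Rightarrow> ((nat \<Rightarrow> real) \<Rightarrow> 'u) \<Rightarrow> 'u chain" where
  "cube_homotopy n c = fmap (cmap (Suc n) c) (cube_homotopy_gen n)"

text \<open>The chain which the homotopy has to bound on the model cube, up to degenerate
  cubes.\<close>

definition homotopy_base :: "nat \<Rightarrow> (nat \<Rightarrow> real) chain" where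
  "homotopy_base n = triangulate_back n (id_cube n) - frag_of (id_cube n) - frag_extend (cube_homotopy (n - 1)) (cbd n (id_cube n))"

lemma cube_homotopy_gen_Suc: "cube_homotopy_gen (Suc n) = fmap (cube_cone (Suc n)) (homotopy_base (Suc n))"
  by (simp add: homotopy_base_def cube_homotopy_def[abs_def])

definition homotopy_defect :: "nat \<Rightarrow> ((nat \<Rightarrow> real) \<Rightarrow> 'u) \<Rightarrow> 'u chain" where
  "homotopy_defect n c = triangulate_back n c - frag_of c - frag_extend (cbd (n + 1)) (cube_homotopy n c) - frag_extend (cube_homotopy (n - 1)) (cbd n c)"

lemma cmap_chains: "u \<in> chains_on (cgen X n) \<Longrightarrow> continuous_map X Y f \<Longrightarrow> fmap (cmap n f) u \<in> chains_on (cgen Y n)"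
  by (erule chains_fmap) (rule cmap_cgen)

lemma cgen_continuous: "c \<in> cgen X n \<Longrightarrow> continuous_map (cube_top n) X c"
  by (simp add: cgen_def singular_cube_def)

lemma cube_homotopy_cgen_if:
  assumes "cube_homotopy_gen n \<in> chains_on (cgen (cube_top n) (Suc n))" "c \<in> cgen X n"
  shows "cube_homotopy n c \<in> chains_on (cgen X (n + 1))"
  unfolding cube_homotopy_def using cmap_chains[OF assms(1) cgen_continuous[OF assms(2)]] by simp

lemma cube_homotopy_gen_cgen: "cube_homotopy_gen n \<in> chains_on (cgen (cube_top n) (Suc n))"
proof (induction n)
  case (Suc n)
  have "homotopy_base (Suc n) \<in> chains_on (cgen (cube_top (Suc n)) (Suc n))"
    unfolding homotopy_base_def
    using chains_extend[OF cbd_cgen[OF id_cube_cgen[of "Suc n"]], of "cube_homotopy n" "cgen (cube_top (Suc n)) (Suc n)"]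
      cube_homotopy_cgen_if[OF Suc] triangulate_back_cgen[OF id_cube_cgen] id_cube_cgen by (auto intro!: chains_diff)
  then show ?case unfolding cube_homotopy_gen_Suc by (rule chains_fmap) (rule cube_cone_cgen)
qed simp

lemmas cube_homotopy_cgen = cube_homotopy_cgen_if[OF cube_homotopy_gen_cgen]

lemma homotopy_base_cgen: "homotopy_base n \<in> chains_on (cgen (cube_top n) n)"
proof (cases n)
  case 0
  then show ?thesis by (auto simp: homotopy_base_def intro!: chains_diff triangulate_back_cgen id_cube_cgen)
next
  case (Suc m)
  then show ?thesis
    unfolding homotopy_base_def
    using chains_extend[OF cbd_cgen[OF id_cube_cgen[of n]], of "cube_homotopy m" "cgen (cube_top n) n"] cube_homotopy_cgen[of _ _ m]
      triangulate_back_cgen[OF id_cube_cgen] id_cube_cgen by (auto intro!: chains_diff)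
qed

lemma cmap_cmap:
  "u \<in> cgen (cube_top n) k \<Longrightarrow> cmap k (cmap n f c) u = cmap k f (cmap k c u)"
  using cgen_cube_mem[of u n k] by (intro ext) (simp add: cmap_def)

lemma cube_homotopy_cmap: "cube_homotopy n (cmap n f c) = fmap (cmap (Suc n) f) (cube_homotopy n c)"
  unfolding cube_homotopy_def fmap_fmap by (rule fmap_cong[OF cube_homotopy_gen_cgen]) (rule cmap_cmap)

lemma homotopy_defect_cmap: "homotopy_defect n (cmap n f c) = fmap (cmap n f) (homotopy_defect n c)"
proof -
  have "frag_extend (cbd (n + 1)) (fmap (cmap (Suc n) f) (cube_homotopy n c)) = fmap (cmap n f) (frag_extend (cbd (n + 1)) (cube_homotopy n c))"
    using cbd_cmap[of "Suc n" f] by (simp add: extend_fmap fmap_extend)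
  moreover have "frag_extend (cube_homotopy (n - 1)) (fmap (cmap (n - 1) f) (cbd n c)) = fmap (cmap n f) (frag_extend (cube_homotopy (n - 1)) (cbd n c))"
    by (cases n) (simp_all add: extend_fmap fmap_extend cube_homotopy_cmap)
  ultimately show ?thesis
    by (simp add: homotopy_defect_def triangulate_back_cmap cube_homotopy_cmap cbd_cmap)
qed

text \<open>A singular cube is the image of the identity cube under itself, so by naturality its
  defect is the image of the defect of the model.\<close>

lemma homotopy_defect_if:
  assumes "homotopy_defect n (id_cube n) \<in> chains_on (cdgen (cube_top n) n)" "c \<in> cgen X n"
  shows "homotopy_defect n c \<in> chains_on (cdgen X n)"
proof -
  have "homotopy_defect n (cmap n c (id_cube n)) \<in> chains_on (cdgen X n)"
    unfolding homotopy_defect_cmap by (rule chains_fmap[OF assms(1)]) (rule cmap_cdgen[OF _ cgen_continuous[OF assms(2)]])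
  then show ?thesis by (simp add: cmap_id_cube[OF assms(2)])
qed

abbreviation "zero_coord i \<equiv> \<lambda>x :: nat \<Rightarrow> real. x(i := 0)"

text \<open>A degenerate cube does not notice the clearing of its coordinate k, so its homotopy is
  the image of the flattened model chain.\<close>

lemma cube_homotopy_cdgen_if:
  assumes "\<And>i. i < n \<Longrightarrow> fmap (cmap (Suc n) (zero_coord i)) (cube_homotopy_gen n) \<in> chains_on (cdgen (cube_top n) (Suc n))" "c \<in> cdgen X n"
  shows "cube_homotopy n c \<in> chains_on (cdgen X (n + 1))"
proof -
  obtain k where k: "c \<in> cgen X n" "k < n" "\<And>x. x \<in> standard_cube n \<Longrightarrow> c (x(k := 0)) = c x"
    using assms(2) by (elim cdgenE) blast
  have "cube_homotopy n c = fmap (cmap (Suc n) c) (fmap (cmap (Suc n) (zero_coord k)) (cube_homotopy_gen n))"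
    unfolding cube_homotopy_def fmap_fmap
  proof (rule fmap_cong[OF cube_homotopy_gen_cgen])
    fix u assume "u \<in> cgen (cube_top n) (Suc n)"
    then show "cmap (Suc n) c u = cmap (Suc n) c (cmap (Suc n) (zero_coord k) u)"
      using k(3) cgen_cube_mem[of u n "Suc n"] by (intro ext) (simp add: cmap_def)
  qed
  also have "\<dots> \<in> chains_on (cdgen X (Suc n))"
    by (rule chains_fmap[OF assms(1)[OF k(2)]]) (rule cmap_cdgen[OF _ cgen_continuous[OF k(1)]])
  finally show ?thesis by simp
qed

lemma continuous_map_zero_coord: "continuous_map (cube_top n) (cube_top n) (zero_coord i)"
  unfolding continuous_map_cube using cube_upd continuous_map_coord by (auto simp: fun_upd_def)

lemma id_cube_zero_coord: "i < n \<Longrightarrow> cmap n (zero_coord i) (id_cube n) \<in> cdgen (cube_top n) n"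
  by (rule cdgenI[OF cmap_cgen[OF id_cube_cgen continuous_map_zero_coord]])
    (auto simp: cmap_def id_cube_def cube_upd)

text \<open>There is just one singular 0-cube in the 0-cube, and each stage of the composite sends a
  single generator to a single generator. Hence the homotopy can start with zero.\<close>

lemma triangulate_back_0: "triangulate_back 0 (id_cube 0) = frag_of (id_cube 0)"
proof -
  have s: "standard_cube 0 = {\<lambda>i. 0}" by (auto simp: standard_cube_def)
  have u: "c = id_cube 0" if "c \<in> cgen (cube_top 0) 0" for c
    using cgen_cube_mem[OF that] cgen_ext[OF that] s
    by (intro extensionalityI[of _ "standard_cube 0"]) (auto simp: id_cube_def)
  have "realize_bits (id_cube 0) [[]] \<in> sgen (cube_top 0) 0"
    by (rule realize_bits_sgen[OF id_cube_cgen]) auto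
  moreover from this have "normalize_simplex 0 (realize_bits (id_cube 0) [[]]) = frag_of (realize_bits (id_cube 0) [[]])"
    using realize_self[of "realize_bits (id_cube 0) [[]]" "cube_top 0" 0] by (simp add: normalize_simplex_def)
  ultimately show ?thesis
    using u[OF simplex_to_cube_cgen] by (simp add: triangulate_back_def triangulate_def triangulate_inv_def)
qed

text \<open>The cone fills \<open>homotopy_base\<close> once the boundary of that chain is
  degenerate, which follows from the homotopy equation for the faces, one degree lower. The second
  part is the condition on the model under which the homotopy preserves degenerate cubes.\<close>

lemma homotopy_induction:
  "homotopy_defect n (id_cube n) \<in> chains_on (cdgen (cube_top n) n) \<and>
    (\<forall>i<n. fmap (cmap (Suc n) (zero_coord i)) (cube_homotopy_gen n) \<in> chains_on (cdgen (cube_top n) (Suc n)))"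
proof (induction n)
  case 0
  then show ?case by (simp add: homotopy_defect_def triangulate_back_0 cube_homotopy_def)
next
  case (Suc n)
  let ?m = "Suc n" and ?id = "id_cube (Suc n)"
  let ?X = "cube_top (Suc n)"
  have U: "homotopy_defect n c \<in> chains_on (cdgen ?X n)" if "c \<in> cgen ?X n" for c
    by (rule homotopy_defect_if[OF conjunct1[OF Suc] that])
  have E: "cube_homotopy n c \<in> chains_on (cdgen ?X (n + 1))" if "c \<in> cdgen ?X n" for c
    by (rule cube_homotopy_cdgen_if[OF _ that]) (use Suc in blast)
  have b: "cbd ?m ?id \<in> chains_on (cgen ?X n)" using cbd_cgen[OF id_cube_cgen[of ?m]] by simp
  have h: "homotopy_base ?m \<in> chains_on (cgen ?X ?m)" by (rule homotopy_base_cgen)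
  have "cube_homotopy ?m ?id = cube_homotopy_gen ?m"
  proof -
    have "cmap (Suc ?m) ?id u = u" if "u \<in> cgen ?X (Suc ?m)" for u
      by (rule cmap_id[OF that]) (simp add: id_cube_def)
    then have "fmap (cmap (Suc ?m) ?id) (cube_homotopy_gen ?m) = fmap (\<lambda>u. u) (cube_homotopy_gen ?m)"
      by (intro fmap_cong[OF cube_homotopy_gen_cgen]) auto
    then show ?thesis by (simp only: cube_homotopy_def fmap_ident)
  qed
  then have "frag_extend (cbd (?m + 1)) (cube_homotopy ?m ?id) = frag_extend (\<lambda>c. cbd (Suc ?m) (cube_cone ?m c)) (homotopy_base ?m)"
    by (simp only: cube_homotopy_gen_Suc extend_fmap Suc_eq_plus1[symmetric])
  then have d: "homotopy_defect ?m ?id = homotopy_base ?m - frag_extend (\<lambda>c. cbd (Suc ?m) (cube_cone ?m c)) (homotopy_base ?m)"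
    by (simp add: homotopy_defect_def homotopy_base_def)
  have "frag_extend (\<lambda>c. cbd (Suc ?m) (cube_cone ?m c) - (frag_of c - fmap (cube_cone (?m - 1)) (cbd ?m c))) (homotopy_base ?m) \<in> chains_on (cdgen ?X ?m)"
    by (rule chains_extend[OF h cube_cone_boundary]) auto
  then have 1: "frag_extend (\<lambda>c. cbd (Suc ?m) (cube_cone ?m c)) (homotopy_base ?m) - homotopy_base ?m + fmap (cube_cone n) (frag_extend (cbd ?m) (homotopy_base ?m)) \<in> chains_on (cdgen ?X ?m)"
    by (simp add: frag_lin fmap_extend algebra_simps)
  \<comment> \<open>The base is a cycle up to degenerate cubes: summing the lower homotopy equation
    over the boundary of the model leaves no term with a double boundary, and
    \<open>triangulate_back\<close> commutes with boundaries modulo degenerate cubes.\<close>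
  have 2: "frag_extend (cbd ?m) (homotopy_base ?m) \<in> chains_on (cdgen ?X n)"
  proof -
    have P: "frag_extend (cbd ?m) (triangulate_back ?m ?id) - frag_extend (triangulate_back n) (cbd ?m ?id) \<in> chains_on (cdgen ?X n)"
      using triangulate_back_boundary[OF id_cube_cgen[of ?m]] by simp
    have "frag_extend (homotopy_defect n) (cbd ?m ?id) \<in> chains_on (cdgen ?X n)"
      by (rule chains_extend[OF b U])
    moreover have "frag_extend (homotopy_defect n) (cbd ?m ?id) = frag_extend (triangulate_back n) (cbd ?m ?id) - cbd ?m ?id
        - frag_extend (cbd ?m) (frag_extend (cube_homotopy n) (cbd ?m ?id)) - frag_extend (cube_homotopy (n - 1)) (frag_extend (cbd n) (cbd ?m ?id))"
      unfolding homotopy_defect_def[abs_def] by (simp add: frag_lin frag_extend_extend)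
    moreover have "frag_extend (cbd n) (cbd ?m ?id) = 0"
      using cbd_cbd[of ?m ?id] by simp
    ultimately have "frag_extend (triangulate_back n) (cbd ?m ?id) - cbd ?m ?id - frag_extend (cbd ?m) (frag_extend (cube_homotopy n) (cbd ?m ?id)) \<in> chains_on (cdgen ?X n)"
      by simp
    from chains_add[OF P this] show ?thesis by (simp add: homotopy_base_def frag_lin algebra_simps)
  qed
  have "fmap (cube_cone n) (frag_extend (cbd ?m) (homotopy_base ?m)) \<in> chains_on (cdgen ?X ?m)"
    by (rule chains_fmap[OF 2]) (rule cube_cone_cdgen)
  from chains_diff[OF this 1] have "homotopy_defect ?m ?id \<in> chains_on (cdgen ?X ?m)"
    unfolding d by (simp add: algebra_simps)
  moreover have "fmap (cmap (Suc ?m) (zero_coord i)) (cube_homotopy_gen ?m) \<in> chains_on (cdgen ?X (Suc ?m))" if i: "i < ?m" for i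
  proof -
    let ?z = "cmap ?m (zero_coord i) ?id"
    \<comment> \<open>Scaling towards the origin commutes with setting a coordinate to 0.\<close>
    have "cmap (Suc ?m) (zero_coord i) (cube_cone ?m c) = cube_cone ?m (cmap ?m (zero_coord i) c)" for c
    proof
      fix x
      show "cmap (Suc ?m) (zero_coord i) (cube_cone ?m c) x = cube_cone ?m (cmap ?m (zero_coord i) c) x"
        using csnd_Suc[of x ?m] by (auto simp: cmap_def cube_cone_def fun_upd_def fun_eq_iff)
    qed
    then have "fmap (cmap (Suc ?m) (zero_coord i)) (cube_homotopy_gen ?m) = fmap (cube_cone ?m) (fmap (cmap ?m (zero_coord i)) (homotopy_base ?m))"
      by (simp only: cube_homotopy_gen_Suc fmap_fmap)
    \<comment> \<open>By naturality the flattening replaces the identity cube by the degenerate cube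
      \<open>?z\<close>, on which each of the three terms vanishes or is degenerate.\<close>
    also have "fmap (cmap ?m (zero_coord i)) (homotopy_base ?m) = triangulate_back ?m ?z - frag_of ?z - frag_extend (cube_homotopy n) (cbd ?m ?z)"
      by (simp add: homotopy_base_def triangulate_back_cmap cbd_cmap extend_fmap cube_homotopy_cmap fmap_extend)
    finally have e: "fmap (cmap (Suc ?m) (zero_coord i)) (cube_homotopy_gen ?m) = fmap (cube_cone ?m) (triangulate_back ?m ?z - frag_of ?z - frag_extend (cube_homotopy n) (cbd ?m ?z))" .
    have z: "?z \<in> cdgen ?X ?m" by (rule id_cube_zero_coord[OF i])
    have "frag_extend (cube_homotopy n) (cbd ?m ?z) \<in> chains_on (cdgen ?X ?m)"
      using chains_extend[OF cbd_cdgen[OF z], of "cube_homotopy n" "cdgen ?X ?m"] E by simp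
    then have "triangulate_back ?m ?z - frag_of ?z - frag_extend (cube_homotopy n) (cbd ?m ?z) \<in> chains_on (cdgen ?X ?m)"
      using z triangulate_back_cdgen[OF z] by (auto intro!: chains_diff)
    then show ?thesis unfolding e by (rule chains_fmap) (rule cube_cone_cdgen)
  qed
  ultimately show ?case by blast
qed

lemma cube_homotopy_cdgen: "c \<in> cdgen X n \<Longrightarrow> cube_homotopy n c \<in> chains_on (cdgen X (n + 1))"
  by (rule cube_homotopy_cdgen_if) (use homotopy_induction in blast)

lemma homotopy_defect_cdgen: "c \<in> cgen X n \<Longrightarrow> homotopy_defect n c \<in> chains_on (cdgen X n)"
  by (rule homotopy_defect_if) (use homotopy_induction in blast)

lemma triangulation_equivalence:
  assumes "inj pr"
  shows "has_weak_homotopy_equivalence pr pt (cubical_functor pr pt) (normalized_singular pr pt)"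
proof -
  interpret C: top_chains pr pt cgen cdgen cbd cmap "ccr pr" "cpt pt"
    by (rule cubical_top_chains[OF assms])
  interpret N: top_chains pr pt sgen sdgen sbd simplex_map "shuffle_simplices pr" "spt pt"
    by (rule singular_top_chains[OF assms]) simp
  interpret P: top_chains_pair pr pt cgen cdgen cbd cmap "ccr pr" "cpt pt"
      sgen sdgen sbd simplex_map "shuffle_simplices pr" "spt pt" triangulate
    by (intro top_chains_pair.intro top_chains_pair_axioms.intro C.top_chains_axioms N.top_chains_axioms)
      (auto intro: triangulate_sgen triangulate_cdgen simp: triangulate_sbd triangulate_cmap triangulate_point N.crc_def ccr_def triangulate_cross simp del: One_nat_def)
  \<comment> \<open>Up to degenerate simplices the composite is the normalization, whose homotopy to
    the identity is already known; no new homotopy is constructed on this side.\<close>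
  have eqB: "frag_extend (triangulate k) (triangulate_inv k x) - frag_of x - frag_extend (sbd (k + 1)) (normalize_homotopy k x)
        - frag_extend (normalize_homotopy (k - 1)) (sbd k x) \<in> chains_on (sdgen X k)" if "x \<in> sgen X k" for X and k and x :: "(nat \<Rightarrow> real) \<Rightarrow> 'a"
    using triangulate_triangulate_inv[OF that] normalize_homotopy_sbd[OF that] by (simp add: algebra_simps)
  show ?thesis
    unfolding cubical_functor_alt normalized_singular_def
    by (rule P.weak_homotopy_equivalence[OF C.presents_qfunctor N.presents_qfunctor,
        where \<Psi> = triangulate_inv and HA = cube_homotopy and HB = normalize_homotopy])
      (use homotopy_defect_cdgen in \<open>auto simp: triangulate_inv_sdgen homotopy_defect_def triangulate_back_def intro: triangulate_inv_cgen triangulate_inv_boundary cube_homotopy_cgen cube_homotopy_cdgen normalize_homotopy_sgen normalize_homotopy_sdgen eqB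
        simp del: One_nat_def\<close>)
qed

text \<open>The identity transformation, which supplies the last arrow of the zigzag.\<close>

lemma cubical_self_equivalence:
  assumes "inj pr"
  shows "has_weak_homotopy_equivalence pr pt (cubical_functor pr pt) (cubical_functor pr pt)"
proof -
  interpret C: top_chains pr pt cgen cdgen cbd cmap "ccr pr" "cpt pt"
    by (rule cubical_top_chains[OF assms])
  interpret P: top_chains_pair pr pt cgen cdgen cbd cmap "ccr pr" "cpt pt"
      cgen cdgen cbd cmap "ccr pr" "cpt pt" "\<lambda>n. frag_of"
    by (intro top_chains_pair.intro top_chains_pair_axioms.intro C.top_chains_axioms) auto
  show ?thesis
    unfolding cubical_functor_alt
    by (rule P.weak_homotopy_equivalence[OF C.presents_qfunctor C.presents_qfunctor,
        where \<Psi> = "\<lambda>n. frag_of" and HA = "\<lambda>n x. 0" and HB = "\<lambda>n x. 0"]) auto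
qed

theorem theorem5p3p1:
  fixes pr :: "'u \<times> 'u \<Rightarrow> 'u" and pt :: 'u
  assumes "inj pr"
  shows "monoidal_functor pr pt (singular_functor pr pt) \<and>
         monoidal_functor pr pt (cubical_functor pr pt) \<and>
         (\<exists>m\<ge>1. \<exists>(F :: nat \<Rightarrow> ('u, 'u chain set) top_functor)
                 (G :: nat \<Rightarrow> ('u, 'u chain set) top_functor).
            has_weak_homotopy_equivalence pr pt (F 1) (singular_functor pr pt) \<and>
            (\<forall>i\<in>{1..<m}. has_weak_homotopy_equivalence pr pt (F i) (G i) \<and>
                          has_weak_homotopy_equivalence pr pt (F (i + 1)) (G i)) \<and>
            has_weak_homotopy_equivalence pr pt (F m) (cubical_functor pr pt))"
proof -
  \<comment> \<open>The zigzag has length m = 2: two sources, the encoded singular and the cubical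
    functor, and between them the normalized singular functor as the only target.\<close>
  let ?F = "\<lambda>i::nat. if i = 1 then encoded_singular pr pt else cubical_functor pr pt"
  let ?G = "\<lambda>i::nat. normalized_singular pr pt"
  note e = encoded_singular_equivalence[OF assms, of pt] normalization_equivalence[OF assms, of pt]
    triangulation_equivalence[OF assms, of pt] cubical_self_equivalence[OF assms, of pt]
  have "{1..<2::nat} = {1}" by auto
  then have "has_weak_homotopy_equivalence pr pt (?F 1) (singular_functor pr pt) \<and>
      (\<forall>i\<in>{1..<2}. has_weak_homotopy_equivalence pr pt (?F i) (?G i) \<and>
                    has_weak_homotopy_equivalence pr pt (?F (i + 1)) (?G i)) \<and>
      has_weak_homotopy_equivalence pr pt (?F 2) (cubical_functor pr pt)"
    using e by simp
  moreover have "monoidal_functor pr pt (singular_functor pr pt)" "monoidal_functor pr pt (cubical_functor pr pt)"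
    using e(1,4) by (simp_all add: has_weak_homotopy_equivalence_def)
  ultimately show ?thesis by (intro conjI exI[of _ 2] exI[of _ ?F] exI[of _ ?G]) auto
qed

end
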